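(* Let $K$ be a field and let $M|N$ be a D2 Frobenius extension of $K$-algebras whose centralizer $R=C_M(N)$ is a separable $K$-algebra. Then $A=\mathrm{End}({}_NM_N)$ and $B=(M\otimes_NM)^N$, with the algebra and coalgebra structures given in the context, are weak Hopf algebras over $K$ dual to one another.
   Context: A ring extension $N\to M$ is D2 if $M\otimes_NM$ is isomorphic to a direct summand of $\oplus^n\,{}_NM_M$ as an $N$-$M$-bimodule and of $\oplus^m\,{}_MM_N$ as an $M$-$N$-bimodule, for some $n,m\ge1$. It is Frobenius if there are an $N$-$N$-bimodule map $E:M\to N$ and finitely many $x_i,y_i\in M$ with $\sum_ix_iE(y_im)=m=\sum_iE(mx_i)y_i$ for all $m\in M$. Elements of $B=\{b\in M\otimes_NM:nb=bn\ \forall n\in N\}$ are written $b=b^1\otimes b^2$. Let $b_i\in B$, $\beta_i\in A$ be a left D2 quasibasis: finite families with $\sum_ib_i^1\otimes b_i^2\beta_i(m)=m\otimes1$ for all $m\in M$ (it exists for D2 extensions). Let $(\phi,e_j,f_j)$ be an index one Frobenius system for $R$ (it exists for every separable algebra over a field): $\phi:R\to K$ linear, $e_j,f_j\in R$ with $\sum_j\phi(re_j)f_j=r=\sum_je_j\phi(f_jr)$ for all $r\in R$ and $\sum_je_jf_j=1$. $A$: multiplication is composition; $\Delta(\alpha)=\sum_{i,j}\alpha(-\,b_i^1)b_i^2e_j\otimes_K\lambda(f_j)\beta_i$ (with $\lambda(f)$ left multiplication by $f$), $\varepsilon(\alpha)=\phi(\alpha(1))$. $B$: $bb'={b'}^1b^1\otimes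 b^2{b'}^2$, unit $1\otimes1$; $\Delta(b)=\sum_{i,j}(b_i^1\otimes_Nb_i^2e_j)\otimes_K(f_j\beta_i(b^1)\otimes_Nb^2)$, $\varepsilon(b)=\phi(b^1b^2)$. The duality is with respect to the pairing $\langle b,\alpha\rangle=\phi(b^1\alpha(b^2))$: it is nondegenerate, and the product and unit of each of $A,B$ are transposed to the coproduct and counit of the other, i.e. $\langle bc,a\rangle=\langle b,a_{(1)}\rangle\langle c,a_{(2)}\rangle$, $\langle b,aa'\rangle=\langle b_{(1)},a\rangle\langle b_{(2)},a'\rangle$, $\langle1_B,a\rangle=\varepsilon(a)$, $\langle b,1_A\rangle=\varepsilon(b)$. A weak Hopf algebra over $K$ is a finite dimensional $K$-space $H$ with an algebra and a coalgebra structure such that $\Delta(ab)=\Delta(a)\Delta(b)$; $(\Delta(1)\otimes1)(1\otimes\Delta(1))=(1\otimes\Delta(1))(\Delta(1)\otimes1)=(\Delta\otimes\mathrm{id})\Delta(1)$; $\varepsilon(abc)=\varepsilon(ab_{(1)})\varepsilon(b_{(2)}c)=\varepsilon(ab_{(2)})\varepsilon(b_{(1)}c)$; and there is a linear antipode $S:H\to H$ with $a_{(1)}S(a_{(2)})=\varepsilon(1_{(1)}a)1_{(2)}$, $S(a_{(1)})a_{(2)}=1_{(1)}\varepsilon(a1_{(2)})$, $S(a_{(1)})a_{(2)}S(a_{(3)})=S(a)$. *)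

theory Defs
  imports "HOL-Algebra.Free_Abelian_Groups" "HOL-Algebra.Module"
begin

section \<open>Algebras over a field\<close>

text \<open>The library locale \<open>algebra\<close> is restricted to commutative algebras.  Here \<open>K\<close> is
  a commutative ring (a field in the application) and \<open>H\<close> an associative unital \<open>K\<close>-algebra,
  possibly noncommutative and possibly zero.\<close>

definition k_algebra :: "('k, 'c) ring_scheme \<Rightarrow> ('k, 'h, 'd) module_scheme \<Rightarrow> bool" where
  "k_algebra K H \<longleftrightarrow> module K H \<and> ring H \<and>
     (\<forall>c \<in> carrier K. \<forall>x \<in> carrier H. \<forall>y \<in> carrier H.
        (c \<odot>\<^bsub>H\<^esub> x) \<otimes>\<^bsub>H\<^esub> y = c \<odot>\<^bsub>H\<^esub> (x \<otimes>\<^bsub>H\<^esub> y) \<and>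
        x \<otimes>\<^bsub>H\<^esub> (c \<odot>\<^bsub>H\<^esub> y) = c \<odot>\<^bsub>H\<^esub> (x \<otimes>\<^bsub>H\<^esub> y))"

definition k_linear ::
  "('k, 'c) ring_scheme \<Rightarrow> ('k, 'x, 'd) module_scheme \<Rightarrow> ('k, 'y, 'e) module_scheme \<Rightarrow> ('x \<Rightarrow> 'y) \<Rightarrow> bool"
where
  "k_linear K X Y f \<longleftrightarrow> f \<in> hom (add_monoid X) (add_monoid Y) \<and>
     (\<forall>c \<in> carrier K. \<forall>x \<in> carrier X. f (c \<odot>\<^bsub>X\<^esub> x) = c \<odot>\<^bsub>Y\<^esub> f x)"

definition k_algebra_hom ::
  "('k, 'c) ring_scheme \<Rightarrow> ('k, 'x, 'd) module_scheme \<Rightarrow> ('k, 'y, 'e) module_scheme \<Rightarrow> ('x \<Rightarrow> 'y) \<Rightarrow> bool"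
where
  "k_algebra_hom K X Y f \<longleftrightarrow> f \<in> ring_hom X Y \<and> k_linear K X Y f"

definition base_module :: "('k, 'c) ring_scheme \<Rightarrow> ('k, 'k) module" where
  "base_module K = \<lparr>carrier = carrier K, mult = mult K, one = one K, zero = zero K,
     add = add K, smult = mult K\<rparr>"

definition finite_dim :: "('k, 'c) ring_scheme \<Rightarrow> ('k, 'h, 'd) module_scheme \<Rightarrow> bool" where
  "finite_dim K H \<longleftrightarrow> (\<exists>G. finite G \<and> G \<subseteq> carrier H \<and>
     (\<forall>x \<in> carrier H. \<exists>c \<in> G \<rightarrow> carrier K. x = (\<Oplus>\<^bsub>H\<^esub>g\<in>G. c g \<odot>\<^bsub>H\<^esub> g)))"


section \<open>Bimodules\<close>

text \<open>A bimodule is given by its underlying abelian group (a monoid record), the carriers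
  \<open>P\<close>, \<open>Q\<close> of the two rings that act, and the two actions.\<close>

definition bimod_hom ::
  "'p set \<Rightarrow> 'q set \<Rightarrow> ('x, 'c) monoid_scheme \<Rightarrow> ('p \<Rightarrow> 'x \<Rightarrow> 'x) \<Rightarrow> ('x \<Rightarrow> 'q \<Rightarrow> 'x) \<Rightarrow>
   ('y, 'd) monoid_scheme \<Rightarrow> ('p \<Rightarrow> 'y \<Rightarrow> 'y) \<Rightarrow> ('y \<Rightarrow> 'q \<Rightarrow> 'y) \<Rightarrow> ('x \<Rightarrow> 'y) \<Rightarrow> bool"
where
  "bimod_hom P Q X lX rX Y lY rY f \<longleftrightarrow> f \<in> hom X Y \<and>
     (\<forall>a \<in> P. \<forall>x \<in> carrier X. f (lX a x) = lY a (f x)) \<and>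
     (\<forall>a \<in> Q. \<forall>x \<in> carrier X. f (rX x a) = rY (f x) a)"

definition sub_bimod ::
  "'p set \<Rightarrow> 'q set \<Rightarrow> ('y, 'd) monoid_scheme \<Rightarrow> ('p \<Rightarrow> 'y \<Rightarrow> 'y) \<Rightarrow> ('y \<Rightarrow> 'q \<Rightarrow> 'y) \<Rightarrow> 'y set \<Rightarrow> bool"
where
  "sub_bimod P Q Y lY rY U \<longleftrightarrow> subgroup U Y \<and>
     (\<forall>a \<in> P. \<forall>y \<in> U. lY a y \<in> U) \<and> (\<forall>a \<in> Q. \<forall>y \<in> U. rY y a \<in> U)"

text \<open>\<open>X\<close> is isomorphic, as a bimodule, to a direct summand \<open>U\<close> of \<open>Y = U \<oplus> V\<close>.\<close>

definition iso_direct_summand ::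
  "'p set \<Rightarrow> 'q set \<Rightarrow> ('x, 'c) monoid_scheme \<Rightarrow> ('p \<Rightarrow> 'x \<Rightarrow> 'x) \<Rightarrow> ('x \<Rightarrow> 'q \<Rightarrow> 'x) \<Rightarrow>
   ('y, 'd) monoid_scheme \<Rightarrow> ('p \<Rightarrow> 'y \<Rightarrow> 'y) \<Rightarrow> ('y \<Rightarrow> 'q \<Rightarrow> 'y) \<Rightarrow> bool"
where
  "iso_direct_summand P Q X lX rX Y lY rY \<longleftrightarrow>
     (\<exists>U V. sub_bimod P Q Y lY rY U \<and> sub_bimod P Q Y lY rY V \<and>
        U \<inter> V = {\<one>\<^bsub>Y\<^esub>} \<and> U <#>\<^bsub>Y\<^esub> V = carrier Y \<and>
        (\<exists>f. bimod_hom P Q X lX rX Y lY rY f \<and> bij_betw f (carrier X) U))"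


section \<open>Tensor products\<close>

text \<open>The tensor product of a right module \<open>X\<close> and a left module \<open>Y\<close> over a ring with carrier
  \<open>Q\<close>, as an abelian group: the free abelian group on \<open>carrier X \<times> carrier Y\<close> modulo
  the subgroup generated by the usual relations.  \<open>X\<close> and \<open>Y\<close> are the underlying abelian groups
  (as monoid records, so \<open>\<otimes>\<^bsub>X\<^esub>\<close> below is the addition of the module), \<open>r\<close> and \<open>l\<close> the
  actions.\<close>

type_synonym ('x, 'y) tensor = "(('x \<times> 'y) \<Rightarrow>\<^sub>0 int) set"

definition tensor_relators ::
  "('x, 'c) monoid_scheme \<Rightarrow> ('y, 'd) monoid_scheme \<Rightarrow> 'q set \<Rightarrow> ('x \<Rightarrow> 'q \<Rightarrow> 'x) \<Rightarrow> ('q \<Rightarrow> 'y \<Rightarrow> 'y) \<Rightarrow>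
   (('x \<times> 'y) \<Rightarrow>\<^sub>0 int) set"
where
  "tensor_relators X Y Q r l =
     {frag_of (x \<otimes>\<^bsub>X\<^esub> x', y) - frag_of (x, y) - frag_of (x', y) | x x' y.
        x \<in> carrier X \<and> x' \<in> carrier X \<and> y \<in> carrier Y} \<union>
     {frag_of (x, y \<otimes>\<^bsub>Y\<^esub> y') - frag_of (x, y) - frag_of (x, y') | x y y'.
        x \<in> carrier X \<and> y \<in> carrier Y \<and> y' \<in> carrier Y} \<union>
     {frag_of (r x a, y) - frag_of (x, l a y) | x a y.
        x \<in> carrier X \<and> a \<in> Q \<and> y \<in> carrier Y}"

definition tensor_null ::
  "('x, 'c) monoid_scheme \<Rightarrow> ('y, 'd) monoid_scheme \<Rightarrow> 'q set \<Rightarrow> ('x \<Rightarrow> 'q \<Rightarrow> 'x) \<Rightarrow> ('q \<Rightarrow> 'y \<Rightarrow> 'y) \<Rightarrow>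
   (('x \<times> 'y) \<Rightarrow>\<^sub>0 int) set"
where
  "tensor_null X Y Q r l =
     generate (free_Abelian_group (carrier X \<times> carrier Y)) (tensor_relators X Y Q r l)"

definition tensor_group ::
  "('x, 'c) monoid_scheme \<Rightarrow> ('y, 'd) monoid_scheme \<Rightarrow> 'q set \<Rightarrow> ('x \<Rightarrow> 'q \<Rightarrow> 'x) \<Rightarrow> ('q \<Rightarrow> 'y \<Rightarrow> 'y) \<Rightarrow>
   ('x, 'y) tensor monoid"
where
  "tensor_group X Y Q r l =
     free_Abelian_group (carrier X \<times> carrier Y) Mod tensor_null X Y Q r l"

definition tensor_pure ::
  "('x, 'c) monoid_scheme \<Rightarrow> ('y, 'd) monoid_scheme \<Rightarrow> 'q set \<Rightarrow> ('x \<Rightarrow> 'q \<Rightarrow> 'x) \<Rightarrow> ('q \<Rightarrow> 'y \<Rightarrow> 'y) \<Rightarrow>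
   'x \<Rightarrow> 'y \<Rightarrow> ('x, 'y) tensor"
where
  "tensor_pure X Y Q r l x y =
     tensor_null X Y Q r l #>\<^bsub>free_Abelian_group (carrier X \<times> carrier Y)\<^esub> frag_of (x, y)"

text \<open>\<open>tensor_lift G f\<close> is the homomorphism from a tensor product to the abelian group \<open>G\<close> with
  \<open>x \<otimes> y \<mapsto> f x y\<close>, for biadditive balanced \<open>f\<close>: it evaluates \<open>f\<close> on a representative
  \<open>\<Sum> n\<^sub>i (x\<^sub>i, y\<^sub>i)\<close> of the class \<open>t\<close>.  For such \<open>f\<close> the value does not depend on the
  representative (lemma below); \<open>f\<close> is biadditive and balanced in every use below.  An expression
  \<open>F(t\<^sup>1, t\<^sup>2)\<close> in Sweedler-type notation is thus \<open>tensor_lift G F t\<close>.\<close>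

definition tensor_lift ::
  "('g, 'c) monoid_scheme \<Rightarrow> ('x \<Rightarrow> 'y \<Rightarrow> 'g) \<Rightarrow> ('x, 'y) tensor \<Rightarrow> 'g"
where
  "tensor_lift G f t =
     (let u = (SOME u. u \<in> t) in
        finprod G (\<lambda>(x, y). f x y [^]\<^bsub>G\<^esub> Poly_Mapping.lookup u (x, y)) (Poly_Mapping.keys u))"


lemma tensor_lift_well_defined:
  assumes G: "comm_group G" and XG: "group X" and YG: "group Y"
    and r: "\<And>x a. x \<in> carrier X \<Longrightarrow> a \<in> Q \<Longrightarrow> r x a \<in> carrier X"
    and l: "\<And>a y. a \<in> Q \<Longrightarrow> y \<in> carrier Y \<Longrightarrow> l a y \<in> carrier Y"
    and f: "\<And>x y. x \<in> carrier X \<Longrightarrow> y \<in> carrier Y \<Longrightarrow> f x y \<in> carrier G"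
    and f1: "\<And>x x' y. x \<in> carrier X \<Longrightarrow> x' \<in> carrier X \<Longrightarrow> y \<in> carrier Y \<Longrightarrow> f (x \<otimes>\<^bsub>X\<^esub> x') y = f x y \<otimes>\<^bsub>G\<^esub> f x' y"
    and f2: "\<And>x y y'. x \<in> carrier X \<Longrightarrow> y \<in> carrier Y \<Longrightarrow> y' \<in> carrier Y \<Longrightarrow> f x (y \<otimes>\<^bsub>Y\<^esub> y') = f x y \<otimes>\<^bsub>G\<^esub> f x y'"
    and f3: "\<And>x a y. x \<in> carrier X \<Longrightarrow> a \<in> Q \<Longrightarrow> y \<in> carrier Y \<Longrightarrow> f (r x a) y = f x (l a y)"
  shows "tensor_lift G f \<in> hom (tensor_group X Y Q r l) G"
    and "\<And>x y. x \<in> carrier X \<Longrightarrow> y \<in> carrier Y \<Longrightarrow> tensor_lift G f (tensor_pure X Y Q r l x y) = f x y"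
    and "comm_group (tensor_group X Y Q r l)"
proof -
  interpret G: comm_group G by fact
  interpret X: group X by fact
  interpret Y: group Y by fact
  define S where "S = carrier X \<times> carrier Y"
  let ?F = "free_Abelian_group S"
  interpret F: comm_group ?F by (rule abelian_free_Abelian_group)
  define g where "g = (\<lambda>(x,y). f x y)"
  define ev where "ev u = finprod G (\<lambda>z. g z [^]\<^bsub>G\<^esub> Poly_Mapping.lookup u z) (Poly_Mapping.keys u)" for u :: "_ \<Rightarrow>\<^sub>0 int"
  have gc: "g z \<in> carrier G" if "z \<in> S" for z using that f by (auto simp: S_def g_def)
  have gp: "g z [^]\<^bsub>G\<^esub> (k::int) \<in> carrier G" if "z \<in> S" for z k using gc[OF that] by (rule G.int_pow_closed)
  have ext: "ev u = finprod G (\<lambda>z. g z [^]\<^bsub>G\<^esub> Poly_Mapping.lookup u z) A"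
    if "finite A" "Poly_Mapping.keys u \<subseteq> A" "A \<subseteq> S" for u :: "_ \<Rightarrow>\<^sub>0 int" and A
    unfolding ev_def
    by (rule G.finprod_mono_neutral_cong_left) (use that gp in \<open>auto simp: in_keys_iff subset_iff simp del: split_paired_All\<close>)
  have evh: "ev \<in> hom ?F G"
  proof (rule homI)
    fix u v assume u: "u \<in> carrier ?F" and v: "v \<in> carrier ?F"
    let ?A = "Poly_Mapping.keys u \<union> Poly_Mapping.keys v"
    have A: "finite ?A" "?A \<subseteq> S" using u v by auto
    have k: "Poly_Mapping.keys (u+v) \<subseteq> ?A" by (rule keys_add)
    have "ev (u+v) = finprod G (\<lambda>z. g z [^]\<^bsub>G\<^esub> Poly_Mapping.lookup u z \<otimes>\<^bsub>G\<^esub> g z [^]\<^bsub>G\<^esub> Poly_Mapping.lookup v z) ?A"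
      unfolding ext[OF A(1) k A(2)]
      by (rule G.finprod_cong') (use A gc in \<open>auto simp: lookup_add G.int_pow_mult subset_iff\<close>)
    also have "\<dots> = ev u \<otimes>\<^bsub>G\<^esub> ev v"
      unfolding ext[OF A(1) Un_upper1 A(2)] ext[OF A(1) Un_upper2 A(2)]
      by (rule G.finprod_multf) (use A gc in auto)
    finally show "ev (u \<otimes>\<^bsub>?F\<^esub> v) = ev u \<otimes>\<^bsub>G\<^esub> ev v" by simp
  next
    fix u assume "u \<in> carrier ?F" then show "ev u \<in> carrier G"
      unfolding ev_def by (intro G.finprod_closed) (use gc in auto)
  qed
  interpret E: group_hom ?F G ev by (unfold_locales) (rule evh)
  have ev1: "ev (frag_of z) = g z" if "z \<in> S" for z
    using gc[OF that] by (simp add: ev_def)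
  let ?N = "tensor_null X Y Q r l"
  let ?R = "tensor_relators X Y Q r l"
  have minus: "ev (u - v) = ev u \<otimes>\<^bsub>G\<^esub> inv\<^bsub>G\<^esub> ev v" if "u \<in> carrier ?F" "v \<in> carrier ?F" for u v
    using E.hom_mult[of u "-v"] E.hom_inv[of v] that inv_free_Abelian_group[of v S] by simp
  have minc: "u - v \<in> carrier ?F" if "u \<in> carrier ?F" "v \<in> carrier ?F" for u v
    using that keys_diff[of u v] by auto
  have fr: "frag_of (x,y) \<in> carrier ?F" if "x \<in> carrier X" "y \<in> carrier Y" for x y
    using that by (simp add: S_def)
  have ek: "ev (frag_of (x,y)) = f x y" if "x \<in> carrier X" "y \<in> carrier Y" for x y
    using ev1[of "(x,y)"] that by (simp add: S_def g_def)
  have R: "?R \<subseteq> carrier ?F" unfolding tensor_relators_def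
    by (intro Un_least) (auto intro!: minc fr r l simp del: carrier_free_Abelian_group_iff)
  have c1: "a \<otimes>\<^bsub>G\<^esub> b \<otimes>\<^bsub>G\<^esub> inv\<^bsub>G\<^esub> a \<otimes>\<^bsub>G\<^esub> inv\<^bsub>G\<^esub> b = \<one>\<^bsub>G\<^esub>" if "a \<in> carrier G" "b \<in> carrier G" for a b
    using that by (metis G.inv_closed G.m_comm G.m_assoc G.r_inv G.m_closed G.inv_mult_group G.l_inv)
  have R0: "u \<in> kernel ?F G ev" if "u \<in> ?R" for u
  proof -
    have "ev u = \<one>\<^bsub>G\<^esub>" using that unfolding tensor_relators_def
      by (elim UnE; clarsimp simp del: frag_of_in_free_Abelian_group carrier_free_Abelian_group_iff simp: minus minc fr ek f r l f1 f2 f3 c1 )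
    then show ?thesis using R that by (auto simp: kernel_def simp del: carrier_free_Abelian_group_iff)
  qed
  have N: "?N \<subseteq> kernel ?F G ev" unfolding tensor_null_def S_def[symmetric]
    by (rule F.generate_subgroup_incl) (use R0 E.subgroup_kernel in auto)
  have Ns: "subgroup ?N ?F" unfolding tensor_null_def S_def[symmetric] by (rule F.generate_is_subgroup[OF R])
  then have Nn: "?N \<lhd> ?F" by (rule F.subgroup_imp_normal)
  interpret N: normal ?N ?F by fact
  have tl: "tensor_lift G f t = ev (SOME u. u \<in> t)" for t
    unfolding tensor_lift_def Let_def ev_def g_def
    by (simp add: case_prod_beta')
  have coset: "tensor_lift G f (?N #>\<^bsub>?F\<^esub> u) = ev u" if u: "u \<in> carrier ?F" for u
  proof -
    define w where "w = (SOME v. v \<in> ?N #>\<^bsub>?F\<^esub> u)"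
    have "u \<in> ?N #>\<^bsub>?F\<^esub> u" using F.rcos_self[OF u Ns] .
    then have "w \<in> ?N #>\<^bsub>?F\<^esub> u" unfolding w_def by (rule someI)
    then obtain h where "h \<in> ?N" "w = h \<otimes>\<^bsub>?F\<^esub> u" by (auto simp: r_coset_def)
    moreover have "h \<in> carrier ?F" "ev h = \<one>\<^bsub>G\<^esub>" using N \<open>h \<in> ?N\<close> by (auto simp: kernel_def)
    ultimately show ?thesis using u E.hom_mult[of h u] E.hom_closed[OF u] unfolding tl w_def[symmetric] by simp
  qed
  have T: "tensor_group X Y Q r l = ?F Mod ?N" by (simp add: tensor_group_def S_def)
  show "tensor_lift G f \<in> hom (tensor_group X Y Q r l) G"
  proof (rule homI)
    fix s assume "s \<in> carrier (tensor_group X Y Q r l)"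
    then obtain u where u: "u \<in> carrier ?F" "s = ?N #>\<^bsub>?F\<^esub> u" unfolding T by (auto simp: FactGroup_def RCOSETS_def)
    then show "tensor_lift G f s \<in> carrier G" using coset by simp
  next
    fix s t assume "s \<in> carrier (tensor_group X Y Q r l)" "t \<in> carrier (tensor_group X Y Q r l)"
    then obtain u v where u: "u \<in> carrier ?F" "s = ?N #>\<^bsub>?F\<^esub> u" and v: "v \<in> carrier ?F" "t = ?N #>\<^bsub>?F\<^esub> v" 
      unfolding T by (auto simp: FactGroup_def RCOSETS_def)
    then show "tensor_lift G f (s \<otimes>\<^bsub>tensor_group X Y Q r l\<^esub> t) = tensor_lift G f s \<otimes>\<^bsub>G\<^esub> tensor_lift G f t"
      unfolding T using coset N.rcos_sum[OF u(1) v(1)] E.hom_mult F.m_closed[OF u(1) v(1)]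
      by (simp add: FactGroup_def del: mult_free_Abelian_group)
  qed
  show "\<And>x y. x \<in> carrier X \<Longrightarrow> y \<in> carrier Y \<Longrightarrow> tensor_lift G f (tensor_pure X Y Q r l x y) = f x y"
    unfolding tensor_pure_def S_def[symmetric] using coset[OF fr] ek by simp
  show "comm_group (tensor_group X Y Q r l)" unfolding T by (rule F.abelian_FactGroup[OF Ns])
qed


subsection \<open>Tensor products over the ground field\<close>

definition k_tensor_group ::
  "('k, 'c) ring_scheme \<Rightarrow> ('k, 'x, 'd) module_scheme \<Rightarrow> ('k, 'y, 'e) module_scheme \<Rightarrow> ('x, 'y) tensor monoid"
where
  "k_tensor_group K X Y =
     tensor_group (add_monoid X) (add_monoid Y) (carrier K) (\<lambda>x c. c \<odot>\<^bsub>X\<^esub> x) (\<lambda>c y. c \<odot>\<^bsub>Y\<^esub> y)"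

definition k_pure ::
  "('k, 'c) ring_scheme \<Rightarrow> ('k, 'x, 'd) module_scheme \<Rightarrow> ('k, 'y, 'e) module_scheme \<Rightarrow>
   'x \<Rightarrow> 'y \<Rightarrow> ('x, 'y) tensor"
where
  "k_pure K X Y =
     tensor_pure (add_monoid X) (add_monoid Y) (carrier K) (\<lambda>x c. c \<odot>\<^bsub>X\<^esub> x) (\<lambda>c y. c \<odot>\<^bsub>Y\<^esub> y)"

text \<open>The \<open>K\<close>-algebra \<open>X \<otimes>\<^sub>K Y\<close>, with \<open>(x \<otimes> y)(x' \<otimes> y') = xx' \<otimes> yy'\<close>.\<close>

definition k_tensor ::
  "('k, 'c) ring_scheme \<Rightarrow> ('k, 'x, 'd) module_scheme \<Rightarrow> ('k, 'y, 'e) module_scheme \<Rightarrow>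
   ('k, ('x, 'y) tensor) module"
where
  "k_tensor K X Y = (let T = k_tensor_group K X Y; p = k_pure K X Y in
     \<lparr>carrier = carrier T,
      mult = (\<lambda>s t. tensor_lift T (\<lambda>x y. tensor_lift T (\<lambda>x' y'. p (x \<otimes>\<^bsub>X\<^esub> x') (y \<otimes>\<^bsub>Y\<^esub> y')) t) s),
      one = p \<one>\<^bsub>X\<^esub> \<one>\<^bsub>Y\<^esub>,
      zero = \<one>\<^bsub>T\<^esub>,
      add = mult T,
      smult = (\<lambda>c t. tensor_lift T (\<lambda>x y. p (c \<odot>\<^bsub>X\<^esub> x) y) t)\<rparr>)"

text \<open>\<open>k_tensor_map K X Y f g = f \<otimes> g\<close>, a map into \<open>X \<otimes>\<^sub>K Y\<close>.\<close>

definition k_tensor_map ::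
  "('k, 'c) ring_scheme \<Rightarrow> ('k, 'x, 'd) module_scheme \<Rightarrow> ('k, 'y, 'e) module_scheme \<Rightarrow>
   ('u \<Rightarrow> 'x) \<Rightarrow> ('v \<Rightarrow> 'y) \<Rightarrow> ('u, 'v) tensor \<Rightarrow> ('x, 'y) tensor"
where
  "k_tensor_map K X Y f g = tensor_lift (k_tensor_group K X Y) (\<lambda>u v. k_pure K X Y (f u) (g v))"

text \<open>The canonical map \<open>(H \<otimes> H) \<otimes> H \<rightarrow> H \<otimes> (H \<otimes> H)\<close>.\<close>

definition k_assoc ::
  "('k, 'c) ring_scheme \<Rightarrow> ('k, 'h, 'd) module_scheme \<Rightarrow> (('h, 'h) tensor, 'h) tensor \<Rightarrow>
   ('h, ('h, 'h) tensor) tensor"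
where
  "k_assoc K H = (let HH = k_tensor K H H; T = k_tensor_group K H HH in
     tensor_lift T (\<lambda>s z. tensor_lift T (\<lambda>x y. k_pure K H HH x (k_pure K H H y z)) s))"


section \<open>Weak Hopf algebras and duality\<close>

definition k_coalgebra ::
  "('k, 'c) ring_scheme \<Rightarrow> ('k, 'h, 'd) module_scheme \<Rightarrow> ('h \<Rightarrow> ('h, 'h) tensor) \<Rightarrow> ('h \<Rightarrow> 'k) \<Rightarrow> bool"
where
  "k_coalgebra K H \<Delta> \<epsilon> \<longleftrightarrow>
     k_linear K H (k_tensor K H H) \<Delta> \<and> k_linear K H (base_module K) \<epsilon> \<and>
     (\<forall>a \<in> carrier H.
        k_assoc K H (k_tensor_map K (k_tensor K H H) H \<Delta> (\<lambda>x. x) (\<Delta> a))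
          = k_tensor_map K H (k_tensor K H H) (\<lambda>x. x) \<Delta> (\<Delta> a) \<and>
        tensor_lift (add_monoid H) (\<lambda>x y. \<epsilon> x \<odot>\<^bsub>H\<^esub> y) (\<Delta> a) = a \<and>
        tensor_lift (add_monoid H) (\<lambda>x y. \<epsilon> y \<odot>\<^bsub>H\<^esub> x) (\<Delta> a) = a)"

text \<open>The three conjuncts for \<open>S\<close> are \<open>a\<^sub>1 S(a\<^sub>2) = \<epsilon>(1\<^sub>1 a) 1\<^sub>2\<close>,
  \<open>S(a\<^sub>1) a\<^sub>2 = 1\<^sub>1 \<epsilon>(a 1\<^sub>2)\<close> and \<open>S(a\<^sub>1) a\<^sub>2 S(a\<^sub>3) = S(a)\<close>, where
  \<open>a\<^sub>1 \<otimes> a\<^sub>2 \<otimes> a\<^sub>3 = (\<Delta> \<otimes> id) \<Delta>(a)\<close>.\<close>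

definition weak_hopf_antipode ::
  "('k, 'c) ring_scheme \<Rightarrow> ('k, 'h, 'd) module_scheme \<Rightarrow> ('h \<Rightarrow> ('h, 'h) tensor) \<Rightarrow> ('h \<Rightarrow> 'k) \<Rightarrow>
   ('h \<Rightarrow> 'h) \<Rightarrow> bool"
where
  "weak_hopf_antipode K H \<Delta> \<epsilon> S \<longleftrightarrow> k_linear K H H S \<and>
     (\<forall>a \<in> carrier H.
        tensor_lift (add_monoid H) (\<lambda>x y. x \<otimes>\<^bsub>H\<^esub> S y) (\<Delta> a)
          = tensor_lift (add_monoid H) (\<lambda>u v. \<epsilon> (u \<otimes>\<^bsub>H\<^esub> a) \<odot>\<^bsub>H\<^esub> v) (\<Delta> \<one>\<^bsub>H\<^esub>) \<and>
        tensor_lift (add_monoid H) (\<lambda>x y. S x \<otimes>\<^bsub>H\<^esub> y) (\<Delta> a)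
          = tensor_lift (add_monoid H) (\<lambda>u v. \<epsilon> (a \<otimes>\<^bsub>H\<^esub> v) \<odot>\<^bsub>H\<^esub> u) (\<Delta> \<one>\<^bsub>H\<^esub>) \<and>
        tensor_lift (add_monoid H)
          (\<lambda>s z. tensor_lift (add_monoid H) (\<lambda>x y. S x \<otimes>\<^bsub>H\<^esub> y \<otimes>\<^bsub>H\<^esub> S z) s)
          (k_tensor_map K (k_tensor K H H) H \<Delta> (\<lambda>x. x) (\<Delta> a)) = S a)"

definition weak_hopf_algebra ::
  "('k, 'c) ring_scheme \<Rightarrow> ('k, 'h, 'd) module_scheme \<Rightarrow> ('h \<Rightarrow> ('h, 'h) tensor) \<Rightarrow> ('h \<Rightarrow> 'k) \<Rightarrow> bool"
where
  "weak_hopf_algebra K H \<Delta> \<epsilon> \<longleftrightarrow>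
     k_algebra K H \<and> finite_dim K H \<and> k_coalgebra K H \<Delta> \<epsilon> \<and>
     (\<forall>a \<in> carrier H. \<forall>b \<in> carrier H. \<Delta> (a \<otimes>\<^bsub>H\<^esub> b) = \<Delta> a \<otimes>\<^bsub>k_tensor K H H\<^esub> \<Delta> b) \<and>
     (let HH = k_tensor K H H; HHH = k_tensor K H HH;
          L = k_assoc K H (k_pure K HH H (\<Delta> \<one>\<^bsub>H\<^esub>) \<one>\<^bsub>H\<^esub>);
          R = k_pure K H HH \<one>\<^bsub>H\<^esub> (\<Delta> \<one>\<^bsub>H\<^esub>);
          D = k_assoc K H (k_tensor_map K HH H \<Delta> (\<lambda>x. x) (\<Delta> \<one>\<^bsub>H\<^esub>))
      in L \<otimes>\<^bsub>HHH\<^esub> R = D \<and> R \<otimes>\<^bsub>HHH\<^esub> L = D) \<and>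
     (\<forall>a \<in> carrier H. \<forall>b \<in> carrier H. \<forall>c \<in> carrier H.
        \<epsilon> (a \<otimes>\<^bsub>H\<^esub> b \<otimes>\<^bsub>H\<^esub> c)
          = tensor_lift (add_monoid K) (\<lambda>x y. \<epsilon> (a \<otimes>\<^bsub>H\<^esub> x) \<otimes>\<^bsub>K\<^esub> \<epsilon> (y \<otimes>\<^bsub>H\<^esub> c)) (\<Delta> b) \<and>
        \<epsilon> (a \<otimes>\<^bsub>H\<^esub> b \<otimes>\<^bsub>H\<^esub> c)
          = tensor_lift (add_monoid K) (\<lambda>x y. \<epsilon> (a \<otimes>\<^bsub>H\<^esub> y) \<otimes>\<^bsub>K\<^esub> \<epsilon> (x \<otimes>\<^bsub>H\<^esub> c)) (\<Delta> b)) \<and>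
     (\<exists>S. weak_hopf_antipode K H \<Delta> \<epsilon> S)"

text \<open>\<open>H\<close> and \<open>G\<close> are dual to one another with respect to the bilinear pairing \<open>P\<close>.\<close>

definition dual_wrt ::
  "('k, 'c) ring_scheme \<Rightarrow>
   ('k, 'h, 'd) module_scheme \<Rightarrow> ('h \<Rightarrow> ('h, 'h) tensor) \<Rightarrow> ('h \<Rightarrow> 'k) \<Rightarrow>
   ('k, 'g, 'e) module_scheme \<Rightarrow> ('g \<Rightarrow> ('g, 'g) tensor) \<Rightarrow> ('g \<Rightarrow> 'k) \<Rightarrow>
   ('h \<Rightarrow> 'g \<Rightarrow> 'k) \<Rightarrow> bool"
where
  "dual_wrt K H \<Delta>H \<epsilon>H G \<Delta>G \<epsilon>G P \<longleftrightarrow>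
     (\<forall>h \<in> carrier H. k_linear K G (base_module K) (\<lambda>g. P h g)) \<and>
     (\<forall>g \<in> carrier G. k_linear K H (base_module K) (\<lambda>h. P h g)) \<and>
     (\<forall>h \<in> carrier H. (\<forall>g \<in> carrier G. P h g = \<zero>\<^bsub>K\<^esub>) \<longrightarrow> h = \<zero>\<^bsub>H\<^esub>) \<and>
     (\<forall>g \<in> carrier G. (\<forall>h \<in> carrier H. P h g = \<zero>\<^bsub>K\<^esub>) \<longrightarrow> g = \<zero>\<^bsub>G\<^esub>) \<and>
     (\<forall>h \<in> carrier H. \<forall>h' \<in> carrier H. \<forall>g \<in> carrier G.
        P (h \<otimes>\<^bsub>H\<^esub> h') g = tensor_lift (add_monoid K) (\<lambda>x y. P h x \<otimes>\<^bsub>K\<^esub> P h' y) (\<Delta>G g)) \<and>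
     (\<forall>h \<in> carrier H. \<forall>g \<in> carrier G. \<forall>g' \<in> carrier G.
        P h (g \<otimes>\<^bsub>G\<^esub> g') = tensor_lift (add_monoid K) (\<lambda>x y. P x g \<otimes>\<^bsub>K\<^esub> P y g') (\<Delta>H h)) \<and>
     (\<forall>g \<in> carrier G. P \<one>\<^bsub>H\<^esub> g = \<epsilon>G g) \<and>
     (\<forall>h \<in> carrier H. P h \<one>\<^bsub>G\<^esub> = \<epsilon>H h)"


section \<open>Separable and Frobenius algebras\<close>

text \<open>Separability is existence of a separability idempotent \<open>t \<in> R \<otimes>\<^sub>K R\<close>:
  \<open>t\<^sup>1 t\<^sup>2 = 1\<close> and \<open>rt = tr\<close> for all \<open>r\<close>.\<close>

definition separable_algebra :: "('k, 'c) ring_scheme \<Rightarrow> ('k, 'r, 'd) module_scheme \<Rightarrow> bool" where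
  "separable_algebra K R \<longleftrightarrow> k_algebra K R \<and>
     (\<exists>t \<in> carrier (k_tensor_group K R R).
        tensor_lift (add_monoid R) (\<lambda>x y. x \<otimes>\<^bsub>R\<^esub> y) t = \<one>\<^bsub>R\<^esub> \<and>
        (\<forall>r \<in> carrier R.
           tensor_lift (k_tensor_group K R R) (\<lambda>x y. k_pure K R R (r \<otimes>\<^bsub>R\<^esub> x) y) t
             = tensor_lift (k_tensor_group K R R) (\<lambda>x y. k_pure K R R x (y \<otimes>\<^bsub>R\<^esub> r)) t))"

definition index_one_frobenius_system ::
  "('k, 'c) ring_scheme \<Rightarrow> ('k, 'r, 'd) module_scheme \<Rightarrow>
   ('r \<Rightarrow> 'k) \<Rightarrow> nat \<Rightarrow> (nat \<Rightarrow> 'r) \<Rightarrow> (nat \<Rightarrow> 'r) \<Rightarrow> bool"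
where
  "index_one_frobenius_system K R \<phi> q e f \<longleftrightarrow>
     k_linear K R (base_module K) \<phi> \<and> e \<in> {..<q} \<rightarrow> carrier R \<and> f \<in> {..<q} \<rightarrow> carrier R \<and>
     (\<forall>r \<in> carrier R.
        (\<Oplus>\<^bsub>R\<^esub>j\<in>{..<q}. \<phi> (r \<otimes>\<^bsub>R\<^esub> e j) \<odot>\<^bsub>R\<^esub> f j) = r \<and>
        (\<Oplus>\<^bsub>R\<^esub>j\<in>{..<q}. \<phi> (f j \<otimes>\<^bsub>R\<^esub> r) \<odot>\<^bsub>R\<^esub> e j) = r) \<and>
     (\<Oplus>\<^bsub>R\<^esub>j\<in>{..<q}. e j \<otimes>\<^bsub>R\<^esub> f j) = \<one>\<^bsub>R\<^esub>"


section \<open>Ring extensions\<close>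

text \<open>A ring extension is a unital homomorphism \<open>\<iota> : N \<rightarrow> M\<close>, not necessarily injective;
  \<open>M\<close> is an \<open>N\<close>-bimodule through \<open>\<iota>\<close>.\<close>

definition centralizer ::
  "('n, 'c) ring_scheme \<Rightarrow> ('k, 'm) module \<Rightarrow> ('n \<Rightarrow> 'm) \<Rightarrow> ('k, 'm) module"
where
  "centralizer N M \<iota> =
     M\<lparr>carrier := {x \<in> carrier M. \<forall>n \<in> carrier N. \<iota> n \<otimes>\<^bsub>M\<^esub> x = x \<otimes>\<^bsub>M\<^esub> \<iota> n}\<rparr>"

definition frobenius_extension ::
  "('n, 'c) ring_scheme \<Rightarrow> ('m, 'd) ring_scheme \<Rightarrow> ('n \<Rightarrow> 'm) \<Rightarrow> bool"
where
  "frobenius_extension N M \<iota> \<longleftrightarrow>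
     (\<exists>E (p :: nat) x y.
        bimod_hom (carrier N) (carrier N)
          (add_monoid M) (\<lambda>n m. \<iota> n \<otimes>\<^bsub>M\<^esub> m) (\<lambda>m n. m \<otimes>\<^bsub>M\<^esub> \<iota> n)
          (add_monoid N) (\<lambda>n n'. n \<otimes>\<^bsub>N\<^esub> n') (\<lambda>n' n. n' \<otimes>\<^bsub>N\<^esub> n) E \<and>
        x \<in> {..<p} \<rightarrow> carrier M \<and> y \<in> {..<p} \<rightarrow> carrier M \<and>
        (\<forall>m \<in> carrier M.
           (\<Oplus>\<^bsub>M\<^esub>i\<in>{..<p}. x i \<otimes>\<^bsub>M\<^esub> \<iota> (E (y i \<otimes>\<^bsub>M\<^esub> m))) = m \<and>
           (\<Oplus>\<^bsub>M\<^esub>i\<in>{..<p}. \<iota> (E (m \<otimes>\<^bsub>M\<^esub> x i)) \<otimes>\<^bsub>M\<^esub> y i) = m))"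

text \<open>The abelian group \<open>M \<otimes>\<^sub>N M\<close>, its elements \<open>x \<otimes>\<^sub>N y\<close>, and its \<open>M\<close>-\<open>M\<close>-bimodule structure.\<close>

definition MM ::
  "('n, 'c) ring_scheme \<Rightarrow> ('m, 'd) ring_scheme \<Rightarrow> ('n \<Rightarrow> 'm) \<Rightarrow> ('m, 'm) tensor monoid"
where
  "MM N M \<iota> = tensor_group (add_monoid M) (add_monoid M) (carrier N)
     (\<lambda>x n. x \<otimes>\<^bsub>M\<^esub> \<iota> n) (\<lambda>n y. \<iota> n \<otimes>\<^bsub>M\<^esub> y)"

definition MM_pure ::
  "('n, 'c) ring_scheme \<Rightarrow> ('m, 'd) ring_scheme \<Rightarrow> ('n \<Rightarrow> 'm) \<Rightarrow> 'm \<Rightarrow> 'm \<Rightarrow> ('m, 'm) tensor"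
where
  "MM_pure N M \<iota> = tensor_pure (add_monoid M) (add_monoid M) (carrier N)
     (\<lambda>x n. x \<otimes>\<^bsub>M\<^esub> \<iota> n) (\<lambda>n y. \<iota> n \<otimes>\<^bsub>M\<^esub> y)"

definition MM_left ::
  "('n, 'c) ring_scheme \<Rightarrow> ('m, 'd) ring_scheme \<Rightarrow> ('n \<Rightarrow> 'm) \<Rightarrow>
   'm \<Rightarrow> ('m, 'm) tensor \<Rightarrow> ('m, 'm) tensor"
where
  "MM_left N M \<iota> m t = tensor_lift (MM N M \<iota>) (\<lambda>x y. MM_pure N M \<iota> (m \<otimes>\<^bsub>M\<^esub> x) y) t"

definition MM_right ::
  "('n, 'c) ring_scheme \<Rightarrow> ('m, 'd) ring_scheme \<Rightarrow> ('n \<Rightarrow> 'm) \<Rightarrow>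
   ('m, 'm) tensor \<Rightarrow> 'm \<Rightarrow> ('m, 'm) tensor"
where
  "MM_right N M \<iota> t m = tensor_lift (MM N M \<iota>) (\<lambda>x y. MM_pure N M \<iota> x (y \<otimes>\<^bsub>M\<^esub> m)) t"

definition depth_two ::
  "('n, 'c) ring_scheme \<Rightarrow> ('m, 'd) ring_scheme \<Rightarrow> ('n \<Rightarrow> 'm) \<Rightarrow> bool"
where
  "depth_two N M \<iota> \<longleftrightarrow>
     (\<exists>n::nat. n \<ge> 1 \<and>
        iso_direct_summand (carrier N) (carrier M)
          (MM N M \<iota>) (\<lambda>a t. MM_left N M \<iota> (\<iota> a) t) (\<lambda>t m. MM_right N M \<iota> t m)
          (product_group {..<n} (\<lambda>_. add_monoid M))
          (\<lambda>a v. \<lambda>i\<in>{..<n}. \<iota> a \<otimes>\<^bsub>M\<^esub> v i) (\<lambda>v m. \<lambda>i\<in>{..<n}. v i \<otimes>\<^bsub>M\<^esub> m)) \<and>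
     (\<exists>n::nat. n \<ge> 1 \<and>
        iso_direct_summand (carrier M) (carrier N)
          (MM N M \<iota>) (\<lambda>m t. MM_left N M \<iota> m t) (\<lambda>t a. MM_right N M \<iota> t (\<iota> a))
          (product_group {..<n} (\<lambda>_. add_monoid M))
          (\<lambda>m v. \<lambda>i\<in>{..<n}. m \<otimes>\<^bsub>M\<^esub> v i) (\<lambda>v a. \<lambda>i\<in>{..<n}. v i \<otimes>\<^bsub>M\<^esub> \<iota> a))"


section \<open>The algebras \<open>A\<close> and \<open>B\<close>\<close>

text \<open>Endomorphisms are taken extensional, so that equality in \<open>A\<close> is equality on \<open>carrier M\<close>.\<close>

definition A_alg :: "('n, 'c) ring_scheme \<Rightarrow> ('k, 'm) module \<Rightarrow> ('n \<Rightarrow> 'm) \<Rightarrow> ('k, 'm \<Rightarrow> 'm) module" where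
  "A_alg N M \<iota> =
     \<lparr>carrier = {\<alpha> \<in> extensional (carrier M).
         bimod_hom (carrier N) (carrier N)
           (add_monoid M) (\<lambda>n m. \<iota> n \<otimes>\<^bsub>M\<^esub> m) (\<lambda>m n. m \<otimes>\<^bsub>M\<^esub> \<iota> n)
           (add_monoid M) (\<lambda>n m. \<iota> n \<otimes>\<^bsub>M\<^esub> m) (\<lambda>m n. m \<otimes>\<^bsub>M\<^esub> \<iota> n) \<alpha>},
      mult = (\<lambda>\<alpha> \<alpha>'. compose (carrier M) \<alpha> \<alpha>'),
      one = (\<lambda>m\<in>carrier M. m),
      zero = (\<lambda>m\<in>carrier M. \<zero>\<^bsub>M\<^esub>),
      add = (\<lambda>\<alpha> \<alpha>'. \<lambda>m\<in>carrier M. \<alpha> m \<oplus>\<^bsub>M\<^esub> \<alpha>' m),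
      smult = (\<lambda>c \<alpha>. \<lambda>m\<in>carrier M. c \<odot>\<^bsub>M\<^esub> \<alpha> m)\<rparr>"

text \<open>The product of \<open>B\<close> is \<open>b b' = b'\<^sup>1 b\<^sup>1 \<otimes> b\<^sup>2 b'\<^sup>2\<close>.  The order of the two lifts matters:
  for \<open>b \<in> B\<close> the map \<open>(x', y') \<mapsto> x' b y'\<close> is balanced over \<open>N\<close>, whereas
  \<open>(x', y') \<mapsto> x' x \<otimes> y y'\<close> for fixed \<open>x, y\<close> is not.\<close>

definition B_alg ::
  "('n, 'c) ring_scheme \<Rightarrow> ('k, 'm) module \<Rightarrow> ('n \<Rightarrow> 'm) \<Rightarrow> ('k, ('m, 'm) tensor) module"
where
  "B_alg N M \<iota> =
     \<lparr>carrier = {b \<in> carrier (MM N M \<iota>). \<forall>n \<in> carrier N.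
         MM_left N M \<iota> (\<iota> n) b = MM_right N M \<iota> b (\<iota> n)},
      mult = (\<lambda>b b'. tensor_lift (MM N M \<iota>)
         (\<lambda>x' y'. tensor_lift (MM N M \<iota>)
            (\<lambda>x y. MM_pure N M \<iota> (x' \<otimes>\<^bsub>M\<^esub> x) (y \<otimes>\<^bsub>M\<^esub> y')) b) b'),
      one = MM_pure N M \<iota> \<one>\<^bsub>M\<^esub> \<one>\<^bsub>M\<^esub>,
      zero = \<one>\<^bsub>MM N M \<iota>\<^esub>,
      add = mult (MM N M \<iota>),
      smult = (\<lambda>c b. tensor_lift (MM N M \<iota>) (\<lambda>x y. MM_pure N M \<iota> (c \<odot>\<^bsub>M\<^esub> x) y) b)\<rparr>"

definition left_D2_quasibasis ::
  "('n, 'c) ring_scheme \<Rightarrow> ('k, 'm) module \<Rightarrow> ('n \<Rightarrow> 'm) \<Rightarrow>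
   nat \<Rightarrow> (nat \<Rightarrow> ('m, 'm) tensor) \<Rightarrow> (nat \<Rightarrow> 'm \<Rightarrow> 'm) \<Rightarrow> bool"
where
  "left_D2_quasibasis N M \<iota> p b \<beta> \<longleftrightarrow>
     b \<in> {..<p} \<rightarrow> carrier (B_alg N M \<iota>) \<and> \<beta> \<in> {..<p} \<rightarrow> carrier (A_alg N M \<iota>) \<and>
     (\<forall>m \<in> carrier M.
        finprod (MM N M \<iota>) (\<lambda>i. MM_right N M \<iota> (b i) (\<beta> i m)) {..<p} = MM_pure N M \<iota> m \<one>\<^bsub>M\<^esub>)"

text \<open>\<open>\<Delta>(\<alpha>) = \<Sum>\<^sub>i\<^sub>,\<^sub>j \<alpha>(- b\<^sub>i\<^sup>1) b\<^sub>i\<^sup>2 e\<^sub>j \<otimes>\<^sub>K \<lambda>(f\<^sub>j) \<beta>\<^sub>i\<close> and \<open>\<epsilon>(\<alpha>) = \<phi>(\<alpha>(1))\<close>.\<close>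

definition A_comult ::
  "('k, 'c) ring_scheme \<Rightarrow> ('n, 'd) ring_scheme \<Rightarrow> ('k, 'm) module \<Rightarrow> ('n \<Rightarrow> 'm) \<Rightarrow>
   nat \<Rightarrow> (nat \<Rightarrow> ('m, 'm) tensor) \<Rightarrow> (nat \<Rightarrow> 'm \<Rightarrow> 'm) \<Rightarrow> nat \<Rightarrow> (nat \<Rightarrow> 'm) \<Rightarrow> (nat \<Rightarrow> 'm) \<Rightarrow>
   ('m \<Rightarrow> 'm) \<Rightarrow> ('m \<Rightarrow> 'm, 'm \<Rightarrow> 'm) tensor"
where
  "A_comult K N M \<iota> p b \<beta> q e f \<alpha> =
     (\<Oplus>\<^bsub>k_tensor K (A_alg N M \<iota>) (A_alg N M \<iota>)\<^esub>i\<in>{..<p}.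
      \<Oplus>\<^bsub>k_tensor K (A_alg N M \<iota>) (A_alg N M \<iota>)\<^esub>j\<in>{..<q}.
        k_pure K (A_alg N M \<iota>) (A_alg N M \<iota>)
          (\<lambda>m\<in>carrier M. tensor_lift (add_monoid M) (\<lambda>x y. \<alpha> (m \<otimes>\<^bsub>M\<^esub> x) \<otimes>\<^bsub>M\<^esub> y) (b i) \<otimes>\<^bsub>M\<^esub> e j)
          (\<lambda>m\<in>carrier M. f j \<otimes>\<^bsub>M\<^esub> \<beta> i m))"

definition A_counit :: "('k, 'm) module \<Rightarrow> ('m \<Rightarrow> 'k) \<Rightarrow> ('m \<Rightarrow> 'm) \<Rightarrow> 'k" where
  "A_counit M \<phi> \<alpha> = \<phi> (\<alpha> \<one>\<^bsub>M\<^esub>)"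

text \<open>\<open>\<Delta>(b) = \<Sum>\<^sub>i\<^sub>,\<^sub>j (b\<^sub>i\<^sup>1 \<otimes> b\<^sub>i\<^sup>2 e\<^sub>j) \<otimes>\<^sub>K (f\<^sub>j \<beta>\<^sub>i(b\<^sup>1) \<otimes> b\<^sup>2)\<close> and
  \<open>\<epsilon>(b) = \<phi>(b\<^sup>1 b\<^sup>2)\<close>.\<close>

definition B_comult ::
  "('k, 'c) ring_scheme \<Rightarrow> ('n, 'd) ring_scheme \<Rightarrow> ('k, 'm) module \<Rightarrow> ('n \<Rightarrow> 'm) \<Rightarrow>
   nat \<Rightarrow> (nat \<Rightarrow> ('m, 'm) tensor) \<Rightarrow> (nat \<Rightarrow> 'm \<Rightarrow> 'm) \<Rightarrow> nat \<Rightarrow> (nat \<Rightarrow> 'm) \<Rightarrow> (nat \<Rightarrow> 'm) \<Rightarrow>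
   ('m, 'm) tensor \<Rightarrow> (('m, 'm) tensor, ('m, 'm) tensor) tensor"
where
  "B_comult K N M \<iota> p b \<beta> q e f t =
     (\<Oplus>\<^bsub>k_tensor K (B_alg N M \<iota>) (B_alg N M \<iota>)\<^esub>i\<in>{..<p}.
      \<Oplus>\<^bsub>k_tensor K (B_alg N M \<iota>) (B_alg N M \<iota>)\<^esub>j\<in>{..<q}.
        k_pure K (B_alg N M \<iota>) (B_alg N M \<iota>)
          (MM_right N M \<iota> (b i) (e j))
          (tensor_lift (MM N M \<iota>) (\<lambda>x y. MM_pure N M \<iota> (f j \<otimes>\<^bsub>M\<^esub> \<beta> i x) y) t))"

definition B_counit :: "('k, 'm) module \<Rightarrow> ('m \<Rightarrow> 'k) \<Rightarrow> ('m, 'm) tensor \<Rightarrow> 'k" where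
  "B_counit M \<phi> t = \<phi> (tensor_lift (add_monoid M) (\<lambda>x y. x \<otimes>\<^bsub>M\<^esub> y) t)"

text \<open>The pairing \<open>\<langle>b, \<alpha>\<rangle> = \<phi>(b\<^sup>1 \<alpha>(b\<^sup>2))\<close> of \<open>B\<close> with \<open>A\<close>.\<close>

definition BA_pairing ::
  "('k, 'm) module \<Rightarrow> ('m \<Rightarrow> 'k) \<Rightarrow> ('m, 'm) tensor \<Rightarrow> ('m \<Rightarrow> 'm) \<Rightarrow> 'k"
where
  "BA_pairing M \<phi> t \<alpha> = \<phi> (tensor_lift (add_monoid M) (\<lambda>x y. x \<otimes>\<^bsub>M\<^esub> \<alpha> y) t)"

end

theory Submission
  imports Defs "HOL-Algebra.Product_Groups"
begin

text \<open>
  The left quasibasis \<open>(b\<^sub>i, \<beta>\<^sub>i)\<close> is the given one; depth two also yields a right one, \<open>c\<^sub>i \<in> B\<close> and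
  \<open>\<gamma>\<^sub>i \<in> A\<close> with \<open>\<Sum> \<gamma>\<^sub>i(m) c\<^sub>i = 1 \<otimes> m\<close>.  The right quasibasis makes \<open>f\<^sub>j c\<^sub>i \<in> B\<close> and
  \<open>\<gamma>\<^sub>i(-) e\<^sub>j \<in> A\<close> dual bases for the pairing \<open>P b a = \<phi>(b\<^sup>1 a(b\<^sup>2))\<close>, so that every identity in a tensor
  power of \<open>A\<close> or \<open>B\<close> can be tested by pairing and becomes an identity between scalars.  The left
  quasibasis makes \<open>b\<^sub>i e\<^sub>j\<close> and \<open>f\<^sub>j \<beta>\<^sub>i\<close> dual bases for the second form \<open>\<tau> b a = \<phi>(a(b\<^sup>1) b\<^sup>2)\<close>.  Both coproducts
  are sums over this second pair of dual bases, \<open>\<Delta>(a) = \<Sum> a(- l\<^sup>1)l\<^sup>2 \<otimes> r\<close> and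
  \<open>\<Delta>(b) = \<Sum> l \<otimes> (r(b\<^sup>1) \<otimes> b\<^sup>2)\<close> with \<open>l = b\<^sub>i e\<^sub>j\<close> and \<open>r = f\<^sub>j \<beta>\<^sub>i\<close>, and the sums collapse by expanding in them.
  The antipodes of \<open>A\<close> and \<open>B\<close> are the transposes \<open>P b (S a) = \<tau> b a = P (S b) a\<close>.
\<close>


section \<open>Sums in abelian groups\<close>

text \<open>The axioms speak of legs of tensors, and every expression in legs first needs a balanced
  map. Pairing removes this burden and halves the work, since transposition turns each axiom of
  \<open>A\<close> into one of \<open>B\<close>: associativity into coassociativity, the weak counit
  axiom into the weak unit axiom, multiplicativity of the coproduct into itself. Both forms are
  needed because they exchange when a leg moves across: t^1 a(t^2 s^1) s^2 is a
  \<open>\<tau>\<close> expression in s and a \<open>P\<close> expression in t. Expanding in the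
  dual bases of \<open>\<tau>\<close> therefore yields values of \<open>P\<close>. The weakness
  stems from the centralizer \<open>R\<close>. Since \<open>\<phi>\<close> represents functionals on
  \<open>R\<close> by elements of \<open>R\<close>, the outer factors of a counit of a threefold
  product are absorbed into r \<otimes> s in \<open>B\<close>, or into left and right
  multiplications in \<open>A\<close>. These pairs commute, and their two orders give the two weak
  counit identities. Index one makes l, r a left quasibasis again, so the legs of a coproduct
  satisfy a_1(x) a_2(y) = a(xy); multiplicativity of the coproduct rests on this.\<close>

lemma hom_finprod:
  assumes "comm_group G" "comm_group H" "h \<in> hom G H" "f \<in> A \<rightarrow> carrier G"
  shows "h (finprod G f A) = finprod H (\<lambda>i. h (f i)) A"
proof -
  interpret G: comm_group G by fact
  interpret H: comm_group H by fact
  interpret group_hom G H h by unfold_locales fact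
  show ?thesis using assms(4)
  \<comment> \<open>Over an infinite index set both products are the unit by convention, and
    homomorphisms preserve it; so the statement holds for every \<open>A\<close>.\<close>
  proof (induct A rule: infinite_finite_induct)
    case (insert x F)
    then have "(\<lambda>i. h (f i)) \<in> F \<rightarrow> carrier H" "h (f x) \<in> carrier H" "f \<in> F \<rightarrow> carrier G" "f x \<in> carrier G"
      by (auto simp: Pi_iff)
    with insert show ?case by simp
  qed auto
qed

lemma hom_finsum:
  assumes "abelian_group X" "comm_group H" "h \<in> hom (add_monoid X) H" "f \<in> A \<rightarrow> carrier X"
  shows "h (finsum X f A) = finprod H (\<lambda>i. h (f i)) A"
  using hom_finprod[OF abelian_group.a_comm_group[OF assms(1)] assms(2,3)] assms(4)
  by (simp add: finsum_def)

lemma (in comm_group) finprod_swap: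
  assumes "finite A" "finite B" "\<And>i j. i \<in> A \<Longrightarrow> j \<in> B \<Longrightarrow> f i j \<in> carrier G"
  shows "finprod G (\<lambda>i. finprod G (f i) B) A = finprod G (\<lambda>j. finprod G (\<lambda>i. f i j) A) B"
  using assms(1,3)
proof (induct A)
  case empty
  show ?case by simp
next
  case (insert x F)
  then have "finprod G (\<lambda>i. finprod G (f i) B) (insert x F)
      = finprod G (f x) B \<otimes> finprod G (\<lambda>j. finprod G (\<lambda>i. f i j) F) B"
    by (subst finprod_insert) (auto simp: Pi_iff)
  also have "\<dots> = finprod G (\<lambda>j. f x j \<otimes> finprod G (\<lambda>i. f i j) F) B"
    by (subst finprod_multf) (use insert in \<open>auto simp: Pi_iff\<close>)
  also have "\<dots> = finprod G (\<lambda>j. finprod G (\<lambda>i. f i j) (insert x F)) B"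
    by (rule finprod_cong') (use insert in \<open>auto simp: Pi_iff\<close>)
  finally show ?case .
qed

lemma (in comm_group) finprod_Times:
  assumes "finite A" "finite B" "\<And>i j. i \<in> A \<Longrightarrow> j \<in> B \<Longrightarrow> f i j \<in> carrier G"
  shows "finprod G (\<lambda>(i, j). f i j) (A \<times> B) = finprod G (\<lambda>i. finprod G (f i) B) A"
  using assms(1,3)
proof (induct A)
  case empty
  show ?case by simp
next
  case (insert x F)
  have "finprod G (\<lambda>(i, j). f i j) ({x} \<times> B) = finprod G (f x) B"
  proof -
    have "finprod G (\<lambda>(i, j). f i j) (Pair x ` B) = finprod G (\<lambda>j. (\<lambda>(i, j). f i j) (x, j)) B"
      by (rule finprod_reindex) (use insert in \<open>auto simp: Pi_iff inj_on_def\<close>)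
    moreover have "Pair x ` B = {x} \<times> B" by auto
    ultimately show ?thesis by simp
  qed
  moreover have "insert x F \<times> B = {x} \<times> B \<union> F \<times> B" by auto
  moreover have "finprod G (\<lambda>(i, j). f i j) ({x} \<times> B \<union> F \<times> B)
      = finprod G (\<lambda>(i, j). f i j) ({x} \<times> B) \<otimes> finprod G (\<lambda>(i, j). f i j) (F \<times> B)"
    by (rule finprod_Un_disjoint) (use insert assms(2) in \<open>auto simp: Pi_iff\<close>)
  moreover have "finprod G (\<lambda>i. finprod G (f i) B) (insert x F)
      = finprod G (f x) B \<otimes> finprod G (\<lambda>i. finprod G (f i) B) F"
    using insert by (subst finprod_insert) (auto simp: Pi_iff)
  ultimately show ?case using insert by simp
qed

text \<open>Products see only these three record fields. This lets sums in
  \<open>base_module K\<close> be read as sums in \<open>K\<close>.\<close>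

lemma finprod_hom_cong:
  assumes "carrier G = carrier H" "mult G = mult H" "one G = one H"
  shows "finprod G f A = finprod H f A"
  using assms by (simp add: finprod_def)


section \<open>Tensor products\<close>

text \<open>Bundles the conditions under which \<open>tensor_lift\<close> is well defined, so that
  closure, additivity and evaluation of a lift all follow from one fact.\<close>

definition balanced ::
  "('x, 'c) monoid_scheme \<Rightarrow> ('y, 'd) monoid_scheme \<Rightarrow> 'q set \<Rightarrow> ('x \<Rightarrow> 'q \<Rightarrow> 'x) \<Rightarrow> ('q \<Rightarrow> 'y \<Rightarrow> 'y) \<Rightarrow>
   ('g, 'e) monoid_scheme \<Rightarrow> ('x \<Rightarrow> 'y \<Rightarrow> 'g) \<Rightarrow> bool"
where
  "balanced X Y Q r l G f \<longleftrightarrow>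
     (\<forall>x \<in> carrier X. \<forall>y \<in> carrier Y. f x y \<in> carrier G) \<and>
     (\<forall>x \<in> carrier X. \<forall>x' \<in> carrier X. \<forall>y \<in> carrier Y. f (x \<otimes>\<^bsub>X\<^esub> x') y = f x y \<otimes>\<^bsub>G\<^esub> f x' y) \<and>
     (\<forall>x \<in> carrier X. \<forall>y \<in> carrier Y. \<forall>y' \<in> carrier Y. f x (y \<otimes>\<^bsub>Y\<^esub> y') = f x y \<otimes>\<^bsub>G\<^esub> f x y') \<and>
     (\<forall>x \<in> carrier X. \<forall>a \<in> Q. \<forall>y \<in> carrier Y. f (r x a) y = f x (l a y))"

lemma balancedI:
  assumes "\<And>x y. x \<in> carrier X \<Longrightarrow> y \<in> carrier Y \<Longrightarrow> f x y \<in> carrier G"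
    and "\<And>x x' y. x \<in> carrier X \<Longrightarrow> x' \<in> carrier X \<Longrightarrow> y \<in> carrier Y \<Longrightarrow>
      f (x \<otimes>\<^bsub>X\<^esub> x') y = f x y \<otimes>\<^bsub>G\<^esub> f x' y"
    and "\<And>x y y'. x \<in> carrier X \<Longrightarrow> y \<in> carrier Y \<Longrightarrow> y' \<in> carrier Y \<Longrightarrow>
      f x (y \<otimes>\<^bsub>Y\<^esub> y') = f x y \<otimes>\<^bsub>G\<^esub> f x y'"
    and "\<And>x a y. x \<in> carrier X \<Longrightarrow> a \<in> Q \<Longrightarrow> y \<in> carrier Y \<Longrightarrow> f (r x a) y = f x (l a y)"
  shows "balanced X Y Q r l G f"
  unfolding balanced_def using assms by simp

locale tensor_product = X: group X + Y: group Y
  for X :: "('x, 'c) monoid_scheme" and Y :: "('y, 'd) monoid_scheme" +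
  fixes Q :: "'q set" and r :: "'x \<Rightarrow> 'q \<Rightarrow> 'x" and l :: "'q \<Rightarrow> 'y \<Rightarrow> 'y"
  assumes r_closed: "x \<in> carrier X \<Longrightarrow> a \<in> Q \<Longrightarrow> r x a \<in> carrier X"
    and l_closed: "a \<in> Q \<Longrightarrow> y \<in> carrier Y \<Longrightarrow> l a y \<in> carrier Y"
begin

abbreviation "T \<equiv> tensor_group X Y Q r l"
abbreviation "pure \<equiv> tensor_pure X Y Q r l"

lemma
  assumes G: "comm_group G" and f: "balanced X Y Q r l G f"
  shows lift_hom: "tensor_lift G f \<in> hom T G"
    and lift_pure: "\<And>x y. x \<in> carrier X \<Longrightarrow> y \<in> carrier Y \<Longrightarrow> tensor_lift G f (pure x y) = f x y"
proof -
  note w = tensor_lift_well_defined[OF G X.is_group Y.is_group, of Q r l f, OF r_closed l_closed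
    f[unfolded balanced_def, THEN conjunct1, rule_format]
    f[unfolded balanced_def, THEN conjunct2, THEN conjunct1, rule_format]
    f[unfolded balanced_def, THEN conjunct2, THEN conjunct2, THEN conjunct1, rule_format]
    f[unfolded balanced_def, THEN conjunct2, THEN conjunct2, THEN conjunct2, rule_format]]
  show "tensor_lift G f \<in> hom T G" by (rule w(1))
  show "\<And>x y. x \<in> carrier X \<Longrightarrow> y \<in> carrier Y \<Longrightarrow> tensor_lift G f (pure x y) = f x y"
    by (rule w(2))
qed

lemma comm_group_T: "comm_group T"
  \<comment> \<open>The conclusion mentions no map, so the constant map into the trivial group
    serves as the balanced map.\<close>
  by (rule tensor_lift_well_defined(3)[where f = "\<lambda>_ _. \<one>\<^bsub>free_Abelian_group {}\<^esub>" and G = "free_Abelian_group {}"])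
    (use r_closed l_closed X.is_group Y.is_group abelian_free_Abelian_group in auto)

abbreviation "F \<equiv> free_Abelian_group (carrier X \<times> carrier Y)"
abbreviation "null \<equiv> tensor_null X Y Q r l"

lemma relators_closed: "tensor_relators X Y Q r l \<subseteq> carrier F"
proof -
  have minc: "u - v \<in> carrier F" if "u \<in> carrier F" "v \<in> carrier F" for u v
    using that keys_diff[of u v] by auto
  have fr: "frag_of (x,y) \<in> carrier F" if "x \<in> carrier X" "y \<in> carrier Y" for x y
    using that by simp
  show ?thesis unfolding tensor_relators_def
    by (intro Un_least) (auto intro!: minc fr r_closed l_closed simp del: carrier_free_Abelian_group_iff)
qed

lemma null_normal: "null \<lhd> F"
proof -
  interpret F: comm_group F by (rule abelian_free_Abelian_group)
  show ?thesis
    unfolding tensor_null_def by (rule F.subgroup_imp_normal[OF F.generate_is_subgroup[OF relators_closed]])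
qed

lemma coset_hom: "(\<lambda>u. null #>\<^bsub>F\<^esub> u) \<in> hom F T"
  using normal.r_coset_hom_Mod[OF null_normal] by (simp add: tensor_group_def)

lemma coset_relator:
  assumes "u \<in> tensor_relators X Y Q r l"
  shows "null #>\<^bsub>F\<^esub> u = \<one>\<^bsub>T\<^esub>"
proof -
  interpret F: comm_group F by (rule abelian_free_Abelian_group)
  interpret normal null F by (rule null_normal)
  have "u \<in> null" unfolding tensor_null_def using assms by (rule generate.incl)
  then show ?thesis using F.coset_join2 subset subgroup_axioms
    by (simp add: tensor_group_def FactGroup_def subset_iff del: carrier_free_Abelian_group_iff)
qed

lemma coset_diff:
  assumes "u \<in> carrier F" "v \<in> carrier F" "null #>\<^bsub>F\<^esub> (u - v) = \<one>\<^bsub>T\<^esub>"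
  shows "null #>\<^bsub>F\<^esub> u = null #>\<^bsub>F\<^esub> v"
proof -
  interpret T: comm_group T by (rule comm_group_T)
  interpret F: comm_group F by (rule abelian_free_Abelian_group)
  interpret group_hom F T "\<lambda>u. null #>\<^bsub>F\<^esub> u"
    by unfold_locales (rule coset_hom)
  have uv: "u - v \<in> carrier F" using assms keys_diff[of u v] by auto
  have "null #>\<^bsub>F\<^esub> ((u - v) + v) = (null #>\<^bsub>F\<^esub> (u - v)) \<otimes>\<^bsub>T\<^esub> (null #>\<^bsub>F\<^esub> v)"
    using hom_mult[OF uv assms(2)] by simp
  then show ?thesis using hom_closed[OF assms(2)] by (simp add: assms(3))
qed

lemma pure_closed [simp, intro]: "x \<in> carrier X \<Longrightarrow> y \<in> carrier Y \<Longrightarrow> pure x y \<in> carrier T"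
  unfolding tensor_pure_def using hom_in_carrier[OF coset_hom] by simp

lemma coset_add:
  assumes "u \<in> carrier F" "v \<in> carrier F"
  shows "null #>\<^bsub>F\<^esub> (u + v) = (null #>\<^bsub>F\<^esub> u) \<otimes>\<^bsub>T\<^esub> (null #>\<^bsub>F\<^esub> v)"
  using hom_mult[OF coset_hom assms] by simp

lemma coset_minus:
  assumes "u \<in> carrier F" "v \<in> carrier F"
  shows "null #>\<^bsub>F\<^esub> (u - v) = (null #>\<^bsub>F\<^esub> u) \<otimes>\<^bsub>T\<^esub> inv\<^bsub>T\<^esub> (null #>\<^bsub>F\<^esub> v)"
proof -
  interpret T: comm_group T by (rule comm_group_T)
  interpret F: comm_group F by (rule abelian_free_Abelian_group)
  interpret group_hom F T "\<lambda>u. null #>\<^bsub>F\<^esub> u"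
    by unfold_locales (rule coset_hom)
  have "Poly_Mapping.keys v \<subseteq> carrier X \<times> carrier Y" using assms(2) by simp
  then show ?thesis using coset_add[of u "- v"] hom_inv[OF assms(2)] assms
    by (simp add: inv_free_Abelian_group)
qed

text \<open>Each law is the vanishing of one family of relators. For the two additive families the
  relator is regrouped as a single difference, to which \<open>coset_diff\<close> applies.\<close>

lemma balanced_pure: "balanced X Y Q r l T pure"
proof -
  have fr: "frag_of (x,y) \<in> carrier F" if "x \<in> carrier X" "y \<in> carrier Y" for x y
    using that by simp
  have ad: "u + v \<in> carrier F" if "u \<in> carrier F" "v \<in> carrier F" for u v
    using that keys_add[of u v] by auto
  have 1: "pure (x \<otimes>\<^bsub>X\<^esub> x') y = pure x y \<otimes>\<^bsub>T\<^esub> pure x' y"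
    if "x \<in> carrier X" "x' \<in> carrier X" "y \<in> carrier Y" for x x' y
    unfolding tensor_pure_def coset_add[OF fr fr, OF that(1,3) that(2,3), symmetric]
  proof (rule coset_diff)
    have "frag_of (x \<otimes>\<^bsub>X\<^esub> x', y) - (frag_of (x, y) + frag_of (x', y)) \<in> tensor_relators X Y Q r l"
      unfolding tensor_relators_def diff_diff_eq[symmetric] using that by blast
    then show "null #>\<^bsub>F\<^esub> (frag_of (x \<otimes>\<^bsub>X\<^esub> x', y) - (frag_of (x, y) + frag_of (x', y))) = \<one>\<^bsub>T\<^esub>"
      by (rule coset_relator)
  qed (use that in \<open>auto intro!: ad fr simp del: carrier_free_Abelian_group_iff\<close>)
  have 2: "pure x (y \<otimes>\<^bsub>Y\<^esub> y') = pure x y \<otimes>\<^bsub>T\<^esub> pure x y'"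
    if "x \<in> carrier X" "y \<in> carrier Y" "y' \<in> carrier Y" for x y y'
    unfolding tensor_pure_def coset_add[OF fr fr, OF that(1,2) that(1,3), symmetric]
  proof (rule coset_diff)
    have "frag_of (x, y \<otimes>\<^bsub>Y\<^esub> y') - (frag_of (x, y) + frag_of (x, y')) \<in> tensor_relators X Y Q r l"
      unfolding tensor_relators_def diff_diff_eq[symmetric] using that by blast
    then show "null #>\<^bsub>F\<^esub> (frag_of (x, y \<otimes>\<^bsub>Y\<^esub> y') - (frag_of (x, y) + frag_of (x, y'))) = \<one>\<^bsub>T\<^esub>"
      by (rule coset_relator)
  qed (use that in \<open>auto intro!: ad fr simp del: carrier_free_Abelian_group_iff\<close>)
  have 3: "pure (r x a) y = pure x (l a y)" if "x \<in> carrier X" "a \<in> Q" "y \<in> carrier Y" for x a y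
    unfolding tensor_pure_def
  proof (rule coset_diff)
    have "frag_of (r x a, y) - frag_of (x, l a y) \<in> tensor_relators X Y Q r l"
      unfolding tensor_relators_def using that by blast
    then show "null #>\<^bsub>F\<^esub> (frag_of (r x a, y) - frag_of (x, l a y)) = \<one>\<^bsub>T\<^esub>"
      by (rule coset_relator)
  qed (use that in \<open>auto intro!: fr r_closed l_closed simp del: carrier_free_Abelian_group_iff\<close>)
  show ?thesis unfolding balanced_def by (intro conjI ballI) (simp_all add: 1 2 3)
qed

lemma
  assumes "x \<in> carrier X" "y \<in> carrier Y"
  shows pure_mult_left: "x' \<in> carrier X \<Longrightarrow> pure (x \<otimes>\<^bsub>X\<^esub> x') y = pure x y \<otimes>\<^bsub>T\<^esub> pure x' y"
    and pure_mult_right: "y' \<in> carrier Y \<Longrightarrow> pure x (y \<otimes>\<^bsub>Y\<^esub> y') = pure x y \<otimes>\<^bsub>T\<^esub> pure x y'"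
    and pure_act: "a \<in> Q \<Longrightarrow> pure (r x a) y = pure x (l a y)"
  using balanced_pure assms unfolding balanced_def by simp_all

text \<open>Uniqueness half of the universal property: the classes of the free generators generate
  the quotient. Identities between additive maps on tensors are reduced to pure tensors through this
  lemma.\<close>

lemma hom_eqI:
  assumes "comm_group G" "h \<in> hom T G" "h' \<in> hom T G"
    and "\<And>x y. x \<in> carrier X \<Longrightarrow> y \<in> carrier Y \<Longrightarrow> h (pure x y) = h' (pure x y)"
    and "t \<in> carrier T"
  shows "h t = h' t"
proof -
  interpret G: comm_group G by fact
  interpret T: comm_group T by (rule comm_group_T)
  interpret h: group_hom T G h by unfold_locales fact
  interpret h': group_hom T G h' by unfold_locales fact
  interpret F: comm_group F by (rule abelian_free_Abelian_group)
  interpret c: group_hom F T "\<lambda>u. null #>\<^bsub>F\<^esub> u"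
    by unfold_locales (rule coset_hom)
  obtain u where u: "u \<in> carrier F" "t = null #>\<^bsub>F\<^esub> u"
    using assms(5) by (auto simp: tensor_group_def FactGroup_def RCOSETS_def)
  have "h (null #>\<^bsub>F\<^esub> u) = h' (null #>\<^bsub>F\<^esub> u)"
  proof (rule free_Abelian_group_induct[of u "carrier X \<times> carrier Y"])
    show "Poly_Mapping.keys u \<subseteq> carrier X \<times> carrier Y" using u(1) by simp
    show "h (null #>\<^bsub>F\<^esub> 0) = h' (null #>\<^bsub>F\<^esub> 0)" using c.hom_one by simp
  next
    fix v w assume "Poly_Mapping.keys v \<subseteq> carrier X \<times> carrier Y" "Poly_Mapping.keys w \<subseteq> carrier X \<times> carrier Y"
      and vw: "h (null #>\<^bsub>F\<^esub> v) = h' (null #>\<^bsub>F\<^esub> v)" "h (null #>\<^bsub>F\<^esub> w) = h' (null #>\<^bsub>F\<^esub> w)"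
    then have c: "v \<in> carrier F" "w \<in> carrier F" by auto
    show "h (null #>\<^bsub>F\<^esub> (v - w)) = h' (null #>\<^bsub>F\<^esub> (v - w))"
      unfolding coset_minus[OF c] using vw c.hom_closed[OF c(1)] c.hom_closed[OF c(2)]
      by (simp add: h.hom_inv h'.hom_inv)
  next
    fix a assume "a \<in> carrier X \<times> carrier Y"
    then show "h (null #>\<^bsub>F\<^esub> frag_of a) = h' (null #>\<^bsub>F\<^esub> frag_of a)"
      using assms(4) by (auto simp: tensor_pure_def)
  qed
  then show ?thesis using u by simp
qed

text \<open>Sums of pure tensors exhaust the group, because the inverse of \<open>pure x y\<close>
  is again pure, with \<open>inv x\<close> in the first place.\<close>

lemma induct [consumes 1, case_names pure mult]:
  assumes t: "t \<in> carrier T"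
    and p: "\<And>x y. x \<in> carrier X \<Longrightarrow> y \<in> carrier Y \<Longrightarrow> P (pure x y)"
    and m: "\<And>s t. s \<in> carrier T \<Longrightarrow> t \<in> carrier T \<Longrightarrow> P s \<Longrightarrow> P t \<Longrightarrow> P (s \<otimes>\<^bsub>T\<^esub> t)"
  shows "P t"
proof -
  interpret T: comm_group T by (rule comm_group_T)
  interpret F: comm_group F by (rule abelian_free_Abelian_group)
  interpret c: group_hom F T "\<lambda>u. null #>\<^bsub>F\<^esub> u"
    by unfold_locales (rule coset_hom)
  have bp: "pure (x \<otimes>\<^bsub>X\<^esub> x') y = pure x y \<otimes>\<^bsub>T\<^esub> pure x' y"
    if "x \<in> carrier X" "x' \<in> carrier X" "y \<in> carrier Y" for x x' y
    using balanced_pure that unfolding balanced_def by simp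
  have p1: "pure \<one>\<^bsub>X\<^esub> y = \<one>\<^bsub>T\<^esub>" if "y \<in> carrier Y" for y
    using bp[of "\<one>\<^bsub>X\<^esub>" "\<one>\<^bsub>X\<^esub>" y] that by (metis T.l_cancel_one' X.one_closed X.r_one pure_closed)
  have pinv: "inv\<^bsub>T\<^esub> (pure x y) = pure (inv\<^bsub>X\<^esub> x) y" if "x \<in> carrier X" "y \<in> carrier Y" for x y
    by (rule T.inv_equality) (use bp[of "inv\<^bsub>X\<^esub> x" x y] p1 that in auto)
  obtain u where u: "u \<in> carrier F" "t = null #>\<^bsub>F\<^esub> u"
    using t by (auto simp: tensor_group_def FactGroup_def RCOSETS_def)
  \<comment> \<open>Induction on the free group proceeds by differences, so the claim is carried for
    a class together with its inverse.\<close>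
  have "P (null #>\<^bsub>F\<^esub> u) \<and> P (inv\<^bsub>T\<^esub> (null #>\<^bsub>F\<^esub> u))"
  proof (rule free_Abelian_group_induct[of u "carrier X \<times> carrier Y"])
    show "Poly_Mapping.keys u \<subseteq> carrier X \<times> carrier Y" using u(1) by simp
    show "P (null #>\<^bsub>F\<^esub> 0) \<and> P (inv\<^bsub>T\<^esub> (null #>\<^bsub>F\<^esub> 0))"
      using c.hom_one p[of "\<one>\<^bsub>X\<^esub>" "\<one>\<^bsub>Y\<^esub>"] p1 by simp
  next
    fix v w assume "Poly_Mapping.keys v \<subseteq> carrier X \<times> carrier Y" "Poly_Mapping.keys w \<subseteq> carrier X \<times> carrier Y"
      and vw: "P (null #>\<^bsub>F\<^esub> v) \<and> P (inv\<^bsub>T\<^esub> (null #>\<^bsub>F\<^esub> v))" "P (null #>\<^bsub>F\<^esub> w) \<and> P (inv\<^bsub>T\<^esub> (null #>\<^bsub>F\<^esub> w))"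
    then have c: "v \<in> carrier F" "w \<in> carrier F" by auto
    show "P (null #>\<^bsub>F\<^esub> (v - w)) \<and> P (inv\<^bsub>T\<^esub> (null #>\<^bsub>F\<^esub> (v - w)))"
      unfolding coset_minus[OF c] using vw m c.hom_closed[OF c(1)] c.hom_closed[OF c(2)]
      by (simp add: T.inv_mult_group)
  next
    fix a assume "a \<in> carrier X \<times> carrier Y"
    then obtain x y where "a = (x, y)" "x \<in> carrier X" "y \<in> carrier Y" by auto
    then show "P (null #>\<^bsub>F\<^esub> frag_of a) \<and> P (inv\<^bsub>T\<^esub> (null #>\<^bsub>F\<^esub> frag_of a))"
      using p p[of "inv\<^bsub>X\<^esub> x" y] pinv[of x y] by (simp add: tensor_pure_def)
  qed
  then show ?thesis using u by simp
qed

end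


section \<open>Tensor products of modules over a commutative ring\<close>

definition k_bilinear ::
  "('k, 'c) ring_scheme \<Rightarrow> ('k, 'x, 'd) module_scheme \<Rightarrow> ('k, 'y, 'e) module_scheme \<Rightarrow>
   ('k, 'z, 'f) module_scheme \<Rightarrow> ('x \<Rightarrow> 'y \<Rightarrow> 'z) \<Rightarrow> bool"
where
  "k_bilinear K X Y Z f \<longleftrightarrow>
     (\<forall>x \<in> carrier X. k_linear K Y Z (f x)) \<and> (\<forall>y \<in> carrier Y. k_linear K X Z (\<lambda>x. f x y))"

lemma k_linearI:
  assumes "\<And>x. x \<in> carrier X \<Longrightarrow> f x \<in> carrier Y"
    and "\<And>x x'. x \<in> carrier X \<Longrightarrow> x' \<in> carrier X \<Longrightarrow> f (x \<oplus>\<^bsub>X\<^esub> x') = f x \<oplus>\<^bsub>Y\<^esub> f x'"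
    and "\<And>c x. c \<in> carrier K \<Longrightarrow> x \<in> carrier X \<Longrightarrow> f (c \<odot>\<^bsub>X\<^esub> x) = c \<odot>\<^bsub>Y\<^esub> f x"
  shows "k_linear K X Y f"
  unfolding k_linear_def using assms by (auto intro: homI)

lemma
  assumes "k_linear K X Y f"
  shows k_linear_closed: "x \<in> carrier X \<Longrightarrow> f x \<in> carrier Y"
    and k_linear_add: "x \<in> carrier X \<Longrightarrow> x' \<in> carrier X \<Longrightarrow> f (x \<oplus>\<^bsub>X\<^esub> x') = f x \<oplus>\<^bsub>Y\<^esub> f x'"
    and k_linear_smult: "c \<in> carrier K \<Longrightarrow> x \<in> carrier X \<Longrightarrow> f (c \<odot>\<^bsub>X\<^esub> x) = c \<odot>\<^bsub>Y\<^esub> f x"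
    and k_linear_hom: "f \<in> hom (add_monoid X) (add_monoid Y)"
  using assms hom_in_carrier[of f "add_monoid X" "add_monoid Y" x]
    hom_mult[of f "add_monoid X" "add_monoid Y" x x'] unfolding k_linear_def by auto

lemmas k_linearD = k_linear_closed k_linear_add k_linear_smult

lemma k_linear_finsum:
  assumes "abelian_group X" "abelian_group Y" "k_linear K X Y f" "g \<in> A \<rightarrow> carrier X"
  shows "f (finsum X g A) = finsum Y (\<lambda>i. f (g i)) A"
  using hom_finsum[OF assms(1) abelian_group.a_comm_group[OF assms(2)] k_linear_hom[OF assms(3)] assms(4)]
  by (simp add: finsum_def)

lemma base_module_simps [simp]:
  "carrier (base_module K) = carrier K" "mult (base_module K) = mult K" "one (base_module K) = one K"
  "zero (base_module K) = zero K" "add (base_module K) = add K" "smult (base_module K) = mult K"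
  by (simp_all add: base_module_def)

lemma base_module_module:
  assumes "cring K"
  shows "module K (base_module K)"
proof -
  interpret cring K by fact
  have "abelian_group (base_module K)"
    by (rule abelian_groupI) (auto simp: a_ac intro: bexI[of _ "\<ominus>\<^bsub>K\<^esub> _"] l_neg)
  then show ?thesis
    by (rule moduleI[OF assms]) (auto simp: l_distr r_distr m_assoc)
qed

lemma finsum_base_module: "finsum (base_module K) f A = finsum K f A"
  unfolding finsum_def by (rule finprod_hom_cong) simp_all

lemma k_bilinearI:
  assumes "\<And>x y. x \<in> carrier X \<Longrightarrow> y \<in> carrier Y \<Longrightarrow> f x y \<in> carrier Z"
    and "\<And>x x' y. x \<in> carrier X \<Longrightarrow> x' \<in> carrier X \<Longrightarrow> y \<in> carrier Y \<Longrightarrow>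
      f (x \<oplus>\<^bsub>X\<^esub> x') y = f x y \<oplus>\<^bsub>Z\<^esub> f x' y"
    and "\<And>x y y'. x \<in> carrier X \<Longrightarrow> y \<in> carrier Y \<Longrightarrow> y' \<in> carrier Y \<Longrightarrow>
      f x (y \<oplus>\<^bsub>Y\<^esub> y') = f x y \<oplus>\<^bsub>Z\<^esub> f x y'"
    and "\<And>c x y. c \<in> carrier K \<Longrightarrow> x \<in> carrier X \<Longrightarrow> y \<in> carrier Y \<Longrightarrow> f (c \<odot>\<^bsub>X\<^esub> x) y = c \<odot>\<^bsub>Z\<^esub> f x y"
    and "\<And>c x y. c \<in> carrier K \<Longrightarrow> x \<in> carrier X \<Longrightarrow> y \<in> carrier Y \<Longrightarrow> f x (c \<odot>\<^bsub>Y\<^esub> y) = c \<odot>\<^bsub>Z\<^esub> f x y"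
  shows "k_bilinear K X Y Z f"
  unfolding k_bilinear_def using assms by (auto intro!: k_linearI)

lemma
  assumes "k_bilinear K X Y Z f" "x \<in> carrier X" "y \<in> carrier Y"
  shows k_bilinear_closed: "f x y \<in> carrier Z"
    and k_bilinear_add_left: "x' \<in> carrier X \<Longrightarrow> f (x \<oplus>\<^bsub>X\<^esub> x') y = f x y \<oplus>\<^bsub>Z\<^esub> f x' y"
    and k_bilinear_add_right: "y' \<in> carrier Y \<Longrightarrow> f x (y \<oplus>\<^bsub>Y\<^esub> y') = f x y \<oplus>\<^bsub>Z\<^esub> f x y'"
    and k_bilinear_smult_left: "c \<in> carrier K \<Longrightarrow> f (c \<odot>\<^bsub>X\<^esub> x) y = c \<odot>\<^bsub>Z\<^esub> f x y"
    and k_bilinear_smult_right: "c \<in> carrier K \<Longrightarrow> f x (c \<odot>\<^bsub>Y\<^esub> y) = c \<odot>\<^bsub>Z\<^esub> f x y"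
  using k_linear_closed[of K Y Z "f x"] k_linear_add[of K X Z "\<lambda>x. f x y"] k_linear_add[of K Y Z "f x"]
    k_linear_smult[of K X Z "\<lambda>x. f x y"] k_linear_smult[of K Y Z "f x"] assms
  unfolding k_bilinear_def by auto

lemmas k_bilinearD = k_bilinear_closed k_bilinear_add_left k_bilinear_add_right
  k_bilinear_smult_left k_bilinear_smult_right

lemma k_bilinear_left: "k_bilinear K X Y Z f \<Longrightarrow> y \<in> carrier Y \<Longrightarrow> k_linear K X Z (\<lambda>x. f x y)"
  and k_bilinear_right: "k_bilinear K X Y Z f \<Longrightarrow> x \<in> carrier X \<Longrightarrow> k_linear K Y Z (f x)"
  by (auto simp: k_bilinear_def)

lemma k_tensor_simps:
  "carrier (k_tensor K X Y) = carrier (k_tensor_group K X Y)"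
  "one (k_tensor K X Y) = k_pure K X Y \<one>\<^bsub>X\<^esub> \<one>\<^bsub>Y\<^esub>"
  "zero (k_tensor K X Y) = one (k_tensor_group K X Y)"
  "add (k_tensor K X Y) = mult (k_tensor_group K X Y)"
  "c \<odot>\<^bsub>k_tensor K X Y\<^esub> t = tensor_lift (k_tensor_group K X Y) (\<lambda>x y. k_pure K X Y (c \<odot>\<^bsub>X\<^esub> x) y) t"
  by (simp_all add: k_tensor_def Let_def)

text \<open>\<open>k_tensor\<close> is a module record and \<open>k_tensor_group\<close> a monoid
  record on the same set: lifts are formed in the second, linearity is stated in the first.\<close>

lemma hom_k_tensor: "hom (add_monoid (k_tensor K X Y)) G = hom (k_tensor_group K X Y) G"
  "hom G (add_monoid (k_tensor K X Y)) = hom G (k_tensor_group K X Y)"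
  by (simp_all add: hom_def k_tensor_simps)

locale k_tensor_product = X: module K X + Y: module K Y
  for K :: "('k, 'c) ring_scheme" and X :: "('k, 'x, 'd) module_scheme" and Y :: "('k, 'y, 'e) module_scheme"
begin

sublocale T: tensor_product "add_monoid X" "add_monoid Y" "carrier K" "\<lambda>x c. c \<odot>\<^bsub>X\<^esub> x" "\<lambda>c y. c \<odot>\<^bsub>Y\<^esub> y"
  rewrites "tensor_group (add_monoid X) (add_monoid Y) (carrier K) (\<lambda>x c. c \<odot>\<^bsub>X\<^esub> x) (\<lambda>c y. c \<odot>\<^bsub>Y\<^esub> y) = k_tensor_group K X Y"
    and "tensor_pure (add_monoid X) (add_monoid Y) (carrier K) (\<lambda>x c. c \<odot>\<^bsub>X\<^esub> x) (\<lambda>c y. c \<odot>\<^bsub>Y\<^esub> y) = k_pure K X Y"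
    and "carrier (add_monoid X) = carrier X" and "carrier (add_monoid Y) = carrier Y"
    and "mult (add_monoid X) = add X" and "mult (add_monoid Y) = add Y"
  by unfold_locales (auto simp: k_tensor_group_def k_pure_def)

abbreviation "XY \<equiv> k_tensor K X Y"

lemma abelian_group_XY: "abelian_group XY"
proof -
  interpret G: comm_group "k_tensor_group K X Y" by (rule T.comm_group_T)
  show ?thesis
    by (rule abelian_groupI) (auto simp: k_tensor_simps G.m_ac intro: bexI[of _ "inv\<^bsub>k_tensor_group K X Y\<^esub> _"])
qed

lemma hom_on_pure_eqI:
  assumes "comm_group G" "h \<in> hom (add_monoid XY) G" "h' \<in> hom (add_monoid XY) G"
    and "\<And>x y. x \<in> carrier X \<Longrightarrow> y \<in> carrier Y \<Longrightarrow> h (k_pure K X Y x y) = h' (k_pure K X Y x y)"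
    and "t \<in> carrier XY"
  shows "h t = h' t"
  using T.hom_eqI[of G h h' t] assms unfolding hom_k_tensor by (simp add: k_tensor_simps)

lemma additive_on_pure_eqI:
  assumes "abelian_group Z"
    and "\<And>x y. x \<in> carrier X \<Longrightarrow> y \<in> carrier Y \<Longrightarrow> h (k_pure K X Y x y) = h' (k_pure K X Y x y)"
    and "t \<in> carrier XY"
    and "\<And>t. t \<in> carrier XY \<Longrightarrow> h t \<in> carrier Z" "\<And>t. t \<in> carrier XY \<Longrightarrow> h' t \<in> carrier Z"
    and "\<And>s t. s \<in> carrier XY \<Longrightarrow> t \<in> carrier XY \<Longrightarrow> h (s \<oplus>\<^bsub>XY\<^esub> t) = h s \<oplus>\<^bsub>Z\<^esub> h t"
    and "\<And>s t. s \<in> carrier XY \<Longrightarrow> t \<in> carrier XY \<Longrightarrow> h' (s \<oplus>\<^bsub>XY\<^esub> t) = h' s \<oplus>\<^bsub>Z\<^esub> h' t"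
  shows "h t = h' t"
  by (rule hom_on_pure_eqI[OF abelian_group.a_comm_group[OF assms(1)]])
    (use assms(2-) in \<open>simp_all add: hom_def\<close>)

lemma k_pure_closed [simp, intro]: "x \<in> carrier X \<Longrightarrow> y \<in> carrier Y \<Longrightarrow> k_pure K X Y x y \<in> carrier XY"
  using T.pure_closed by (simp add: k_tensor_simps)

lemma k_pure_add_left: "x \<in> carrier X \<Longrightarrow> x' \<in> carrier X \<Longrightarrow> y \<in> carrier Y \<Longrightarrow>
    k_pure K X Y (x \<oplus>\<^bsub>X\<^esub> x') y = k_pure K X Y x y \<oplus>\<^bsub>XY\<^esub> k_pure K X Y x' y"
  and k_pure_add_right: "x \<in> carrier X \<Longrightarrow> y \<in> carrier Y \<Longrightarrow> y' \<in> carrier Y \<Longrightarrow>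
    k_pure K X Y x (y \<oplus>\<^bsub>Y\<^esub> y') = k_pure K X Y x y \<oplus>\<^bsub>XY\<^esub> k_pure K X Y x y'"
  and k_pure_balanced: "x \<in> carrier X \<Longrightarrow> y \<in> carrier Y \<Longrightarrow> c \<in> carrier K \<Longrightarrow>
    k_pure K X Y (c \<odot>\<^bsub>X\<^esub> x) y = k_pure K X Y x (c \<odot>\<^bsub>Y\<^esub> y)"
  using T.pure_mult_left T.pure_mult_right T.pure_act by (simp_all add: k_tensor_simps)

lemma balanced_T_I:
  assumes "\<And>x y. x \<in> carrier X \<Longrightarrow> y \<in> carrier Y \<Longrightarrow> f x y \<in> carrier G"
    and "\<And>x x' y. x \<in> carrier X \<Longrightarrow> x' \<in> carrier X \<Longrightarrow> y \<in> carrier Y \<Longrightarrow>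
      f (x \<oplus>\<^bsub>X\<^esub> x') y = f x y \<otimes>\<^bsub>G\<^esub> f x' y"
    and "\<And>x y y'. x \<in> carrier X \<Longrightarrow> y \<in> carrier Y \<Longrightarrow> y' \<in> carrier Y \<Longrightarrow>
      f x (y \<oplus>\<^bsub>Y\<^esub> y') = f x y \<otimes>\<^bsub>G\<^esub> f x y'"
    and "\<And>x c y. x \<in> carrier X \<Longrightarrow> c \<in> carrier K \<Longrightarrow> y \<in> carrier Y \<Longrightarrow> f (c \<odot>\<^bsub>X\<^esub> x) y = f x (c \<odot>\<^bsub>Y\<^esub> y)"
  shows "balanced (add_monoid X) (add_monoid Y) (carrier K) (\<lambda>x c. c \<odot>\<^bsub>X\<^esub> x) (\<lambda>c y. c \<odot>\<^bsub>Y\<^esub> y) G f"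
  by (rule balancedI) (use assms in simp_all)

text \<open>Scaling one factor by \<open>c\<close> is balanced because \<open>c\<close> commutes
  with the scalar \<open>d\<close> that is moved across; commutativity of \<open>K\<close> enters
  here.\<close>

lemma balanced_smult:
  assumes "c \<in> carrier K"
  shows "balanced (add_monoid X) (add_monoid Y) (carrier K) (\<lambda>x c. c \<odot>\<^bsub>X\<^esub> x) (\<lambda>c y. c \<odot>\<^bsub>Y\<^esub> y)
    (k_tensor_group K X Y) (\<lambda>x y. k_pure K X Y (c \<odot>\<^bsub>X\<^esub> x) y)"
proof (rule balanced_T_I)
  fix x d y assume *: "x \<in> carrier X" "d \<in> carrier K" "y \<in> carrier Y"
  have "c \<odot>\<^bsub>X\<^esub> (d \<odot>\<^bsub>X\<^esub> x) = d \<odot>\<^bsub>X\<^esub> (c \<odot>\<^bsub>X\<^esub> x)"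
    using * assms by (simp add: X.smult_assoc1[symmetric] X.R.m_comm)
  then show "k_pure K X Y (c \<odot>\<^bsub>X\<^esub> (d \<odot>\<^bsub>X\<^esub> x)) y = k_pure K X Y (c \<odot>\<^bsub>X\<^esub> x) (d \<odot>\<^bsub>Y\<^esub> y)"
    using * assms by (simp add: k_pure_balanced)
qed (use assms in \<open>simp_all add: X.smult_r_distr T.pure_mult_left T.pure_mult_right\<close>)

lemma smult_hom: "c \<in> carrier K \<Longrightarrow> (\<lambda>t. c \<odot>\<^bsub>XY\<^esub> t) \<in> hom (add_monoid XY) (add_monoid XY)"
  and smult_pure: "c \<in> carrier K \<Longrightarrow> x \<in> carrier X \<Longrightarrow> y \<in> carrier Y \<Longrightarrow>
    c \<odot>\<^bsub>XY\<^esub> k_pure K X Y x y = k_pure K X Y (c \<odot>\<^bsub>X\<^esub> x) y"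
  using T.lift_hom[OF T.comm_group_T balanced_smult] T.lift_pure[OF T.comm_group_T balanced_smult]
  unfolding hom_k_tensor by (simp_all add: k_tensor_simps)

text \<open>Both sides of each axiom are additive in the tensor, so pure tensors suffice.
  \<open>comp\<close>, \<open>plus\<close> and \<open>ident\<close> record the additivity of the
  right-hand sides.\<close>

lemma module_XY: "module K XY"
proof -
  interpret G: abelian_group XY by (rule abelian_group_XY)
  have cg: "comm_group (add_monoid XY)" by (rule G.a_comm_group)
  note sc = hom_in_carrier[OF smult_hom, simplified]
  note sa = hom_mult[OF smult_hom, simplified]
  have comp: "(\<lambda>t. c \<odot>\<^bsub>XY\<^esub> (d \<odot>\<^bsub>XY\<^esub> t)) \<in> hom (add_monoid XY) (add_monoid XY)"
    if "c \<in> carrier K" "d \<in> carrier K" for c d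
    by (rule homI) (use that in \<open>simp_all add: sc sa\<close>)
  have plus: "(\<lambda>t. c \<odot>\<^bsub>XY\<^esub> t \<oplus>\<^bsub>XY\<^esub> d \<odot>\<^bsub>XY\<^esub> t) \<in> hom (add_monoid XY) (add_monoid XY)"
    if "c \<in> carrier K" "d \<in> carrier K" for c d
    by (rule homI) (use that in \<open>simp_all add: sc sa G.a_ac\<close>)
  have ident: "(\<lambda>t. t) \<in> hom (add_monoid XY) (add_monoid XY)" by (rule homI) simp_all
  show ?thesis
  proof (rule moduleI)
    fix c d t assume *: "c \<in> carrier K" "d \<in> carrier K" "t \<in> carrier XY"
    show "(c \<oplus>\<^bsub>K\<^esub> d) \<odot>\<^bsub>XY\<^esub> t = c \<odot>\<^bsub>XY\<^esub> t \<oplus>\<^bsub>XY\<^esub> d \<odot>\<^bsub>XY\<^esub> t"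
      by (rule hom_on_pure_eqI[OF cg smult_hom plus])
        (use * in \<open>simp_all add: smult_pure X.smult_l_distr k_pure_add_left\<close>)
    show "(c \<otimes>\<^bsub>K\<^esub> d) \<odot>\<^bsub>XY\<^esub> t = c \<odot>\<^bsub>XY\<^esub> (d \<odot>\<^bsub>XY\<^esub> t)"
      by (rule hom_on_pure_eqI[OF cg smult_hom comp])
        (use * in \<open>simp_all add: smult_pure X.smult_assoc1\<close>)
  next
    fix t assume *: "t \<in> carrier XY"
    show "\<one>\<^bsub>K\<^esub> \<odot>\<^bsub>XY\<^esub> t = t"
      by (rule hom_on_pure_eqI[OF cg smult_hom ident]) (use * in \<open>simp_all add: smult_pure\<close>)
  qed (use sc sa in \<open>auto intro: X.R.is_cring abelian_group_XY\<close>)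
qed

lemma k_bilinear_pure: "k_bilinear K X Y XY (k_pure K X Y)"
  by (rule k_bilinearI) (simp_all add: k_pure_add_left k_pure_add_right smult_pure k_pure_balanced)

text \<open>The group \<open>G\<close> of the lift and the module \<open>Z\<close> are kept apart
  because the given structures lift into three kinds of records: \<open>add_monoid Z\<close>,
  \<open>add_monoid K\<close> and \<open>k_tensor_group\<close>. One specialisation for each
  follows.\<close>

lemma
  assumes Z: "module K Z" and G: "comm_group G" and GZ: "carrier G = carrier Z" "mult G = add Z"
    and f: "k_bilinear K X Y Z f"
  shows lift_linear_gen: "k_linear K XY Z (tensor_lift G f)"
    and lift_pure_gen: "\<And>x y. x \<in> carrier X \<Longrightarrow> y \<in> carrier Y \<Longrightarrow> tensor_lift G f (k_pure K X Y x y) = f x y"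
proof -
  interpret Z: module K Z by fact
  interpret XY: module K XY by (rule module_XY)
  have b: "balanced (add_monoid X) (add_monoid Y) (carrier K) (\<lambda>x c. c \<odot>\<^bsub>X\<^esub> x) (\<lambda>c y. c \<odot>\<^bsub>Y\<^esub> y) G f"
    by (rule balanced_T_I)
      (simp_all add: GZ k_bilinearD[OF f])
  have h: "tensor_lift G f \<in> hom (add_monoid XY) G"
    unfolding hom_k_tensor by (rule T.lift_hom[OF G b])
  show p: "\<And>x y. x \<in> carrier X \<Longrightarrow> y \<in> carrier Y \<Longrightarrow> tensor_lift G f (k_pure K X Y x y) = f x y"
    by (rule T.lift_pure[OF G b])
  note hc = hom_in_carrier[OF h, simplified, unfolded GZ]
  note hm = hom_mult[OF h, simplified, unfolded GZ]
  have 1: "(\<lambda>t. tensor_lift G f (c \<odot>\<^bsub>XY\<^esub> t)) \<in> hom (add_monoid XY) G" if "c \<in> carrier K" for c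
    by (rule homI) (use that in \<open>simp_all add: GZ hc hm XY.smult_r_distr\<close>)
  have 2: "(\<lambda>t. c \<odot>\<^bsub>Z\<^esub> tensor_lift G f t) \<in> hom (add_monoid XY) G" if "c \<in> carrier K" for c
    by (rule homI) (use that in \<open>simp_all add: GZ hc hm Z.smult_r_distr\<close>)
  show "k_linear K XY Z (tensor_lift G f)"
  proof (rule k_linearI)
    fix c t assume c: "c \<in> carrier K" "t \<in> carrier XY"
    show "tensor_lift G f (c \<odot>\<^bsub>XY\<^esub> t) = c \<odot>\<^bsub>Z\<^esub> tensor_lift G f t"
      by (rule hom_on_pure_eqI[OF G 1 2]) (use c f in \<open>simp_all add: smult_pure p k_bilinear_smult_left\<close>)
  qed (simp_all add: hc hm)
qed

lemma
  assumes "module K Z" "k_bilinear K X Y Z f"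
  shows lift_linear: "k_linear K XY Z (tensor_lift (add_monoid Z) f)"
    and lift_k_pure: "\<And>x y. x \<in> carrier X \<Longrightarrow> y \<in> carrier Y \<Longrightarrow>
      tensor_lift (add_monoid Z) f (k_pure K X Y x y) = f x y"
proof -
  interpret Z: module K Z by fact
  show "k_linear K XY Z (tensor_lift (add_monoid Z) f)"
    "\<And>x y. x \<in> carrier X \<Longrightarrow> y \<in> carrier Y \<Longrightarrow> tensor_lift (add_monoid Z) f (k_pure K X Y x y) = f x y"
    by (rule lift_linear_gen lift_pure_gen; use assms Z.a_comm_group in simp)+
qed

lemma
  assumes "k_bilinear K X Y (base_module K) f"
  shows lift_form_linear: "k_linear K XY (base_module K) (tensor_lift (add_monoid K) f)"
    and lift_form_pure: "\<And>x y. x \<in> carrier X \<Longrightarrow> y \<in> carrier Y \<Longrightarrow>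
      tensor_lift (add_monoid K) f (k_pure K X Y x y) = f x y"
  by (rule lift_linear_gen[OF base_module_module] lift_pure_gen[OF base_module_module];
      use assms X.R.add.comm_group_axioms X.R.is_cring in simp)+

lemma
  assumes "module K U" "module K V" "k_bilinear K X Y (k_tensor K U V) f"
  shows lift_tensor_linear: "k_linear K XY (k_tensor K U V) (tensor_lift (k_tensor_group K U V) f)"
    and lift_tensor_pure: "\<And>x y. x \<in> carrier X \<Longrightarrow> y \<in> carrier Y \<Longrightarrow>
      tensor_lift (k_tensor_group K U V) f (k_pure K X Y x y) = f x y"
proof -
  interpret UV: k_tensor_product K U V by (intro k_tensor_product.intro assms)
  show "k_linear K XY (k_tensor K U V) (tensor_lift (k_tensor_group K U V) f)"
    "\<And>x y. x \<in> carrier X \<Longrightarrow> y \<in> carrier Y \<Longrightarrow>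
      tensor_lift (k_tensor_group K U V) f (k_pure K X Y x y) = f x y"
    by (rule lift_linear_gen[OF UV.module_XY UV.T.comm_group_T]
        lift_pure_gen[OF UV.module_XY UV.T.comm_group_T]; simp add: k_tensor_simps assms)+
qed

lemma linear_sum_pure:
  assumes "module K Z" "k_linear K XY Z h" "x \<in> A \<rightarrow> carrier X" "y \<in> A \<rightarrow> carrier Y"
  shows "h (\<Oplus>\<^bsub>XY\<^esub>i\<in>A. k_pure K X Y (x i) (y i)) = (\<Oplus>\<^bsub>Z\<^esub>i\<in>A. h (k_pure K X Y (x i) (y i)))"
proof -
  interpret Z: module K Z by fact
  show ?thesis
    by (rule k_linear_finsum) (use assms abelian_group_XY Z.abelian_group_axioms in \<open>auto simp: Pi_iff\<close>)
qed

end

section \<open>Dual bases\<close>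

text \<open>The dual basis of a finitely generated projective module: vectors \<open>v\<close> with
  coordinate functionals \<open>g\<close>. It only reconstructs elements, which makes sense over any
  commutative ring and passes to tensor products.\<close>

definition dual_basis ::
  "('k, 'c) ring_scheme \<Rightarrow> ('k, 'x, 'd) module_scheme \<Rightarrow> 'j set \<Rightarrow> ('j \<Rightarrow> 'x \<Rightarrow> 'k) \<Rightarrow> ('j \<Rightarrow> 'x) \<Rightarrow> bool"
where
  "dual_basis K X J g v \<longleftrightarrow> finite J \<and> v \<in> J \<rightarrow> carrier X \<and>
     (\<forall>k \<in> J. k_linear K X (base_module K) (g k)) \<and>
     (\<forall>x \<in> carrier X. x = (\<Oplus>\<^bsub>X\<^esub>k\<in>J. g k x \<odot>\<^bsub>X\<^esub> v k))"

lemma dual_basis_eqI: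
  assumes "module K X" "dual_basis K X J g v" "x \<in> carrier X" "y \<in> carrier X" "\<And>k. k \<in> J \<Longrightarrow> g k x = g k y"
  shows "x = y"
proof -
  interpret X: module K X by fact
  have "(\<Oplus>\<^bsub>X\<^esub>k\<in>J. g k x \<odot>\<^bsub>X\<^esub> v k) = (\<Oplus>\<^bsub>X\<^esub>k\<in>J. g k y \<odot>\<^bsub>X\<^esub> v k)"
    by (rule X.finsum_cong')
      (use assms k_linear_closed[of K X "base_module K" _ y] in \<open>auto simp: dual_basis_def Pi_iff\<close>)
  then show ?thesis using assms unfolding dual_basis_def by metis
qed

lemma dual_basis_finite_dim:
  assumes "module K X" "dual_basis K X J g v"
  shows "finite_dim K X"
  unfolding finite_dim_def
proof (intro exI conjI ballI)
  interpret X: module K X by fact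
  have J: "finite J" "v \<in> J \<rightarrow> carrier X" using assms(2) by (auto simp: dual_basis_def)
  show "finite (v ` J)" "v ` J \<subseteq> carrier X" using J by auto
  fix x assume x: "x \<in> carrier X"
  have gc: "g k x \<in> carrier K" if "k \<in> J" for k
    using assms(2) that k_linear_closed[of K X "base_module K" "g k" x] x by (auto simp: dual_basis_def)
  \<comment> \<open>\<open>v\<close> may repeat a vector, whereas \<open>finite_dim\<close> indexes
    coefficients by vectors; coefficients belonging to the same vector are added up.\<close>
  define c where "c z = (\<Oplus>\<^bsub>K\<^esub>k\<in>{k\<in>J. v k = z}. g k x)" for z
  have cc: "c z \<in> carrier K" for z unfolding c_def by (rule X.R.finsum_closed) (auto simp: gc)
  have "(\<Oplus>\<^bsub>X\<^esub>z\<in>v ` J. c z \<odot>\<^bsub>X\<^esub> z) = (\<Oplus>\<^bsub>X\<^esub>z\<in>v ` J. \<Oplus>\<^bsub>X\<^esub>k\<in>{k\<in>J. v k = z}. g k x \<odot>\<^bsub>X\<^esub> v k)"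
  proof (rule X.finsum_cong')
    fix z assume "z \<in> v ` J"
    then have z: "z \<in> carrier X" using J by auto
    have "c z \<odot>\<^bsub>X\<^esub> z = (\<Oplus>\<^bsub>X\<^esub>k\<in>{k\<in>J. v k = z}. g k x \<odot>\<^bsub>X\<^esub> z)"
      unfolding c_def
      using k_linear_finsum[OF _ X.abelian_group_axioms, of "base_module K" K "\<lambda>c. c \<odot>\<^bsub>X\<^esub> z" "\<lambda>k. g k x" "{k\<in>J. v k = z}"]
        k_linearI[of "base_module K" "\<lambda>c. c \<odot>\<^bsub>X\<^esub> z" X K] z gc X.R.is_cring
      by (simp add: finsum_base_module X.smult_l_distr X.smult_assoc1 Pi_iff module.axioms(2)[OF base_module_module])
    also have "\<dots> = (\<Oplus>\<^bsub>X\<^esub>k\<in>{k\<in>J. v k = z}. g k x \<odot>\<^bsub>X\<^esub> v k)"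
      by (rule X.finsum_cong') (use J gc in auto)
    finally show "c z \<odot>\<^bsub>X\<^esub> z = \<dots>" .
  qed (use J gc in \<open>auto intro!: X.finsum_closed\<close>)
  also have "\<dots> = (\<Oplus>\<^bsub>X\<^esub>k\<in>(\<Union>z\<in>v ` J. {k\<in>J. v k = z}). g k x \<odot>\<^bsub>X\<^esub> v k)"
    by (rule X.add.finprod_UN_disjoint[symmetric]) (use J gc in \<open>auto simp: pairwise_def disjnt_def\<close>)
  also have "(\<Union>z\<in>v ` J. {k\<in>J. v k = z}) = J" by auto
  also have "(\<Oplus>\<^bsub>X\<^esub>k\<in>J. g k x \<odot>\<^bsub>X\<^esub> v k) = x" using assms(2) x by (auto simp: dual_basis_def)
  finally show "\<exists>c \<in> v ` J \<rightarrow> carrier K. x = (\<Oplus>\<^bsub>X\<^esub>z\<in>v ` J. c z \<odot>\<^bsub>X\<^esub> z)" using cc by auto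
qed

text \<open>Expanding both factors settles pure tensors; the reconstruction map \<open>H\<close> is
  additive, so it is the identity everywhere. Used twice, this gives coordinates on a threefold
  tensor power.\<close>

lemma (in k_tensor_product) dual_basis_tensor:
  assumes g: "dual_basis K X J g v" and h: "dual_basis K Y L h w"
  shows "dual_basis K XY (J \<times> L)
    (\<lambda>(k, l). tensor_lift (add_monoid K) (\<lambda>x y. g k x \<otimes>\<^bsub>K\<^esub> h l y)) (\<lambda>(k, l). k_pure K X Y (v k) (w l))"
proof -
  interpret XY: module K XY by (rule module_XY)
  have J: "finite J" "\<And>k. k \<in> J \<Longrightarrow> v k \<in> carrier X" "\<And>k. k \<in> J \<Longrightarrow> k_linear K X (base_module K) (g k)"
    using g by (auto simp: dual_basis_def)
  have L: "finite L" "\<And>k. k \<in> L \<Longrightarrow> w k \<in> carrier Y" "\<And>k. k \<in> L \<Longrightarrow> k_linear K Y (base_module K) (h k)"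
    using h by (auto simp: dual_basis_def)
  note gs = k_linearD[OF J(3), simplified]
  note hs = k_linearD[OF L(3), simplified]
  have bil: "k_bilinear K X Y (base_module K) (\<lambda>x y. g k x \<otimes>\<^bsub>K\<^esub> h l y)" if "k \<in> J" "l \<in> L" for k l
    by (rule k_bilinearI) (use that in \<open>simp_all add: gs hs X.R.l_distr X.R.r_distr X.R.m_ac\<close>)
  note lin = lift_form_linear[OF bil]
  note lins = k_linearD[OF lin, simplified]
  define H where "H t = (\<Oplus>\<^bsub>XY\<^esub>kl\<in>J \<times> L. (case kl of (k, l) \<Rightarrow> tensor_lift (add_monoid K) (\<lambda>x y. g k x \<otimes>\<^bsub>K\<^esub> h l y)) t
      \<odot>\<^bsub>XY\<^esub> (case kl of (k, l) \<Rightarrow> k_pure K X Y (v k) (w l)))" for t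
  have Hc: "H t \<in> carrier XY" if "t \<in> carrier XY" for t
    unfolding H_def by (rule XY.finsum_closed) (use that J L lins in auto)
  have "H \<in> hom (add_monoid XY) (add_monoid XY)"
  proof (rule homI)
    fix s t assume "s \<in> carrier (add_monoid XY)" "t \<in> carrier (add_monoid XY)"
    then have st: "s \<in> carrier XY" "t \<in> carrier XY" by simp_all
    have "H (s \<oplus>\<^bsub>XY\<^esub> t) = (\<Oplus>\<^bsub>XY\<^esub>kl\<in>J \<times> L.
        (case kl of (k, l) \<Rightarrow> tensor_lift (add_monoid K) (\<lambda>x y. g k x \<otimes>\<^bsub>K\<^esub> h l y)) s
          \<odot>\<^bsub>XY\<^esub> (case kl of (k, l) \<Rightarrow> k_pure K X Y (v k) (w l)) \<oplus>\<^bsub>XY\<^esub>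
        (case kl of (k, l) \<Rightarrow> tensor_lift (add_monoid K) (\<lambda>x y. g k x \<otimes>\<^bsub>K\<^esub> h l y)) t
          \<odot>\<^bsub>XY\<^esub> (case kl of (k, l) \<Rightarrow> k_pure K X Y (v k) (w l)))"
      unfolding H_def
      by (rule XY.finsum_cong') (use st J L lins in \<open>clarsimp simp: XY.smult_l_distr\<close>)+
    also have "\<dots> = H s \<oplus>\<^bsub>XY\<^esub> H t"
      unfolding H_def
      by (rule XY.finsum_addf) (use st J L lins in \<open>clarsimp\<close>)+
    finally have "H (s \<oplus>\<^bsub>XY\<^esub> t) = H s \<oplus>\<^bsub>XY\<^esub> H t" .
    then show "H (s \<otimes>\<^bsub>add_monoid XY\<^esub> t) = H s \<otimes>\<^bsub>add_monoid XY\<^esub> H t" by simp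
  qed (simp add: Hc)
  moreover have "(\<lambda>t. t) \<in> hom (add_monoid XY) (add_monoid XY)" by (rule homI) simp_all
  moreover have "k_pure K X Y x y = H (k_pure K X Y x y)" if xy: "x \<in> carrier X" "y \<in> carrier Y" for x y
  proof -
    have ex: "x = (\<Oplus>\<^bsub>X\<^esub>k\<in>J. g k x \<odot>\<^bsub>X\<^esub> v k)" and ey: "y = (\<Oplus>\<^bsub>Y\<^esub>l\<in>L. h l y \<odot>\<^bsub>Y\<^esub> w l)"
      using g h xy by (auto simp: dual_basis_def)
    have "k_pure K X Y x y = k_pure K X Y (\<Oplus>\<^bsub>X\<^esub>k\<in>J. g k x \<odot>\<^bsub>X\<^esub> v k) y" using ex by simp
    also have "\<dots> = (\<Oplus>\<^bsub>XY\<^esub>k\<in>J. k_pure K X Y (g k x \<odot>\<^bsub>X\<^esub> v k) y)"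
      by (rule k_linear_finsum[OF _ _ k_bilinear_left[OF k_bilinear_pure xy(2)]])
        (use J gs xy X.abelian_group_axioms abelian_group_XY in auto)
    also have "\<dots> = (\<Oplus>\<^bsub>XY\<^esub>k\<in>J. \<Oplus>\<^bsub>XY\<^esub>l\<in>L. k_pure K X Y (g k x \<odot>\<^bsub>X\<^esub> v k) (h l y \<odot>\<^bsub>Y\<^esub> w l))"
    proof (rule XY.finsum_cong')
      fix k assume k: "k \<in> J"
      have "k_pure K X Y (g k x \<odot>\<^bsub>X\<^esub> v k) y = k_pure K X Y (g k x \<odot>\<^bsub>X\<^esub> v k) (\<Oplus>\<^bsub>Y\<^esub>l\<in>L. h l y \<odot>\<^bsub>Y\<^esub> w l)"
        using ey by simp
      also have "\<dots> = (\<Oplus>\<^bsub>XY\<^esub>l\<in>L. k_pure K X Y (g k x \<odot>\<^bsub>X\<^esub> v k) (h l y \<odot>\<^bsub>Y\<^esub> w l))"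
        by (rule k_linear_finsum[OF _ _ k_bilinear_right[OF k_bilinear_pure]])
          (use k J L gs hs xy Y.abelian_group_axioms abelian_group_XY in auto)
      finally show "k_pure K X Y (g k x \<odot>\<^bsub>X\<^esub> v k) y = \<dots>" .
    qed (use J L gs hs xy in \<open>auto intro!: XY.finsum_closed\<close>)
    also have "\<dots> = H (k_pure K X Y x y)"
      unfolding H_def
    proof (subst XY.add.finprod_Times[symmetric])
      show "(\<Oplus>\<^bsub>XY\<^esub>kl\<in>J \<times> L. (case kl of (k, l) \<Rightarrow> k_pure K X Y (g k x \<odot>\<^bsub>X\<^esub> v k) (h l y \<odot>\<^bsub>Y\<^esub> w l))) =
        (\<Oplus>\<^bsub>XY\<^esub>kl\<in>J \<times> L. (case kl of (k, l) \<Rightarrow> tensor_lift (add_monoid K) (\<lambda>x y. g k x \<otimes>\<^bsub>K\<^esub> h l y)) (k_pure K X Y x y)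
          \<odot>\<^bsub>XY\<^esub> (case kl of (k, l) \<Rightarrow> k_pure K X Y (v k) (w l)))"
      proof (rule XY.finsum_cong')
        show "(\<lambda>kl. (case kl of (k, l) \<Rightarrow> tensor_lift (add_monoid K) (\<lambda>x y. g k x \<otimes>\<^bsub>K\<^esub> h l y)) (k_pure K X Y x y)
            \<odot>\<^bsub>XY\<^esub> (case kl of (k, l) \<Rightarrow> k_pure K X Y (v k) (w l))) \<in> J \<times> L \<rightarrow> carrier XY"
          using J L lins xy by clarsimp
        fix kl assume "kl \<in> J \<times> L"
        then obtain k l where kl: "kl = (k, l)" "k \<in> J" "l \<in> L" by auto
        have "(g k x \<otimes>\<^bsub>K\<^esub> h l y) \<odot>\<^bsub>XY\<^esub> k_pure K X Y (v k) (w l)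
          = k_pure K X Y (h l y \<odot>\<^bsub>X\<^esub> (g k x \<odot>\<^bsub>X\<^esub> v k)) (w l)"
          using J L gs hs xy kl by (simp add: smult_pure X.smult_assoc1[symmetric] X.R.m_comm[of "g k x"])
        then show "(case kl of (k, l) \<Rightarrow> k_pure K X Y (g k x \<odot>\<^bsub>X\<^esub> v k) (h l y \<odot>\<^bsub>Y\<^esub> w l)) =
          (case kl of (k, l) \<Rightarrow> tensor_lift (add_monoid K) (\<lambda>x y. g k x \<otimes>\<^bsub>K\<^esub> h l y)) (k_pure K X Y x y)
          \<odot>\<^bsub>XY\<^esub> (case kl of (k, l) \<Rightarrow> k_pure K X Y (v k) (w l))"
          using J L gs hs xy kl by (simp add: lift_form_pure[OF bil] k_pure_balanced)
      qed simp
    qed (use J L gs hs xy in auto)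
    finally show ?thesis .
  qed
  ultimately have "t = H t" if "t \<in> carrier XY" for t
    using hom_on_pure_eqI[OF XY.a_comm_group, of "\<lambda>t. t" H t] that by blast
  then show ?thesis unfolding dual_basis_def using J L lin by (auto simp: H_def)
qed


section \<open>Weak Hopf algebras from dual pairs\<close>

lemma (in cring) finsum_swap:
  assumes "finite A" "finite B" "\<And>i j. i \<in> A \<Longrightarrow> j \<in> B \<Longrightarrow> f i j \<in> carrier R"
  shows "(\<Oplus>i\<in>A. \<Oplus>j\<in>B. f i j) = (\<Oplus>j\<in>B. \<Oplus>i\<in>A. f i j)"
  using add.finprod_swap[OF assms] .

lemma (in cring) finsum_mult_finsum:
  assumes "finite A" "finite B" "\<And>i. i \<in> A \<Longrightarrow> f i \<in> carrier R" "\<And>j. j \<in> B \<Longrightarrow> g j \<in> carrier R"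
  shows "(\<Oplus>i\<in>A. f i) \<otimes> (\<Oplus>j\<in>B. g j) = (\<Oplus>i\<in>A. \<Oplus>j\<in>B. f i \<otimes> g j)"
proof -
  have "(\<Oplus>i\<in>A. f i) \<otimes> (\<Oplus>j\<in>B. g j) = (\<Oplus>i\<in>A. f i \<otimes> (\<Oplus>j\<in>B. g j))"
    by (rule finsum_ldistr) (use assms in \<open>auto intro!: finsum_closed\<close>)
  also have "\<dots> = (\<Oplus>i\<in>A. \<Oplus>j\<in>B. f i \<otimes> g j)"
    by (rule finsum_cong') (use assms in \<open>auto simp: Pi_iff intro!: finsum_rdistr finsum_closed\<close>)
  finally show ?thesis .
qed

text \<open>The inner sum is a middle factor split by a coproduct. Once it is pulled out, the two
  outer sums become independent; this is the computation behind the weak unit axiom.\<close>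

lemma (in cring) finsum_contract:
  assumes "finite A" "finite B" "finite C"
    and "\<And>i. i \<in> A \<Longrightarrow> x i \<in> carrier R" "\<And>j. j \<in> B \<Longrightarrow> y j \<in> carrier R"
    and "\<And>k i. k \<in> C \<Longrightarrow> i \<in> A \<Longrightarrow> f k i \<in> carrier R" "\<And>k j. k \<in> C \<Longrightarrow> j \<in> B \<Longrightarrow> g k j \<in> carrier R"
  shows "(\<Oplus>i\<in>A. \<Oplus>j\<in>B. x i \<otimes> ((\<Oplus>k\<in>C. f k i \<otimes> g k j) \<otimes> y j))
       = (\<Oplus>k\<in>C. (\<Oplus>i\<in>A. x i \<otimes> f k i) \<otimes> (\<Oplus>j\<in>B. g k j \<otimes> y j))" (is "?l = ?r")
proof -
  have "?l = (\<Oplus>i\<in>A. \<Oplus>j\<in>B. \<Oplus>k\<in>C. (x i \<otimes> f k i) \<otimes> (g k j \<otimes> y j))"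
  proof (intro finsum_cong')
    fix i j assume ij: "i \<in> A" "j \<in> B"
    have "x i \<otimes> ((\<Oplus>k\<in>C. f k i \<otimes> g k j) \<otimes> y j) = (x i \<otimes> y j) \<otimes> (\<Oplus>k\<in>C. f k i \<otimes> g k j)"
      using assms ij by (simp add: m_ac Pi_iff)
    also have "\<dots> = (\<Oplus>k\<in>C. (x i \<otimes> y j) \<otimes> (f k i \<otimes> g k j))"
      by (rule finsum_rdistr) (use assms ij in auto)
    also have "\<dots> = (\<Oplus>k\<in>C. (x i \<otimes> f k i) \<otimes> (g k j \<otimes> y j))"
      by (rule finsum_cong') (use assms ij in \<open>auto simp: m_ac\<close>)
    finally show "x i \<otimes> ((\<Oplus>k\<in>C. f k i \<otimes> g k j) \<otimes> y j) = \<dots>" .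
  qed (use assms in \<open>auto intro!: finsum_closed\<close>)
  also have "\<dots> = (\<Oplus>i\<in>A. \<Oplus>k\<in>C. \<Oplus>j\<in>B. (x i \<otimes> f k i) \<otimes> (g k j \<otimes> y j))"
    by (intro finsum_cong' finsum_swap) (use assms in \<open>auto intro!: finsum_closed\<close>)
  also have "\<dots> = (\<Oplus>k\<in>C. \<Oplus>i\<in>A. \<Oplus>j\<in>B. (x i \<otimes> f k i) \<otimes> (g k j \<otimes> y j))"
    by (rule finsum_swap) (use assms in \<open>auto intro!: finsum_closed\<close>)
  also have "\<dots> = ?r"
    by (intro finsum_cong' finsum_mult_finsum[symmetric]) (use assms in \<open>auto intro!: finsum_closed\<close>)
  finally show ?thesis .
qed

text \<open>The index pattern of the compatibility of product and coproduct: four matrices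
  contracted in pairs, by one pair of indices or by the other. It makes that axiom self-dual under a
  pairing.\<close>

lemma (in cring) finsum_contract4:
  assumes fin: "finite A" "finite B" "finite C" "finite D"
    and c: "\<And>k i. k \<in> C \<Longrightarrow> i \<in> A \<Longrightarrow> f k i \<in> carrier R" "\<And>k j. k \<in> C \<Longrightarrow> j \<in> B \<Longrightarrow> h k j \<in> carrier R"
      "\<And>m i. m \<in> D \<Longrightarrow> i \<in> A \<Longrightarrow> g m i \<in> carrier R" "\<And>m j. m \<in> D \<Longrightarrow> j \<in> B \<Longrightarrow> w m j \<in> carrier R"
  shows "(\<Oplus>k\<in>C. \<Oplus>m\<in>D. (\<Oplus>i\<in>A. f k i \<otimes> g m i) \<otimes> (\<Oplus>j\<in>B. h k j \<otimes> w m j))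
       = (\<Oplus>i\<in>A. \<Oplus>j\<in>B. (\<Oplus>k\<in>C. f k i \<otimes> h k j) \<otimes> (\<Oplus>m\<in>D. g m i \<otimes> w m j))" (is "?l = ?r")
proof -
  define F where "F k m i j = (f k i \<otimes> h k j) \<otimes> (g m i \<otimes> w m j)" for k m i j
  have F: "F k m i j \<in> carrier R" if "k \<in> C" "m \<in> D" "i \<in> A" "j \<in> B" for k m i j
    using that c by (simp add: F_def)
  have "?l = (\<Oplus>k\<in>C. \<Oplus>m\<in>D. \<Oplus>i\<in>A. \<Oplus>j\<in>B. F k m i j)"
  proof (intro finsum_cong')
    fix k m assume km: "k \<in> C" "m \<in> D"
    have "(\<Oplus>i\<in>A. f k i \<otimes> g m i) \<otimes> (\<Oplus>j\<in>B. h k j \<otimes> w m j)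
        = (\<Oplus>i\<in>A. \<Oplus>j\<in>B. (f k i \<otimes> g m i) \<otimes> (h k j \<otimes> w m j))"
      by (rule finsum_mult_finsum) (use fin c km in auto)
    also have "\<dots> = (\<Oplus>i\<in>A. \<Oplus>j\<in>B. F k m i j)"
      by (intro finsum_cong') (use fin c km in \<open>auto simp: F_def m_ac intro!: finsum_closed\<close>)
    finally show "(\<Oplus>i\<in>A. f k i \<otimes> g m i) \<otimes> (\<Oplus>j\<in>B. h k j \<otimes> w m j) = \<dots>" .
  qed (use F in \<open>auto intro!: finsum_closed\<close>)
  also have "\<dots> = (\<Oplus>k\<in>C. \<Oplus>i\<in>A. \<Oplus>m\<in>D. \<Oplus>j\<in>B. F k m i j)"
    by (intro finsum_cong' finsum_swap) (use fin F in \<open>auto intro!: finsum_closed\<close>)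
  also have "\<dots> = (\<Oplus>i\<in>A. \<Oplus>k\<in>C. \<Oplus>m\<in>D. \<Oplus>j\<in>B. F k m i j)"
    by (intro finsum_swap) (use fin F in \<open>auto intro!: finsum_closed\<close>)
  also have "\<dots> = (\<Oplus>i\<in>A. \<Oplus>k\<in>C. \<Oplus>j\<in>B. \<Oplus>m\<in>D. F k m i j)"
    by (intro finsum_cong' finsum_swap) (use fin F in \<open>auto intro!: finsum_closed\<close>)
  also have "\<dots> = (\<Oplus>i\<in>A. \<Oplus>j\<in>B. \<Oplus>k\<in>C. \<Oplus>m\<in>D. F k m i j)"
    by (intro finsum_cong' finsum_swap) (use fin F in \<open>auto intro!: finsum_closed\<close>)
  also have "\<dots> = ?r" unfolding F_def
    by (intro finsum_cong' finsum_mult_finsum[symmetric]) (use fin c in \<open>auto intro!: finsum_closed\<close>)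
  finally show ?thesis .
qed

text \<open>Serves to show that the counital projections of the two algebras are transposes of one
  another.\<close>

lemma (in cring) finsum_interchange:
  assumes "finite A" "finite C" "\<And>k i. k \<in> C \<Longrightarrow> i \<in> A \<Longrightarrow> x k i \<in> carrier R"
    "\<And>k. k \<in> C \<Longrightarrow> y k \<in> carrier R" "\<And>i. i \<in> A \<Longrightarrow> z i \<in> carrier R"
  shows "(\<Oplus>i\<in>A. (\<Oplus>k\<in>C. x k i \<otimes> y k) \<otimes> z i) = (\<Oplus>k\<in>C. (\<Oplus>i\<in>A. x k i \<otimes> z i) \<otimes> y k)"
proof -
  have "(\<Oplus>i\<in>A. (\<Oplus>k\<in>C. x k i \<otimes> y k) \<otimes> z i) = (\<Oplus>i\<in>A. \<Oplus>k\<in>C. x k i \<otimes> y k \<otimes> z i)"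
    by (intro finsum_cong') (use assms in \<open>auto simp: finsum_ldistr Pi_iff intro!: finsum_closed\<close>)
  also have "\<dots> = (\<Oplus>k\<in>C. \<Oplus>i\<in>A. x k i \<otimes> y k \<otimes> z i)"
    by (rule finsum_swap) (use assms in auto)
  also have "\<dots> = (\<Oplus>k\<in>C. \<Oplus>i\<in>A. x k i \<otimes> z i \<otimes> y k)"
    by (intro finsum_cong') (use assms in \<open>auto simp: m_ac intro!: finsum_closed\<close>)
  also have "\<dots> = (\<Oplus>k\<in>C. (\<Oplus>i\<in>A. x k i \<otimes> z i) \<otimes> y k)"
    by (intro finsum_cong') (use assms in \<open>auto simp: finsum_ldistr Pi_iff intro!: finsum_closed\<close>)
  finally show ?thesis .
qed

text \<open>Only a bilinear product is recorded, since this property is stable under tensor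
  products; the product on the threefold power is then available by iteration.\<close>

definition k_mult :: "('k, 'c) ring_scheme \<Rightarrow> ('k, 'x, 'd) module_scheme \<Rightarrow> bool" where
  "k_mult K X \<longleftrightarrow> module K X \<and> k_bilinear K X X X (mult X)"

lemma k_algebra_k_mult:
  assumes "k_algebra K X"
  shows "k_mult K X"
proof -
  interpret X: ring X using assms by (simp add: k_algebra_def)
  show ?thesis using assms unfolding k_mult_def
    by (auto intro!: k_bilinearI simp: k_algebra_def X.l_distr X.r_distr)
qed

text \<open>The product of \<open>k_tensor\<close> is a lift inside a lift. Neither can be evaluated
  before it is known to be bilinear: the inner one (\<open>b1\<close>) directly, the outer one
  (\<open>b2\<close>) by testing at pure \<open>t\<close>.\<close>

lemma
  assumes X: "k_mult K X" and Y: "k_mult K Y"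
  shows k_mult_tensor: "k_mult K (k_tensor K X Y)"
    and k_tensor_mult_pure: "x \<in> carrier X \<Longrightarrow> y \<in> carrier Y \<Longrightarrow> x' \<in> carrier X \<Longrightarrow> y' \<in> carrier Y \<Longrightarrow>
      k_pure K X Y x y \<otimes>\<^bsub>k_tensor K X Y\<^esub> k_pure K X Y x' y' = k_pure K X Y (x \<otimes>\<^bsub>X\<^esub> x') (y \<otimes>\<^bsub>Y\<^esub> y')"
proof -
  have mX: "module K X" and mY: "module K Y" using X Y by (auto simp: k_mult_def)
  interpret XY: k_tensor_product K X Y by (intro k_tensor_product.intro mX mY)
  interpret T: module K "k_tensor K X Y" by (rule XY.module_XY)
  let ?p = "k_pure K X Y" and ?T = "k_tensor_group K X Y"
  have bX: "k_bilinear K X X X (mult X)" and bY: "k_bilinear K Y Y Y (mult Y)"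
    using X Y by (auto simp: k_mult_def)
  note fX = k_bilinearD[OF bX]
  note fY = k_bilinearD[OF bY]
  note pp = XY.k_pure_add_left XY.k_pure_add_right XY.smult_pure XY.k_pure_balanced[symmetric]
  have b1: "k_bilinear K X Y (k_tensor K X Y) (\<lambda>x' y'. ?p (x \<otimes>\<^bsub>X\<^esub> x') (y \<otimes>\<^bsub>Y\<^esub> y'))"
    if "x \<in> carrier X" "y \<in> carrier Y" for x y
    by (rule k_bilinearI) (use that in \<open>simp_all add: fX fY pp\<close>)
  define g where "g x y = tensor_lift ?T (\<lambda>x' y'. ?p (x \<otimes>\<^bsub>X\<^esub> x') (y \<otimes>\<^bsub>Y\<^esub> y'))" for x y
  have gl: "k_linear K (k_tensor K X Y) (k_tensor K X Y) (g x y)" if "x \<in> carrier X" "y \<in> carrier Y" for x y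
    unfolding g_def by (rule XY.lift_tensor_linear[OF mX mY b1[OF that]])
  have gp: "g x y (?p x' y') = ?p (x \<otimes>\<^bsub>X\<^esub> x') (y \<otimes>\<^bsub>Y\<^esub> y')"
    if "x \<in> carrier X" "y \<in> carrier Y" "x' \<in> carrier X" "y' \<in> carrier Y" for x y x' y'
    unfolding g_def by (rule XY.lift_tensor_pure[OF mX mY b1[OF that(1,2)] that(3,4)])
  note gs = k_linearD[OF gl]
  have b2: "k_bilinear K X Y (k_tensor K X Y) (\<lambda>x y. g x y t)" if t: "t \<in> carrier (k_tensor K X Y)" for t
  proof (rule k_bilinearI)
    note eq = XY.additive_on_pure_eqI[OF T.abelian_group_axioms _ t]
    fix x x' y y' c
    show "x \<in> carrier X \<Longrightarrow> y \<in> carrier Y \<Longrightarrow> g x y t \<in> carrier (k_tensor K X Y)" by (rule gs(1)[OF _ _ t])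
    show "g (x \<oplus>\<^bsub>X\<^esub> x') y t = g x y t \<oplus>\<^bsub>k_tensor K X Y\<^esub> g x' y t"
      if "x \<in> carrier X" "x' \<in> carrier X" "y \<in> carrier Y"
      by (rule eq) (use that in \<open>simp_all add: gp fX fY pp gs T.a_ac\<close>)
    show "g x (y \<oplus>\<^bsub>Y\<^esub> y') t = g x y t \<oplus>\<^bsub>k_tensor K X Y\<^esub> g x y' t"
      if "x \<in> carrier X" "y \<in> carrier Y" "y' \<in> carrier Y"
      by (rule eq) (use that in \<open>simp_all add: gp fX fY pp gs T.a_ac\<close>)
    show "g (c \<odot>\<^bsub>X\<^esub> x) y t = c \<odot>\<^bsub>k_tensor K X Y\<^esub> g x y t" if "c \<in> carrier K" "x \<in> carrier X" "y \<in> carrier Y"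
      by (rule eq) (use that in \<open>simp_all add: gp fX fY pp gs T.smult_r_distr\<close>)
    show "g x (c \<odot>\<^bsub>Y\<^esub> y) t = c \<odot>\<^bsub>k_tensor K X Y\<^esub> g x y t" if "c \<in> carrier K" "x \<in> carrier X" "y \<in> carrier Y"
      by (rule eq) (use that in \<open>simp_all add: gp fX fY pp gs T.smult_r_distr\<close>)
  qed
  have m: "s \<otimes>\<^bsub>k_tensor K X Y\<^esub> t = tensor_lift ?T (\<lambda>x y. g x y t) s" for s t
    by (simp add: k_tensor_def Let_def g_def)
  note ml = XY.lift_tensor_linear[OF mX mY b2] and mp = XY.lift_tensor_pure[OF mX mY b2]
  show "?p x y \<otimes>\<^bsub>k_tensor K X Y\<^esub> ?p x' y' = ?p (x \<otimes>\<^bsub>X\<^esub> x') (y \<otimes>\<^bsub>Y\<^esub> y')"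
    if "x \<in> carrier X" "y \<in> carrier Y" "x' \<in> carrier X" "y' \<in> carrier Y" for x y x' y'
    using that by (simp add: m mp gp)
  note ms = k_linearD[OF ml]
  have "k_bilinear K (k_tensor K X Y) (k_tensor K X Y) (k_tensor K X Y) (mult (k_tensor K X Y))"
    unfolding k_bilinear_def
  proof (intro conjI ballI)
    fix t assume t: "t \<in> carrier (k_tensor K X Y)"
    show "k_linear K (k_tensor K X Y) (k_tensor K X Y) (\<lambda>s. s \<otimes>\<^bsub>k_tensor K X Y\<^esub> t)"
      unfolding m by (rule ml[OF t])
  next
    fix s assume s: "s \<in> carrier (k_tensor K X Y)"
    note eq = XY.additive_on_pure_eqI[OF T.abelian_group_axioms _ s]
    show "k_linear K (k_tensor K X Y) (k_tensor K X Y) (mult (k_tensor K X Y) s)"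
    proof (rule k_linearI)
      fix t t' c assume t: "t \<in> carrier (k_tensor K X Y)"
      show "s \<otimes>\<^bsub>k_tensor K X Y\<^esub> t \<in> carrier (k_tensor K X Y)" unfolding m by (rule ms(1)[OF t s])
      show "s \<otimes>\<^bsub>k_tensor K X Y\<^esub> (t \<oplus>\<^bsub>k_tensor K X Y\<^esub> t')
          = s \<otimes>\<^bsub>k_tensor K X Y\<^esub> t \<oplus>\<^bsub>k_tensor K X Y\<^esub> s \<otimes>\<^bsub>k_tensor K X Y\<^esub> t'"
        if t': "t' \<in> carrier (k_tensor K X Y)"
        unfolding m by (rule eq) (use t t' in \<open>simp_all add: mp gs ms T.a_ac\<close>)
      show "s \<otimes>\<^bsub>k_tensor K X Y\<^esub> (c \<odot>\<^bsub>k_tensor K X Y\<^esub> t) = c \<odot>\<^bsub>k_tensor K X Y\<^esub> (s \<otimes>\<^bsub>k_tensor K X Y\<^esub> t)"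
        if c: "c \<in> carrier K"
        unfolding m by (rule eq) (use t c in \<open>simp_all add: mp gs ms T.smult_r_distr\<close>)
    qed
  qed
  then show "k_mult K (k_tensor K X Y)" unfolding k_mult_def using T.module_axioms by simp
qed


text \<open>Coproducts are presented by explicit finite families of legs, so a Sweedler sum becomes
  a finite sum of scalars after pairing. Coassociativity and the counit laws are not assumed: they
  are the transposed algebra laws of the other side.\<close>

locale dual_algebras = K: cring K + A: module K A + A': ring A + B: module K B + B': ring B
  for K :: "('k, 'c) ring_scheme" (structure) and A :: "('k, 'a, 'd) module_scheme" and B :: "('k, 'b, 'e) module_scheme" +
  fixes P :: "'b \<Rightarrow> 'a \<Rightarrow> 'k" and J :: "'j set" and u :: "'j \<Rightarrow> 'b" and v :: "'j \<Rightarrow> 'a"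
    and IA :: "'i set" and lA rA :: "'i \<Rightarrow> 'a \<Rightarrow> 'a" and \<Delta>A :: "'a \<Rightarrow> ('a, 'a) tensor" and \<epsilon>A :: "'a \<Rightarrow> 'k"
    and IB :: "'h set" and lB rB :: "'h \<Rightarrow> 'b \<Rightarrow> 'b" and \<Delta>B :: "'b \<Rightarrow> ('b, 'b) tensor" and \<epsilon>B :: "'b \<Rightarrow> 'k"
  assumes algA: "k_algebra K A" and algB: "k_algebra K B"
    and P_bilinear: "k_bilinear K B A (base_module K) P"
    and dual_A: "dual_basis K A J (\<lambda>k a. P (u k) a) v" and dual_B: "dual_basis K B J (\<lambda>k b. P b (v k)) u"
    and finite_IA: "finite IA" and finite_IB: "finite IB"
    and lA_closed [simp]: "i \<in> IA \<Longrightarrow> a \<in> carrier A \<Longrightarrow> lA i a \<in> carrier A"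
    and rA_closed [simp]: "i \<in> IA \<Longrightarrow> a \<in> carrier A \<Longrightarrow> rA i a \<in> carrier A"
    and lB_closed [simp]: "j \<in> IB \<Longrightarrow> b \<in> carrier B \<Longrightarrow> lB j b \<in> carrier B"
    and rB_closed [simp]: "j \<in> IB \<Longrightarrow> b \<in> carrier B \<Longrightarrow> rB j b \<in> carrier B"
    and \<Delta>A: "a \<in> carrier A \<Longrightarrow> \<Delta>A a = (\<Oplus>\<^bsub>k_tensor K A A\<^esub>i\<in>IA. k_pure K A A (lA i a) (rA i a))"
    and \<Delta>B: "b \<in> carrier B \<Longrightarrow> \<Delta>B b = (\<Oplus>\<^bsub>k_tensor K B B\<^esub>j\<in>IB. k_pure K B B (lB j b) (rB j b))"
    and P_mult_left: "b \<in> carrier B \<Longrightarrow> c \<in> carrier B \<Longrightarrow> a \<in> carrier A \<Longrightarrow>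
      P (b \<otimes>\<^bsub>B\<^esub> c) a = (\<Oplus>i\<in>IA. P b (lA i a) \<otimes> P c (rA i a))"
    and P_mult_right: "b \<in> carrier B \<Longrightarrow> a \<in> carrier A \<Longrightarrow> a' \<in> carrier A \<Longrightarrow>
      P b (a \<otimes>\<^bsub>A\<^esub> a') = (\<Oplus>j\<in>IB. P (lB j b) a \<otimes> P (rB j b) a')"
    and P_one_left: "a \<in> carrier A \<Longrightarrow> P \<one>\<^bsub>B\<^esub> a = \<epsilon>A a"
    and P_one_right: "b \<in> carrier B \<Longrightarrow> P b \<one>\<^bsub>A\<^esub> = \<epsilon>B b"
begin

abbreviation "A2 \<equiv> k_tensor K A A"
abbreviation "A3 \<equiv> k_tensor K A A2"

text \<open>The assumptions are symmetric once the dual bases \<open>u\<close> and \<open>v\<close>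
  trade places. Facts are therefore proved for \<open>A\<close> and read off for \<open>B\<close>
  through this instance.\<close>

lemma swap: "dual_algebras K B A (\<lambda>a b. P b a) J v u IB lB rB \<Delta>B \<epsilon>B IA lA rA \<Delta>A \<epsilon>A"
proof unfold_locales
  show "k_bilinear K A B (base_module K) (\<lambda>a b. P b a)" using P_bilinear by (auto simp: k_bilinear_def)
  fix b b' a assume "a \<in> carrier A" "b \<in> carrier B" "b' \<in> carrier B"
  then show "P (b \<otimes>\<^bsub>B\<^esub> b') a = (\<Oplus>j\<in>IA. P b (lA j a) \<otimes> P b' (rA j a))" by (simp add: P_mult_left)
next
  fix a c b assume "a \<in> carrier A" "c \<in> carrier A" "b \<in> carrier B"
  then show "P b (a \<otimes>\<^bsub>A\<^esub> c) = (\<Oplus>i\<in>IB. P (lB i b) a \<otimes> P (rB i b) c)" by (simp add: P_mult_right)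
qed (simp_all add: algA algB dual_A dual_B finite_IA finite_IB \<Delta>A \<Delta>B P_one_left P_one_right)

lemma P_closed [simp]: "b \<in> carrier B \<Longrightarrow> a \<in> carrier A \<Longrightarrow> P b a \<in> carrier K"
  using k_bilinear_closed[OF P_bilinear] by simp

lemma P_linear: "b \<in> carrier B \<Longrightarrow> k_linear K A (base_module K) (P b)"
  by (rule k_bilinear_right[OF P_bilinear])

lemma P_finsum_right: "b \<in> carrier B \<Longrightarrow> f \<in> I \<rightarrow> carrier A \<Longrightarrow> P b (finsum A f I) = (\<Oplus>i\<in>I. P b (f i))"
  using k_linear_finsum[OF A.abelian_group_axioms _ P_linear, of b f I]
    module.axioms(2)[OF base_module_module[OF K.is_cring]] by (simp add: finsum_base_module)

lemma P_add_right: "b \<in> carrier B \<Longrightarrow> a \<in> carrier A \<Longrightarrow> a' \<in> carrier A \<Longrightarrow> P b (a \<oplus>\<^bsub>A\<^esub> a') = P b a \<oplus> P b a'"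
  and P_smult_right: "b \<in> carrier B \<Longrightarrow> a \<in> carrier A \<Longrightarrow> c \<in> carrier K \<Longrightarrow> P b (c \<odot>\<^bsub>A\<^esub> a) = c \<otimes> P b a"
  using k_bilinear_add_right[OF P_bilinear] k_bilinear_smult_right[OF P_bilinear] by simp_all

lemma u_closed [simp]: "k \<in> J \<Longrightarrow> u k \<in> carrier B" and v_closed [simp]: "k \<in> J \<Longrightarrow> v k \<in> carrier A"
  using dual_A dual_B by (auto simp: dual_basis_def)

text \<open>The values \<open>P (u k) a\<close> are the coordinates of \<open>a\<close>, so pairing
  separates the points of \<open>A\<close>. \<open>PP_eqI\<close> and \<open>PPP_eqI\<close> are the
  same principle in the tensor powers.\<close>

lemma P_eqI:
  assumes "a \<in> carrier A" "a' \<in> carrier A" "\<And>b. b \<in> carrier B \<Longrightarrow> P b a = P b a'"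
  shows "a = a'"
  by (rule dual_basis_eqI[OF A.module_axioms dual_A]) (use assms in auto)

sublocale AA: k_tensor_product K A A by unfold_locales
sublocale AAm: module K "A2" by (rule AA.module_XY)
sublocale AAA: k_tensor_product K A "A2" by unfold_locales
sublocale AAAm: module K "A3" by (rule AAA.module_XY)
sublocale AAA': k_tensor_product K "A2" A by unfold_locales
sublocale AAAm': module K "k_tensor K A2 A" by (rule AAA'.module_XY)
sublocale Kb: module K "base_module K" by (rule base_module_module[OF K.is_cring])

definition "PP b c = tensor_lift (add_monoid K) (\<lambda>x y. P b x \<otimes> P c y)"
text \<open>Nested to the right, to match \<open>A3\<close>, the codomain of
  \<open>k_assoc\<close>.\<close>

definition "PPP b c d = tensor_lift (add_monoid K) (\<lambda>x s. P b x \<otimes> PP c d s)"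

lemma PP_bilinear: "b \<in> carrier B \<Longrightarrow> c \<in> carrier B \<Longrightarrow> k_bilinear K A A (base_module K) (\<lambda>x y. P b x \<otimes> P c y)"
  by (rule k_bilinearI) (simp_all add: P_add_right P_smult_right K.l_distr K.r_distr K.m_ac)

lemma PP_linear: "b \<in> carrier B \<Longrightarrow> c \<in> carrier B \<Longrightarrow> k_linear K A2 (base_module K) (PP b c)"
  and PP_pure: "b \<in> carrier B \<Longrightarrow> c \<in> carrier B \<Longrightarrow> x \<in> carrier A \<Longrightarrow> y \<in> carrier A \<Longrightarrow>
    PP b c (k_pure K A A x y) = P b x \<otimes> P c y"
  unfolding PP_def by (simp_all add: AA.lift_form_linear[OF PP_bilinear] AA.lift_form_pure[OF PP_bilinear])

lemmas PP_simps = k_linearD[OF PP_linear, simplified]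

lemma PP_eqI:
  assumes "s \<in> carrier A2" "t \<in> carrier A2"
    "\<And>b c. b \<in> carrier B \<Longrightarrow> c \<in> carrier B \<Longrightarrow> PP b c s = PP b c t"
  shows "s = t"
  by (rule dual_basis_eqI[OF AA.module_XY AA.dual_basis_tensor[OF dual_A dual_A]])
    (use assms in \<open>auto simp: PP_def\<close>)

lemma PPP_bilinear: "b \<in> carrier B \<Longrightarrow> c \<in> carrier B \<Longrightarrow> d \<in> carrier B \<Longrightarrow>
    k_bilinear K A A2 (base_module K) (\<lambda>x s. P b x \<otimes> PP c d s)"
  by (rule k_bilinearI)
    (simp_all add: P_add_right P_smult_right PP_simps K.l_distr K.r_distr K.m_ac)

lemma PPP_linear: "b \<in> carrier B \<Longrightarrow> c \<in> carrier B \<Longrightarrow> d \<in> carrier B \<Longrightarrow>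
    k_linear K A3 (base_module K) (PPP b c d)"
  and PPP_pure: "b \<in> carrier B \<Longrightarrow> c \<in> carrier B \<Longrightarrow> d \<in> carrier B \<Longrightarrow> x \<in> carrier A \<Longrightarrow> s \<in> carrier A2 \<Longrightarrow>
    PPP b c d (k_pure K A A2 x s) = P b x \<otimes> PP c d s"
  unfolding PPP_def by (simp_all add: AAA.lift_form_linear[OF PPP_bilinear] AAA.lift_form_pure[OF PPP_bilinear])

lemma PPP_finsum:
  assumes "b \<in> carrier B" "c \<in> carrier B" "d \<in> carrier B" "f \<in> I \<rightarrow> carrier A3"
  shows "PPP b c d (finsum A3 f I) = (\<Oplus>i\<in>I. PPP b c d (f i))"
  using k_linear_finsum[OF AAAm.abelian_group_axioms Kb.abelian_group_axioms PPP_linear] assms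
  by (simp add: finsum_base_module)

lemma PPP_eqI:
  assumes "s \<in> carrier A3" "t \<in> carrier A3"
    "\<And>b c d. b \<in> carrier B \<Longrightarrow> c \<in> carrier B \<Longrightarrow> d \<in> carrier B \<Longrightarrow> PPP b c d s = PPP b c d t"
  shows "s = t"
  by (rule dual_basis_eqI[OF AAA.module_XY AAA.dual_basis_tensor[OF dual_A AA.dual_basis_tensor[OF dual_A dual_A]]])
    (use assms in \<open>auto simp: PP_def PPP_def\<close>)

lemma \<Delta>A_closed [simp]: "a \<in> carrier A \<Longrightarrow> \<Delta>A a \<in> carrier A2"
  unfolding \<Delta>A by (rule AAm.finsum_closed) simp

text \<open>The coproduct is the transpose of the product of \<open>B\<close>. Together with
  \<open>PP_eqI\<close> this determines \<open>\<Delta>A a\<close>, whatever family of legs presents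
  it; linearity of \<open>\<Delta>A\<close> is a consequence.\<close>

lemma PP_\<Delta>A: "b \<in> carrier B \<Longrightarrow> c \<in> carrier B \<Longrightarrow> a \<in> carrier A \<Longrightarrow> PP b c (\<Delta>A a) = P (b \<otimes>\<^bsub>B\<^esub> c) a"
  unfolding \<Delta>A using k_linear_finsum[OF AAm.abelian_group_axioms Kb.abelian_group_axioms PP_linear, of b c
      "\<lambda>i. k_pure K A A (lA i a) (rA i a)" IA]
  by (simp add: finsum_base_module P_mult_left PP_pure cong: K.finsum_cong)

lemma linear_\<Delta>A:
  assumes "module K Z" "k_linear K A2 Z h" "a \<in> carrier A"
  shows "h (\<Delta>A a) = (\<Oplus>\<^bsub>Z\<^esub>i\<in>IA. h (k_pure K A A (lA i a) (rA i a)))"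
  unfolding \<Delta>A[OF assms(3)] by (rule AA.linear_sum_pure[OF assms(1,2)]) (use assms(3) in auto)

lemma lift_\<Delta>A:
  assumes "module K Z" "k_bilinear K A A Z f" "a \<in> carrier A"
  shows "tensor_lift (add_monoid Z) f (\<Delta>A a) = (\<Oplus>\<^bsub>Z\<^esub>i\<in>IA. f (lA i a) (rA i a))"
proof -
  interpret Z: module K Z by fact
  show ?thesis
    unfolding linear_\<Delta>A[OF assms(1) AA.lift_linear[OF assms(1,2)] assms(3)]
    by (rule Z.finsum_cong') (use assms(3) in \<open>simp_all add: AA.lift_k_pure[OF assms(1,2)] k_bilinear_closed[OF assms(2)]\<close>)
qed

lemma lift_form_\<Delta>A:
  assumes "k_bilinear K A A (base_module K) f" "a \<in> carrier A"
  shows "tensor_lift (add_monoid K) f (\<Delta>A a) = (\<Oplus>i\<in>IA. f (lA i a) (rA i a))"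
  unfolding linear_\<Delta>A[OF Kb.module_axioms AA.lift_form_linear[OF assms(1)] assms(2)] finsum_base_module
  by (rule K.finsum_cong')
    (use assms(2) k_bilinear_closed[OF assms(1)] in \<open>simp_all add: AA.lift_form_pure[OF assms(1)]\<close>)

lemma \<Delta>A_linear: "k_linear K A A2 \<Delta>A"
proof (rule k_linearI)
  fix a a' c assume a: "a \<in> carrier A"
  show "\<Delta>A (a \<oplus>\<^bsub>A\<^esub> a') = \<Delta>A a \<oplus>\<^bsub>A2\<^esub> \<Delta>A a'" if "a' \<in> carrier A"
    by (rule PP_eqI) (use a that in \<open>simp_all add: PP_simps PP_\<Delta>A P_add_right\<close>)
  show "\<Delta>A (c \<odot>\<^bsub>A\<^esub> a) = c \<odot>\<^bsub>A2\<^esub> \<Delta>A a" if "c \<in> carrier K"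
    by (rule PP_eqI) (use a that in \<open>simp_all add: PP_simps PP_\<Delta>A P_smult_right\<close>)
qed simp

lemma \<epsilon>A_linear: "k_linear K A (base_module K) \<epsilon>A"
  by (rule k_linearI) (simp_all add: P_one_left[symmetric] P_add_right P_smult_right)

lemmas \<Delta>A_simps = k_linearD[OF \<Delta>A_linear]
lemmas \<epsilon>A_simps = k_linearD[OF \<epsilon>A_linear, simplified]

abbreviation "\<Delta>id \<equiv> k_tensor_map K A2 A \<Delta>A (\<lambda>x. x)"
abbreviation "id\<Delta> \<equiv> k_tensor_map K A A2 (\<lambda>x. x) \<Delta>A"

lemma \<Delta>id_bilinear: "k_bilinear K A A (k_tensor K A2 A) (\<lambda>x y. k_pure K A2 A (\<Delta>A x) y)"
  by (rule k_bilinearI) (simp_all add: \<Delta>A_simps AAA'.k_pure_add_left AAA'.k_pure_add_right AAA'.smult_pure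
      AAA'.k_pure_balanced[symmetric])

lemma id\<Delta>_bilinear: "k_bilinear K A A A3 (\<lambda>x y. k_pure K A A2 x (\<Delta>A y))"
  by (rule k_bilinearI) (simp_all add: \<Delta>A_simps AAA.k_pure_add_left AAA.k_pure_add_right AAA.smult_pure
      AAA.k_pure_balanced[symmetric])

lemma \<Delta>id_linear: "k_linear K A2 (k_tensor K A2 A) \<Delta>id"
  and \<Delta>id_pure: "x \<in> carrier A \<Longrightarrow> y \<in> carrier A \<Longrightarrow>
    \<Delta>id (k_pure K A A x y) = k_pure K A2 A (\<Delta>A x) y"
  unfolding k_tensor_map_def
  by (simp_all add: AA.lift_tensor_linear[OF AA.module_XY A.module_axioms \<Delta>id_bilinear]
      AA.lift_tensor_pure[OF AA.module_XY A.module_axioms \<Delta>id_bilinear])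

lemma id\<Delta>_linear: "k_linear K A2 A3 id\<Delta>"
  and id\<Delta>_pure: "x \<in> carrier A \<Longrightarrow> y \<in> carrier A \<Longrightarrow>
    id\<Delta> (k_pure K A A x y) = k_pure K A A2 x (\<Delta>A y)"
  unfolding k_tensor_map_def
  by (simp_all add: AA.lift_tensor_linear[OF A.module_axioms AA.module_XY id\<Delta>_bilinear]
      AA.lift_tensor_pure[OF A.module_axioms AA.module_XY id\<Delta>_bilinear])

lemma pure3_bilinear: "z \<in> carrier A \<Longrightarrow>
    k_bilinear K A A A3 (\<lambda>x y. k_pure K A A2 x (k_pure K A A y z))"
  by (rule k_bilinearI) (simp_all add: AA.k_pure_add_left AA.k_pure_balanced[symmetric] AA.smult_pure[symmetric]
      AAA.k_pure_add_left AAA.k_pure_add_right AAA.smult_pure AAA.k_pure_balanced[symmetric])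

text \<open>Rebracketing with the last factor held fixed, so that it becomes an ordinary lift on the
  twofold power.\<close>

definition "assoc3 z = tensor_lift (k_tensor_group K A A2) (\<lambda>x y. k_pure K A A2 x (k_pure K A A y z))"

lemma assoc3_linear: "z \<in> carrier A \<Longrightarrow> k_linear K A2 A3 (assoc3 z)"
  and assoc3_pure: "x \<in> carrier A \<Longrightarrow> y \<in> carrier A \<Longrightarrow> z \<in> carrier A \<Longrightarrow>
    assoc3 z (k_pure K A A x y) = k_pure K A A2 x (k_pure K A A y z)"
  unfolding assoc3_def
  by (simp_all add: AA.lift_tensor_linear[OF A.module_axioms AA.module_XY pure3_bilinear]
      AA.lift_tensor_pure[OF A.module_axioms AA.module_XY pure3_bilinear])

lemmas assoc3_simps = k_linearD[OF assoc3_linear]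

lemma assoc3_bilinear: "k_bilinear K A2 A A3 (\<lambda>s z. assoc3 z s)"
proof (rule k_bilinearI)
  fix s z z' c assume s: "s \<in> carrier A2" and z: "z \<in> carrier A"
  note eq = AA.additive_on_pure_eqI[OF AAAm.abelian_group_axioms _ s]
  show "assoc3 (z \<oplus>\<^bsub>A\<^esub> z') s = assoc3 z s \<oplus>\<^bsub>A3\<^esub> assoc3 z' s" if "z' \<in> carrier A"
    by (rule eq) (use z that in \<open>simp_all add: assoc3_simps assoc3_pure AA.k_pure_add_right AAA.k_pure_add_right AAAm.a_ac\<close>)
  show "assoc3 (c \<odot>\<^bsub>A\<^esub> z) s = c \<odot>\<^bsub>A3\<^esub> assoc3 z s" if "c \<in> carrier K"
    by (rule eq) (use z that in \<open>simp_all add: assoc3_simps assoc3_pure AA.k_pure_balanced[symmetric]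
        AA.smult_pure[symmetric] AAA.k_pure_balanced[symmetric] AAA.smult_pure[symmetric] AAAm.smult_r_distr\<close>)
qed (simp_all add: assoc3_simps)

lemma k_assoc_eq: "k_assoc K A = tensor_lift (k_tensor_group K A A2) (\<lambda>s z. assoc3 z s)"
  by (simp add: k_assoc_def Let_def assoc3_def)

lemma k_assoc_linear: "k_linear K (k_tensor K A2 A) A3 (k_assoc K A)"
  and k_assoc_pure: "s \<in> carrier A2 \<Longrightarrow> z \<in> carrier A \<Longrightarrow>
    k_assoc K A (k_pure K A2 A s z) = assoc3 z s"
  unfolding k_assoc_eq
  by (simp_all add: AAA'.lift_tensor_linear[OF A.module_axioms AA.module_XY assoc3_bilinear]
      AAA'.lift_tensor_pure[OF A.module_axioms AA.module_XY assoc3_bilinear])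

text \<open>Pairing with three elements does not see the bracketing; on pure tensors this is
  associativity in \<open>K\<close>.\<close>

lemma PPP_assoc3:
  assumes "b \<in> carrier B" "c \<in> carrier B" "d \<in> carrier B" "s \<in> carrier A2" "z \<in> carrier A"
  shows "PPP b c d (assoc3 z s) = PP b c s \<otimes> P d z"
proof -
  note ppp = k_linear_closed[OF PPP_linear, simplified] k_linear_add[OF PPP_linear, simplified]
  show ?thesis
    using AA.additive_on_pure_eqI[OF K.abelian_group_axioms _ assms(4), of "\<lambda>s. PPP b c d (assoc3 z s)" "\<lambda>s. PP b c s \<otimes> P d z"] assms
    by (simp add: assoc3_simps assoc3_pure ppp PP_simps PPP_pure PP_pure K.l_distr K.m_assoc)
qed

text \<open>Each of the two coproducts multiplies two of the test elements, by
  \<open>PP_\<Delta>A\<close> and \<open>P_mult_left\<close>. The same value is reused at the unit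
  for the weak unit axiom.\<close>

lemma coassoc_value:
  assumes "b \<in> carrier B" "c \<in> carrier B" "d \<in> carrier B" "a \<in> carrier A"
  shows "k_assoc K A (\<Delta>id (\<Delta>A a)) \<in> carrier A3"
    and "PPP b c d (k_assoc K A (\<Delta>id (\<Delta>A a))) = P (b \<otimes>\<^bsub>B\<^esub> c \<otimes>\<^bsub>B\<^esub> d) a"
proof -
  show "k_assoc K A (\<Delta>id (\<Delta>A a)) \<in> carrier A3"
    using k_linear_closed[OF k_assoc_linear] k_linear_closed[OF \<Delta>id_linear] assms by simp
  have "PPP b c d (k_assoc K A (\<Delta>id (\<Delta>A a)))
      = (\<Oplus>i\<in>IA. PPP b c d (k_assoc K A (\<Delta>id (k_pure K A A (lA i a) (rA i a)))))"
    using linear_\<Delta>A[OF Kb.module_axioms _ assms(4), of "\<lambda>t. PPP b c d (k_assoc K A (\<Delta>id t))"]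
      k_linearD[OF \<Delta>id_linear]
      k_linearD[OF k_assoc_linear]
      k_linearD[OF PPP_linear, simplified] assms
    by (simp add: finsum_base_module k_linearI)
  also have "\<dots> = (\<Oplus>i\<in>IA. P (b \<otimes>\<^bsub>B\<^esub> c) (lA i a) \<otimes> P d (rA i a))"
    by (rule K.finsum_cong') (use assms in \<open>simp_all add: \<Delta>id_pure k_assoc_pure PPP_assoc3 PP_\<Delta>A\<close>)
  also have "\<dots> = P (b \<otimes>\<^bsub>B\<^esub> c \<otimes>\<^bsub>B\<^esub> d) a" using assms by (simp add: P_mult_left)
  finally show "PPP b c d (k_assoc K A (\<Delta>id (\<Delta>A a))) = P (b \<otimes>\<^bsub>B\<^esub> c \<otimes>\<^bsub>B\<^esub> d) a" .
qed

text \<open>Paired with test elements, coassociativity becomes associativity of \<open>B\<close> and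
  the two counit laws become the two unit laws of \<open>B\<close>.\<close>

lemma coalgebra: "k_coalgebra K A \<Delta>A \<epsilon>A"
  unfolding k_coalgebra_def
proof (intro conjI ballI \<Delta>A_linear \<epsilon>A_linear)
  fix a assume a: "a \<in> carrier A"
  show "k_assoc K A (\<Delta>id (\<Delta>A a)) = id\<Delta> (\<Delta>A a)"
  proof (rule PPP_eqI)
    show "k_assoc K A (\<Delta>id (\<Delta>A a)) \<in> carrier A3"
      using coassoc_value(1)[OF _ _ _ a] B'.one_closed by blast
    show "id\<Delta> (\<Delta>A a) \<in> carrier A3"
      using a k_linear_closed[OF id\<Delta>_linear] by simp
    fix b c d assume bcd: "b \<in> carrier B" "c \<in> carrier B" "d \<in> carrier B"
    have "PPP b c d (id\<Delta> (\<Delta>A a)) = (\<Oplus>i\<in>IA. PPP b c d (id\<Delta> (k_pure K A A (lA i a) (rA i a))))"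
      using linear_\<Delta>A[OF Kb.module_axioms _ a, of "\<lambda>t. PPP b c d (id\<Delta> t)"]
        k_linearD[OF id\<Delta>_linear]
        k_linearD[OF PPP_linear, simplified] bcd
      by (simp add: finsum_base_module k_linearI)
    also have "\<dots> = (\<Oplus>i\<in>IA. P b (lA i a) \<otimes> P (c \<otimes>\<^bsub>B\<^esub> d) (rA i a))"
      by (rule K.finsum_cong') (use a bcd in \<open>simp_all add: id\<Delta>_pure PPP_pure PP_\<Delta>A\<close>)
    also have "\<dots> = P (b \<otimes>\<^bsub>B\<^esub> c \<otimes>\<^bsub>B\<^esub> d) a" using a bcd by (simp add: P_mult_left[symmetric] B'.m_assoc)
    finally show "PPP b c d (k_assoc K A (\<Delta>id (\<Delta>A a))) = PPP b c d (id\<Delta> (\<Delta>A a))"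
      using coassoc_value(2)[OF bcd a] by simp
  qed
  have b1: "k_bilinear K A A A (\<lambda>x y. \<epsilon>A x \<odot>\<^bsub>A\<^esub> y)" and b2: "k_bilinear K A A A (\<lambda>x y. \<epsilon>A y \<odot>\<^bsub>A\<^esub> x)"
    by (auto intro!: k_bilinearI simp: \<epsilon>A_simps A.smult_l_distr A.smult_r_distr A.smult_assoc1[symmetric] K.m_ac)
  show "tensor_lift (add_monoid A) (\<lambda>x y. \<epsilon>A x \<odot>\<^bsub>A\<^esub> y) (\<Delta>A a) = a"
    unfolding lift_\<Delta>A[OF A.module_axioms b1 a]
    by (rule P_eqI) (use a in \<open>simp_all add: \<epsilon>A_simps P_finsum_right Pi_iff P_smult_right P_one_left[symmetric]
        P_mult_left[symmetric] cong: K.finsum_cong\<close>)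
  show "tensor_lift (add_monoid A) (\<lambda>x y. \<epsilon>A y \<odot>\<^bsub>A\<^esub> x) (\<Delta>A a) = a"
    unfolding lift_\<Delta>A[OF A.module_axioms b2 a]
    by (rule P_eqI) (use a in \<open>simp_all add: \<epsilon>A_simps P_finsum_right Pi_iff P_smult_right P_one_left[symmetric]
        K.m_comm[of "P \<one>\<^bsub>B\<^esub> _"] P_mult_left[symmetric] cong: K.finsum_cong\<close>)
qed

end

text \<open>The form \<open>\<tau> b a\<close> plays the role of \<open>P b (S a)\<close> and, symmetrically, of \<open>P (S b) a\<close>;
  \<open>et\<close> and \<open>es\<close> are the forms of the two counital projections.\<close>

locale weak_hopf_pairing = dual_algebras +
  fixes \<tau> et es
  assumes mult_compat: "\<And>b c a a'. b \<in> carrier B \<Longrightarrow> c \<in> carrier B \<Longrightarrow> a \<in> carrier A \<Longrightarrow> a' \<in> carrier A \<Longrightarrow>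
      (\<Oplus>i\<in>IA. \<Oplus>j\<in>IA. P b (lA i a \<otimes>\<^bsub>A\<^esub> lA j a') \<otimes> P c (rA i a \<otimes>\<^bsub>A\<^esub> rA j a')) = P (b \<otimes>\<^bsub>B\<^esub> c) (a \<otimes>\<^bsub>A\<^esub> a')"
    and counit_A1: "\<And>a b c. a \<in> carrier A \<Longrightarrow> b \<in> carrier A \<Longrightarrow> c \<in> carrier A \<Longrightarrow>
      (\<Oplus>i\<in>IA. \<epsilon>A (a \<otimes>\<^bsub>A\<^esub> lA i b) \<otimes> \<epsilon>A (rA i b \<otimes>\<^bsub>A\<^esub> c)) = \<epsilon>A (a \<otimes>\<^bsub>A\<^esub> b \<otimes>\<^bsub>A\<^esub> c)"
    and counit_A2: "\<And>a b c. a \<in> carrier A \<Longrightarrow> b \<in> carrier A \<Longrightarrow> c \<in> carrier A \<Longrightarrow>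
      (\<Oplus>i\<in>IA. \<epsilon>A (a \<otimes>\<^bsub>A\<^esub> rA i b) \<otimes> \<epsilon>A (lA i b \<otimes>\<^bsub>A\<^esub> c)) = \<epsilon>A (a \<otimes>\<^bsub>A\<^esub> b \<otimes>\<^bsub>A\<^esub> c)"
    and counit_B1: "\<And>b c d. b \<in> carrier B \<Longrightarrow> c \<in> carrier B \<Longrightarrow> d \<in> carrier B \<Longrightarrow>
      (\<Oplus>k\<in>IB. \<epsilon>B (b \<otimes>\<^bsub>B\<^esub> lB k c) \<otimes> \<epsilon>B (rB k c \<otimes>\<^bsub>B\<^esub> d)) = \<epsilon>B (b \<otimes>\<^bsub>B\<^esub> c \<otimes>\<^bsub>B\<^esub> d)"
    and counit_B2: "\<And>b c d. b \<in> carrier B \<Longrightarrow> c \<in> carrier B \<Longrightarrow> d \<in> carrier B \<Longrightarrow>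
      (\<Oplus>k\<in>IB. \<epsilon>B (b \<otimes>\<^bsub>B\<^esub> rB k c) \<otimes> \<epsilon>B (lB k c \<otimes>\<^bsub>B\<^esub> d)) = \<epsilon>B (b \<otimes>\<^bsub>B\<^esub> c \<otimes>\<^bsub>B\<^esub> d)"
    and \<tau>: "k_bilinear K B A (base_module K) \<tau>"
    and et: "\<And>b a. b \<in> carrier B \<Longrightarrow> a \<in> carrier A \<Longrightarrow>
      (\<Oplus>i\<in>IA. \<epsilon>A (lA i \<one>\<^bsub>A\<^esub> \<otimes>\<^bsub>A\<^esub> a) \<otimes> P b (rA i \<one>\<^bsub>A\<^esub>)) = et b a"
    and es: "\<And>b a. b \<in> carrier B \<Longrightarrow> a \<in> carrier A \<Longrightarrow>
      (\<Oplus>i\<in>IA. \<epsilon>A (a \<otimes>\<^bsub>A\<^esub> rA i \<one>\<^bsub>A\<^esub>) \<otimes> P b (lA i \<one>\<^bsub>A\<^esub>)) = es b a"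
    and form_target: "\<And>b a. b \<in> carrier B \<Longrightarrow> a \<in> carrier A \<Longrightarrow>
      (\<Oplus>i\<in>IA. \<Oplus>k\<in>IB. P (lB k b) (lA i a) \<otimes> \<tau> (rB k b) (rA i a)) = et b a"
    and form_source: "\<And>b a. b \<in> carrier B \<Longrightarrow> a \<in> carrier A \<Longrightarrow>
      (\<Oplus>i\<in>IA. \<Oplus>k\<in>IB. \<tau> (lB k b) (lA i a) \<otimes> P (rB k b) (rA i a)) = es b a"
    and form_triple: "\<And>b a. b \<in> carrier B \<Longrightarrow> a \<in> carrier A \<Longrightarrow>
      (\<Oplus>i\<in>IA. \<Oplus>k\<in>IB. es (lB k b) (lA i a) \<otimes> \<tau> (rB k b) (rA i a)) = \<tau> b a"
begin

section \<open>The weak Hopf axioms and the antipode, tested by pairing\<close>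

lemma comult_mult:
  assumes a: "a \<in> carrier A" "a' \<in> carrier A"
  shows "\<Delta>A (a \<otimes>\<^bsub>A\<^esub> a') = \<Delta>A a \<otimes>\<^bsub>A2\<^esub> \<Delta>A a'"
proof -
  note km = k_algebra_k_mult[OF algA]
  have bm: "k_bilinear K A2 A2 A2 (mult A2)"
    using k_mult_tensor[OF km km] by (simp add: k_mult_def)
  note mp = k_tensor_mult_pure[OF km km]
  show ?thesis
  proof (rule PP_eqI)
    show "\<Delta>A a \<otimes>\<^bsub>A2\<^esub> \<Delta>A a' \<in> carrier A2"
      using a k_bilinear_closed[OF bm] by simp
    fix b c assume bc: "b \<in> carrier B" "c \<in> carrier B"
    \<comment> \<open>Pairing after multiplication is linear in either factor, so the two coproducts
      can be replaced one after the other by their presenting sums.\<close>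
    have lin1: "k_linear K A2 (base_module K) (\<lambda>s. PP b c (s \<otimes>\<^bsub>A2\<^esub> t))"
      and lin2: "k_linear K A2 (base_module K) (\<lambda>s. PP b c (t \<otimes>\<^bsub>A2\<^esub> s))"
      if "t \<in> carrier A2" for t
      by (rule k_linearI; use that bc k_bilinearD[OF bm] in \<open>simp add: PP_simps\<close>)+
    have "PP b c (\<Delta>A a \<otimes>\<^bsub>A2\<^esub> \<Delta>A a')
        = (\<Oplus>i\<in>IA. PP b c (k_pure K A A (lA i a) (rA i a) \<otimes>\<^bsub>A2\<^esub> \<Delta>A a'))"
      using linear_\<Delta>A[OF Kb.module_axioms lin1, of "\<Delta>A a'" a] a by (simp add: finsum_base_module)
    also have "\<dots> = (\<Oplus>i\<in>IA. \<Oplus>j\<in>IA. P b (lA i a \<otimes>\<^bsub>A\<^esub> lA j a') \<otimes> P c (rA i a \<otimes>\<^bsub>A\<^esub> rA j a'))"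
    proof (rule K.finsum_cong')
      fix i assume i: "i \<in> IA"
      have "PP b c (k_pure K A A (lA i a) (rA i a) \<otimes>\<^bsub>A2\<^esub> \<Delta>A a') =
        (\<Oplus>j\<in>IA. PP b c (k_pure K A A (lA i a) (rA i a) \<otimes>\<^bsub>A2\<^esub> k_pure K A A (lA j a') (rA j a')))"
        using linear_\<Delta>A[OF Kb.module_axioms lin2, of "k_pure K A A (lA i a) (rA i a)" a'] a i
        by (simp add: finsum_base_module)
      also have "\<dots> = (\<Oplus>j\<in>IA. P b (lA i a \<otimes>\<^bsub>A\<^esub> lA j a') \<otimes> P c (rA i a \<otimes>\<^bsub>A\<^esub> rA j a'))"
        by (rule K.finsum_cong') (use a i bc in \<open>simp_all add: mp PP_pure\<close>)
      finally show "PP b c (k_pure K A A (lA i a) (rA i a) \<otimes>\<^bsub>A2\<^esub> \<Delta>A a') = \<dots>" .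
    qed (use a bc in \<open>auto intro!: K.finsum_closed\<close>)
    also have "\<dots> = P (b \<otimes>\<^bsub>B\<^esub> c) (a \<otimes>\<^bsub>A\<^esub> a')" by (rule mult_compat[OF bc a])
    finally show "PP b c (\<Delta>A (a \<otimes>\<^bsub>A\<^esub> a')) = PP b c (\<Delta>A a \<otimes>\<^bsub>A2\<^esub> \<Delta>A a')"
      using a bc by (simp add: PP_\<Delta>A)
  qed (use a in simp)
qed

text \<open>Paired with \<open>b\<close>, \<open>c\<close>, \<open>d\<close>, the twofold coproduct
  of the unit gives the counit of the product b c d, and either product of the two factors gives one
  of the weak counit expansions in \<open>B\<close>. The unit axiom of \<open>A\<close> is thus the
  counit axiom of \<open>B\<close>.\<close>

lemma weak_unit:
  defines "HHH \<equiv> A3"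
    and "L \<equiv> k_assoc K A (k_pure K A2 A (\<Delta>A \<one>\<^bsub>A\<^esub>) \<one>\<^bsub>A\<^esub>)"
    and "R \<equiv> k_pure K A A2 \<one>\<^bsub>A\<^esub> (\<Delta>A \<one>\<^bsub>A\<^esub>)"
  shows "L \<otimes>\<^bsub>HHH\<^esub> R = k_assoc K A (\<Delta>id (\<Delta>A \<one>\<^bsub>A\<^esub>)) \<and> R \<otimes>\<^bsub>HHH\<^esub> L = k_assoc K A (\<Delta>id (\<Delta>A \<one>\<^bsub>A\<^esub>))"
proof -
  define l r where "l i = lA i \<one>\<^bsub>A\<^esub>" and "r i = rA i \<one>\<^bsub>A\<^esub>" for i
  have lr [simp]: "l i \<in> carrier A" "r i \<in> carrier A" if "i \<in> IA" for i using that by (simp_all add: l_def r_def)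
  note km = k_algebra_k_mult[OF algA]
  note km2 = k_mult_tensor[OF km km]
  have bm: "k_bilinear K HHH HHH HHH (mult HHH)"
    unfolding HHH_def using k_mult_tensor[OF km km2] by (simp add: k_mult_def)
  note bms = k_bilinearD[OF bm]
  note mp = k_tensor_mult_pure[OF km km] k_tensor_mult_pure[OF km km2]
  let ?x = "\<lambda>i. k_pure K A A2 (l i) (k_pure K A A (r i) \<one>\<^bsub>A\<^esub>)"
  let ?y = "\<lambda>j. k_pure K A A2 \<one>\<^bsub>A\<^esub> (k_pure K A A (l j) (r j))"
  have L: "L = (\<Oplus>\<^bsub>HHH\<^esub>i\<in>IA. ?x i)"
    unfolding L_def HHH_def
    using linear_\<Delta>A[OF AAAm.module_axioms assoc3_linear, of "\<one>\<^bsub>A\<^esub>" "\<one>\<^bsub>A\<^esub>"]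
    by (simp add: k_assoc_pure assoc3_pure l_def r_def Pi_iff cong: AAAm.finsum_cong)
  have R: "R = (\<Oplus>\<^bsub>HHH\<^esub>j\<in>IA. ?y j)"
    unfolding R_def HHH_def l_def r_def
    by (rule linear_\<Delta>A[OF AAAm.module_axioms k_bilinear_right[OF AAA.k_bilinear_pure]]) simp_all
  have xc: "?x \<in> IA \<rightarrow> carrier HHH" and yc: "?y \<in> IA \<rightarrow> carrier HHH" by (auto simp: HHH_def)
  have xyc: "?x i \<otimes>\<^bsub>HHH\<^esub> ?y j \<in> carrier HHH" "?y i \<otimes>\<^bsub>HHH\<^esub> ?x j \<in> carrier HHH" if "i \<in> IA" "j \<in> IA" for i j
    using xc yc that bms(1) by (auto simp: Pi_iff)
  have ab: "abelian_group HHH" unfolding HHH_def by (rule AAAm.abelian_group_axioms)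
  interpret H: abelian_group HHH by (rule ab)
  have Lc: "L \<in> carrier HHH" and Rc: "R \<in> carrier HHH" unfolding L R using xc yc by (auto intro: H.finsum_closed)
  have LR: "L \<otimes>\<^bsub>HHH\<^esub> R = (\<Oplus>\<^bsub>HHH\<^esub>i\<in>IA. \<Oplus>\<^bsub>HHH\<^esub>j\<in>IA. ?x i \<otimes>\<^bsub>HHH\<^esub> ?y j)"
  proof -
    have "L \<otimes>\<^bsub>HHH\<^esub> R = (\<Oplus>\<^bsub>HHH\<^esub>i\<in>IA. ?x i \<otimes>\<^bsub>HHH\<^esub> R)"
      unfolding L by (rule k_linear_finsum[OF ab ab k_bilinear_left[OF bm Rc] xc])
    also have "\<dots> = (\<Oplus>\<^bsub>HHH\<^esub>i\<in>IA. \<Oplus>\<^bsub>HHH\<^esub>j\<in>IA. ?x i \<otimes>\<^bsub>HHH\<^esub> ?y j)"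
      by (rule H.finsum_cong'[OF refl])
        (use xyc xc in \<open>auto simp: R Pi_iff intro!: H.finsum_closed k_linear_finsum[OF ab ab k_bilinear_right[OF bm] yc]\<close>)
    finally show ?thesis .
  qed
  have RL: "R \<otimes>\<^bsub>HHH\<^esub> L = (\<Oplus>\<^bsub>HHH\<^esub>i\<in>IA. \<Oplus>\<^bsub>HHH\<^esub>j\<in>IA. ?y j \<otimes>\<^bsub>HHH\<^esub> ?x i)"
  proof -
    have "R \<otimes>\<^bsub>HHH\<^esub> L = (\<Oplus>\<^bsub>HHH\<^esub>i\<in>IA. R \<otimes>\<^bsub>HHH\<^esub> ?x i)"
      unfolding L by (rule k_linear_finsum[OF ab ab k_bilinear_right[OF bm Rc] xc])
    also have "\<dots> = (\<Oplus>\<^bsub>HHH\<^esub>i\<in>IA. \<Oplus>\<^bsub>HHH\<^esub>j\<in>IA. ?y j \<otimes>\<^bsub>HHH\<^esub> ?x i)"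
      by (rule H.finsum_cong'[OF refl])
        (use xyc xc in \<open>auto simp: R Pi_iff intro!: H.finsum_closed k_linear_finsum[OF ab ab k_bilinear_left[OF bm] yc]\<close>)
    finally show ?thesis .
  qed
  have ev: "PPP b c d (\<Oplus>\<^bsub>HHH\<^esub>i\<in>IA. \<Oplus>\<^bsub>HHH\<^esub>j\<in>IA. z i j) = (\<Oplus>i\<in>IA. \<Oplus>j\<in>IA. PPP b c d (z i j))"
    if "b \<in> carrier B" "c \<in> carrier B" "d \<in> carrier B" "\<And>i j. i \<in> IA \<Longrightarrow> j \<in> IA \<Longrightarrow> z i j \<in> carrier HHH" for b c d z
  proof -
    have "PPP b c d (\<Oplus>\<^bsub>HHH\<^esub>i\<in>IA. \<Oplus>\<^bsub>HHH\<^esub>j\<in>IA. z i j) = (\<Oplus>i\<in>IA. PPP b c d (\<Oplus>\<^bsub>HHH\<^esub>j\<in>IA. z i j))"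
      unfolding HHH_def by (rule PPP_finsum) (use that in \<open>auto simp: HHH_def[symmetric] intro!: H.finsum_closed\<close>)
    also have "\<dots> = (\<Oplus>i\<in>IA. \<Oplus>j\<in>IA. PPP b c d (z i j))"
      unfolding HHH_def
      by (rule K.finsum_cong'[OF refl _ PPP_finsum])
        (use that k_linear_closed[OF PPP_linear, simplified] in \<open>auto simp: HHH_def intro!: K.finsum_closed\<close>)
    finally show ?thesis .
  qed
  have D: "k_assoc K A (\<Delta>id (\<Delta>A \<one>\<^bsub>A\<^esub>)) \<in> carrier HHH"
    unfolding HHH_def using coassoc_value(1) B'.one_closed A'.one_closed by blast
  have Dv: "PPP b c d (k_assoc K A (\<Delta>id (\<Delta>A \<one>\<^bsub>A\<^esub>))) = \<epsilon>B (b \<otimes>\<^bsub>B\<^esub> c \<otimes>\<^bsub>B\<^esub> d)"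
    if "b \<in> carrier B" "c \<in> carrier B" "d \<in> carrier B" for b c d
    using that by (simp add: coassoc_value(2) P_one_right)
  have e1: "(\<Oplus>i\<in>IA. P x (l i) \<otimes> P y (r i)) = \<epsilon>B (x \<otimes>\<^bsub>B\<^esub> y)" if "x \<in> carrier B" "y \<in> carrier B" for x y
    using that by (simp add: P_one_right[symmetric] P_mult_left l_def r_def)
  \<comment> \<open>The middle legs are multiplied in \<open>A\<close>, so \<open>c\<close> is split
    by the coproduct of \<open>B\<close>; each outer sum is then the counit of a product, by
    \<open>e1\<close>.\<close>
  have lrv: "(\<Oplus>i\<in>IA. \<Oplus>j\<in>IA. P b (l i) \<otimes> (P c (r i \<otimes>\<^bsub>A\<^esub> l j) \<otimes> P d (r j))) = \<epsilon>B (b \<otimes>\<^bsub>B\<^esub> c \<otimes>\<^bsub>B\<^esub> d)"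
    if bcd: "b \<in> carrier B" "c \<in> carrier B" "d \<in> carrier B" for b c d
  proof -
    have "(\<Oplus>i\<in>IA. \<Oplus>j\<in>IA. P b (l i) \<otimes> (P c (r i \<otimes>\<^bsub>A\<^esub> l j) \<otimes> P d (r j)))
      = (\<Oplus>i\<in>IA. \<Oplus>j\<in>IA. P b (l i) \<otimes> ((\<Oplus>k\<in>IB. P (lB k c) (r i) \<otimes> P (rB k c) (l j)) \<otimes> P d (r j)))"
      by (intro K.finsum_cong') (use bcd in \<open>auto simp: P_mult_right intro!: K.finsum_closed\<close>)
    also have "\<dots> = (\<Oplus>k\<in>IB. (\<Oplus>i\<in>IA. P b (l i) \<otimes> P (lB k c) (r i)) \<otimes> (\<Oplus>j\<in>IA. P (rB k c) (l j) \<otimes> P d (r j)))"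
      by (rule K.finsum_contract) (use bcd finite_IA finite_IB in auto)
    also have "\<dots> = (\<Oplus>k\<in>IB. \<epsilon>B (b \<otimes>\<^bsub>B\<^esub> lB k c) \<otimes> \<epsilon>B (rB k c \<otimes>\<^bsub>B\<^esub> d))"
      by (rule K.finsum_cong') (use bcd in \<open>auto simp: e1 P_one_right[symmetric]\<close>)
    also have "\<dots> = \<epsilon>B (b \<otimes>\<^bsub>B\<^esub> c \<otimes>\<^bsub>B\<^esub> d)" by (rule counit_B1[OF bcd])
    finally show ?thesis .
  qed
  \<comment> \<open>In the opposite order the two halves of \<open>c\<close> trade places, and
    \<open>counit_B2\<close> takes over from \<open>counit_B1\<close>.\<close>
  have rlv: "(\<Oplus>i\<in>IA. \<Oplus>j\<in>IA. P b (l i) \<otimes> (P c (l j \<otimes>\<^bsub>A\<^esub> r i) \<otimes> P d (r j))) = \<epsilon>B (b \<otimes>\<^bsub>B\<^esub> c \<otimes>\<^bsub>B\<^esub> d)"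
    if bcd: "b \<in> carrier B" "c \<in> carrier B" "d \<in> carrier B" for b c d
  proof -
    have "(\<Oplus>i\<in>IA. \<Oplus>j\<in>IA. P b (l i) \<otimes> (P c (l j \<otimes>\<^bsub>A\<^esub> r i) \<otimes> P d (r j)))
      = (\<Oplus>i\<in>IA. \<Oplus>j\<in>IA. P b (l i) \<otimes> ((\<Oplus>k\<in>IB. P (rB k c) (r i) \<otimes> P (lB k c) (l j)) \<otimes> P d (r j)))"
    proof (intro K.finsum_cong')
      fix i j assume ij: "i \<in> IA" "j \<in> IA"
      have "P c (l j \<otimes>\<^bsub>A\<^esub> r i) = (\<Oplus>k\<in>IB. P (rB k c) (r i) \<otimes> P (lB k c) (l j))"
        unfolding P_mult_right[OF bcd(2) lr(1)[OF ij(2)] lr(2)[OF ij(1)]]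
        by (rule K.finsum_cong') (use ij bcd in \<open>auto intro: K.m_comm\<close>)
      then show "P b (l i) \<otimes> (P c (l j \<otimes>\<^bsub>A\<^esub> r i) \<otimes> P d (r j)) = P b (l i) \<otimes>
        ((\<Oplus>k\<in>IB. P (rB k c) (r i) \<otimes> P (lB k c) (l j)) \<otimes> P d (r j))" by simp
    qed (use bcd in \<open>auto intro!: K.finsum_closed\<close>)
    also have "\<dots> = (\<Oplus>k\<in>IB. (\<Oplus>i\<in>IA. P b (l i) \<otimes> P (rB k c) (r i)) \<otimes> (\<Oplus>j\<in>IA. P (lB k c) (l j) \<otimes> P d (r j)))"
      by (rule K.finsum_contract) (use bcd finite_IA finite_IB in auto)
    also have "\<dots> = (\<Oplus>k\<in>IB. \<epsilon>B (b \<otimes>\<^bsub>B\<^esub> rB k c) \<otimes> \<epsilon>B (lB k c \<otimes>\<^bsub>B\<^esub> d))"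
      by (rule K.finsum_cong') (use bcd in \<open>auto simp: e1 P_one_right[symmetric]\<close>)
    also have "\<dots> = \<epsilon>B (b \<otimes>\<^bsub>B\<^esub> c \<otimes>\<^bsub>B\<^esub> d)" by (rule counit_B2[OF bcd])
    finally show ?thesis .
  qed
  have xy: "PPP b c d (?x i \<otimes>\<^bsub>HHH\<^esub> ?y j) = P b (l i) \<otimes> (P c (r i \<otimes>\<^bsub>A\<^esub> l j) \<otimes> P d (r j))"
    "PPP b c d (?y j \<otimes>\<^bsub>HHH\<^esub> ?x i) = P b (l i) \<otimes> (P c (l j \<otimes>\<^bsub>A\<^esub> r i) \<otimes> P d (r j))"
    if "b \<in> carrier B" "c \<in> carrier B" "d \<in> carrier B" "i \<in> IA" "j \<in> IA" for b c d i j
    using that by (simp_all add: HHH_def mp PPP_pure PP_pure)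
  show ?thesis
  proof
    show "L \<otimes>\<^bsub>HHH\<^esub> R = k_assoc K A (\<Delta>id (\<Delta>A \<one>\<^bsub>A\<^esub>))"
    proof (rule PPP_eqI)
      fix b c d assume bcd: "b \<in> carrier B" "c \<in> carrier B" "d \<in> carrier B"
      have "PPP b c d (L \<otimes>\<^bsub>HHH\<^esub> R) = (\<Oplus>i\<in>IA. \<Oplus>j\<in>IA. PPP b c d (?x i \<otimes>\<^bsub>HHH\<^esub> ?y j))"
        unfolding LR by (rule ev[OF bcd]) (rule xyc(1))
      also have "\<dots> = (\<Oplus>i\<in>IA. \<Oplus>j\<in>IA. P b (l i) \<otimes> (P c (r i \<otimes>\<^bsub>A\<^esub> l j) \<otimes> P d (r j)))"
        by (intro K.finsum_cong') (use bcd xy in \<open>auto intro!: K.finsum_closed\<close>)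
      finally show "PPP b c d (L \<otimes>\<^bsub>HHH\<^esub> R) = PPP b c d (k_assoc K A (\<Delta>id (\<Delta>A \<one>\<^bsub>A\<^esub>)))"
        using bcd by (simp add: lrv Dv)
    qed (use D bms(1)[OF Lc Rc] in \<open>simp_all add: HHH_def\<close>)
    show "R \<otimes>\<^bsub>HHH\<^esub> L = k_assoc K A (\<Delta>id (\<Delta>A \<one>\<^bsub>A\<^esub>))"
    proof (rule PPP_eqI)
      fix b c d assume bcd: "b \<in> carrier B" "c \<in> carrier B" "d \<in> carrier B"
      have "PPP b c d (R \<otimes>\<^bsub>HHH\<^esub> L) = (\<Oplus>i\<in>IA. \<Oplus>j\<in>IA. PPP b c d (?y j \<otimes>\<^bsub>HHH\<^esub> ?x i))"
        unfolding RL by (rule ev[OF bcd]) (rule xyc(2))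
      also have "\<dots> = (\<Oplus>i\<in>IA. \<Oplus>j\<in>IA. P b (l i) \<otimes> (P c (l j \<otimes>\<^bsub>A\<^esub> r i) \<otimes> P d (r j)))"
        by (intro K.finsum_cong') (use bcd xy in \<open>auto intro!: K.finsum_closed\<close>)
      finally show "PPP b c d (R \<otimes>\<^bsub>HHH\<^esub> L) = PPP b c d (k_assoc K A (\<Delta>id (\<Delta>A \<one>\<^bsub>A\<^esub>)))"
        using bcd by (simp add: rlv Dv)
    qed (use D bms(1)[OF Rc Lc] in \<open>simp_all add: HHH_def\<close>)
  qed
qed

lemma weak_counit:
  assumes abc: "a \<in> carrier A" "b \<in> carrier A" "c \<in> carrier A"
  shows "\<epsilon>A (a \<otimes>\<^bsub>A\<^esub> b \<otimes>\<^bsub>A\<^esub> c) = tensor_lift (add_monoid K) (\<lambda>x y. \<epsilon>A (a \<otimes>\<^bsub>A\<^esub> x) \<otimes> \<epsilon>A (y \<otimes>\<^bsub>A\<^esub> c)) (\<Delta>A b)"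
    "\<epsilon>A (a \<otimes>\<^bsub>A\<^esub> b \<otimes>\<^bsub>A\<^esub> c) = tensor_lift (add_monoid K) (\<lambda>x y. \<epsilon>A (a \<otimes>\<^bsub>A\<^esub> y) \<otimes> \<epsilon>A (x \<otimes>\<^bsub>A\<^esub> c)) (\<Delta>A b)"
proof -
  have bA: "k_bilinear K A A A (mult A)" using k_algebra_k_mult[OF algA] by (simp add: k_mult_def)
  note sm = k_bilinear_smult_left[OF bA] k_bilinear_smult_right[OF bA]
  have b1: "k_bilinear K A A (base_module K) (\<lambda>x y. \<epsilon>A (a \<otimes>\<^bsub>A\<^esub> x) \<otimes> \<epsilon>A (y \<otimes>\<^bsub>A\<^esub> c))"
    and b2: "k_bilinear K A A (base_module K) (\<lambda>x y. \<epsilon>A (a \<otimes>\<^bsub>A\<^esub> y) \<otimes> \<epsilon>A (x \<otimes>\<^bsub>A\<^esub> c))"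
    by (rule k_bilinearI; use abc in \<open>simp add: \<epsilon>A_simps sm A'.l_distr A'.r_distr K.l_distr K.r_distr K.m_ac\<close>)+
  show "\<epsilon>A (a \<otimes>\<^bsub>A\<^esub> b \<otimes>\<^bsub>A\<^esub> c) = tensor_lift (add_monoid K) (\<lambda>x y. \<epsilon>A (a \<otimes>\<^bsub>A\<^esub> x) \<otimes> \<epsilon>A (y \<otimes>\<^bsub>A\<^esub> c)) (\<Delta>A b)"
    unfolding lift_form_\<Delta>A[OF b1 abc(2)] by (rule counit_A1[OF abc, symmetric])
  show "\<epsilon>A (a \<otimes>\<^bsub>A\<^esub> b \<otimes>\<^bsub>A\<^esub> c) = tensor_lift (add_monoid K) (\<lambda>x y. \<epsilon>A (a \<otimes>\<^bsub>A\<^esub> y) \<otimes> \<epsilon>A (x \<otimes>\<^bsub>A\<^esub> c)) (\<Delta>A b)"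
    unfolding lift_form_\<Delta>A[OF b2 abc(2)] by (rule counit_A2[OF abc, symmetric])
qed

lemma antipode:
  shows "\<exists>S. weak_hopf_antipode K A \<Delta>A \<epsilon>A S"
proof -
  have bA: "k_bilinear K A A A (mult A)" using k_algebra_k_mult[OF algA] by (simp add: k_mult_def)
  note sm = k_bilinear_smult_left[OF bA] k_bilinear_smult_right[OF bA]
  note \<tau>s = k_bilinearD[OF \<tau>, simplified]
  \<comment> \<open>The coordinates of \<open>S a\<close> along \<open>v\<close> are prescribed by
    \<open>\<tau>\<close>; expanding the test element along \<open>u\<close> then gives
    \<open>PS\<close>.\<close>
  define S where "S a = (\<Oplus>\<^bsub>A\<^esub>k\<in>J. \<tau> (u k) a \<odot>\<^bsub>A\<^esub> v k)" for a
  have Sc [simp]: "S a \<in> carrier A" if "a \<in> carrier A" for a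
    unfolding S_def by (rule A.finsum_closed) (use that \<tau>s in auto)
  have PS: "P b (S a) = \<tau> b a" if "b \<in> carrier B" "a \<in> carrier A" for b a
  proof -
    have "P b (S a) = (\<Oplus>k\<in>J. \<tau> (u k) a \<otimes> P b (v k))"
      unfolding S_def by (subst P_finsum_right) (use that \<tau>s in \<open>auto simp: P_smult_right intro!: K.finsum_cong'\<close>)
    also have "\<dots> = (\<Oplus>k\<in>J. \<tau> (P b (v k) \<odot>\<^bsub>B\<^esub> u k) a)"
      by (rule K.finsum_cong') (use that \<tau>s in \<open>auto simp: K.m_comm\<close>)
    also have "\<dots> = \<tau> (\<Oplus>\<^bsub>B\<^esub>k\<in>J. P b (v k) \<odot>\<^bsub>B\<^esub> u k) a"
      using k_linear_finsum[OF B.abelian_group_axioms Kb.abelian_group_axioms k_bilinear_left[OF \<tau> that(2)],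
          of "\<lambda>k. P b (v k) \<odot>\<^bsub>B\<^esub> u k" J] that by (simp add: finsum_base_module)
    also have "(\<Oplus>\<^bsub>B\<^esub>k\<in>J. P b (v k) \<odot>\<^bsub>B\<^esub> u k) = b" using dual_B that by (simp add: dual_basis_def)
    finally show ?thesis .
  qed
  have Slin: "k_linear K A A S"
  proof (rule k_linearI)
    fix a a' c assume a: "a \<in> carrier A"
    show "S (a \<oplus>\<^bsub>A\<^esub> a') = S a \<oplus>\<^bsub>A\<^esub> S a'" if "a' \<in> carrier A"
      by (rule P_eqI) (use a that in \<open>simp_all add: PS P_add_right \<tau>s\<close>)
    show "S (c \<odot>\<^bsub>A\<^esub> a) = c \<odot>\<^bsub>A\<^esub> S a" if "c \<in> carrier K"
      by (rule P_eqI) (use a that in \<open>simp_all add: PS P_smult_right \<tau>s\<close>)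
  qed simp
  note Ss = k_linear_add[OF Slin] k_linear_smult[OF Slin]
  have esc: "es b a \<in> carrier K" if "b \<in> carrier B" "a \<in> carrier A" for b a
    unfolding es[OF that, symmetric] by (rule K.finsum_closed) (use that \<epsilon>A_simps in auto)
  have b1: "k_bilinear K A A A (\<lambda>x y. x \<otimes>\<^bsub>A\<^esub> S y)" and b2: "k_bilinear K A A A (\<lambda>x y. S x \<otimes>\<^bsub>A\<^esub> y)"
    by (rule k_bilinearI; simp add: Ss sm A'.l_distr A'.r_distr)+
  have b3: "k_bilinear K A A A (\<lambda>x y. \<epsilon>A (x \<otimes>\<^bsub>A\<^esub> a) \<odot>\<^bsub>A\<^esub> y)"
    and b4: "k_bilinear K A A A (\<lambda>x y. \<epsilon>A (a \<otimes>\<^bsub>A\<^esub> y) \<odot>\<^bsub>A\<^esub> x)" if "a \<in> carrier A" for a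
    by (rule k_bilinearI; use that in \<open>simp add: \<epsilon>A_simps sm A'.l_distr A'.r_distr A.smult_l_distr A.smult_r_distr
        A.smult_assoc1[symmetric] K.m_ac\<close>)+
  define F where "F z = tensor_lift (add_monoid A) (\<lambda>x y. S x \<otimes>\<^bsub>A\<^esub> y \<otimes>\<^bsub>A\<^esub> S z)" for z
  define G where "G = tensor_lift (add_monoid A) (\<lambda>x y. S x \<otimes>\<^bsub>A\<^esub> y)"
  have Glin: "k_linear K A2 A G" unfolding G_def by (rule AA.lift_linear[OF A.module_axioms b2])
  note Gs = k_linearD[OF Glin]
  have Gp: "G (k_pure K A A x y) = S x \<otimes>\<^bsub>A\<^esub> y" if "x \<in> carrier A" "y \<in> carrier A" for x y
    unfolding G_def by (rule AA.lift_k_pure[OF A.module_axioms b2 that])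
  have bF: "k_bilinear K A A A (\<lambda>x y. S x \<otimes>\<^bsub>A\<^esub> y \<otimes>\<^bsub>A\<^esub> S z)" if "z \<in> carrier A" for z
    by (rule k_bilinearI) (use that in \<open>simp_all add: Ss sm A'.l_distr A'.r_distr\<close>)
  \<comment> \<open>The third antipode factor splits off, so S(a_1) a_2 S(a_3) becomes the source
    projection of the first leg times the antipode of the second; this is the shape treated by
    \<open>form_triple\<close>.\<close>
  have FG: "F z s = G s \<otimes>\<^bsub>A\<^esub> S z" if z: "z \<in> carrier A" and s: "s \<in> carrier A2" for z s
  proof -
    note Fl = AA.lift_linear[OF A.module_axioms bF[OF z], folded F_def]
    note Fp = AA.lift_k_pure[OF A.module_axioms bF[OF z], folded F_def]
    show ?thesis
      by (rule AA.additive_on_pure_eqI[OF A.abelian_group_axioms _ s])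
        (use z k_linear_closed[OF Fl] k_linear_add[OF Fl] in \<open>simp_all add: Fp Gp Gs A'.l_distr\<close>)
  qed
  have bFG: "k_bilinear K A2 A A (\<lambda>s z. F z s)"
    by (rule k_bilinearI) (simp_all add: FG Gs Ss sm A'.l_distr A'.r_distr)
  have PG: "P b (G (\<Delta>A a)) = es b a" if "b \<in> carrier B" "a \<in> carrier A" for b a
  proof -
    have "P b (G (\<Delta>A a)) = (\<Oplus>i\<in>IA. P b (S (lA i a) \<otimes>\<^bsub>A\<^esub> rA i a))"
      unfolding G_def lift_\<Delta>A[OF A.module_axioms b2 that(2)] by (rule P_finsum_right) (use that in auto)
    also have "\<dots> = (\<Oplus>i\<in>IA. \<Oplus>k\<in>IB. \<tau> (lB k b) (lA i a) \<otimes> P (rB k b) (rA i a))"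
      by (intro K.finsum_cong') (use that in \<open>auto simp: P_mult_right PS \<tau>s intro!: K.finsum_closed K.finsum_cong'\<close>)
    finally show ?thesis by (simp add: form_source[OF that])
  qed
  have "weak_hopf_antipode K A \<Delta>A \<epsilon>A S"
    unfolding weak_hopf_antipode_def F_def[symmetric] G_def[symmetric]
  proof (intro conjI ballI Slin)
    fix a assume a: "a \<in> carrier A"
    show "tensor_lift (add_monoid A) (\<lambda>x y. x \<otimes>\<^bsub>A\<^esub> S y) (\<Delta>A a)
      = tensor_lift (add_monoid A) (\<lambda>u v. \<epsilon>A (u \<otimes>\<^bsub>A\<^esub> a) \<odot>\<^bsub>A\<^esub> v) (\<Delta>A \<one>\<^bsub>A\<^esub>)"
      unfolding lift_\<Delta>A[OF A.module_axioms b1 a] lift_\<Delta>A[OF A.module_axioms b3[OF a] A'.one_closed]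
    proof (rule P_eqI)
      fix b assume b: "b \<in> carrier B"
      have "P b (\<Oplus>\<^bsub>A\<^esub>i\<in>IA. lA i a \<otimes>\<^bsub>A\<^esub> S (rA i a)) = (\<Oplus>i\<in>IA. P b (lA i a \<otimes>\<^bsub>A\<^esub> S (rA i a)))"
        by (rule P_finsum_right) (use a b in auto)
      also have "\<dots> = (\<Oplus>i\<in>IA. \<Oplus>k\<in>IB. P (lB k b) (lA i a) \<otimes> \<tau> (rB k b) (rA i a))"
        by (intro K.finsum_cong') (use a b in \<open>auto simp: P_mult_right PS \<tau>s intro!: K.finsum_closed K.finsum_cong'\<close>)
      also have "\<dots> = (\<Oplus>i\<in>IA. \<epsilon>A (lA i \<one>\<^bsub>A\<^esub> \<otimes>\<^bsub>A\<^esub> a) \<otimes> P b (rA i \<one>\<^bsub>A\<^esub>))"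
        by (simp add: form_target[OF b a] et[OF b a])
      also have "\<dots> = P b (\<Oplus>\<^bsub>A\<^esub>i\<in>IA. \<epsilon>A (lA i \<one>\<^bsub>A\<^esub> \<otimes>\<^bsub>A\<^esub> a) \<odot>\<^bsub>A\<^esub> rA i \<one>\<^bsub>A\<^esub>)"
        by (subst P_finsum_right) (use a b in \<open>auto simp: P_smult_right \<epsilon>A_simps intro!: K.finsum_cong'\<close>)
      finally show "P b (\<Oplus>\<^bsub>A\<^esub>i\<in>IA. lA i a \<otimes>\<^bsub>A\<^esub> S (rA i a)) = \<dots>" .
    qed (use a in \<open>auto simp: \<epsilon>A_simps intro!: A.finsum_closed\<close>)
    show "G (\<Delta>A a) = tensor_lift (add_monoid A) (\<lambda>u v. \<epsilon>A (a \<otimes>\<^bsub>A\<^esub> v) \<odot>\<^bsub>A\<^esub> u) (\<Delta>A \<one>\<^bsub>A\<^esub>)"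
      unfolding lift_\<Delta>A[OF A.module_axioms b4[OF a] A'.one_closed]
    proof (rule P_eqI)
      fix b assume b: "b \<in> carrier B"
      have "(\<Oplus>i\<in>IA. \<epsilon>A (a \<otimes>\<^bsub>A\<^esub> rA i \<one>\<^bsub>A\<^esub>) \<otimes> P b (lA i \<one>\<^bsub>A\<^esub>))
        = P b (\<Oplus>\<^bsub>A\<^esub>i\<in>IA. \<epsilon>A (a \<otimes>\<^bsub>A\<^esub> rA i \<one>\<^bsub>A\<^esub>) \<odot>\<^bsub>A\<^esub> lA i \<one>\<^bsub>A\<^esub>)"
        by (subst P_finsum_right) (use a b in \<open>auto simp: P_smult_right \<epsilon>A_simps intro!: K.finsum_cong'\<close>)
      then show "P b (G (\<Delta>A a)) = P b (\<Oplus>\<^bsub>A\<^esub>i\<in>IA. \<epsilon>A (a \<otimes>\<^bsub>A\<^esub> rA i \<one>\<^bsub>A\<^esub>) \<odot>\<^bsub>A\<^esub> lA i \<one>\<^bsub>A\<^esub>)"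
        by (simp add: PG[OF b a] es[OF b a])
    qed (use a Gs in \<open>auto simp: \<epsilon>A_simps intro!: A.finsum_closed\<close>)
    have "tensor_lift (add_monoid A) (\<lambda>s z. F z s) (\<Delta>id (\<Delta>A a)) = (\<Oplus>\<^bsub>A\<^esub>i\<in>IA. G (\<Delta>A (lA i a)) \<otimes>\<^bsub>A\<^esub> S (rA i a))"
    proof -
      note lin = AAA'.lift_linear[OF A.module_axioms bFG]
      have "tensor_lift (add_monoid A) (\<lambda>s z. F z s) (\<Delta>id (\<Delta>A a))
          = (\<Oplus>\<^bsub>A\<^esub>i\<in>IA. tensor_lift (add_monoid A) (\<lambda>s z. F z s) (\<Delta>id (k_pure K A A (lA i a) (rA i a))))"
        by (rule linear_\<Delta>A[OF A.module_axioms k_linearI a])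
          (simp_all add: k_linearD[OF lin]
            k_linearD[OF \<Delta>id_linear])
      also have "\<dots> = (\<Oplus>\<^bsub>A\<^esub>i\<in>IA. G (\<Delta>A (lA i a)) \<otimes>\<^bsub>A\<^esub> S (rA i a))"
        by (rule A.finsum_cong') (use a Gs in \<open>simp_all add: \<Delta>id_pure AAA'.lift_k_pure[OF A.module_axioms bFG] FG\<close>)
      finally show ?thesis .
    qed
    also have "\<dots> = S a"
    proof (rule P_eqI)
      fix b assume b: "b \<in> carrier B"
      have "P b (\<Oplus>\<^bsub>A\<^esub>i\<in>IA. G (\<Delta>A (lA i a)) \<otimes>\<^bsub>A\<^esub> S (rA i a)) = (\<Oplus>i\<in>IA. P b (G (\<Delta>A (lA i a)) \<otimes>\<^bsub>A\<^esub> S (rA i a)))"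
        by (rule P_finsum_right) (use a b Gs in auto)
      also have "\<dots> = (\<Oplus>i\<in>IA. \<Oplus>k\<in>IB. es (lB k b) (lA i a) \<otimes> \<tau> (rB k b) (rA i a))"
        by (intro K.finsum_cong') (use a b Gs esc in \<open>auto simp: P_mult_right PS PG \<tau>s intro!: K.finsum_closed K.finsum_cong'\<close>)
      also have "\<dots> = P b (S a)" by (simp add: form_triple[OF b a] PS[OF b a])
      finally show "P b (\<Oplus>\<^bsub>A\<^esub>i\<in>IA. G (\<Delta>A (lA i a)) \<otimes>\<^bsub>A\<^esub> S (rA i a)) = P b (S a)" .
    qed (use a Gs in \<open>auto intro!: A.finsum_closed\<close>)
    finally show "tensor_lift (add_monoid A) (\<lambda>s z. F z s) (\<Delta>id (\<Delta>A a)) = S a" .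
  qed
  then show ?thesis by blast
qed


lemma weak_hopf: "weak_hopf_algebra K A \<Delta>A \<epsilon>A"
  unfolding weak_hopf_algebra_def Let_def
proof (intro conjI ballI)
  show "finite_dim K A" by (rule dual_basis_finite_dim[OF A.module_axioms dual_A])
  show "\<exists>S. weak_hopf_antipode K A \<Delta>A \<epsilon>A S" by (rule antipode)
  show "k_assoc K A (k_pure K A2 A (\<Delta>A \<one>\<^bsub>A\<^esub>) \<one>\<^bsub>A\<^esub>) \<otimes>\<^bsub>A3\<^esub>
      k_pure K A A2 \<one>\<^bsub>A\<^esub> (\<Delta>A \<one>\<^bsub>A\<^esub>) = k_assoc K A (\<Delta>id (\<Delta>A \<one>\<^bsub>A\<^esub>))"
    "k_pure K A A2 \<one>\<^bsub>A\<^esub> (\<Delta>A \<one>\<^bsub>A\<^esub>) \<otimes>\<^bsub>A3\<^esub>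
      k_assoc K A (k_pure K A2 A (\<Delta>A \<one>\<^bsub>A\<^esub>) \<one>\<^bsub>A\<^esub>) = k_assoc K A (\<Delta>id (\<Delta>A \<one>\<^bsub>A\<^esub>))"
    using weak_unit by simp_all
  fix a b assume ab: "a \<in> carrier A" "b \<in> carrier A"
  show "\<Delta>A (a \<otimes>\<^bsub>A\<^esub> b) = \<Delta>A a \<otimes>\<^bsub>A2\<^esub> \<Delta>A b"
    by (rule comult_mult[OF ab])
  fix c assume "c \<in> carrier A"
  with weak_counit[OF ab]
  show "\<epsilon>A (a \<otimes>\<^bsub>A\<^esub> b \<otimes>\<^bsub>A\<^esub> c) = tensor_lift (add_monoid K) (\<lambda>x y. \<epsilon>A (a \<otimes>\<^bsub>A\<^esub> x) \<otimes> \<epsilon>A (y \<otimes>\<^bsub>A\<^esub> c)) (\<Delta>A b)"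
    "\<epsilon>A (a \<otimes>\<^bsub>A\<^esub> b \<otimes>\<^bsub>A\<^esub> c) = tensor_lift (add_monoid K) (\<lambda>x y. \<epsilon>A (a \<otimes>\<^bsub>A\<^esub> y) \<otimes> \<epsilon>A (x \<otimes>\<^bsub>A\<^esub> c)) (\<Delta>A b)"
    by simp_all
qed (rule algA coalgebra)+

lemma P_zero_right: "b \<in> carrier B \<Longrightarrow> P b \<zero>\<^bsub>A\<^esub> = \<zero>"
  using P_smult_right[of b "\<zero>\<^bsub>A\<^esub>" "\<zero>"] by simp

lemma nondegenerate: "a \<in> carrier A \<Longrightarrow> (\<And>b. b \<in> carrier B \<Longrightarrow> P b a = \<zero>) \<Longrightarrow> a = \<zero>\<^bsub>A\<^esub>"
  by (rule P_eqI) (simp_all add: P_zero_right)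

lemma lift_form_PP:
  assumes "b \<in> carrier B" "c \<in> carrier B" "a \<in> carrier A"
  shows "P (b \<otimes>\<^bsub>B\<^esub> c) a = tensor_lift (add_monoid K) (\<lambda>x y. P b x \<otimes> P c y) (\<Delta>A a)"
  using PP_\<Delta>A[OF assms] by (simp add: PP_def)

text \<open>Compatibility is self-dual by \<open>finsum_contract4\<close>. For the projections, the
  counit of \<open>A\<close> inside \<open>et\<close> and \<open>es\<close> is split by the
  coproduct of the unit of \<open>B\<close>; regrouping leaves the counit of \<open>B\<close>, so
  the same forms serve both sides. The antipode identities only exchange the order of
  summation.\<close>

lemma swap_pairing:
  "weak_hopf_pairing K B A (\<lambda>a b. P b a) J v u IB lB rB \<Delta>B \<epsilon>B IA lA rA \<Delta>A \<epsilon>A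
    (\<lambda>a b. \<tau> b a) (\<lambda>a b. et b a) (\<lambda>a b. es b a)"
proof -
  interpret sw: dual_algebras K B A "\<lambda>a b. P b a" J v u IB lB rB \<Delta>B \<epsilon>B IA lA rA \<Delta>A \<epsilon>A by (rule swap)
  note \<tau>c = k_bilinear_closed[OF \<tau>, simplified]
  have esc: "es b a \<in> carrier K" if "b \<in> carrier B" "a \<in> carrier A" for b a
    unfolding es[OF that, symmetric] by (rule K.finsum_closed) (use that in \<open>auto simp: P_one_left[symmetric]\<close>)
  show ?thesis
  proof unfold_locales
    show "k_bilinear K A B (base_module K) (\<lambda>a b. \<tau> b a)" using \<tau> by (auto simp: k_bilinear_def)
    fix a a' b c assume a: "a \<in> carrier A" "a' \<in> carrier A" and b: "b \<in> carrier B" "c \<in> carrier B"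
    have "(\<Oplus>i\<in>IB. \<Oplus>j\<in>IB. P (lB i b \<otimes>\<^bsub>B\<^esub> lB j c) a \<otimes> P (rB i b \<otimes>\<^bsub>B\<^esub> rB j c) a')
      = (\<Oplus>k\<in>IB. \<Oplus>m\<in>IB. (\<Oplus>i\<in>IA. P (lB k b) (lA i a) \<otimes> P (lB m c) (rA i a)) \<otimes>
          (\<Oplus>j\<in>IA. P (rB k b) (lA j a') \<otimes> P (rB m c) (rA j a')))"
      by (intro K.finsum_cong') (use a b in \<open>auto simp: P_mult_left intro!: K.finsum_closed\<close>)
    also have "\<dots> = (\<Oplus>i\<in>IA. \<Oplus>j\<in>IA. (\<Oplus>k\<in>IB. P (lB k b) (lA i a) \<otimes> P (rB k b) (lA j a')) \<otimes>
          (\<Oplus>m\<in>IB. P (lB m c) (rA i a) \<otimes> P (rB m c) (rA j a')))"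
      by (rule K.finsum_contract4) (use a b finite_IA finite_IB in auto)
    also have "\<dots> = (\<Oplus>i\<in>IA. \<Oplus>j\<in>IA. P b (lA i a \<otimes>\<^bsub>A\<^esub> lA j a') \<otimes> P c (rA i a \<otimes>\<^bsub>A\<^esub> rA j a'))"
      by (intro K.finsum_cong') (use a b in \<open>auto simp: P_mult_right intro!: K.finsum_closed\<close>)
    finally show "(\<Oplus>i\<in>IB. \<Oplus>j\<in>IB. P (lB i b \<otimes>\<^bsub>B\<^esub> lB j c) a \<otimes> P (rB i b \<otimes>\<^bsub>B\<^esub> rB j c) a') = P (b \<otimes>\<^bsub>B\<^esub> c) (a \<otimes>\<^bsub>A\<^esub> a')"
      using mult_compat[OF b a] by simp
  next
    fix a b assume a: "a \<in> carrier A" and b: "b \<in> carrier B"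
    have "et b a = (\<Oplus>i\<in>IA. (\<Oplus>k\<in>IB. P (lB k \<one>\<^bsub>B\<^esub>) (lA i \<one>\<^bsub>A\<^esub>) \<otimes> P (rB k \<one>\<^bsub>B\<^esub>) a) \<otimes> P b (rA i \<one>\<^bsub>A\<^esub>))"
      unfolding et[OF b a, symmetric]
      by (intro K.finsum_cong') (use a b in \<open>auto simp: P_mult_right P_one_left[symmetric] intro!: K.finsum_closed\<close>)
    also have "\<dots> = (\<Oplus>k\<in>IB. (\<Oplus>i\<in>IA. P (lB k \<one>\<^bsub>B\<^esub>) (lA i \<one>\<^bsub>A\<^esub>) \<otimes> P b (rA i \<one>\<^bsub>A\<^esub>)) \<otimes> P (rB k \<one>\<^bsub>B\<^esub>) a)"
      by (rule K.finsum_interchange) (use a b finite_IA finite_IB in auto)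
    also have "\<dots> = (\<Oplus>k\<in>IB. \<epsilon>B (lB k \<one>\<^bsub>B\<^esub> \<otimes>\<^bsub>B\<^esub> b) \<otimes> P (rB k \<one>\<^bsub>B\<^esub>) a)"
      by (intro K.finsum_cong') (use a b in \<open>auto simp: P_mult_left P_one_right[symmetric] intro!: K.finsum_closed\<close>)
    finally show "(\<Oplus>k\<in>IB. \<epsilon>B (lB k \<one>\<^bsub>B\<^esub> \<otimes>\<^bsub>B\<^esub> b) \<otimes> P (rB k \<one>\<^bsub>B\<^esub>) a) = et b a" by simp
    have "es b a = (\<Oplus>i\<in>IA. (\<Oplus>k\<in>IB. P (rB k \<one>\<^bsub>B\<^esub>) (rA i \<one>\<^bsub>A\<^esub>) \<otimes> P (lB k \<one>\<^bsub>B\<^esub>) a) \<otimes> P b (lA i \<one>\<^bsub>A\<^esub>))"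
      unfolding es[OF b a, symmetric]
    proof (rule K.finsum_cong')
      fix i assume i: "i \<in> IA"
      have "P \<one>\<^bsub>B\<^esub> (a \<otimes>\<^bsub>A\<^esub> rA i \<one>\<^bsub>A\<^esub>) = (\<Oplus>k\<in>IB. P (rB k \<one>\<^bsub>B\<^esub>) (rA i \<one>\<^bsub>A\<^esub>) \<otimes> P (lB k \<one>\<^bsub>B\<^esub>) a)"
        unfolding P_mult_right[OF B'.one_closed a rA_closed[OF i A'.one_closed]]
        by (rule K.finsum_cong') (use a i in \<open>auto intro!: K.m_comm\<close>)
      then show "\<epsilon>A (a \<otimes>\<^bsub>A\<^esub> rA i \<one>\<^bsub>A\<^esub>) \<otimes> P b (lA i \<one>\<^bsub>A\<^esub>)
        = (\<Oplus>k\<in>IB. P (rB k \<one>\<^bsub>B\<^esub>) (rA i \<one>\<^bsub>A\<^esub>) \<otimes> P (lB k \<one>\<^bsub>B\<^esub>) a) \<otimes> P b (lA i \<one>\<^bsub>A\<^esub>)"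
        using a i by (simp add: P_one_left[symmetric])
    qed (use a b in \<open>auto intro!: K.finsum_closed\<close>)
    also have "\<dots> = (\<Oplus>k\<in>IB. (\<Oplus>i\<in>IA. P (rB k \<one>\<^bsub>B\<^esub>) (rA i \<one>\<^bsub>A\<^esub>) \<otimes> P b (lA i \<one>\<^bsub>A\<^esub>)) \<otimes> P (lB k \<one>\<^bsub>B\<^esub>) a)"
      by (rule K.finsum_interchange) (use a b finite_IA finite_IB in auto)
    also have "\<dots> = (\<Oplus>k\<in>IB. \<epsilon>B (b \<otimes>\<^bsub>B\<^esub> rB k \<one>\<^bsub>B\<^esub>) \<otimes> P (lB k \<one>\<^bsub>B\<^esub>) a)"
    proof (rule K.finsum_cong')
      fix k assume k: "k \<in> IB"
      have "(\<Oplus>i\<in>IA. P (rB k \<one>\<^bsub>B\<^esub>) (rA i \<one>\<^bsub>A\<^esub>) \<otimes> P b (lA i \<one>\<^bsub>A\<^esub>)) = P (b \<otimes>\<^bsub>B\<^esub> rB k \<one>\<^bsub>B\<^esub>) \<one>\<^bsub>A\<^esub>"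
        unfolding P_mult_left[OF b rB_closed[OF k B'.one_closed] A'.one_closed]
        by (rule K.finsum_cong') (use b k in \<open>auto intro!: K.m_comm\<close>)
      then show "(\<Oplus>i\<in>IA. P (rB k \<one>\<^bsub>B\<^esub>) (rA i \<one>\<^bsub>A\<^esub>) \<otimes> P b (lA i \<one>\<^bsub>A\<^esub>)) \<otimes> P (lB k \<one>\<^bsub>B\<^esub>) a
        = \<epsilon>B (b \<otimes>\<^bsub>B\<^esub> rB k \<one>\<^bsub>B\<^esub>) \<otimes> P (lB k \<one>\<^bsub>B\<^esub>) a"
        using b k by (simp add: P_one_right)
    qed (use a b in \<open>auto simp: P_one_right[symmetric]\<close>)
    finally show "(\<Oplus>k\<in>IB. \<epsilon>B (b \<otimes>\<^bsub>B\<^esub> rB k \<one>\<^bsub>B\<^esub>) \<otimes> P (lB k \<one>\<^bsub>B\<^esub>) a) = es b a" by simp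
    show "(\<Oplus>k\<in>IB. \<Oplus>i\<in>IA. P (lB k b) (lA i a) \<otimes> \<tau> (rB k b) (rA i a)) = et b a"
      unfolding form_target[OF b a, symmetric] by (rule K.finsum_swap) (use a b \<tau>c finite_IA finite_IB in auto)
    show "(\<Oplus>k\<in>IB. \<Oplus>i\<in>IA. \<tau> (lB k b) (lA i a) \<otimes> P (rB k b) (rA i a)) = es b a"
      unfolding form_source[OF b a, symmetric] by (rule K.finsum_swap) (use a b \<tau>c finite_IA finite_IB in auto)
    show "(\<Oplus>k\<in>IB. \<Oplus>i\<in>IA. es (lB k b) (lA i a) \<otimes> \<tau> (rB k b) (rA i a)) = \<tau> b a"
      unfolding form_triple[OF b a, symmetric] by (rule K.finsum_swap) (use a b \<tau>c esc finite_IA finite_IB in auto)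
  qed (rule counit_A1 counit_A2 counit_B1 counit_B2; assumption)+
qed

lemma weak_hopf_dual:
  "weak_hopf_algebra K A \<Delta>A \<epsilon>A \<and> weak_hopf_algebra K B \<Delta>B \<epsilon>B \<and> dual_wrt K B \<Delta>B \<epsilon>B A \<Delta>A \<epsilon>A P"
proof -
  interpret sw: weak_hopf_pairing K B A "\<lambda>a b. P b a" J v u IB lB rB \<Delta>B \<epsilon>B IA lA rA \<Delta>A \<epsilon>A
    "\<lambda>a b. \<tau> b a" "\<lambda>a b. et b a" "\<lambda>a b. es b a" by (rule swap_pairing)
  have "dual_wrt K B \<Delta>B \<epsilon>B A \<Delta>A \<epsilon>A P"
    unfolding dual_wrt_def
    using P_linear sw.P_linear nondegenerate sw.nondegenerate lift_form_PP sw.lift_form_PP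
    by (simp add: P_one_left P_one_right)
  then show ?thesis using weak_hopf sw.weak_hopf by blast
qed

end


section \<open>The bimodule \<open>M \<otimes>\<^sub>N M\<close> and the algebras \<open>A\<close> and \<open>B\<close>\<close>

locale algebra_extension = K: cring K + M?: ring M + Mm: module K M + N: ring N
  for K :: "('k, 'c) ring_scheme" and N :: "('k, 'n) module" and M :: "('k, 'm) module" (structure) +
  fixes \<iota> :: "'n \<Rightarrow> 'm"
  assumes algM: "k_algebra K M" and algN: "k_algebra K N" and \<iota>_hom: "k_algebra_hom K N M \<iota>"
begin

abbreviation "T \<equiv> MM N M \<iota>"
abbreviation "tn \<equiv> MM_pure N M \<iota>"
abbreviation "bal G \<equiv> balanced (add_monoid M) (add_monoid M) (carrier N) (\<lambda>x n. x \<otimes> \<iota> n) (\<lambda>n y. \<iota> n \<otimes> y) G"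
abbreviation "lm \<equiv> MM_left N M \<iota>"
abbreviation "rm \<equiv> MM_right N M \<iota>"
abbreviation "A \<equiv> A_alg N M \<iota>"
abbreviation "B \<equiv> B_alg N M \<iota>"
abbreviation "R \<equiv> centralizer N M \<iota>"
abbreviation "L \<equiv> tensor_lift (add_monoid M)"

lemma \<iota>_closed [simp]: "n \<in> carrier N \<Longrightarrow> \<iota> n \<in> carrier M"
  and \<iota>_one: "\<iota> \<one>\<^bsub>N\<^esub> = \<one>"
  and \<iota>_smult: "k \<in> carrier K \<Longrightarrow> n \<in> carrier N \<Longrightarrow> \<iota> (k \<odot>\<^bsub>N\<^esub> n) = k \<odot> \<iota> n"
  using \<iota>_hom unfolding k_algebra_hom_def k_linear_def by (auto simp: ring_hom_closed ring_hom_mult ring_hom_one)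

lemma smult_mult: "k \<in> carrier K \<Longrightarrow> x \<in> carrier M \<Longrightarrow> y \<in> carrier M \<Longrightarrow> (k \<odot> x) \<otimes> y = k \<odot> (x \<otimes> y)"
  and mult_smult: "k \<in> carrier K \<Longrightarrow> x \<in> carrier M \<Longrightarrow> y \<in> carrier M \<Longrightarrow> x \<otimes> (k \<odot> y) = k \<odot> (x \<otimes> y)"
  using algM by (auto simp: k_algebra_def)

lemma smult_N_closed: "k \<in> carrier K \<Longrightarrow> k \<odot>\<^bsub>N\<^esub> \<one>\<^bsub>N\<^esub> \<in> carrier N"
proof -
  interpret Nm: module K N using algN by (simp add: k_algebra_def)
  show "k \<in> carrier K \<Longrightarrow> k \<odot>\<^bsub>N\<^esub> \<one>\<^bsub>N\<^esub> \<in> carrier N" by simp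
qed

text \<open>A scalar \<open>k\<close> acts as the image of \<open>k\<close> times the unit of
  \<open>N\<close>. Hence maps that are linear or balanced over \<open>N\<close> are so over
  \<open>K\<close>, as used in \<open>tn_smult\<close> and \<open>A_smult\<close>.\<close>

lemma sc_mult: "k \<in> carrier K \<Longrightarrow> x \<in> carrier M \<Longrightarrow> \<iota> (k \<odot>\<^bsub>N\<^esub> \<one>\<^bsub>N\<^esub>) \<otimes> x = k \<odot> x"
  and mult_sc: "k \<in> carrier K \<Longrightarrow> x \<in> carrier M \<Longrightarrow> x \<otimes> \<iota> (k \<odot>\<^bsub>N\<^esub> \<one>\<^bsub>N\<^esub>) = k \<odot> x"
  by (simp_all add: \<iota>_smult \<iota>_one smult_mult mult_smult)

sublocale TP: tensor_product "add_monoid M" "add_monoid M" "carrier N" "\<lambda>x n. x \<otimes> \<iota> n" "\<lambda>n y. \<iota> n \<otimes> y"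
  rewrites "tensor_group (add_monoid M) (add_monoid M) (carrier N) (\<lambda>x n. x \<otimes> \<iota> n) (\<lambda>n y. \<iota> n \<otimes> y) = T"
    and "tensor_pure (add_monoid M) (add_monoid M) (carrier N) (\<lambda>x n. x \<otimes> \<iota> n) (\<lambda>n y. \<iota> n \<otimes> y) = tn"
    and "carrier (add_monoid M) = carrier M" and "mult (add_monoid M) = add M"
  by unfold_locales (auto simp: MM_def MM_pure_def)

sublocale T: comm_group T by (rule TP.comm_group_T)

lemma tn_closed [simp]: "x \<in> carrier M \<Longrightarrow> y \<in> carrier M \<Longrightarrow> tn x y \<in> carrier T" by (rule TP.pure_closed)

lemmas tn_add = TP.pure_mult_left TP.pure_mult_right

lemma tn_N: "x \<in> carrier M \<Longrightarrow> y \<in> carrier M \<Longrightarrow> n \<in> carrier N \<Longrightarrow> tn (x \<otimes> \<iota> n) y = tn x (\<iota> n \<otimes> y)"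
  by (rule TP.pure_act)

lemma tn_smult: "x \<in> carrier M \<Longrightarrow> y \<in> carrier M \<Longrightarrow> k \<in> carrier K \<Longrightarrow> tn x (k \<odot> y) = tn (k \<odot> x) y"
  using tn_N[of x y "k \<odot>\<^bsub>N\<^esub> \<one>\<^bsub>N\<^esub>"] by (simp add: smult_N_closed sc_mult mult_sc)

lemma balI:
  assumes "\<And>x y. x \<in> carrier M \<Longrightarrow> y \<in> carrier M \<Longrightarrow> g x y \<in> carrier G"
    and "\<And>x x' y. x \<in> carrier M \<Longrightarrow> x' \<in> carrier M \<Longrightarrow> y \<in> carrier M \<Longrightarrow> g (x \<oplus> x') y = g x y \<otimes>\<^bsub>G\<^esub> g x' y"
    and "\<And>x y y'. x \<in> carrier M \<Longrightarrow> y \<in> carrier M \<Longrightarrow> y' \<in> carrier M \<Longrightarrow> g x (y \<oplus> y') = g x y \<otimes>\<^bsub>G\<^esub> g x y'"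
    and "\<And>x n y. x \<in> carrier M \<Longrightarrow> n \<in> carrier N \<Longrightarrow> y \<in> carrier M \<Longrightarrow> g (x \<otimes> \<iota> n) y = g x (\<iota> n \<otimes> y)"
  shows "bal G g"
  by (rule balancedI) (use assms in simp_all)

lemma
  assumes "comm_group G" "bal G g"
  shows lift_closed: "t \<in> carrier T \<Longrightarrow> tensor_lift G g t \<in> carrier G"
    and lift_mult: "s \<in> carrier T \<Longrightarrow> t \<in> carrier T \<Longrightarrow> tensor_lift G g (s \<otimes>\<^bsub>T\<^esub> t) = tensor_lift G g s \<otimes>\<^bsub>G\<^esub> tensor_lift G g t"
    and lift_tn: "x \<in> carrier M \<Longrightarrow> y \<in> carrier M \<Longrightarrow> tensor_lift G g (tn x y) = g x y"
  using TP.lift_hom[OF assms] hom_in_carrier[OF TP.lift_hom[OF assms]] hom_mult[OF TP.lift_hom[OF assms]]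
    TP.lift_pure[OF assms] by simp_all

lemma
  assumes "bal (add_monoid M) g"
  shows L_closed: "t \<in> carrier T \<Longrightarrow> L g t \<in> carrier M"
    and L_add: "s \<in> carrier T \<Longrightarrow> t \<in> carrier T \<Longrightarrow> L g (s \<otimes>\<^bsub>T\<^esub> t) = L g s \<oplus> L g t"
    and L_tn: "x \<in> carrier M \<Longrightarrow> y \<in> carrier M \<Longrightarrow> L g (tn x y) = g x y"
  using lift_closed[OF M.a_comm_group assms] lift_mult[OF M.a_comm_group assms] lift_tn[OF M.a_comm_group assms]
    by simp_all

lemmas L_rules = L_closed L_add L_tn

lemmas LT = lift_closed[OF T.comm_group_axioms] lift_mult[OF T.comm_group_axioms] lift_tn[OF T.comm_group_axioms]

lemma T_eqI_gen:
  assumes "comm_group G" "t \<in> carrier T"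
    and "\<And>x y. x \<in> carrier M \<Longrightarrow> y \<in> carrier M \<Longrightarrow> h (tn x y) = h' (tn x y)"
    and "\<And>t. t \<in> carrier T \<Longrightarrow> h t \<in> carrier G" "\<And>t. t \<in> carrier T \<Longrightarrow> h' t \<in> carrier G"
    and "\<And>s t. s \<in> carrier T \<Longrightarrow> t \<in> carrier T \<Longrightarrow> h (s \<otimes>\<^bsub>T\<^esub> t) = h s \<otimes>\<^bsub>G\<^esub> h t"
    and "\<And>s t. s \<in> carrier T \<Longrightarrow> t \<in> carrier T \<Longrightarrow> h' (s \<otimes>\<^bsub>T\<^esub> t) = h' s \<otimes>\<^bsub>G\<^esub> h' t"
  shows "h t = h' t"
  by (rule TP.hom_eqI[OF assms(1)]) (use assms in \<open>simp_all add: hom_def\<close>)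

lemmas T_eqI = T_eqI_gen[OF T.comm_group_axioms]

lemma M_eqI:
  assumes "t \<in> carrier T"
    and "\<And>x y. x \<in> carrier M \<Longrightarrow> y \<in> carrier M \<Longrightarrow> h (tn x y) = h' (tn x y)"
    and "\<And>t. t \<in> carrier T \<Longrightarrow> h t \<in> carrier M" "\<And>t. t \<in> carrier T \<Longrightarrow> h' t \<in> carrier M"
    and "\<And>s t. s \<in> carrier T \<Longrightarrow> t \<in> carrier T \<Longrightarrow> h (s \<otimes>\<^bsub>T\<^esub> t) = h s \<oplus> h t"
    and "\<And>s t. s \<in> carrier T \<Longrightarrow> t \<in> carrier T \<Longrightarrow> h' (s \<otimes>\<^bsub>T\<^esub> t) = h' s \<oplus> h' t"
  shows "h t = h' t"
  by (rule T_eqI_gen[OF M.a_comm_group]) (use assms in simp_all)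

lemma bal_lm: "m \<in> carrier M \<Longrightarrow> bal T (\<lambda>x y. tn (m \<otimes> x) y)"
  and bal_rm: "m \<in> carrier M \<Longrightarrow> bal T (\<lambda>x y. tn x (y \<otimes> m))"
  and bal_smult: "k \<in> carrier K \<Longrightarrow> bal T (\<lambda>x y. tn (k \<odot> x) y)"
  by (rule balI; simp add: tn_add r_distr l_distr Mm.smult_r_distr m_assoc[symmetric] smult_mult[symmetric] tn_N;
      simp add: m_assoc tn_N)+

lemma lm_closed [simp]: "m \<in> carrier M \<Longrightarrow> t \<in> carrier T \<Longrightarrow> lm m t \<in> carrier T"
  and lm_add: "m \<in> carrier M \<Longrightarrow> s \<in> carrier T \<Longrightarrow> t \<in> carrier T \<Longrightarrow> lm m (s \<otimes>\<^bsub>T\<^esub> t) = lm m s \<otimes>\<^bsub>T\<^esub> lm m t"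
  and lm_tn: "m \<in> carrier M \<Longrightarrow> x \<in> carrier M \<Longrightarrow> y \<in> carrier M \<Longrightarrow> lm m (tn x y) = tn (m \<otimes> x) y"
  and rm_closed [simp]: "m \<in> carrier M \<Longrightarrow> t \<in> carrier T \<Longrightarrow> rm t m \<in> carrier T"
  and rm_add: "m \<in> carrier M \<Longrightarrow> s \<in> carrier T \<Longrightarrow> t \<in> carrier T \<Longrightarrow> rm (s \<otimes>\<^bsub>T\<^esub> t) m = rm s m \<otimes>\<^bsub>T\<^esub> rm t m"
  and rm_tn: "m \<in> carrier M \<Longrightarrow> x \<in> carrier M \<Longrightarrow> y \<in> carrier M \<Longrightarrow> rm (tn x y) m = tn x (y \<otimes> m)"
  using LT[OF bal_lm] LT[OF bal_rm] by (simp_all add: MM_left_def MM_right_def)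

lemma smult_B: "k \<odot>\<^bsub>B\<^esub> t = tensor_lift T (\<lambda>x y. tn (k \<odot> x) y) t"
  by (simp add: B_alg_def)

lemma sm_closed [simp]: "k \<in> carrier K \<Longrightarrow> t \<in> carrier T \<Longrightarrow> k \<odot>\<^bsub>B\<^esub> t \<in> carrier T"
  and sm_add: "k \<in> carrier K \<Longrightarrow> s \<in> carrier T \<Longrightarrow> t \<in> carrier T \<Longrightarrow> k \<odot>\<^bsub>B\<^esub> (s \<otimes>\<^bsub>T\<^esub> t) = (k \<odot>\<^bsub>B\<^esub> s) \<otimes>\<^bsub>T\<^esub> (k \<odot>\<^bsub>B\<^esub> t)"
  and sm_tn: "k \<in> carrier K \<Longrightarrow> x \<in> carrier M \<Longrightarrow> y \<in> carrier M \<Longrightarrow> k \<odot>\<^bsub>B\<^esub> tn x y = tn (k \<odot> x) y"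
  using LT[OF bal_smult] by (simp_all add: smult_B)

lemmas T_rules = lm_add rm_add sm_add lm_tn rm_tn sm_tn T.m_ac

lemma lm_lm: "m \<in> carrier M \<Longrightarrow> m' \<in> carrier M \<Longrightarrow> t \<in> carrier T \<Longrightarrow> lm m (lm m' t) = lm (m \<otimes> m') t"
  by (erule T_eqI) (simp_all add: T_rules m_assoc)

lemma rm_rm: "m \<in> carrier M \<Longrightarrow> m' \<in> carrier M \<Longrightarrow> t \<in> carrier T \<Longrightarrow> rm (rm t m) m' = rm t (m \<otimes> m')"
  by (erule T_eqI) (simp_all add: T_rules m_assoc)

lemma lm_rm: "m \<in> carrier M \<Longrightarrow> m' \<in> carrier M \<Longrightarrow> t \<in> carrier T \<Longrightarrow> rm (lm m t) m' = lm m (rm t m')"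
  by (erule T_eqI) (simp_all add: T_rules)

lemma lm_plus: "m \<in> carrier M \<Longrightarrow> m' \<in> carrier M \<Longrightarrow> t \<in> carrier T \<Longrightarrow> lm (m \<oplus> m') t = lm m t \<otimes>\<^bsub>T\<^esub> lm m' t"
  by (erule T_eqI) (simp_all add: T_rules l_distr tn_add)

lemma rm_plus: "m \<in> carrier M \<Longrightarrow> m' \<in> carrier M \<Longrightarrow> t \<in> carrier T \<Longrightarrow> rm t (m \<oplus> m') = rm t m \<otimes>\<^bsub>T\<^esub> rm t m'"
  by (erule T_eqI) (simp_all add: T_rules r_distr tn_add)

lemma lm_one: "t \<in> carrier T \<Longrightarrow> lm \<one> t = t" and rm_one: "t \<in> carrier T \<Longrightarrow> rm t \<one> = t"
  by (erule T_eqI; simp add: T_rules)+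

lemma lm_smult: "k \<in> carrier K \<Longrightarrow> m \<in> carrier M \<Longrightarrow> t \<in> carrier T \<Longrightarrow> lm (k \<odot> m) t = k \<odot>\<^bsub>B\<^esub> lm m t"
  by (erule T_eqI) (simp_all add: T_rules smult_mult)

lemma rm_smult: "k \<in> carrier K \<Longrightarrow> m \<in> carrier M \<Longrightarrow> t \<in> carrier T \<Longrightarrow> rm t (k \<odot> m) = k \<odot>\<^bsub>B\<^esub> rm t m"
  by (erule T_eqI) (simp_all add: T_rules mult_smult tn_smult)

lemma lm_sm: "k \<in> carrier K \<Longrightarrow> m \<in> carrier M \<Longrightarrow> t \<in> carrier T \<Longrightarrow> lm m (k \<odot>\<^bsub>B\<^esub> t) = k \<odot>\<^bsub>B\<^esub> lm m t"
  by (erule T_eqI) (simp_all add: T_rules mult_smult)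

lemma rm_sm: "k \<in> carrier K \<Longrightarrow> m \<in> carrier M \<Longrightarrow> t \<in> carrier T \<Longrightarrow> rm (k \<odot>\<^bsub>B\<^esub> t) m = k \<odot>\<^bsub>B\<^esub> rm t m"
  by (erule T_eqI) (simp_all add: T_rules)

lemma B_simps: "carrier B = {b \<in> carrier T. \<forall>n \<in> carrier N. lm (\<iota> n) b = rm b (\<iota> n)}"
  "one B = tn \<one> \<one>" "zero B = \<one>\<^bsub>T\<^esub>" "add B = mult T"
  by (simp_all add: B_alg_def)

lemma B_T: "b \<in> carrier B \<Longrightarrow> b \<in> carrier T"
  and B_comm: "b \<in> carrier B \<Longrightarrow> n \<in> carrier N \<Longrightarrow> lm (\<iota> n) b = rm b (\<iota> n)"
  by (auto simp: B_simps)

lemma B_I: "t \<in> carrier T \<Longrightarrow> (\<And>n. n \<in> carrier N \<Longrightarrow> lm (\<iota> n) t = rm t (\<iota> n)) \<Longrightarrow> t \<in> carrier B"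
  by (auto simp: B_simps)

lemma one_B: "tn \<one> \<one> \<in> carrier B"
  using tn_N[of \<one> \<one>] by (intro B_I) (simp_all add: T_rules)

lemma B_abelian_group: "abelian_group B"
proof (rule abelian_groupI)
  fix x assume x: "x \<in> carrier B"
  have "inv\<^bsub>T\<^esub> x \<in> carrier B"
  proof (rule B_I)
    fix n assume n: "n \<in> carrier N"
    interpret l: group_hom T T "lm (\<iota> n)"
      by unfold_locales (use n in \<open>auto simp: hom_def lm_add\<close>)
    interpret r: group_hom T T "\<lambda>t. rm t (\<iota> n)"
      by unfold_locales (use n in \<open>auto simp: hom_def rm_add\<close>)
    show "lm (\<iota> n) (inv\<^bsub>T\<^esub> x) = rm (inv\<^bsub>T\<^esub> x) (\<iota> n)" using x n by (simp add: B_T B_comm)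
  qed (simp add: B_T x)
  moreover have "inv\<^bsub>T\<^esub> x \<otimes>\<^bsub>T\<^esub> x = \<one>\<^bsub>T\<^esub>" using x by (simp add: B_T)
  ultimately show "\<exists>y\<in>carrier B. y \<oplus>\<^bsub>B\<^esub> x = \<zero>\<^bsub>B\<^esub>" by (auto simp: B_simps(3,4))
next
  show "\<zero>\<^bsub>B\<^esub> \<in> carrier B" unfolding B_simps(3)
  proof (rule B_I)
    fix n assume n: "n \<in> carrier N"
    interpret l: group_hom T T "lm (\<iota> n)"
      by unfold_locales (use n in \<open>auto simp: hom_def lm_add\<close>)
    interpret r: group_hom T T "\<lambda>t. rm t (\<iota> n)"
      by unfold_locales (use n in \<open>auto simp: hom_def rm_add\<close>)
    show "lm (\<iota> n) \<one>\<^bsub>T\<^esub> = rm \<one>\<^bsub>T\<^esub> (\<iota> n)" by simp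
  qed simp
qed (auto simp: B_simps T_rules)

sublocale B: abelian_group B by (rule B_abelian_group)

lemma B_module: "module K B"
proof (rule moduleI)
  show "abelian_group B" by (rule B_abelian_group)
  show "k \<odot>\<^bsub>B\<^esub> x \<in> carrier B" if "k \<in> carrier K" "x \<in> carrier B" for k x
    using that by (intro B_I) (simp_all add: B_T lm_sm rm_sm B_comm)
  show "(k \<oplus>\<^bsub>K\<^esub> k') \<odot>\<^bsub>B\<^esub> x = k \<odot>\<^bsub>B\<^esub> x \<oplus>\<^bsub>B\<^esub> k' \<odot>\<^bsub>B\<^esub> x"
    if "k \<in> carrier K" "k' \<in> carrier K" "x \<in> carrier B" for k k' x
    unfolding B_simps(4)
    by (rule T_eqI[OF B_T[OF that(3)]]) (use that in \<open>simp_all add: T_rules Mm.smult_l_distr tn_add\<close>)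
  show "(k \<otimes>\<^bsub>K\<^esub> k') \<odot>\<^bsub>B\<^esub> x = k \<odot>\<^bsub>B\<^esub> (k' \<odot>\<^bsub>B\<^esub> x)"
    if "k \<in> carrier K" "k' \<in> carrier K" "x \<in> carrier B" for k k' x
    by (rule T_eqI[OF B_T[OF that(3)]]) (use that in \<open>simp_all add: T_rules Mm.smult_assoc1\<close>)
  show "\<one>\<^bsub>K\<^esub> \<odot>\<^bsub>B\<^esub> x = x" if "x \<in> carrier B" for x
    by (rule T_eqI[OF B_T[OF that]]) (simp_all add: T_rules)
qed (simp_all add: K.is_cring B_simps(4) sm_add B_T)

text \<open>An element of \<open>N\<close> passes from one side to the other through
  \<open>b\<close>; this is possible precisely because \<open>b\<close> commutes with
  \<open>N\<close>.\<close>

lemma bal_sand: "b \<in> carrier B \<Longrightarrow> bal T (\<lambda>x y. lm x (rm b y))"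
proof (rule balI)
  fix x n y assume *: "x \<in> carrier M" "n \<in> carrier N" "y \<in> carrier M" "b \<in> carrier B"
  then have "lm (x \<otimes> \<iota> n) (rm b y) = lm x (rm (lm (\<iota> n) b) y)"
    by (simp add: lm_lm[symmetric] lm_rm B_T)
  then show "lm (x \<otimes> \<iota> n) (rm b y) = lm x (rm b (\<iota> n \<otimes> y))"
    using * by (simp add: B_comm rm_rm B_T)
qed (simp_all add: B_T lm_plus rm_plus lm_add)

text \<open>The inner lift of the definition sandwiches \<open>b\<close> between \<open>x'\<close>
  and \<open>y'\<close>. In this form \<open>c\<close> may be any tensor: \<open>b\<close> acts on
  the whole of \<open>T\<close> by x \<otimes> y \<mapsto> x b y, an endomorphism of
  \<open>M\<close>-\<open>M\<close>-bimodules.\<close>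

lemma mult_B: "b \<in> carrier B \<Longrightarrow> c \<in> carrier T \<Longrightarrow> b \<otimes>\<^bsub>B\<^esub> c = tensor_lift T (\<lambda>x y. lm x (rm b y)) c"
proof -
  assume b: "b \<in> carrier B" and c: "c \<in> carrier T"
  have bl: "bal T (\<lambda>x y. tn (x' \<otimes> x) (y \<otimes> y'))" if "x' \<in> carrier M" "y' \<in> carrier M" for x' y'
  proof (rule balI)
    fix x n y assume "x \<in> carrier M" "n \<in> carrier N" "y \<in> carrier M"
    then show "tn (x' \<otimes> (x \<otimes> \<iota> n)) (y \<otimes> y') = tn (x' \<otimes> x) (\<iota> n \<otimes> y \<otimes> y')"
      using that tn_N[of "x' \<otimes> x" "y \<otimes> y'" n] by (simp add: m_assoc)
  qed (use that in \<open>simp_all add: tn_add r_distr l_distr\<close>)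
  have e: "tensor_lift T (\<lambda>x y. tn (x' \<otimes> x) (y \<otimes> y')) b = lm x' (rm b y')"
    if "x' \<in> carrier M" "y' \<in> carrier M" for x' y'
    by (rule T_eqI[OF B_T[OF b]]) (use that in \<open>simp_all add: LT[OF bl] T_rules\<close>)
  have bl2: "bal T (\<lambda>x' y'. tensor_lift T (\<lambda>x y. tn (x' \<otimes> x) (y \<otimes> y')) b)"
    using bal_sand[OF b] unfolding balanced_def by (simp add: e)
  have "b \<otimes>\<^bsub>B\<^esub> c = tensor_lift T (\<lambda>x' y'. tensor_lift T (\<lambda>x y. tn (x' \<otimes> x) (y \<otimes> y')) b) c"
    by (simp add: B_alg_def)
  also have "\<dots> = tensor_lift T (\<lambda>x y. lm x (rm b y)) c"
    by (rule T_eqI[OF c]) (simp_all add: LT[OF bl2] LT[OF bal_sand[OF b]] e)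
  finally show ?thesis .
qed

lemma multB_closed: "b \<in> carrier B \<Longrightarrow> c \<in> carrier T \<Longrightarrow> b \<otimes>\<^bsub>B\<^esub> c \<in> carrier T"
  and multB_add: "b \<in> carrier B \<Longrightarrow> c \<in> carrier T \<Longrightarrow> d \<in> carrier T \<Longrightarrow> b \<otimes>\<^bsub>B\<^esub> (c \<otimes>\<^bsub>T\<^esub> d) = (b \<otimes>\<^bsub>B\<^esub> c) \<otimes>\<^bsub>T\<^esub> (b \<otimes>\<^bsub>B\<^esub> d)"
  and multB_tn: "b \<in> carrier B \<Longrightarrow> x \<in> carrier M \<Longrightarrow> y \<in> carrier M \<Longrightarrow> b \<otimes>\<^bsub>B\<^esub> tn x y = lm x (rm b y)"
  using LT[OF bal_sand] by (simp_all add: mult_B)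

lemmas multB = multB_closed multB_add multB_tn

lemma lm_multB: "b \<in> carrier B \<Longrightarrow> c \<in> carrier T \<Longrightarrow> x \<in> carrier M \<Longrightarrow> lm x (b \<otimes>\<^bsub>B\<^esub> c) = b \<otimes>\<^bsub>B\<^esub> lm x c"
  by (rule T_eqI[of c]) (simp_all add: multB T_rules lm_lm B_T)

lemma rm_multB: "b \<in> carrier B \<Longrightarrow> c \<in> carrier T \<Longrightarrow> x \<in> carrier M \<Longrightarrow> rm (b \<otimes>\<^bsub>B\<^esub> c) x = b \<otimes>\<^bsub>B\<^esub> rm c x"
  by (rule T_eqI[of c]) (simp_all add: multB T_rules lm_rm rm_rm B_T)

lemma mult_B_closed [simp]: "b \<in> carrier B \<Longrightarrow> c \<in> carrier B \<Longrightarrow> b \<otimes>\<^bsub>B\<^esub> c \<in> carrier B"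
  by (rule B_I) (simp_all add: multB_closed B_T lm_multB rm_multB B_comm)

text \<open>The product of \<open>B\<close> is composition of the induced bimodule endomorphisms of
  \<open>T\<close>. This is why \<open>d\<close> ranges over \<open>T\<close>, where pure tensors
  are available for testing.\<close>

lemma multB_assoc:
  assumes "b \<in> carrier B" "c \<in> carrier B" "d \<in> carrier T"
  shows "b \<otimes>\<^bsub>B\<^esub> c \<otimes>\<^bsub>B\<^esub> d = b \<otimes>\<^bsub>B\<^esub> (c \<otimes>\<^bsub>B\<^esub> d)"
  by (rule T_eqI[OF assms(3)]) (use assms in \<open>simp_all add: multB B_T lm_multB rm_multB\<close>)

lemma B_algebra: "k_algebra K B"
proof -
  have "ring B"
  proof (rule ringI)
    show "monoid B"
    proof (rule monoidI)
      fix x assume x: "x \<in> carrier B"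
      show "\<one>\<^bsub>B\<^esub> \<otimes>\<^bsub>B\<^esub> x = x" unfolding B_simps(2)
        by (rule T_eqI[OF B_T[OF x]]) (simp_all add: multB one_B T_rules)
      show "x \<otimes>\<^bsub>B\<^esub> \<one>\<^bsub>B\<^esub> = x" unfolding B_simps(2) using x by (simp add: multB B_T lm_one rm_one)
    qed (simp_all add: B_simps(2) one_B multB_assoc B_T)
    fix x y z assume x: "x \<in> carrier B" and y: "y \<in> carrier B" and z: "z \<in> carrier B"
    show "(x \<oplus>\<^bsub>B\<^esub> y) \<otimes>\<^bsub>B\<^esub> z = x \<otimes>\<^bsub>B\<^esub> z \<oplus>\<^bsub>B\<^esub> y \<otimes>\<^bsub>B\<^esub> z"
      unfolding B_simps(4)
      by (rule T_eqI[OF B_T[OF z]])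
        (use B.a_closed[OF x y] x y in \<open>simp_all add: B_simps(4) multB lm_add rm_add B_T T.m_ac\<close>)
    show "z \<otimes>\<^bsub>B\<^esub> (x \<oplus>\<^bsub>B\<^esub> y) = z \<otimes>\<^bsub>B\<^esub> x \<oplus>\<^bsub>B\<^esub> z \<otimes>\<^bsub>B\<^esub> y"
      unfolding B_simps(4) using x y z by (simp add: multB B_T)
  qed (rule B_abelian_group)
  moreover have "(k \<odot>\<^bsub>B\<^esub> x) \<otimes>\<^bsub>B\<^esub> y = k \<odot>\<^bsub>B\<^esub> (x \<otimes>\<^bsub>B\<^esub> y)" "x \<otimes>\<^bsub>B\<^esub> (k \<odot>\<^bsub>B\<^esub> y) = k \<odot>\<^bsub>B\<^esub> (x \<otimes>\<^bsub>B\<^esub> y)"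
    if "k \<in> carrier K" and x: "x \<in> carrier B" and y: "y \<in> carrier B" for k x y
  proof -
    have kx: "k \<odot>\<^bsub>B\<^esub> x \<in> carrier B" using B_module that by (simp add: module.smult_closed)
    show "(k \<odot>\<^bsub>B\<^esub> x) \<otimes>\<^bsub>B\<^esub> y = k \<odot>\<^bsub>B\<^esub> (x \<otimes>\<^bsub>B\<^esub> y)"
      by (rule T_eqI[OF B_T[OF y]]) (use that kx in \<open>simp_all add: multB B_T lm_sm rm_sm sm_add\<close>)
    show "x \<otimes>\<^bsub>B\<^esub> (k \<odot>\<^bsub>B\<^esub> y) = k \<odot>\<^bsub>B\<^esub> (x \<otimes>\<^bsub>B\<^esub> y)"
      by (rule T_eqI[OF B_T[OF y]]) (use that in \<open>simp_all add: multB B_T lm_smult sm_add sm_tn\<close>)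
  qed
  ultimately show ?thesis using B_module by (simp add: k_algebra_def)
qed

lemma A_simps: "carrier A = {\<alpha> \<in> extensional (carrier M).
    (\<forall>x \<in> carrier M. \<alpha> x \<in> carrier M) \<and> (\<forall>x \<in> carrier M. \<forall>y \<in> carrier M. \<alpha> (x \<oplus> y) = \<alpha> x \<oplus> \<alpha> y) \<and>
    (\<forall>n \<in> carrier N. \<forall>x \<in> carrier M. \<alpha> (\<iota> n \<otimes> x) = \<iota> n \<otimes> \<alpha> x) \<and>
    (\<forall>n \<in> carrier N. \<forall>x \<in> carrier M. \<alpha> (x \<otimes> \<iota> n) = \<alpha> x \<otimes> \<iota> n)}"
  "\<alpha> \<otimes>\<^bsub>A\<^esub> \<alpha>' = compose (carrier M) \<alpha> \<alpha>'"
  "\<one>\<^bsub>A\<^esub> = (\<lambda>m\<in>carrier M. m)" "\<zero>\<^bsub>A\<^esub> = (\<lambda>m\<in>carrier M. \<zero>)"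
  "\<alpha> \<oplus>\<^bsub>A\<^esub> \<alpha>' = (\<lambda>m\<in>carrier M. \<alpha> m \<oplus> \<alpha>' m)" "k \<odot>\<^bsub>A\<^esub> \<alpha> = (\<lambda>m\<in>carrier M. k \<odot> \<alpha> m)"
  by (auto simp: A_alg_def bimod_hom_def hom_def Pi_iff)

lemma
  assumes "\<alpha> \<in> carrier A"
  shows A_closed [simp]: "x \<in> carrier M \<Longrightarrow> \<alpha> x \<in> carrier M"
    and A_add: "x \<in> carrier M \<Longrightarrow> y \<in> carrier M \<Longrightarrow> \<alpha> (x \<oplus> y) = \<alpha> x \<oplus> \<alpha> y"
    and A_left: "n \<in> carrier N \<Longrightarrow> x \<in> carrier M \<Longrightarrow> \<alpha> (\<iota> n \<otimes> x) = \<iota> n \<otimes> \<alpha> x"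
    and A_right: "n \<in> carrier N \<Longrightarrow> x \<in> carrier M \<Longrightarrow> \<alpha> (x \<otimes> \<iota> n) = \<alpha> x \<otimes> \<iota> n"
    and A_smult: "k \<in> carrier K \<Longrightarrow> x \<in> carrier M \<Longrightarrow> \<alpha> (k \<odot> x) = k \<odot> \<alpha> x"
proof -
  show "x \<in> carrier M \<Longrightarrow> \<alpha> x \<in> carrier M"
    "x \<in> carrier M \<Longrightarrow> y \<in> carrier M \<Longrightarrow> \<alpha> (x \<oplus> y) = \<alpha> x \<oplus> \<alpha> y"
    "n \<in> carrier N \<Longrightarrow> x \<in> carrier M \<Longrightarrow> \<alpha> (x \<otimes> \<iota> n) = \<alpha> x \<otimes> \<iota> n"
    and *: "n \<in> carrier N \<Longrightarrow> x \<in> carrier M \<Longrightarrow> \<alpha> (\<iota> n \<otimes> x) = \<iota> n \<otimes> \<alpha> x" for n x y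
    using assms by (auto simp: A_simps(1))
  show "k \<in> carrier K \<Longrightarrow> x \<in> carrier M \<Longrightarrow> \<alpha> (k \<odot> x) = k \<odot> \<alpha> x"
    using *[of "k \<odot>\<^bsub>N\<^esub> \<one>\<^bsub>N\<^esub>" x] assms by (simp add: smult_N_closed sc_mult A_simps(1))
qed

lemmas A_rules = A_add A_left A_right A_smult

lemma A_I:
  assumes "\<And>x. x \<in> carrier M \<Longrightarrow> g x \<in> carrier M"
    and "\<And>x y. x \<in> carrier M \<Longrightarrow> y \<in> carrier M \<Longrightarrow> g (x \<oplus> y) = g x \<oplus> g y"
    and "\<And>n x. n \<in> carrier N \<Longrightarrow> x \<in> carrier M \<Longrightarrow> g (\<iota> n \<otimes> x) = \<iota> n \<otimes> g x"
    and "\<And>n x. n \<in> carrier N \<Longrightarrow> x \<in> carrier M \<Longrightarrow> g (x \<otimes> \<iota> n) = g x \<otimes> \<iota> n"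
  shows "(\<lambda>x\<in>carrier M. g x) \<in> carrier A"
  unfolding A_simps(1) by (intro CollectI conjI ballI) (simp_all add: assms)

lemma A_eqI:
  assumes "\<alpha> \<in> carrier A" "\<alpha>' \<in> carrier A" "\<And>x. x \<in> carrier M \<Longrightarrow> \<alpha> x = \<alpha>' x"
  shows "\<alpha> = \<alpha>'"
proof (rule extensionalityI)
  show "\<alpha> \<in> extensional (carrier M)" "\<alpha>' \<in> extensional (carrier M)"
    using assms(1,2) unfolding A_simps(1) by blast+
qed (rule assms(3))

lemma A_module: "module K A"
proof -
  have add: "x \<oplus>\<^bsub>A\<^esub> y \<in> carrier A" if "x \<in> carrier A" "y \<in> carrier A" for x y
    unfolding A_simps(5) by (rule A_I) (use that in \<open>simp_all add: A_rules l_distr r_distr a_ac\<close>)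
  have zero: "\<zero>\<^bsub>A\<^esub> \<in> carrier A" unfolding A_simps(4) by (rule A_I) simp_all
  have sm: "k \<odot>\<^bsub>A\<^esub> x \<in> carrier A" if "k \<in> carrier K" "x \<in> carrier A" for k x
    unfolding A_simps(6)
    by (rule A_I) (use that in \<open>simp_all add: A_rules Mm.smult_r_distr smult_mult mult_smult\<close>)
  have ab: "abelian_group A"
  proof (rule abelian_groupI)
    fix x assume x: "x \<in> carrier A"
    let ?y = "\<lambda>m\<in>carrier M. \<ominus> x m"
    have "?y \<in> carrier A" by (rule A_I) (use x in \<open>simp_all add: A_rules minus_add l_minus r_minus\<close>)
    moreover from this have "?y \<oplus>\<^bsub>A\<^esub> x = \<zero>\<^bsub>A\<^esub>"
      by (intro A_eqI add zero x) (use x in \<open>simp_all add: A_simps(4,5) l_neg\<close>)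
    ultimately show "\<exists>y\<in>carrier A. y \<oplus>\<^bsub>A\<^esub> x = \<zero>\<^bsub>A\<^esub>" by blast
  next
    fix x y z assume *: "x \<in> carrier A" "y \<in> carrier A" "z \<in> carrier A"
    show "x \<oplus>\<^bsub>A\<^esub> y \<oplus>\<^bsub>A\<^esub> z = x \<oplus>\<^bsub>A\<^esub> (y \<oplus>\<^bsub>A\<^esub> z)"
      by (intro A_eqI add *) (use * in \<open>simp_all add: A_simps(5) a_assoc\<close>)
  next
    fix x y assume *: "x \<in> carrier A" "y \<in> carrier A"
    show "x \<oplus>\<^bsub>A\<^esub> y = y \<oplus>\<^bsub>A\<^esub> x" by (intro A_eqI add *) (use * in \<open>simp_all add: A_simps(5) a_comm\<close>)
  next
    fix x assume *: "x \<in> carrier A"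
    show "\<zero>\<^bsub>A\<^esub> \<oplus>\<^bsub>A\<^esub> x = x" by (intro A_eqI add zero *) (use * in \<open>simp_all add: A_simps(4,5)\<close>)
  qed (rule add zero; assumption?)+
  show ?thesis
  proof (rule moduleI[OF K.is_cring ab])
    fix k k' x y assume k: "k \<in> carrier K" "k' \<in> carrier K" and x: "x \<in> carrier A"
    show "(k \<oplus>\<^bsub>K\<^esub> k') \<odot>\<^bsub>A\<^esub> x = k \<odot>\<^bsub>A\<^esub> x \<oplus>\<^bsub>A\<^esub> k' \<odot>\<^bsub>A\<^esub> x"
      by (intro A_eqI add sm k x K.a_closed) (use k x in \<open>simp_all add: A_simps(5,6) Mm.smult_l_distr\<close>)
    show "(k \<otimes>\<^bsub>K\<^esub> k') \<odot>\<^bsub>A\<^esub> x = k \<odot>\<^bsub>A\<^esub> (k' \<odot>\<^bsub>A\<^esub> x)"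
      by (intro A_eqI add sm k x K.m_closed) (use k x in \<open>simp_all add: A_simps(6) Mm.smult_assoc1\<close>)
  next
    fix k x y assume k: "k \<in> carrier K" and x: "x \<in> carrier A" "y \<in> carrier A"
    show "k \<odot>\<^bsub>A\<^esub> (x \<oplus>\<^bsub>A\<^esub> y) = k \<odot>\<^bsub>A\<^esub> x \<oplus>\<^bsub>A\<^esub> k \<odot>\<^bsub>A\<^esub> y"
      by (intro A_eqI add sm k x) (use k x in \<open>simp_all add: A_simps(5,6) Mm.smult_r_distr\<close>)
  next
    fix x assume x: "x \<in> carrier A"
    show "\<one>\<^bsub>K\<^esub> \<odot>\<^bsub>A\<^esub> x = x" by (intro A_eqI sm x) (use x in \<open>simp_all add: A_simps(6)\<close>)
  qed (rule sm)
qed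

lemma A_mult_closed: "x \<in> carrier A \<Longrightarrow> y \<in> carrier A \<Longrightarrow> x \<otimes>\<^bsub>A\<^esub> y \<in> carrier A"
  unfolding A_simps(2) compose_def by (rule A_I) (simp_all add: A_rules)

lemma A_mult_apply: "m \<in> carrier M \<Longrightarrow> (x \<otimes>\<^bsub>A\<^esub> y) m = x (y m)"
  by (simp add: A_simps(2) compose_eq)

lemma A_one_closed: "\<one>\<^bsub>A\<^esub> \<in> carrier A"
  unfolding A_simps(3) by (rule A_I) simp_all

lemma A_algebra: "k_algebra K A"
proof -
  interpret Am: module K A by (rule A_module)
  have "ring A"
  proof (rule ringI)
    show "monoid A"
    proof (rule monoidI)
      fix x y z assume *: "x \<in> carrier A" "y \<in> carrier A" "z \<in> carrier A"
      show "x \<otimes>\<^bsub>A\<^esub> y \<otimes>\<^bsub>A\<^esub> z = x \<otimes>\<^bsub>A\<^esub> (y \<otimes>\<^bsub>A\<^esub> z)"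
        by (intro A_eqI A_mult_closed *) (use * in \<open>simp_all add: A_mult_apply\<close>)
    next
      fix x assume *: "x \<in> carrier A"
      show "\<one>\<^bsub>A\<^esub> \<otimes>\<^bsub>A\<^esub> x = x" "x \<otimes>\<^bsub>A\<^esub> \<one>\<^bsub>A\<^esub> = x"
        by (intro A_eqI A_mult_closed A_one_closed *; use * in \<open>simp add: A_mult_apply A_simps(3)\<close>)+
    qed (simp_all add: A_mult_closed A_one_closed)
    fix x y z assume *: "x \<in> carrier A" "y \<in> carrier A" "z \<in> carrier A"
    show "(x \<oplus>\<^bsub>A\<^esub> y) \<otimes>\<^bsub>A\<^esub> z = x \<otimes>\<^bsub>A\<^esub> z \<oplus>\<^bsub>A\<^esub> y \<otimes>\<^bsub>A\<^esub> z" "z \<otimes>\<^bsub>A\<^esub> (x \<oplus>\<^bsub>A\<^esub> y) = z \<otimes>\<^bsub>A\<^esub> x \<oplus>\<^bsub>A\<^esub> z \<otimes>\<^bsub>A\<^esub> y"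
      by (intro A_eqI A_mult_closed Am.a_closed *; use * in \<open>simp add: A_mult_apply A_simps(5) A_add\<close>)+
  qed (rule Am.abelian_group_axioms)
  moreover have "(k \<odot>\<^bsub>A\<^esub> x) \<otimes>\<^bsub>A\<^esub> y = k \<odot>\<^bsub>A\<^esub> (x \<otimes>\<^bsub>A\<^esub> y)" "x \<otimes>\<^bsub>A\<^esub> (k \<odot>\<^bsub>A\<^esub> y) = k \<odot>\<^bsub>A\<^esub> (x \<otimes>\<^bsub>A\<^esub> y)"
    if "k \<in> carrier K" "x \<in> carrier A" "y \<in> carrier A" for k x y
    by (intro A_eqI A_mult_closed Am.smult_closed that; use that in \<open>simp add: A_mult_apply A_simps(6) A_smult\<close>)+
  ultimately show ?thesis using A_module by (simp add: k_algebra_def)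
qed


sublocale Am: module K A by (rule A_module)
sublocale Ar: ring A using A_algebra by (simp add: k_algebra_def)
sublocale Bm: module K B by (rule B_module)
sublocale Br: ring B using B_algebra by (simp add: k_algebra_def)

section \<open>Evaluation of tensors against endomorphisms\<close>

definition "br t a = L (\<lambda>x y. x \<otimes> a y) t"
definition "rb t a = L (\<lambda>x y. a x \<otimes> y) t"
definition "m1 a t = tensor_lift T (\<lambda>x y. tn (a x) y) t"
definition "m2 a t = tensor_lift T (\<lambda>x y. tn x (a y)) t"
text \<open>In Sweedler form \<open>la t a\<close> is t^1 a(t^2 -), the transpose of left
  multiplication by \<open>t\<close> in \<open>B\<close>, and \<open>lc a t\<close> below is a(-
  t^1) t^2, the shape of the left legs in the coproduct of \<open>A\<close>.\<close>

definition "la t a = (\<lambda>m\<in>carrier M. br (rm t m) a)"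
definition "lc a t = (\<lambda>m\<in>carrier M. rb (lm m t) a)"
definition "lam r = (\<lambda>m\<in>carrier M. r \<otimes> m)"
definition "rho r = (\<lambda>m\<in>carrier M. m \<otimes> r)"

lemma bal_br: "a \<in> carrier A \<Longrightarrow> bal (add_monoid M) (\<lambda>x y. x \<otimes> a y)"
  and bal_rb: "a \<in> carrier A \<Longrightarrow> bal (add_monoid M) (\<lambda>x y. a x \<otimes> y)"
  by (rule balI; simp add: A_rules l_distr r_distr m_assoc)+

lemma bal_m1: "a \<in> carrier A \<Longrightarrow> bal T (\<lambda>x y. tn (a x) y)"
  and bal_m2: "a \<in> carrier A \<Longrightarrow> bal T (\<lambda>x y. tn x (a y))"
  by (rule balI; simp add: A_rules tn_add tn_N)+

lemma br_closed [simp]: "a \<in> carrier A \<Longrightarrow> t \<in> carrier T \<Longrightarrow> br t a \<in> carrier M"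
  and br_add: "a \<in> carrier A \<Longrightarrow> s \<in> carrier T \<Longrightarrow> t \<in> carrier T \<Longrightarrow> br (s \<otimes>\<^bsub>T\<^esub> t) a = br s a \<oplus> br t a"
  and br_tn: "a \<in> carrier A \<Longrightarrow> x \<in> carrier M \<Longrightarrow> y \<in> carrier M \<Longrightarrow> br (tn x y) a = x \<otimes> a y"
  and rb_closed [simp]: "a \<in> carrier A \<Longrightarrow> t \<in> carrier T \<Longrightarrow> rb t a \<in> carrier M"
  and rb_add: "a \<in> carrier A \<Longrightarrow> s \<in> carrier T \<Longrightarrow> t \<in> carrier T \<Longrightarrow> rb (s \<otimes>\<^bsub>T\<^esub> t) a = rb s a \<oplus> rb t a"
  and rb_tn: "a \<in> carrier A \<Longrightarrow> x \<in> carrier M \<Longrightarrow> y \<in> carrier M \<Longrightarrow> rb (tn x y) a = a x \<otimes> y"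
  and m1_closed [simp]: "a \<in> carrier A \<Longrightarrow> t \<in> carrier T \<Longrightarrow> m1 a t \<in> carrier T"
  and m1_add: "a \<in> carrier A \<Longrightarrow> s \<in> carrier T \<Longrightarrow> t \<in> carrier T \<Longrightarrow> m1 a (s \<otimes>\<^bsub>T\<^esub> t) = m1 a s \<otimes>\<^bsub>T\<^esub> m1 a t"
  and m1_tn: "a \<in> carrier A \<Longrightarrow> x \<in> carrier M \<Longrightarrow> y \<in> carrier M \<Longrightarrow> m1 a (tn x y) = tn (a x) y"
  and m2_closed [simp]: "a \<in> carrier A \<Longrightarrow> t \<in> carrier T \<Longrightarrow> m2 a t \<in> carrier T"
  and m2_add: "a \<in> carrier A \<Longrightarrow> s \<in> carrier T \<Longrightarrow> t \<in> carrier T \<Longrightarrow> m2 a (s \<otimes>\<^bsub>T\<^esub> t) = m2 a s \<otimes>\<^bsub>T\<^esub> m2 a t"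
  and m2_tn: "a \<in> carrier A \<Longrightarrow> x \<in> carrier M \<Longrightarrow> y \<in> carrier M \<Longrightarrow> m2 a (tn x y) = tn x (a y)"
  unfolding br_def rb_def m1_def m2_def
  using L_rules[OF bal_br] L_rules[OF bal_rb]
    LT[OF bal_m1] LT[OF bal_m2] by simp_all

lemmas T_ops = br_add br_tn rb_add rb_tn m1_add m1_tn m2_add m2_tn lm_add lm_tn rm_add rm_tn sm_add sm_tn

lemma br_lm: "a \<in> carrier A \<Longrightarrow> t \<in> carrier T \<Longrightarrow> m \<in> carrier M \<Longrightarrow> br (lm m t) a = m \<otimes> br t a"
  by (rule M_eqI[of t]) (simp_all add: T_ops r_distr m_assoc)

lemma rb_rm: "a \<in> carrier A \<Longrightarrow> t \<in> carrier T \<Longrightarrow> m \<in> carrier M \<Longrightarrow> rb (rm t m) a = rb t a \<otimes> m"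
  by (rule M_eqI[of t]) (simp_all add: T_ops l_distr m_assoc)

lemma br_rm_N: "a \<in> carrier A \<Longrightarrow> t \<in> carrier T \<Longrightarrow> n \<in> carrier N \<Longrightarrow> br (rm t (\<iota> n)) a = br t a \<otimes> \<iota> n"
  by (rule M_eqI[of t]) (simp_all add: T_ops l_distr m_assoc A_rules)

lemma rb_lm_N: "a \<in> carrier A \<Longrightarrow> t \<in> carrier T \<Longrightarrow> n \<in> carrier N \<Longrightarrow> rb (lm (\<iota> n) t) a = \<iota> n \<otimes> rb t a"
  by (rule M_eqI[of t]) (simp_all add: T_ops r_distr m_assoc A_rules)

lemma A_plus_apply: "m \<in> carrier M \<Longrightarrow> (a \<oplus>\<^bsub>A\<^esub> a') m = a m \<oplus> a' m"
  and A_smult_apply: "m \<in> carrier M \<Longrightarrow> (k \<odot>\<^bsub>A\<^esub> a) m = k \<odot> a m"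
  by (simp_all add: A_simps(5,6))

lemma br_plus: "a \<in> carrier A \<Longrightarrow> a' \<in> carrier A \<Longrightarrow> t \<in> carrier T \<Longrightarrow> br t (a \<oplus>\<^bsub>A\<^esub> a') = br t a \<oplus> br t a'"
  by (rule M_eqI[of t]) (simp_all add: T_ops r_distr A_plus_apply a_ac)

lemma rb_plus: "a \<in> carrier A \<Longrightarrow> a' \<in> carrier A \<Longrightarrow> t \<in> carrier T \<Longrightarrow> rb t (a \<oplus>\<^bsub>A\<^esub> a') = rb t a \<oplus> rb t a'"
  by (rule M_eqI[of t]) (simp_all add: T_ops l_distr A_plus_apply a_ac)

lemma br_smult: "k \<in> carrier K \<Longrightarrow> a \<in> carrier A \<Longrightarrow> t \<in> carrier T \<Longrightarrow> br t (k \<odot>\<^bsub>A\<^esub> a) = k \<odot> br t a"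
  by (rule M_eqI[of t]) (simp_all add: T_ops mult_smult A_smult_apply Mm.smult_r_distr)

lemma rb_smult: "k \<in> carrier K \<Longrightarrow> a \<in> carrier A \<Longrightarrow> t \<in> carrier T \<Longrightarrow> rb t (k \<odot>\<^bsub>A\<^esub> a) = k \<odot> rb t a"
  by (rule M_eqI[of t]) (simp_all add: T_ops smult_mult A_smult_apply Mm.smult_r_distr)

lemma br_sm: "k \<in> carrier K \<Longrightarrow> a \<in> carrier A \<Longrightarrow> t \<in> carrier T \<Longrightarrow> br (k \<odot>\<^bsub>B\<^esub> t) a = k \<odot> br t a"
  by (rule M_eqI[of t]) (simp_all add: T_ops smult_mult Mm.smult_r_distr)

lemma rb_sm: "k \<in> carrier K \<Longrightarrow> a \<in> carrier A \<Longrightarrow> t \<in> carrier T \<Longrightarrow> rb (k \<odot>\<^bsub>B\<^esub> t) a = k \<odot> rb t a"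
  by (rule M_eqI[of t]) (simp_all add: T_ops smult_mult A_smult Mm.smult_r_distr)

section \<open>The centralizer, and sums in the structures at hand\<close>

lemma R_simps: "carrier R = {x \<in> carrier M. \<forall>n \<in> carrier N. \<iota> n \<otimes> x = x \<otimes> \<iota> n}"
  "mult R = mult M" "one R = one M" "zero R = zero M" "add R = add M" "smult R = smult M"
  by (simp_all add: centralizer_def)

lemma R_M [simp]: "r \<in> carrier R \<Longrightarrow> r \<in> carrier M"
  and R_comm: "r \<in> carrier R \<Longrightarrow> n \<in> carrier N \<Longrightarrow> \<iota> n \<otimes> r = r \<otimes> \<iota> n"
  and R_I: "x \<in> carrier M \<Longrightarrow> (\<And>n. n \<in> carrier N \<Longrightarrow> \<iota> n \<otimes> x = x \<otimes> \<iota> n) \<Longrightarrow> x \<in> carrier R"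
  by (simp_all add: R_simps)

lemma R_add [simp]: "r \<in> carrier R \<Longrightarrow> s \<in> carrier R \<Longrightarrow> r \<oplus> s \<in> carrier R"
  and R_smult [simp]: "k \<in> carrier K \<Longrightarrow> r \<in> carrier R \<Longrightarrow> k \<odot> r \<in> carrier R"
  by (rule R_I; simp add: l_distr r_distr R_comm smult_mult mult_smult)+

lemma R_mult [simp]: "r \<in> carrier R \<Longrightarrow> s \<in> carrier R \<Longrightarrow> r \<otimes> s \<in> carrier R"
proof (rule R_I)
  fix n assume *: "r \<in> carrier R" "s \<in> carrier R" "n \<in> carrier N"
  have "\<iota> n \<otimes> (r \<otimes> s) = (r \<otimes> \<iota> n) \<otimes> s" using * by (simp add: m_assoc[symmetric] R_comm[of r])
  then show "\<iota> n \<otimes> (r \<otimes> s) = r \<otimes> s \<otimes> \<iota> n" using * by (simp add: m_assoc R_comm)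
qed simp

lemma R_one [simp]: "\<one> \<in> carrier R" by (rule R_I) simp_all

lemma R_abelian_group: "abelian_group R"
proof (rule abelian_groupI)
  fix x assume x: "x \<in> carrier R"
  have "\<ominus> x \<in> carrier R" using x by (intro R_I) (simp_all add: l_minus r_minus R_comm)
  moreover have "\<ominus> x \<oplus>\<^bsub>R\<^esub> x = \<zero>\<^bsub>R\<^esub>" using x by (simp add: R_simps(4,5) l_neg)
  ultimately show "\<exists>y\<in>carrier R. y \<oplus>\<^bsub>R\<^esub> x = \<zero>\<^bsub>R\<^esub>" by blast
next
  show "\<zero>\<^bsub>R\<^esub> \<in> carrier R" unfolding R_simps(4) by (rule R_I) simp_all
qed (simp_all add: R_simps(4,5) a_ac)

lemma finsum_R: "g \<in> S \<rightarrow> carrier R \<Longrightarrow> finsum R g S = finsum M g S"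
  using hom_finsum[OF R_abelian_group M.a_comm_group, of "\<lambda>x. x" g S]
  by (simp add: hom_def R_simps(5) finsum_def)

lemma finsum_R_closed: "g \<in> S \<rightarrow> carrier R \<Longrightarrow> finsum M g S \<in> carrier R"
  using abelian_monoid.finsum_closed[OF abelian_group.axioms(1)[OF R_abelian_group], of g S] by (simp add: finsum_R)

lemma finsum_B: "g \<in> S \<rightarrow> carrier B \<Longrightarrow> finsum B g S = finprod T g S"
  using hom_finsum[OF B_abelian_group T.comm_group_axioms, of "\<lambda>x. x" g S]
  by (simp add: hom_def B_simps(4) B_T)

lemma finsum_A_apply: "g \<in> S \<rightarrow> carrier A \<Longrightarrow> m \<in> carrier M \<Longrightarrow> (finsum A g S) m = (\<Oplus>i\<in>S. g i m)"
  using hom_finsum[OF Am.abelian_group_axioms M.a_comm_group, of "\<lambda>a. a m" g S]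
  by (simp add: hom_def A_plus_apply finsum_def)

lemma T_hom_finsum:
  assumes "g \<in> S \<rightarrow> carrier T" "\<And>t. t \<in> carrier T \<Longrightarrow> h t \<in> carrier M"
    "\<And>s t. s \<in> carrier T \<Longrightarrow> t \<in> carrier T \<Longrightarrow> h (s \<otimes>\<^bsub>T\<^esub> t) = h s \<oplus> h t"
  shows "h (finprod T g S) = (\<Oplus>i\<in>S. h (g i))"
  using hom_finprod[OF T.comm_group_axioms M.a_comm_group, of h g S] assms
  by (simp add: hom_def finsum_def)

text \<open>A sum of additive maps is additive, so a summed identity can still be tested on pure
  tensors, where the quasibasis identities apply.\<close>

lemma M_eqI_finsum:
  assumes "t \<in> carrier T"
    and "\<And>x y. x \<in> carrier M \<Longrightarrow> y \<in> carrier M \<Longrightarrow> (\<Oplus>i\<in>S. g i (tn x y)) = h (tn x y)"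
    and c: "\<And>i t. i \<in> S \<Longrightarrow> t \<in> carrier T \<Longrightarrow> g i t \<in> carrier M" "\<And>t. t \<in> carrier T \<Longrightarrow> h t \<in> carrier M"
    and a: "\<And>i s t. i \<in> S \<Longrightarrow> s \<in> carrier T \<Longrightarrow> t \<in> carrier T \<Longrightarrow> g i (s \<otimes>\<^bsub>T\<^esub> t) = g i s \<oplus> g i t"
      "\<And>s t. s \<in> carrier T \<Longrightarrow> t \<in> carrier T \<Longrightarrow> h (s \<otimes>\<^bsub>T\<^esub> t) = h s \<oplus> h t"
  shows "(\<Oplus>i\<in>S. g i t) = h t"
proof (rule M_eqI[OF assms(1)])
  fix s t assume st: "s \<in> carrier T" "t \<in> carrier T"
  have "(\<Oplus>i\<in>S. g i (s \<otimes>\<^bsub>T\<^esub> t)) = (\<Oplus>i\<in>S. g i s \<oplus> g i t)"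
    by (rule finsum_cong') (use st c a in \<open>simp_all add: Pi_iff\<close>)
  also have "\<dots> = (\<Oplus>i\<in>S. g i s) \<oplus> (\<Oplus>i\<in>S. g i t)"
    by (rule finsum_addf) (use st c in \<open>simp_all add: Pi_iff\<close>)
  finally show "(\<Oplus>i\<in>S. g i (s \<otimes>\<^bsub>T\<^esub> t)) = \<dots>" .
qed (use assms(2) c a in \<open>simp_all add: Pi_iff\<close>)

lemma T_finprod_ident:
  assumes "t \<in> carrier T"
    and "\<And>x y. x \<in> carrier M \<Longrightarrow> y \<in> carrier M \<Longrightarrow> finprod T (\<lambda>i. g i (tn x y)) S = tn x y"
    and c: "\<And>i t. i \<in> S \<Longrightarrow> t \<in> carrier T \<Longrightarrow> g i t \<in> carrier T"
    and a: "\<And>i s t. i \<in> S \<Longrightarrow> s \<in> carrier T \<Longrightarrow> t \<in> carrier T \<Longrightarrow> g i (s \<otimes>\<^bsub>T\<^esub> t) = g i s \<otimes>\<^bsub>T\<^esub> g i t"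
  shows "finprod T (\<lambda>i. g i t) S = t"
proof (rule T_eqI[OF assms(1)])
  fix s t assume st: "s \<in> carrier T" "t \<in> carrier T"
  have "finprod T (\<lambda>i. g i (s \<otimes>\<^bsub>T\<^esub> t)) S = finprod T (\<lambda>i. g i s \<otimes>\<^bsub>T\<^esub> g i t) S"
    by (rule T.finprod_cong') (use st c a in \<open>simp_all add: Pi_iff\<close>)
  also have "\<dots> = finprod T (\<lambda>i. g i s) S \<otimes>\<^bsub>T\<^esub> finprod T (\<lambda>i. g i t) S"
    by (rule T.finprod_multf) (use st c in \<open>simp_all add: Pi_iff\<close>)
  finally show "finprod T (\<lambda>i. g i (s \<otimes>\<^bsub>T\<^esub> t)) S = \<dots>" .
qed (use assms(2) c in \<open>simp_all add: Pi_iff\<close>)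

text \<open>Elements of \<open>N\<close> pass through both \<open>t\<close> and the endomorphism, so
  the value centralizes \<open>N\<close>. This puts it in the domain on which \<open>\<phi>\<close>
  is known to be linear.\<close>

lemma br_R: "t \<in> carrier B \<Longrightarrow> a \<in> carrier A \<Longrightarrow> br t a \<in> carrier R"
  by (rule R_I) (simp_all add: B_T br_lm[symmetric] br_rm_N[symmetric] B_comm)

lemma rb_R: "t \<in> carrier B \<Longrightarrow> a \<in> carrier A \<Longrightarrow> rb t a \<in> carrier R"
  by (rule R_I) (simp_all add: B_T rb_lm_N[symmetric] rb_rm[symmetric] B_comm)

lemma A_one_R: "a \<in> carrier A \<Longrightarrow> r \<in> carrier R \<Longrightarrow> a r \<in> carrier R"
  by (rule R_I) (simp_all add: A_left[symmetric] A_right[symmetric] R_comm)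

lemma lm_B: "r \<in> carrier R \<Longrightarrow> t \<in> carrier B \<Longrightarrow> lm r t \<in> carrier B"
  by (rule B_I) (simp_all add: B_T lm_lm R_comm lm_rm B_comm[symmetric])

lemma rm_B: "r \<in> carrier R \<Longrightarrow> t \<in> carrier B \<Longrightarrow> rm t r \<in> carrier B"
  by (rule B_I) (simp_all add: B_T rm_rm R_comm[symmetric] lm_rm[symmetric] B_comm)

lemma m1_lm_N: "a \<in> carrier A \<Longrightarrow> t \<in> carrier T \<Longrightarrow> n \<in> carrier N \<Longrightarrow> m1 a (lm (\<iota> n) t) = lm (\<iota> n) (m1 a t)"
  and m1_rm: "a \<in> carrier A \<Longrightarrow> t \<in> carrier T \<Longrightarrow> m \<in> carrier M \<Longrightarrow> m1 a (rm t m) = rm (m1 a t) m"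
  and m2_lm: "a \<in> carrier A \<Longrightarrow> t \<in> carrier T \<Longrightarrow> m \<in> carrier M \<Longrightarrow> m2 a (lm m t) = lm m (m2 a t)"
  and m2_rm_N: "a \<in> carrier A \<Longrightarrow> t \<in> carrier T \<Longrightarrow> n \<in> carrier N \<Longrightarrow> m2 a (rm t (\<iota> n)) = rm (m2 a t) (\<iota> n)"
  by (rule T_eqI[of t]; simp add: T_ops A_rules)+

lemma m1_B [simp]: "a \<in> carrier A \<Longrightarrow> t \<in> carrier B \<Longrightarrow> m1 a t \<in> carrier B"
  by (rule B_I) (simp_all add: B_T m1_lm_N[symmetric] m1_rm[symmetric] B_comm)

lemma m2_B [simp]: "a \<in> carrier A \<Longrightarrow> t \<in> carrier B \<Longrightarrow> m2 a t \<in> carrier B"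
  by (rule B_I) (simp_all add: B_T m2_lm[symmetric] m2_rm_N[symmetric] B_comm)

lemma la_A [simp]:
  assumes "a \<in> carrier A" "t \<in> carrier B"
  shows "la t a \<in> carrier A"
  unfolding la_def
proof (rule A_I)
  fix n x assume *: "n \<in> carrier N" "x \<in> carrier M"
  have "rm t (\<iota> n \<otimes> x) = lm (\<iota> n) (rm t x)"
    using * assms by (simp add: rm_rm[symmetric] B_comm[symmetric] B_T lm_rm)
  then show "br (rm t (\<iota> n \<otimes> x)) a = \<iota> n \<otimes> br (rm t x) a" using * assms by (simp add: br_lm B_T)
  have "rm t (x \<otimes> \<iota> n) = rm (rm t x) (\<iota> n)" using * assms by (simp add: rm_rm B_T)
  then show "br (rm t (x \<otimes> \<iota> n)) a = br (rm t x) a \<otimes> \<iota> n" using * assms by (simp add: br_rm_N B_T)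
qed (use assms in \<open>simp_all add: B_T rm_plus br_add\<close>)

lemma lc_A [simp]:
  assumes "a \<in> carrier A" "t \<in> carrier B"
  shows "lc a t \<in> carrier A"
  unfolding lc_def
proof (rule A_I)
  fix n x assume *: "n \<in> carrier N" "x \<in> carrier M"
  have "lm (x \<otimes> \<iota> n) t = rm (lm x t) (\<iota> n)"
    using * assms by (simp add: lm_lm[symmetric] B_comm B_T lm_rm)
  then show "rb (lm (x \<otimes> \<iota> n) t) a = rb (lm x t) a \<otimes> \<iota> n" using * assms by (simp add: rb_rm B_T)
  have "lm (\<iota> n \<otimes> x) t = lm (\<iota> n) (lm x t)" using * assms by (simp add: lm_lm B_T)
  then show "rb (lm (\<iota> n \<otimes> x) t) a = \<iota> n \<otimes> rb (lm x t) a" using * assms by (simp add: rb_lm_N B_T)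
qed (use assms in \<open>simp_all add: B_T lm_plus rb_add\<close>)

lemma lam_A [simp]: "r \<in> carrier R \<Longrightarrow> lam r \<in> carrier A"
  unfolding lam_def by (rule A_I) (simp_all add: r_distr m_assoc[symmetric] R_comm)

lemma rho_A [simp]: "r \<in> carrier R \<Longrightarrow> rho r \<in> carrier A"
  unfolding rho_def by (rule A_I) (simp_all add: l_distr m_assoc R_comm)

lemma la_apply: "m \<in> carrier M \<Longrightarrow> la t a m = br (rm t m) a"
  and lc_apply: "m \<in> carrier M \<Longrightarrow> lc a t m = rb (lm m t) a"
  and lam_apply: "m \<in> carrier M \<Longrightarrow> lam r m = r \<otimes> m"
  and rho_apply: "m \<in> carrier M \<Longrightarrow> rho r m = m \<otimes> r"
  and one_A_apply: "m \<in> carrier M \<Longrightarrow> \<one>\<^bsub>A\<^esub> m = m"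
  by (simp_all add: la_def lc_def lam_def rho_def A_simps(3))

lemmas applies = la_apply lc_apply lam_apply rho_apply one_A_apply A_mult_apply

text \<open>Both sides are s^1 t^1 a(t^2 s^2).\<close>

lemma br_mult: "a \<in> carrier A \<Longrightarrow> t \<in> carrier B \<Longrightarrow> s \<in> carrier T \<Longrightarrow> br (t \<otimes>\<^bsub>B\<^esub> s) a = br s (la t a)"
  by (rule M_eqI[of s]) (simp_all add: T_ops multB B_T br_lm la_apply)

text \<open>Both sides are t^1 a(t^2 s^1) s^2. Under \<open>\<phi>\<close> the left one is a value
  of \<open>\<tau>\<close> and the right one a value of \<open>P\<close>; this exchange yields the
  coproduct of \<open>A\<close>.\<close>

lemma rb_la:
  assumes a: "a \<in> carrier A" and t: "t \<in> carrier B" and s: "s \<in> carrier B"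
  shows "rb s (la t a) = br t (lc a s)"
proof -
  have bl: "bal (add_monoid M) (\<lambda>x y. br (rm t x) a \<otimes> y)" if "t \<in> carrier T" for t
    by (rule balI; use that a in \<open>simp add: rm_plus br_add l_distr r_distr rm_rm[symmetric] br_rm_N m_assoc\<close>)
  \<comment> \<open>The common expression, read as a function of \<open>t\<close> for fixed
    \<open>s\<close>: it is compared with one side on pure tensors in \<open>s\<close> and with the
    other on pure tensors in \<open>t\<close>.\<close>
  define g where "g t = L (\<lambda>x y. br (rm t x) a \<otimes> y) s" for t
  have "rb s (la t a) = g t" unfolding g_def
    by (rule M_eqI[OF B_T[OF s]]) (use a t in \<open>simp_all add: T_ops la_apply L_rules[OF bl] B_T\<close>)
  also have "g t = br t (lc a s)"
  proof (rule M_eqI[OF B_T[OF t]])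
    fix x y assume xy: "x \<in> carrier M" "y \<in> carrier M"
    show "g (tn x y) = br (tn x y) (lc a s)" unfolding g_def br_tn[OF lc_A[OF a s] xy] lc_apply[OF xy(2)]
      by (rule M_eqI[OF B_T[OF s]])
        (use a xy in \<open>simp_all add: T_ops L_rules[OF bl] m_assoc r_distr\<close>)
  next
    fix t t' assume tt: "t \<in> carrier T" "t' \<in> carrier T"
    then have tt': "t \<otimes>\<^bsub>T\<^esub> t' \<in> carrier T" by simp
    show "g (t \<otimes>\<^bsub>T\<^esub> t') = g t \<oplus> g t'" unfolding g_def
      by (rule M_eqI[OF B_T[OF s]])
        (use a tt tt' in \<open>simp_all add: T_ops L_rules[OF bl] l_distr a_ac\<close>)
  qed (use a s in \<open>simp_all add: g_def L_closed[OF bl] B_T br_add\<close>)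
  finally show ?thesis .
qed

lemma br_comp: "a \<in> carrier A \<Longrightarrow> a' \<in> carrier A \<Longrightarrow> t \<in> carrier T \<Longrightarrow> br t (a \<otimes>\<^bsub>A\<^esub> a') = br (m2 a' t) a"
  by (rule M_eqI[of t]) (simp_all add: T_ops A_mult_apply)

text \<open>Both sides are x(t^1) a(t^2). This is the exchange of the two forms that yields the
  coproduct of \<open>B\<close>.\<close>

lemma rb_m2: "a \<in> carrier A \<Longrightarrow> x \<in> carrier A \<Longrightarrow> t \<in> carrier T \<Longrightarrow> rb (m2 a t) x = br (m1 x t) a"
  by (rule M_eqI[of t]) (simp_all add: T_ops)

lemma rb_lam: "a \<in> carrier A \<Longrightarrow> r \<in> carrier R \<Longrightarrow> t \<in> carrier T \<Longrightarrow> rb t (a \<otimes>\<^bsub>A\<^esub> lam r) = rb (lm r t) a"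
  by (rule M_eqI[of t]) (simp_all add: T_ops applies)

lemma br_rho: "a \<in> carrier A \<Longrightarrow> r \<in> carrier R \<Longrightarrow> t \<in> carrier T \<Longrightarrow> br t (rho r \<otimes>\<^bsub>A\<^esub> a) = br t a \<otimes> r"
  by (rule M_eqI[of t]) (simp_all add: T_ops applies l_distr m_assoc)

lemma br_rm_one: "t \<in> carrier T \<Longrightarrow> m \<in> carrier M \<Longrightarrow> br (rm t m) \<one>\<^bsub>A\<^esub> = br t \<one>\<^bsub>A\<^esub> \<otimes> m"
  by (rule M_eqI[of t]) (simp_all add: T_ops one_A_apply l_distr m_assoc)

lemma la_one: "t \<in> carrier B \<Longrightarrow> la t \<one>\<^bsub>A\<^esub> = lam (br t \<one>\<^bsub>A\<^esub>)"
  by (rule A_eqI) (simp_all add: applies br_rm_one B_T br_R)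

lemma la_rho: "t \<in> carrier B \<Longrightarrow> r \<in> carrier R \<Longrightarrow> la t (rho r) = lam (br t \<one>\<^bsub>A\<^esub>) \<otimes>\<^bsub>A\<^esub> rho r"
proof (rule A_eqI)
  fix m assume *: "m \<in> carrier M" "t \<in> carrier B" "r \<in> carrier R"
  have "br (rm t m) (rho r \<otimes>\<^bsub>A\<^esub> \<one>\<^bsub>A\<^esub>) = br t \<one>\<^bsub>A\<^esub> \<otimes> m \<otimes> r"
    using * by (simp only: br_rho Ar.one_closed rm_closed B_T br_rm_one)
  then show "la t (rho r) m = (lam (br t \<one>\<^bsub>A\<^esub>) \<otimes>\<^bsub>A\<^esub> rho r) m" using * by (simp add: applies B_T m_assoc)
qed (simp_all add: br_R)

text \<open>Associativity of \<open>M\<close>. It is the counterpart in \<open>A\<close> of the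
  commutation of r \<otimes> 1 with 1 \<otimes> s in \<open>B\<close>, and gives the second counit
  identity of \<open>B\<close>.\<close>

lemma lam_rho: "r \<in> carrier R \<Longrightarrow> s \<in> carrier R \<Longrightarrow> rho s \<otimes>\<^bsub>A\<^esub> lam r = lam r \<otimes>\<^bsub>A\<^esub> rho s"
  by (rule A_eqI) (simp_all add: applies m_assoc)

lemma tn_B: "r \<in> carrier R \<Longrightarrow> s \<in> carrier R \<Longrightarrow> tn r s \<in> carrier B"
  by (rule B_I) (simp_all add: lm_tn rm_tn R_comm tn_N)

end


section \<open>Quasibases and the two forms\<close>

text \<open>The right quasibasis \<open>c\<close>, \<open>\<gamma>\<close> is part of the context
  here; it is constructed from depth two afterwards, in \<open>right_quasibasis\<close>.\<close>

locale d2_extension = algebra_extension K N M \<iota>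
  for K :: "('k, 'c) ring_scheme" and N :: "('k, 'n) module" and M :: "('k, 'm) module" (structure)
    and \<iota> :: "'n \<Rightarrow> 'm" +
  fixes p q s :: nat and b c :: "nat \<Rightarrow> ('m, 'm) tensor" and \<beta> \<gamma> :: "nat \<Rightarrow> 'm \<Rightarrow> 'm"
    and \<phi> :: "'m \<Rightarrow> 'k" and e f :: "nat \<Rightarrow> 'm"
  assumes left: "left_D2_quasibasis N M \<iota> p b \<beta>"
    and frob: "index_one_frobenius_system K R \<phi> q e f"
    and c_B: "i < s \<Longrightarrow> c i \<in> carrier B" and \<gamma>_A: "i < s \<Longrightarrow> \<gamma> i \<in> carrier A"
    and right: "m \<in> carrier M \<Longrightarrow> finprod T (\<lambda>i. lm (\<gamma> i m) (c i)) {..<s} = tn \<one> m"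
begin

lemma b_B [simp]: "i < p \<Longrightarrow> b i \<in> carrier B" and \<beta>_A [simp]: "i < p \<Longrightarrow> \<beta> i \<in> carrier A"
  and left_eq: "m \<in> carrier M \<Longrightarrow> finprod T (\<lambda>i. rm (b i) (\<beta> i m)) {..<p} = tn m \<one>"
  using left by (auto simp: left_D2_quasibasis_def)

declare c_B [simp] \<gamma>_A [simp]

lemma \<phi>_lin: "k_linear K R (base_module K) \<phi>" and e_R [simp]: "j < q \<Longrightarrow> e j \<in> carrier R"
  and f_R [simp]: "j < q \<Longrightarrow> f j \<in> carrier R"
  using frob by (auto simp: index_one_frobenius_system_def)

lemma \<phi>_closed [simp]: "r \<in> carrier R \<Longrightarrow> \<phi> r \<in> carrier K"
  and \<phi>_add: "r \<in> carrier R \<Longrightarrow> r' \<in> carrier R \<Longrightarrow> \<phi> (r \<oplus> r') = \<phi> r \<oplus>\<^bsub>K\<^esub> \<phi> r'"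
  and \<phi>_smult: "k \<in> carrier K \<Longrightarrow> r \<in> carrier R \<Longrightarrow> \<phi> (k \<odot> r) = k \<otimes>\<^bsub>K\<^esub> \<phi> r"
  using k_linearD[OF \<phi>_lin]
  by (simp_all add: R_simps(5,6))

lemma \<phi>_finsum: "g \<in> S \<rightarrow> carrier R \<Longrightarrow> \<phi> (finsum M g S) = (\<Oplus>\<^bsub>K\<^esub>i\<in>S. \<phi> (g i))"
  using k_linear_finsum[OF R_abelian_group module.axioms(2)[OF base_module_module[OF K.is_cring]] \<phi>_lin, of g S]
  by (simp add: finsum_R finsum_base_module)

lemma frobenius_left: "r \<in> carrier R \<Longrightarrow> (\<Oplus>j\<in>{..<q}. \<phi> (r \<otimes> e j) \<odot> f j) = r"
  and frobenius_right: "r \<in> carrier R \<Longrightarrow> (\<Oplus>j\<in>{..<q}. \<phi> (f j \<otimes> r) \<odot> e j) = r"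
  and index_one: "(\<Oplus>j\<in>{..<q}. e j \<otimes> f j) = \<one>"
proof -
  show "r \<in> carrier R \<Longrightarrow> (\<Oplus>j\<in>{..<q}. \<phi> (r \<otimes> e j) \<odot> f j) = r"
    "r \<in> carrier R \<Longrightarrow> (\<Oplus>j\<in>{..<q}. \<phi> (f j \<otimes> r) \<odot> e j) = r"
    using frob finsum_R[of "\<lambda>j. \<phi> (r \<otimes> e j) \<odot> f j" "{..<q}"] finsum_R[of "\<lambda>j. \<phi> (f j \<otimes> r) \<odot> e j" "{..<q}"]
    unfolding index_one_frobenius_system_def by (simp_all add: R_simps(2,6) Pi_iff)
  show "(\<Oplus>j\<in>{..<q}. e j \<otimes> f j) = \<one>"
    using frob finsum_R[of "\<lambda>j. e j \<otimes> f j" "{..<q}"]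
    unfolding index_one_frobenius_system_def by (simp add: R_simps(2,3) Pi_iff)
qed

text \<open>The Frobenius expansion with a spectator \<open>m\<close>: a sum over j with
  coefficients in \<open>\<phi>\<close> turns back into multiplication by \<open>r\<close>.
  \<open>collapse_right\<close> is the mirror image.\<close>

lemma collapse_left:
  assumes r: "r \<in> carrier R" and m: "m \<in> carrier M"
  shows "(\<Oplus>j\<in>{..<q}. \<phi> (r \<otimes> e j) \<odot> (f j \<otimes> m)) = r \<otimes> m"
proof -
  have "r \<otimes> m = (\<Oplus>j\<in>{..<q}. \<phi> (r \<otimes> e j) \<odot> f j) \<otimes> m" using r by (simp add: frobenius_left)
  also have "\<dots> = (\<Oplus>j\<in>{..<q}. \<phi> (r \<otimes> e j) \<odot> f j \<otimes> m)"
    by (rule finsum_ldistr) (use r m in auto)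
  also have "\<dots> = (\<Oplus>j\<in>{..<q}. \<phi> (r \<otimes> e j) \<odot> (f j \<otimes> m))"
    by (rule finsum_cong') (use r m in \<open>auto simp: smult_mult\<close>)
  finally show ?thesis by simp
qed

lemma collapse_right:
  assumes r: "r \<in> carrier R" and m: "m \<in> carrier M"
  shows "(\<Oplus>j\<in>{..<q}. \<phi> (f j \<otimes> r) \<odot> (m \<otimes> e j)) = m \<otimes> r"
proof -
  have "m \<otimes> r = m \<otimes> (\<Oplus>j\<in>{..<q}. \<phi> (f j \<otimes> r) \<odot> e j)" using r by (simp add: frobenius_right)
  also have "\<dots> = (\<Oplus>j\<in>{..<q}. m \<otimes> (\<phi> (f j \<otimes> r) \<odot> e j))"
    by (rule finsum_rdistr) (use r m in auto)
  also have "\<dots> = (\<Oplus>j\<in>{..<q}. \<phi> (f j \<otimes> r) \<odot> (m \<otimes> e j))"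
    by (rule finsum_cong') (use r m in \<open>auto simp: mult_smult\<close>)
  finally show ?thesis by simp
qed

abbreviation "I \<equiv> {..<p} \<times> {..<q}"
definition "lB i = rm (b (fst i)) (e (snd i))"
definition "rA i = (\<lambda>m\<in>carrier M. f (snd i) \<otimes> \<beta> (fst i) m)"

lemma lB_B [simp]: "i \<in> I \<Longrightarrow> lB i \<in> carrier B"
  unfolding lB_def by (rule rm_B) auto

lemma lB_T [simp]: "i \<in> I \<Longrightarrow> lB i \<in> carrier T"
  by (rule B_T) (rule lB_B)

lemma rA_A [simp]:
  assumes "i \<in> I"
  shows "rA i \<in> carrier A"
proof -
  have i: "f (snd i) \<in> carrier R" "\<beta> (fst i) \<in> carrier A" using assms by auto
  have c: "f (snd i) \<otimes> (\<iota> n \<otimes> y) = \<iota> n \<otimes> (f (snd i) \<otimes> y)" if "n \<in> carrier N" "y \<in> carrier M" for n y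
    using that i by (simp add: m_assoc[symmetric] R_comm)
  show ?thesis unfolding rA_def by (rule A_I) (use i c in \<open>simp_all add: A_rules r_distr m_assoc\<close>)
qed

lemma finsum_I:
  "(\<And>i j. i < p \<Longrightarrow> j < q \<Longrightarrow> g i j \<in> carrier M) \<Longrightarrow>
    (\<Oplus>i\<in>I. g (fst i) (snd i)) = (\<Oplus>i\<in>{..<p}. \<Oplus>j\<in>{..<q}. g i j)"
  using M.add.finprod_Times[of "{..<p}" "{..<q}" g] by (simp add: case_prod_beta')

lemma finprod_I:
  "(\<And>i j. i < p \<Longrightarrow> j < q \<Longrightarrow> g i j \<in> carrier T) \<Longrightarrow>
    finprod T (\<lambda>i. g (fst i) (snd i)) I = finprod T (\<lambda>i. finprod T (g i) {..<q}) {..<p}"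
  using T.finprod_Times[of "{..<p}" "{..<q}" g] by (simp add: case_prod_beta')

lemma rm_finsum: "t \<in> carrier T \<Longrightarrow> g \<in> S \<rightarrow> carrier M \<Longrightarrow> rm t (finsum M g S) = finprod T (\<lambda>i. rm t (g i)) S"
  using hom_finsum[OF M.abelian_group_axioms T.comm_group_axioms, of "rm t" g S] by (simp add: hom_def rm_plus)

lemma lm_finsum: "t \<in> carrier T \<Longrightarrow> g \<in> S \<rightarrow> carrier M \<Longrightarrow> lm (finsum M g S) t = finprod T (\<lambda>i. lm (g i) t) S"
  using hom_finsum[OF M.abelian_group_axioms T.comm_group_axioms, of "\<lambda>x. lm x t" g S] by (simp add: hom_def lm_plus)

text \<open>The sum over j inserts the product of \<open>e j\<close> and \<open>f j\<close> between
  \<open>b i\<close> and \<open>\<beta> i x\<close>, and by index one these products add up to 1.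
  The enlarged families therefore satisfy the left quasibasis identity again.\<close>

lemma quasi:
  assumes x: "x \<in> carrier M"
  shows "finprod T (\<lambda>i. rm (lB i) (rA i x)) I = tn x \<one>"
proof -
  have "finprod T (\<lambda>i. rm (lB i) (rA i x)) I = finprod T (\<lambda>i. rm (b (fst i)) (e (snd i) \<otimes> (f (snd i) \<otimes> \<beta> (fst i) x))) I"
    by (rule T.finprod_cong') (use x in \<open>auto simp: lB_def rA_def rm_rm B_T\<close>)
  also have "\<dots> = finprod T (\<lambda>i. finprod T (\<lambda>j. rm (b i) (e j \<otimes> (f j \<otimes> \<beta> i x))) {..<q}) {..<p}"
    by (rule finprod_I) (use x in \<open>auto simp: B_T\<close>)
  also have "\<dots> = finprod T (\<lambda>i. rm (b i) (\<beta> i x)) {..<p}"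
  proof (rule T.finprod_cong')
    fix i assume i: "i \<in> {..<p}"
    have "finprod T (\<lambda>j. rm (b i) (e j \<otimes> (f j \<otimes> \<beta> i x))) {..<q} = rm (b i) (\<Oplus>j\<in>{..<q}. e j \<otimes> (f j \<otimes> \<beta> i x))"
      by (rule rm_finsum[symmetric]) (use x i in \<open>auto simp: B_T\<close>)
    also have "(\<Oplus>j\<in>{..<q}. e j \<otimes> (f j \<otimes> \<beta> i x)) = (\<Oplus>j\<in>{..<q}. e j \<otimes> f j \<otimes> \<beta> i x)"
      by (rule finsum_cong') (use x i in \<open>auto simp: m_assoc\<close>)
    also have "\<dots> = (\<Oplus>j\<in>{..<q}. e j \<otimes> f j) \<otimes> \<beta> i x"
      by (rule finsum_ldistr[symmetric]) (use x i in auto)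
    also have "\<dots> = \<beta> i x" using x i by (simp add: index_one)
    finally show "finprod T (\<lambda>j. rm (b i) (e j \<otimes> (f j \<otimes> \<beta> i x))) {..<q} = rm (b i) (\<beta> i x)" .
  qed (use x in \<open>auto simp: B_T\<close>)
  finally show ?thesis using x by (simp add: left_eq)
qed

lemma quasi_M:
  assumes h: "\<And>t. t \<in> carrier T \<Longrightarrow> h t \<in> carrier M"
    "\<And>s t. s \<in> carrier T \<Longrightarrow> t \<in> carrier T \<Longrightarrow> h (s \<otimes>\<^bsub>T\<^esub> t) = h s \<oplus> h t" and x: "x \<in> carrier M"
  shows "(\<Oplus>i\<in>I. h (rm (lB i) (rA i x))) = h (tn x \<one>)"
  unfolding quasi[OF x, symmetric]
  by (rule T_hom_finsum[symmetric]) (use h x in auto)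

text \<open>The image of \<open>quasi\<close> under t \<mapsto> a(x t^1) t^2. It says a_1(x) a_2(y)
  = a(xy), the characteristic property of the coproduct of \<open>A\<close>.\<close>

lemma quasi_lc:
  assumes "a \<in> carrier A" "x \<in> carrier M" "y \<in> carrier M"
  shows "(\<Oplus>i\<in>I. lc a (lB i) x \<otimes> rA i y) = a (x \<otimes> y)"
proof -
  have "(\<Oplus>i\<in>I. rb (lm x (rm (lB i) (rA i y))) a) = a (x \<otimes> y)"
    using quasi_M[of "\<lambda>t. rb (lm x t) a" y] assms by (simp add: lm_add rb_add lm_tn rb_tn)
  moreover have "(\<Oplus>i\<in>I. lc a (lB i) x \<otimes> rA i y) = (\<Oplus>i\<in>I. rb (lm x (rm (lB i) (rA i y))) a)"
    by (rule finsum_cong') (use assms in \<open>simp_all add: lc_apply lm_rm[symmetric] rb_rm Pi_iff\<close>)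
  ultimately show ?thesis by simp
qed

text \<open>The image of \<open>quasi\<close> under t \<mapsto> t^1 a(t^2), evaluated on x \<otimes>
  1.\<close>

lemma quasi_la:
  assumes "a \<in> carrier A" "x \<in> carrier M"
  shows "(\<Oplus>i\<in>I. la (lB i) a (rA i x)) = x \<otimes> a \<one>"
proof -
  have "(\<Oplus>i\<in>I. br (rm (lB i) (rA i x)) a) = x \<otimes> a \<one>"
    using quasi_M[of "\<lambda>t. br t a" x] assms by (simp add: br_add br_tn)
  moreover have "(\<Oplus>i\<in>I. la (lB i) a (rA i x)) = (\<Oplus>i\<in>I. br (rm (lB i) (rA i x)) a)"
    by (rule finsum_cong') (use assms in \<open>simp_all add: la_apply Pi_iff\<close>)
  ultimately show ?thesis by simp
qed

section \<open>The two forms and the expansions in the dual bases of the second\<close>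

definition "P t a = \<phi> (br t a)"
definition "\<tau> t a = \<phi> (rb t a)"

lemma P_bil: "k_bilinear K B A (base_module K) P"
  by (rule k_bilinearI)
    (simp_all add: P_def br_R br_add br_plus br_smult br_sm B_T B_simps(4) \<phi>_add \<phi>_smult)

lemma \<tau>_bil: "k_bilinear K B A (base_module K) \<tau>"
  by (rule k_bilinearI)
    (simp_all add: \<tau>_def rb_R rb_add rb_plus rb_smult rb_sm B_T B_simps(4) \<phi>_add \<phi>_smult)

lemma P_closed [simp]: "t \<in> carrier B \<Longrightarrow> a \<in> carrier A \<Longrightarrow> P t a \<in> carrier K"
  and \<tau>_closed [simp]: "t \<in> carrier B \<Longrightarrow> a \<in> carrier A \<Longrightarrow> \<tau> t a \<in> carrier K"
  by (simp_all add: P_def \<tau>_def br_R rb_R)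

lemma \<tau>_lB: "i < p \<Longrightarrow> j < q \<Longrightarrow> a \<in> carrier A \<Longrightarrow> \<tau> (lB (i, j)) a = \<phi> (rb (b i) a \<otimes> e j)"
  by (simp add: \<tau>_def lB_def rb_rm B_T)

text \<open>For fixed i the Frobenius expansion rebuilds a(b^1) b^2 in front of
  \<open>\<beta> i m\<close>; summing over i is then the left quasibasis identity pushed through t
  \<mapsto> a(t^1) t^2.\<close>

lemma \<tau>_dual_A:
  assumes a: "a \<in> carrier A"
  shows "a = (\<Oplus>\<^bsub>A\<^esub>i\<in>I. \<tau> (lB i) a \<odot>\<^bsub>A\<^esub> rA i)"
proof (rule A_eqI[OF a])
  have cl: "(\<lambda>i. \<tau> (lB i) a \<odot>\<^bsub>A\<^esub> rA i) \<in> I \<rightarrow> carrier A" using a by (simp add: Pi_iff)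
  then show "(\<Oplus>\<^bsub>A\<^esub>i\<in>I. \<tau> (lB i) a \<odot>\<^bsub>A\<^esub> rA i) \<in> carrier A" by (rule Am.finsum_closed)
  fix m assume m: "m \<in> carrier M"
  have "(\<Oplus>\<^bsub>A\<^esub>i\<in>I. \<tau> (lB i) a \<odot>\<^bsub>A\<^esub> rA i) m = (\<Oplus>i\<in>I. \<phi> (rb (b (fst i)) a \<otimes> e (snd i)) \<odot> (f (snd i) \<otimes> \<beta> (fst i) m))"
    unfolding finsum_A_apply[OF cl m]
    by (rule finsum_cong') (use a m in \<open>auto simp: A_smult_apply rA_def \<tau>_lB rb_R\<close>)
  also have "\<dots> = (\<Oplus>i\<in>{..<p}. \<Oplus>j\<in>{..<q}. \<phi> (rb (b i) a \<otimes> e j) \<odot> (f j \<otimes> \<beta> i m))"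
    by (rule finsum_I) (use a m in \<open>auto simp: rb_R\<close>)
  also have "\<dots> = (\<Oplus>i\<in>{..<p}. rb (rm (b i) (\<beta> i m)) a)"
    by (rule finsum_cong') (use a m in \<open>auto simp: collapse_left rb_R rb_rm B_T\<close>)
  also have "\<dots> = rb (finprod T (\<lambda>i. rm (b i) (\<beta> i m)) {..<p}) a"
    by (rule T_hom_finsum[symmetric]) (use a m in \<open>auto simp: B_T rb_add\<close>)
  also have "\<dots> = a m" using a m by (simp add: left_eq rb_tn)
  finally show "a m = (\<Oplus>\<^bsub>A\<^esub>i\<in>I. \<tau> (lB i) a \<odot>\<^bsub>A\<^esub> rA i) m" by simp
qed

text \<open>The other Frobenius expansion absorbs \<open>f j\<close> and \<open>e j\<close> and
  leaves \<open>b i\<close> times \<beta>(t^1) t^2. On pure tensors this is the left quasibasis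
  identity multiplied by the second leg.\<close>

lemma \<tau>_dual_B:
  assumes t: "t \<in> carrier B"
  shows "t = (\<Oplus>\<^bsub>B\<^esub>i\<in>I. \<tau> t (rA i) \<odot>\<^bsub>B\<^esub> lB i)"
proof -
  have rb_rA: "rb t (rA i) = f (snd i) \<otimes> rb t (\<beta> (fst i))" if i: "i \<in> I" and t: "t \<in> carrier T" for i t
  proof -
    have i': "f (snd i) \<in> carrier R" "\<beta> (fst i) \<in> carrier A" using i by auto
    have ap: "rA i x = f (snd i) \<otimes> \<beta> (fst i) x" if "x \<in> carrier M" for x using that by (simp add: rA_def)
    show ?thesis
      by (rule M_eqI[OF t]) (use i' rA_A[OF i] in \<open>simp_all add: T_ops ap r_distr m_assoc\<close>)
  qed
  have cl: "(\<lambda>i. \<tau> t (rA i) \<odot>\<^bsub>B\<^esub> lB i) \<in> I \<rightarrow> carrier B" using t by (simp add: Pi_iff)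
  have "(\<Oplus>\<^bsub>B\<^esub>i\<in>I. \<tau> t (rA i) \<odot>\<^bsub>B\<^esub> lB i) = finprod T (\<lambda>i. \<tau> t (rA i) \<odot>\<^bsub>B\<^esub> lB i) I"
    by (rule finsum_B[OF cl])
  also have "\<dots> = finprod T (\<lambda>i. rm (b (fst i)) (\<phi> (f (snd i) \<otimes> rb t (\<beta> (fst i))) \<odot> e (snd i))) I"
    by (rule T.finprod_cong') (use t in \<open>auto simp: \<tau>_def rb_rA lB_def rm_smult B_T rb_R\<close>)
  also have "\<dots> = finprod T (\<lambda>i. finprod T (\<lambda>j. rm (b i) (\<phi> (f j \<otimes> rb t (\<beta> i)) \<odot> e j)) {..<q}) {..<p}"
    by (rule finprod_I) (use t in \<open>auto simp: B_T rb_R\<close>)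
  also have "\<dots> = finprod T (\<lambda>i. rm (b i) (rb t (\<beta> i))) {..<p}"
  proof (rule T.finprod_cong')
    fix i assume i: "i \<in> {..<p}"
    have "finprod T (\<lambda>j. rm (b i) (\<phi> (f j \<otimes> rb t (\<beta> i)) \<odot> e j)) {..<q}
        = rm (b i) (\<Oplus>j\<in>{..<q}. \<phi> (f j \<otimes> rb t (\<beta> i)) \<odot> e j)"
      by (rule rm_finsum[symmetric]) (use i t in \<open>auto simp: B_T rb_R\<close>)
    then show "finprod T (\<lambda>j. rm (b i) (\<phi> (f j \<otimes> rb t (\<beta> i)) \<odot> e j)) {..<q} = rm (b i) (rb t (\<beta> i))"
      using i t by (simp add: frobenius_right rb_R)
  qed (use t in \<open>auto simp: B_T\<close>)
  also have "\<dots> = t"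
  proof (rule T_finprod_ident[OF B_T[OF t]])
    fix x y assume xy: "x \<in> carrier M" "y \<in> carrier M"
    have "finprod T (\<lambda>i. rm (b i) (rb (tn x y) (\<beta> i))) {..<p} = finprod T (\<lambda>i. rm (rm (b i) (\<beta> i x)) y) {..<p}"
      by (rule T.finprod_cong') (use xy in \<open>auto simp: rb_tn rm_rm B_T\<close>)
    also have "\<dots> = rm (finprod T (\<lambda>i. rm (b i) (\<beta> i x)) {..<p}) y"
      using hom_finprod[OF T.comm_group_axioms T.comm_group_axioms, of "\<lambda>t. rm t y" "\<lambda>i. rm (b i) (\<beta> i x)" "{..<p}"] xy
      by (simp add: hom_def rm_add B_T)
    also have "\<dots> = tn x y" using xy by (simp add: left_eq rm_tn)
    finally show "finprod T (\<lambda>i. rm (b i) (rb (tn x y) (\<beta> i))) {..<p} = tn x y" .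
  qed (simp_all add: B_T rb_add rm_plus)
  finally show ?thesis by simp
qed

text \<open>The collapsing rule: a sum over \<open>I\<close> against these coordinates is a linear
  functional applied to an expanded element. The sums over coproduct legs below are evaluated by it
  or by its twin for \<open>B\<close>.\<close>

lemma \<tau>_expand_A:
  assumes "k_linear K A (base_module K) g" "a \<in> carrier A"
  shows "(\<Oplus>\<^bsub>K\<^esub>i\<in>I. \<tau> (lB i) a \<otimes>\<^bsub>K\<^esub> g (rA i)) = g a"
proof -
  have cl: "(\<lambda>i. \<tau> (lB i) a \<odot>\<^bsub>A\<^esub> rA i) \<in> I \<rightarrow> carrier A" using assms by (simp add: Pi_iff)
  have "g (\<Oplus>\<^bsub>A\<^esub>i\<in>I. \<tau> (lB i) a \<odot>\<^bsub>A\<^esub> rA i) = (\<Oplus>\<^bsub>K\<^esub>i\<in>I. g (\<tau> (lB i) a \<odot>\<^bsub>A\<^esub> rA i))"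
    using k_linear_finsum[OF Am.abelian_group_axioms _ assms(1) cl] module.axioms(2)[OF base_module_module[OF K.is_cring]]
    by (simp add: finsum_base_module)
  also have "\<dots> = (\<Oplus>\<^bsub>K\<^esub>i\<in>I. \<tau> (lB i) a \<otimes>\<^bsub>K\<^esub> g (rA i))"
    by (rule K.finsum_cong')
      (use assms(2) k_linear_closed[OF assms(1)] k_linear_smult[OF assms(1)] in \<open>simp_all add: Pi_iff\<close>)
  finally show ?thesis using \<tau>_dual_A[OF assms(2)] by simp
qed

lemma \<tau>_expand_B:
  assumes "k_linear K B (base_module K) g" "t \<in> carrier B"
  shows "(\<Oplus>\<^bsub>K\<^esub>i\<in>I. \<tau> t (rA i) \<otimes>\<^bsub>K\<^esub> g (lB i)) = g t"
proof -
  have cl: "(\<lambda>i. \<tau> t (rA i) \<odot>\<^bsub>B\<^esub> lB i) \<in> I \<rightarrow> carrier B" using assms by (simp add: Pi_iff)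
  have "g (\<Oplus>\<^bsub>B\<^esub>i\<in>I. \<tau> t (rA i) \<odot>\<^bsub>B\<^esub> lB i) = (\<Oplus>\<^bsub>K\<^esub>i\<in>I. g (\<tau> t (rA i) \<odot>\<^bsub>B\<^esub> lB i))"
    using k_linear_finsum[OF B_abelian_group _ assms(1) cl] module.axioms(2)[OF base_module_module[OF K.is_cring]]
    by (simp add: finsum_base_module)
  also have "\<dots> = (\<Oplus>\<^bsub>K\<^esub>i\<in>I. \<tau> t (rA i) \<otimes>\<^bsub>K\<^esub> g (lB i))"
    by (rule K.finsum_cong')
      (use assms(2) k_linear_closed[OF assms(1)] k_linear_smult[OF assms(1)] in \<open>simp_all add: Pi_iff\<close>)
  finally show ?thesis using \<tau>_dual_B[OF assms(2)] by simp
qed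


section \<open>The scalar identities\<close>

lemma P_right: "t \<in> carrier B \<Longrightarrow> k_linear K A (base_module K) (P t)"
  and P_left: "a \<in> carrier A \<Longrightarrow> k_linear K B (base_module K) (\<lambda>t. P t a)"
  and \<tau>_right: "t \<in> carrier B \<Longrightarrow> k_linear K A (base_module K) (\<tau> t)"
  using k_bilinear_left[OF P_bil] k_bilinear_right[OF P_bil] k_bilinear_right[OF \<tau>_bil]
  by simp_all

lemma P_mult: "a \<in> carrier A \<Longrightarrow> t \<in> carrier B \<Longrightarrow> t' \<in> carrier B \<Longrightarrow> P (t \<otimes>\<^bsub>B\<^esub> t') a = P t' (la t a)"
  by (simp add: P_def br_mult B_T)

lemma \<tau>_la: "a \<in> carrier A \<Longrightarrow> t \<in> carrier B \<Longrightarrow> t' \<in> carrier B \<Longrightarrow> \<tau> t' (la t a) = P t (lc a t')"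
  by (simp add: P_def \<tau>_def rb_la)

lemma P_comp: "a \<in> carrier A \<Longrightarrow> a' \<in> carrier A \<Longrightarrow> t \<in> carrier B \<Longrightarrow> P t (a \<otimes>\<^bsub>A\<^esub> a') = P (m2 a' t) a"
  by (simp add: P_def br_comp B_T)

lemma \<tau>_m2: "a \<in> carrier A \<Longrightarrow> x \<in> carrier A \<Longrightarrow> t \<in> carrier B \<Longrightarrow> \<tau> (m2 a t) x = P (m1 x t) a"
  by (simp add: P_def \<tau>_def rb_m2 B_T)

text \<open>\<open>la t a\<close> is expanded in the right legs \<open>rA i\<close>; by
  \<open>rb_la\<close> its coordinates are the pairings of \<open>t\<close> with the left legs. So
  the coproduct of \<open>A\<close> is transposed to the product of \<open>B\<close>.\<close>

lemma P_mult_expand: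
  assumes "a \<in> carrier A" "t \<in> carrier B" "t' \<in> carrier B"
  shows "P (t \<otimes>\<^bsub>B\<^esub> t') a = (\<Oplus>\<^bsub>K\<^esub>i\<in>I. P t (lc a (lB i)) \<otimes>\<^bsub>K\<^esub> P t' (rA i))"
proof -
  have "(\<Oplus>\<^bsub>K\<^esub>i\<in>I. \<tau> (lB i) (la t a) \<otimes>\<^bsub>K\<^esub> P t' (rA i)) = P t' (la t a)"
    by (rule \<tau>_expand_A[OF P_right]) (use assms in simp_all)
  then show ?thesis using assms by (simp add: P_mult \<tau>_la cong: K.finsum_cong)
qed

text \<open>Here \<open>m2 a' t\<close> is expanded in the left legs \<open>lB i\<close>, and
  \<open>rb_m2\<close> turns its coordinates into pairings of the right legs with
  \<open>a'\<close>.\<close>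

lemma P_comp_expand:
  assumes "a \<in> carrier A" "a' \<in> carrier A" "t \<in> carrier B"
  shows "P t (a \<otimes>\<^bsub>A\<^esub> a') = (\<Oplus>\<^bsub>K\<^esub>i\<in>I. P (lB i) a \<otimes>\<^bsub>K\<^esub> P (m1 (rA i) t) a')"
proof -
  have "(\<Oplus>\<^bsub>K\<^esub>i\<in>I. \<tau> (m2 a' t) (rA i) \<otimes>\<^bsub>K\<^esub> P (lB i) a) = P (m2 a' t) a"
    by (rule \<tau>_expand_B[OF P_left]) (use assms in simp_all)
  moreover have "(\<Oplus>\<^bsub>K\<^esub>i\<in>I. \<tau> (m2 a' t) (rA i) \<otimes>\<^bsub>K\<^esub> P (lB i) a)
    = (\<Oplus>\<^bsub>K\<^esub>i\<in>I. P (lB i) a \<otimes>\<^bsub>K\<^esub> P (m1 (rA i) t) a')"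
    by (rule K.finsum_cong') (use assms in \<open>simp_all add: \<tau>_m2 K.m_comm Pi_iff\<close>)
  ultimately show ?thesis using assms by (simp add: P_comp)
qed

lemma P_one_left: "P \<one>\<^bsub>B\<^esub> a = \<phi> (a \<one>)" if "a \<in> carrier A"
  using that by (simp add: P_def B_simps(2) br_tn)

abbreviation "\<epsilon>A a \<equiv> \<phi> (a \<one>)"
abbreviation "\<epsilon>B t \<equiv> P t \<one>\<^bsub>A\<^esub>"
abbreviation "lA i a \<equiv> lc a (lB i)"
abbreviation "rB i t \<equiv> m1 (rA i) t"

text \<open>For fixed j the right-hand factors of both compositions move into second legs of
  \<open>t\<close> and \<open>t'\<close> by \<open>P_comp\<close>, and the sum over i collapses
  through \<open>P_mult_expand\<close>. The sum over j is then taken inside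
  \<open>A\<close>.\<close>

lemma mult_compatible:
  assumes t: "t \<in> carrier B" "t' \<in> carrier B" and a: "a \<in> carrier A" "a' \<in> carrier A"
  shows "(\<Oplus>\<^bsub>K\<^esub>i\<in>I. \<Oplus>\<^bsub>K\<^esub>j\<in>I. P t (lA i a \<otimes>\<^bsub>A\<^esub> lA j a') \<otimes>\<^bsub>K\<^esub> P t' (rA i \<otimes>\<^bsub>A\<^esub> rA j)) = P (t \<otimes>\<^bsub>B\<^esub> t') (a \<otimes>\<^bsub>A\<^esub> a')"
proof -
  have "(\<Oplus>\<^bsub>K\<^esub>i\<in>I. \<Oplus>\<^bsub>K\<^esub>j\<in>I. P t (lA i a \<otimes>\<^bsub>A\<^esub> lA j a') \<otimes>\<^bsub>K\<^esub> P t' (rA i \<otimes>\<^bsub>A\<^esub> rA j))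
    = (\<Oplus>\<^bsub>K\<^esub>j\<in>I. \<Oplus>\<^bsub>K\<^esub>i\<in>I. P t (lA i a \<otimes>\<^bsub>A\<^esub> lA j a') \<otimes>\<^bsub>K\<^esub> P t' (rA i \<otimes>\<^bsub>A\<^esub> rA j))"
    by (rule K.finsum_swap) (use t a in \<open>simp_all add: A_mult_closed\<close>)
  also have "\<dots> = (\<Oplus>\<^bsub>K\<^esub>j\<in>I. P t' (la (m2 (lA j a') t) a \<otimes>\<^bsub>A\<^esub> rA j))"
  proof (rule K.finsum_cong')
    fix j assume j: "j \<in> I"
    have "(\<Oplus>\<^bsub>K\<^esub>i\<in>I. P t (lA i a \<otimes>\<^bsub>A\<^esub> lA j a') \<otimes>\<^bsub>K\<^esub> P t' (rA i \<otimes>\<^bsub>A\<^esub> rA j))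
      = (\<Oplus>\<^bsub>K\<^esub>i\<in>I. P (m2 (lA j a') t) (lA i a) \<otimes>\<^bsub>K\<^esub> P (m2 (rA j) t') (rA i))"
      by (rule K.finsum_cong') (use t a j in \<open>simp_all add: P_comp Pi_iff\<close>)
    also have "\<dots> = P (m2 (lA j a') t \<otimes>\<^bsub>B\<^esub> m2 (rA j) t') a"
      by (rule P_mult_expand[symmetric]) (use t a j in simp_all)
    also have "\<dots> = P t' (la (m2 (lA j a') t) a \<otimes>\<^bsub>A\<^esub> rA j)"
      using t a j by (simp add: P_mult P_comp)
    finally show "(\<Oplus>\<^bsub>K\<^esub>i\<in>I. P t (lA i a \<otimes>\<^bsub>A\<^esub> lA j a') \<otimes>\<^bsub>K\<^esub> P t' (rA i \<otimes>\<^bsub>A\<^esub> rA j)) = \<dots>" .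
  qed (use t a in \<open>simp_all add: A_mult_closed Pi_iff\<close>)
  also have "\<dots> = P t' (\<Oplus>\<^bsub>A\<^esub>j\<in>I. la (m2 (lA j a') t) a \<otimes>\<^bsub>A\<^esub> rA j)"
    using k_linear_finsum[OF Am.abelian_group_axioms _ P_right[OF t(2)], of "\<lambda>j. la (m2 (lA j a') t) a \<otimes>\<^bsub>A\<^esub> rA j" I]
      module.axioms(2)[OF base_module_module[OF K.is_cring]] t a
    by (simp add: finsum_base_module A_mult_closed Pi_iff)
  \<comment> \<open>At m each summand is t^1 a(x r), with x the left leg of a' at t^2 and r the
    right leg at m; \<open>quasi_lc\<close> adds up these arguments to a'(t^2 m).\<close>
  also have "(\<Oplus>\<^bsub>A\<^esub>j\<in>I. la (m2 (lA j a') t) a \<otimes>\<^bsub>A\<^esub> rA j) = la t (a \<otimes>\<^bsub>A\<^esub> a')"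
  proof (rule A_eqI)
    have cl: "(\<lambda>j. la (m2 (lA j a') t) a \<otimes>\<^bsub>A\<^esub> rA j) \<in> I \<rightarrow> carrier A" using t a by (simp add: A_mult_closed Pi_iff)
    then show "(\<Oplus>\<^bsub>A\<^esub>j\<in>I. la (m2 (lA j a') t) a \<otimes>\<^bsub>A\<^esub> rA j) \<in> carrier A" by (rule Am.finsum_closed)
    fix m assume m: "m \<in> carrier M"
    have "(\<Oplus>\<^bsub>A\<^esub>j\<in>I. la (m2 (lA j a') t) a \<otimes>\<^bsub>A\<^esub> rA j) m = (\<Oplus>j\<in>I. br (rm (m2 (lA j a') t) (rA j m)) a)"
      unfolding finsum_A_apply[OF cl m]
      by (rule finsum_cong') (use t a m in \<open>simp_all add: applies B_T Pi_iff\<close>)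
    also have "\<dots> = br (rm t m) (a \<otimes>\<^bsub>A\<^esub> a')"
    proof (rule M_eqI_finsum[OF B_T[OF t(1)]])
      fix x y assume xy: "x \<in> carrier M" "y \<in> carrier M"
      have "(\<Oplus>j\<in>I. br (rm (m2 (lA j a') (tn x y)) (rA j m)) a) = (\<Oplus>j\<in>I. x \<otimes> a (lA j a' y \<otimes> rA j m))"
        by (rule finsum_cong') (use a m xy in \<open>simp_all add: T_ops Pi_iff\<close>)
      also have "\<dots> = x \<otimes> (\<Oplus>j\<in>I. a (lA j a' y \<otimes> rA j m))"
        by (rule finsum_rdistr[symmetric]) (use a m xy in \<open>simp_all add: Pi_iff\<close>)
      also have "(\<Oplus>j\<in>I. a (lA j a' y \<otimes> rA j m)) = a (\<Oplus>j\<in>I. lA j a' y \<otimes> rA j m)"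
        using hom_finsum[OF M.abelian_group_axioms M.a_comm_group, of a "\<lambda>j. lA j a' y \<otimes> rA j m" I] a m xy
        by (simp add: hom_def A_add finsum_def Pi_iff)
      also have "\<dots> = a (a' (y \<otimes> m))" using a m xy by (simp add: quasi_lc)
      finally show "(\<Oplus>j\<in>I. br (rm (m2 (lA j a') (tn x y)) (rA j m)) a) = br (rm (tn x y) m) (a \<otimes>\<^bsub>A\<^esub> a')"
        using a m xy by (simp add: T_ops A_mult_closed A_mult_apply)
    qed (use a m in \<open>simp_all add: T_ops A_mult_closed Pi_iff\<close>)
    finally show "(\<Oplus>\<^bsub>A\<^esub>j\<in>I. la (m2 (lA j a') t) a \<otimes>\<^bsub>A\<^esub> rA j) m = la t (a \<otimes>\<^bsub>A\<^esub> a') m" using m by (simp add: la_apply)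
  qed (use t a in \<open>simp add: A_mult_closed\<close>)
  finally show ?thesis using t a by (simp add: P_mult A_mult_closed)
qed

section \<open>Counits of products\<close>

definition "wA a = (\<Oplus>j\<in>{..<q}. \<phi> (a (e j)) \<odot> f j)"
definition "wB t = (\<Oplus>j\<in>{..<q}. \<phi> (br t (lam (f j))) \<odot> e j)"

lemma wA_R: "a \<in> carrier A \<Longrightarrow> wA a \<in> carrier R"
  unfolding wA_def by (rule finsum_R_closed) (simp add: A_one_R Pi_iff)

lemma wB_R: "t \<in> carrier B \<Longrightarrow> wB t \<in> carrier R"
  unfolding wB_def by (rule finsum_R_closed) (simp add: br_R Pi_iff)

text \<open>The Frobenius form represents functionals on \<open>R\<close> by elements of
  \<open>R\<close>: \<open>wA a\<close> stands for z \<mapsto> \<phi>(a(z)) and is assembled from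
  its values at \<open>e j\<close>. After trading scalars, the expansion of \<open>z\<close>
  reappears under \<open>a\<close>.\<close>

lemma \<phi>_wA:
  assumes a: "a \<in> carrier A" and z: "z \<in> carrier R"
  shows "\<phi> (wA a \<otimes> z) = \<phi> (a z)"
proof -
  have "wA a \<otimes> z = (\<Oplus>j\<in>{..<q}. \<phi> (a (e j)) \<odot> f j \<otimes> z)"
    unfolding wA_def by (rule finsum_ldistr) (use a z in \<open>simp_all add: A_one_R Pi_iff\<close>)
  also have "\<phi> \<dots> = (\<Oplus>\<^bsub>K\<^esub>j\<in>{..<q}. \<phi> (\<phi> (a (e j)) \<odot> f j \<otimes> z))"
    by (rule \<phi>_finsum) (use a z in \<open>simp_all add: A_one_R Pi_iff\<close>)
  also have "\<dots> = (\<Oplus>\<^bsub>K\<^esub>j\<in>{..<q}. \<phi> (\<phi> (f j \<otimes> z) \<odot> a (e j)))"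
    by (rule K.finsum_cong') (use a z in \<open>simp_all add: A_one_R smult_mult \<phi>_smult K.m_comm Pi_iff\<close>)
  also have "\<dots> = \<phi> (\<Oplus>j\<in>{..<q}. \<phi> (f j \<otimes> z) \<odot> a (e j))"
    by (rule \<phi>_finsum[symmetric]) (use a z in \<open>simp_all add: A_one_R Pi_iff\<close>)
  also have "(\<Oplus>j\<in>{..<q}. \<phi> (f j \<otimes> z) \<odot> a (e j)) = (\<Oplus>j\<in>{..<q}. a (\<phi> (f j \<otimes> z) \<odot> e j))"
    by (rule finsum_cong') (use a z in \<open>simp_all add: A_smult Pi_iff\<close>)
  also have "\<dots> = a (\<Oplus>j\<in>{..<q}. \<phi> (f j \<otimes> z) \<odot> e j)"
    using hom_finsum[OF M.abelian_group_axioms M.a_comm_group, of a "\<lambda>j. \<phi> (f j \<otimes> z) \<odot> e j" "{..<q}"] a z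
    by (simp add: hom_def A_add finsum_def Pi_iff)
  finally show ?thesis using z by (simp add: frobenius_right)
qed

text \<open>The same representation for r \<mapsto> \<phi>(t^1 r t^2), on the other side of the
  form; the scalars rebuild \<open>lam r\<close> from the \<open>lam (f j)\<close>.\<close>

lemma \<phi>_wB:
  assumes t: "t \<in> carrier B" and r: "r \<in> carrier R"
  shows "\<phi> (r \<otimes> wB t) = \<phi> (br t (lam r))"
proof -
  have "r \<otimes> wB t = (\<Oplus>j\<in>{..<q}. r \<otimes> (\<phi> (br t (lam (f j))) \<odot> e j))"
    unfolding wB_def by (rule finsum_rdistr) (use t r in \<open>simp_all add: br_R Pi_iff\<close>)
  also have "\<phi> \<dots> = (\<Oplus>\<^bsub>K\<^esub>j\<in>{..<q}. \<phi> (r \<otimes> (\<phi> (br t (lam (f j))) \<odot> e j)))"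
    by (rule \<phi>_finsum) (use t r in \<open>simp_all add: br_R Pi_iff\<close>)
  also have "\<dots> = (\<Oplus>\<^bsub>K\<^esub>j\<in>{..<q}. P t (\<phi> (r \<otimes> e j) \<odot>\<^bsub>A\<^esub> lam (f j)))"
    by (rule K.finsum_cong') (use t r in \<open>simp_all add: P_def br_R mult_smult \<phi>_smult br_smult B_T K.m_comm Pi_iff\<close>)
  also have "\<dots> = P t (\<Oplus>\<^bsub>A\<^esub>j\<in>{..<q}. \<phi> (r \<otimes> e j) \<odot>\<^bsub>A\<^esub> lam (f j))"
    using k_linear_finsum[OF Am.abelian_group_axioms _ P_right[OF t], of "\<lambda>j. \<phi> (r \<otimes> e j) \<odot>\<^bsub>A\<^esub> lam (f j)" "{..<q}"]
      module.axioms(2)[OF base_module_module[OF K.is_cring]] r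
    by (simp add: finsum_base_module Pi_iff)
  also have "(\<Oplus>\<^bsub>A\<^esub>j\<in>{..<q}. \<phi> (r \<otimes> e j) \<odot>\<^bsub>A\<^esub> lam (f j)) = lam r"
  proof (rule A_eqI)
    have cl: "(\<lambda>j. \<phi> (r \<otimes> e j) \<odot>\<^bsub>A\<^esub> lam (f j)) \<in> {..<q} \<rightarrow> carrier A" using r by (simp add: Pi_iff)
    then show "(\<Oplus>\<^bsub>A\<^esub>j\<in>{..<q}. \<phi> (r \<otimes> e j) \<odot>\<^bsub>A\<^esub> lam (f j)) \<in> carrier A" by (rule Am.finsum_closed)
    fix m assume m: "m \<in> carrier M"
    have "(\<Oplus>\<^bsub>A\<^esub>j\<in>{..<q}. \<phi> (r \<otimes> e j) \<odot>\<^bsub>A\<^esub> lam (f j)) m = (\<Oplus>j\<in>{..<q}. \<phi> (r \<otimes> e j) \<odot> (f j \<otimes> m))"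
      unfolding finsum_A_apply[OF cl m]
      by (rule finsum_cong') (use r m in \<open>simp_all add: A_smult_apply lam_apply Pi_iff\<close>)
    then show "(\<Oplus>\<^bsub>A\<^esub>j\<in>{..<q}. \<phi> (r \<otimes> e j) \<odot>\<^bsub>A\<^esub> lam (f j)) m = lam r m"
      using r m by (simp add: collapse_left lam_apply)
  qed (use r in simp)
  finally show ?thesis by (simp add: P_def)
qed

text \<open>In the counit of a composition either factor can be absorbed into a tensor of
  \<open>B\<close>: the outer one through its representing element, the inner one through its value
  at 1.\<close>

lemma \<epsilon>A_mult_left: "a \<in> carrier A \<Longrightarrow> a' \<in> carrier A \<Longrightarrow> \<epsilon>A (a \<otimes>\<^bsub>A\<^esub> a') = P (tn (wA a) \<one>) a'"
  and \<epsilon>A_mult_right: "a \<in> carrier A \<Longrightarrow> a' \<in> carrier A \<Longrightarrow> \<epsilon>A (a \<otimes>\<^bsub>A\<^esub> a') = P (tn \<one> (a' \<one>)) a"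
  by (simp_all add: A_mult_apply P_def br_tn wA_R \<phi>_wA A_one_R)

lemma \<epsilon>B_mult_left: "t \<in> carrier B \<Longrightarrow> t' \<in> carrier B \<Longrightarrow> \<epsilon>B (t \<otimes>\<^bsub>B\<^esub> t') = P t' (lam (br t \<one>\<^bsub>A\<^esub>))"
  by (simp add: P_mult la_one)

lemma \<epsilon>B_mult_right: "t \<in> carrier B \<Longrightarrow> t' \<in> carrier B \<Longrightarrow> \<epsilon>B (t \<otimes>\<^bsub>B\<^esub> t') = P t (rho (wB t'))"
  using \<phi>_wB[of t' "br t \<one>\<^bsub>A\<^esub>"] br_rho[of "\<one>\<^bsub>A\<^esub>" "wB t'" t]
  by (simp add: P_def br_mult la_one br_R wB_R B_T)

text \<open>Absorbing both outer factors leaves the pairing of a' with w \<otimes> z, where w and z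
  lie in \<open>R\<close>. In \<open>B\<close> this tensor is the product of w \<otimes> 1 and 1
  \<otimes> z in either order, and \<open>P_mult_expand\<close> on the two orders gives the two
  identities.\<close>

lemma counit_A:
  assumes "a \<in> carrier A" "a' \<in> carrier A" "a'' \<in> carrier A"
  shows "(\<Oplus>\<^bsub>K\<^esub>i\<in>I. \<epsilon>A (a \<otimes>\<^bsub>A\<^esub> lA i a') \<otimes>\<^bsub>K\<^esub> \<epsilon>A (rA i \<otimes>\<^bsub>A\<^esub> a'')) = \<epsilon>A (a \<otimes>\<^bsub>A\<^esub> a' \<otimes>\<^bsub>A\<^esub> a'')"
    and "(\<Oplus>\<^bsub>K\<^esub>i\<in>I. \<epsilon>A (a \<otimes>\<^bsub>A\<^esub> rA i) \<otimes>\<^bsub>K\<^esub> \<epsilon>A (lA i a' \<otimes>\<^bsub>A\<^esub> a'')) = \<epsilon>A (a \<otimes>\<^bsub>A\<^esub> a' \<otimes>\<^bsub>A\<^esub> a'')"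
proof -
  let ?w = "tn (wA a) \<one>" and ?z = "tn \<one> (a'' \<one>)"
  have R: "wA a \<in> carrier R" "a'' \<one> \<in> carrier R" using assms by (simp_all add: wA_R A_one_R)
  then have wz: "?w \<in> carrier B" "?z \<in> carrier B" by (simp_all add: tn_B)
  have m: "?w \<otimes>\<^bsub>B\<^esub> ?z = tn (wA a) (a'' \<one>)" "?z \<otimes>\<^bsub>B\<^esub> ?w = tn (wA a) (a'' \<one>)"
    using R wz by (simp_all add: multB_tn lm_tn rm_tn)
  have v: "\<epsilon>A (a \<otimes>\<^bsub>A\<^esub> a' \<otimes>\<^bsub>A\<^esub> a'') = P (tn (wA a) (a'' \<one>)) a'"
    using assms R by (simp add: A_mult_apply P_def br_tn \<phi>_wA A_one_R)
  show "(\<Oplus>\<^bsub>K\<^esub>i\<in>I. \<epsilon>A (a \<otimes>\<^bsub>A\<^esub> lA i a') \<otimes>\<^bsub>K\<^esub> \<epsilon>A (rA i \<otimes>\<^bsub>A\<^esub> a'')) = \<epsilon>A (a \<otimes>\<^bsub>A\<^esub> a' \<otimes>\<^bsub>A\<^esub> a'')"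
    unfolding v m(1)[symmetric] P_mult_expand[OF assms(2) wz]
    by (rule K.finsum_cong') (use assms wz in \<open>simp_all add: \<epsilon>A_mult_left[of a] \<epsilon>A_mult_right[of _ a''] Pi_iff\<close>)
  show "(\<Oplus>\<^bsub>K\<^esub>i\<in>I. \<epsilon>A (a \<otimes>\<^bsub>A\<^esub> rA i) \<otimes>\<^bsub>K\<^esub> \<epsilon>A (lA i a' \<otimes>\<^bsub>A\<^esub> a'')) = \<epsilon>A (a \<otimes>\<^bsub>A\<^esub> a' \<otimes>\<^bsub>A\<^esub> a'')"
    unfolding v m(2)[symmetric] P_mult_expand[OF assms(2) wz(2,1)]
    by (rule K.finsum_cong') (use assms wz in \<open>simp_all add: \<epsilon>A_mult_left[of a] \<epsilon>A_mult_right[of _ a''] K.m_comm Pi_iff\<close>)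
qed

text \<open>The outer factors become a left and a right multiplication by elements of
  \<open>R\<close>. These commute in \<open>A\<close>, and \<open>P_comp_expand\<close> on the two
  orders gives the two identities.\<close>

lemma counit_B:
  assumes "t \<in> carrier B" "t' \<in> carrier B" "t'' \<in> carrier B"
  shows "(\<Oplus>\<^bsub>K\<^esub>i\<in>I. \<epsilon>B (t \<otimes>\<^bsub>B\<^esub> lB i) \<otimes>\<^bsub>K\<^esub> \<epsilon>B (rB i t' \<otimes>\<^bsub>B\<^esub> t'')) = \<epsilon>B (t \<otimes>\<^bsub>B\<^esub> t' \<otimes>\<^bsub>B\<^esub> t'')"
    and "(\<Oplus>\<^bsub>K\<^esub>i\<in>I. \<epsilon>B (t \<otimes>\<^bsub>B\<^esub> rB i t') \<otimes>\<^bsub>K\<^esub> \<epsilon>B (lB i \<otimes>\<^bsub>B\<^esub> t'')) = \<epsilon>B (t \<otimes>\<^bsub>B\<^esub> t' \<otimes>\<^bsub>B\<^esub> t'')"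
proof -
  let ?y = "lam (br t \<one>\<^bsub>A\<^esub>)" and ?w = "rho (wB t'')"
  have R: "br t \<one>\<^bsub>A\<^esub> \<in> carrier R" "wB t'' \<in> carrier R" using assms by (simp_all add: wB_R br_R)
  then have yw: "?y \<in> carrier A" "?w \<in> carrier A" by simp_all
  have v: "\<epsilon>B (t \<otimes>\<^bsub>B\<^esub> t' \<otimes>\<^bsub>B\<^esub> t'') = P t' (?y \<otimes>\<^bsub>A\<^esub> ?w)"
    unfolding \<epsilon>B_mult_right[OF mult_B_closed[OF assms(1,2)] assms(3)] using assms R by (simp add: P_mult la_rho)
  show "(\<Oplus>\<^bsub>K\<^esub>i\<in>I. \<epsilon>B (t \<otimes>\<^bsub>B\<^esub> lB i) \<otimes>\<^bsub>K\<^esub> \<epsilon>B (rB i t' \<otimes>\<^bsub>B\<^esub> t'')) = \<epsilon>B (t \<otimes>\<^bsub>B\<^esub> t' \<otimes>\<^bsub>B\<^esub> t'')"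
    unfolding v P_comp_expand[OF yw assms(2)]
    by (rule K.finsum_cong') (use assms yw in \<open>simp_all add: \<epsilon>B_mult_left[of t] \<epsilon>B_mult_right[of _ t''] Pi_iff\<close>)
  show "(\<Oplus>\<^bsub>K\<^esub>i\<in>I. \<epsilon>B (t \<otimes>\<^bsub>B\<^esub> rB i t') \<otimes>\<^bsub>K\<^esub> \<epsilon>B (lB i \<otimes>\<^bsub>B\<^esub> t'')) = \<epsilon>B (t \<otimes>\<^bsub>B\<^esub> t' \<otimes>\<^bsub>B\<^esub> t'')"
    unfolding v lam_rho[OF R, symmetric] P_comp_expand[OF yw(2,1) assms(2)]
    by (rule K.finsum_cong') (use assms yw in \<open>simp_all add: \<epsilon>B_mult_left[of t] \<epsilon>B_mult_right[of _ t''] K.m_comm Pi_iff\<close>)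
qed

section \<open>Counital projections and the antipode identities\<close>

lemma lA_lam: "i \<in> I \<Longrightarrow> a \<in> carrier A \<Longrightarrow> r \<in> carrier R \<Longrightarrow> \<phi> (lA i a r) = \<tau> (lB i) (a \<otimes>\<^bsub>A\<^esub> lam r)"
  by (simp add: \<tau>_def lc_apply rb_lam)

text \<open>The coefficients are the coordinates of \<open>lam (a \<one>)\<close>, so the sum is its
  expansion: the target projection of \<open>a\<close> is left multiplication by a(1).\<close>

lemma target_counit:
  assumes "t \<in> carrier B" "a \<in> carrier A"
  shows "(\<Oplus>\<^bsub>K\<^esub>i\<in>I. \<epsilon>A (lA i \<one>\<^bsub>A\<^esub> \<otimes>\<^bsub>A\<^esub> a) \<otimes>\<^bsub>K\<^esub> P t (rA i)) = P t (lam (a \<one>))"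
proof -
  have "(\<Oplus>\<^bsub>K\<^esub>i\<in>I. \<tau> (lB i) (lam (a \<one>)) \<otimes>\<^bsub>K\<^esub> P t (rA i)) = P t (lam (a \<one>))"
    by (rule \<tau>_expand_A[OF P_right]) (use assms in \<open>simp_all add: A_one_R\<close>)
  then show ?thesis using assms by (simp add: A_mult_apply lA_lam A_one_R cong: K.finsum_cong)
qed

lemma source_counit:
  assumes "t \<in> carrier B" "a \<in> carrier A"
  shows "(\<Oplus>\<^bsub>K\<^esub>i\<in>I. \<epsilon>A (a \<otimes>\<^bsub>A\<^esub> rA i) \<otimes>\<^bsub>K\<^esub> P t (lA i \<one>\<^bsub>A\<^esub>)) = \<phi> (a (br t \<one>\<^bsub>A\<^esub>))"
proof -
  have g: "k_linear K A (base_module K) (\<lambda>x. \<epsilon>A (a \<otimes>\<^bsub>A\<^esub> x))"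
    by (rule k_linearI)
      (use assms in \<open>simp_all add: A_mult_apply A_one_R A_plus_apply A_smult_apply A_add A_smult \<phi>_add \<phi>_smult\<close>)
  have "(\<Oplus>\<^bsub>K\<^esub>i\<in>I. \<tau> (lB i) (la t \<one>\<^bsub>A\<^esub>) \<otimes>\<^bsub>K\<^esub> \<epsilon>A (a \<otimes>\<^bsub>A\<^esub> rA i)) = \<epsilon>A (a \<otimes>\<^bsub>A\<^esub> la t \<one>\<^bsub>A\<^esub>)"
    by (rule \<tau>_expand_A[OF g]) (use assms in simp_all)
  moreover have "(\<Oplus>\<^bsub>K\<^esub>i\<in>I. \<tau> (lB i) (la t \<one>\<^bsub>A\<^esub>) \<otimes>\<^bsub>K\<^esub> \<epsilon>A (a \<otimes>\<^bsub>A\<^esub> rA i))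
    = (\<Oplus>\<^bsub>K\<^esub>i\<in>I. \<epsilon>A (a \<otimes>\<^bsub>A\<^esub> rA i) \<otimes>\<^bsub>K\<^esub> P t (lA i \<one>\<^bsub>A\<^esub>))"
    by (rule K.finsum_cong') (use assms in \<open>simp_all add: \<tau>_la A_mult_closed A_one_R K.m_comm Pi_iff\<close>)
  ultimately show ?thesis using assms by (simp add: A_mult_apply la_one lam_apply br_R B_T)
qed

text \<open>The sum over i expands \<open>la (lB k) a\<close>, since its coordinates are the values
  \<open>P (lB k) (lA i a)\<close>. What remains over k is \<open>quasi_la\<close> at the first leg
  of \<open>t\<close>, multiplied by the second.\<close>

lemma antipode_target:
  assumes "t \<in> carrier B" "a \<in> carrier A"
  shows "(\<Oplus>\<^bsub>K\<^esub>i\<in>I. \<Oplus>\<^bsub>K\<^esub>k\<in>I. P (lB k) (lA i a) \<otimes>\<^bsub>K\<^esub> \<tau> (rB k t) (rA i)) = P t (lam (a \<one>))"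
proof -
  have "(\<Oplus>\<^bsub>K\<^esub>i\<in>I. \<Oplus>\<^bsub>K\<^esub>k\<in>I. P (lB k) (lA i a) \<otimes>\<^bsub>K\<^esub> \<tau> (rB k t) (rA i))
    = (\<Oplus>\<^bsub>K\<^esub>k\<in>I. \<Oplus>\<^bsub>K\<^esub>i\<in>I. P (lB k) (lA i a) \<otimes>\<^bsub>K\<^esub> \<tau> (rB k t) (rA i))"
    by (rule K.finsum_swap) (use assms in simp_all)
  also have "\<dots> = (\<Oplus>\<^bsub>K\<^esub>k\<in>I. \<phi> (rb (rB k t) (la (lB k) a)))"
  proof (rule K.finsum_cong')
    fix k assume k: "k \<in> I"
    have "(\<Oplus>\<^bsub>K\<^esub>i\<in>I. \<tau> (lB i) (la (lB k) a) \<otimes>\<^bsub>K\<^esub> \<tau> (rB k t) (rA i)) = \<tau> (rB k t) (la (lB k) a)"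
      by (rule \<tau>_expand_A[OF \<tau>_right]) (use assms k in simp_all)
    then show "(\<Oplus>\<^bsub>K\<^esub>i\<in>I. P (lB k) (lA i a) \<otimes>\<^bsub>K\<^esub> \<tau> (rB k t) (rA i)) = \<phi> (rb (rB k t) (la (lB k) a))"
      using assms k by (simp add: \<tau>_la \<tau>_def[of "rB k t" "la (lB k) a"] cong: K.finsum_cong)
  qed (use assms in \<open>simp_all add: rb_R Pi_iff\<close>)
  also have "\<dots> = \<phi> (\<Oplus>k\<in>I. rb (rB k t) (la (lB k) a))"
    by (rule \<phi>_finsum[symmetric]) (use assms in \<open>simp add: rb_R Pi_iff\<close>)
  also have "(\<Oplus>k\<in>I. rb (rB k t) (la (lB k) a)) = br t (lam (a \<one>))"
  proof (rule M_eqI_finsum[OF B_T[OF assms(1)]])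
    fix x y assume xy: "x \<in> carrier M" "y \<in> carrier M"
    have "(\<Oplus>k\<in>I. rb (rB k (tn x y)) (la (lB k) a)) = (\<Oplus>k\<in>I. la (lB k) a (rA k x) \<otimes> y)"
      by (rule finsum_cong') (use assms xy in \<open>simp_all add: T_ops Pi_iff\<close>)
    also have "\<dots> = (\<Oplus>k\<in>I. la (lB k) a (rA k x)) \<otimes> y"
      by (rule finsum_ldistr[symmetric]) (use assms xy in \<open>simp_all add: Pi_iff\<close>)
    finally show "(\<Oplus>k\<in>I. rb (rB k (tn x y)) (la (lB k) a)) = br (tn x y) (lam (a \<one>))"
      using assms xy by (simp add: quasi_la br_tn lam_apply A_one_R m_assoc)
  qed (use assms in \<open>simp_all add: T_ops A_one_R\<close>)
  finally show ?thesis by (simp add: P_def)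
qed

text \<open>Here k is summed first: \<open>\<tau>_m2\<close> converts
  \<open>P (rB k t) (rA i)\<close> into a value of \<open>\<tau>\<close> at \<open>rA k\<close>, so
  the left legs of \<open>a\<close> are being expanded. The sum over i is \<open>quasi_lc\<close> at
  the two legs of \<open>t\<close>.\<close>

lemma antipode_source:
  assumes "t \<in> carrier B" "a \<in> carrier A"
  shows "(\<Oplus>\<^bsub>K\<^esub>i\<in>I. \<Oplus>\<^bsub>K\<^esub>k\<in>I. \<tau> (lB k) (lA i a) \<otimes>\<^bsub>K\<^esub> P (rB k t) (rA i)) = \<phi> (a (br t \<one>\<^bsub>A\<^esub>))"
proof -
  have "(\<Oplus>\<^bsub>K\<^esub>i\<in>I. \<Oplus>\<^bsub>K\<^esub>k\<in>I. \<tau> (lB k) (lA i a) \<otimes>\<^bsub>K\<^esub> P (rB k t) (rA i))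
    = (\<Oplus>\<^bsub>K\<^esub>i\<in>I. \<phi> (rb (m2 (rA i) t) (lA i a)))"
  proof (rule K.finsum_cong')
    fix i assume i: "i \<in> I"
    have "(\<Oplus>\<^bsub>K\<^esub>k\<in>I. \<tau> (lB k) (lA i a) \<otimes>\<^bsub>K\<^esub> \<tau> (m2 (rA i) t) (rA k)) = \<tau> (m2 (rA i) t) (lA i a)"
      by (rule \<tau>_expand_A[OF \<tau>_right]) (use assms i in simp_all)
    then show "(\<Oplus>\<^bsub>K\<^esub>k\<in>I. \<tau> (lB k) (lA i a) \<otimes>\<^bsub>K\<^esub> P (rB k t) (rA i)) = \<phi> (rb (m2 (rA i) t) (lA i a))"
      using assms i by (simp add: \<tau>_m2 \<tau>_def[of "m2 (rA i) t" "lA i a"] cong: K.finsum_cong)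
  qed (use assms in \<open>simp_all add: rb_R Pi_iff\<close>)
  also have "\<dots> = \<phi> (\<Oplus>i\<in>I. rb (m2 (rA i) t) (lA i a))"
    by (rule \<phi>_finsum[symmetric]) (use assms in \<open>simp add: rb_R Pi_iff\<close>)
  also have "(\<Oplus>i\<in>I. rb (m2 (rA i) t) (lA i a)) = a (br t \<one>\<^bsub>A\<^esub>)"
  proof (rule M_eqI_finsum[OF B_T[OF assms(1)]])
    fix x y assume xy: "x \<in> carrier M" "y \<in> carrier M"
    have "(\<Oplus>i\<in>I. rb (m2 (rA i) (tn x y)) (lA i a)) = (\<Oplus>i\<in>I. lA i a x \<otimes> rA i y)"
      by (rule finsum_cong') (use assms xy in \<open>simp_all add: T_ops Pi_iff\<close>)
    then show "(\<Oplus>i\<in>I. rb (m2 (rA i) (tn x y)) (lA i a)) = a (br (tn x y) \<one>\<^bsub>A\<^esub>)"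
      using assms xy by (simp add: quasi_lc br_tn one_A_apply)
  qed (use assms in \<open>simp_all add: T_ops A_add\<close>)
  finally show ?thesis .
qed

text \<open>The source projection contributes the elements \<open>r k\<close>, products of the legs
  of \<open>lB k\<close>. By \<open>lA_lam\<close> the sum over i expands a composed with left
  multiplication by \<open>r k\<close>; the sum over k disappears because \<open>quasi_la\<close>
  for the identity makes \<open>r k \<otimes> rA k x\<close> add up to x.\<close>

lemma antipode_triple:
  assumes "t \<in> carrier B" "a \<in> carrier A"
  shows "(\<Oplus>\<^bsub>K\<^esub>i\<in>I. \<Oplus>\<^bsub>K\<^esub>k\<in>I. \<phi> (lA i a (br (lB k) \<one>\<^bsub>A\<^esub>)) \<otimes>\<^bsub>K\<^esub> \<tau> (rB k t) (rA i)) = \<tau> t a"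
proof -
  define r where "r k = br (lB k) \<one>\<^bsub>A\<^esub>" for k
  have r: "r k \<in> carrier R" if "k \<in> I" for k unfolding r_def by (rule br_R) (use that in simp_all)
  have rx: "(\<Oplus>k\<in>I. r k \<otimes> rA k x) = x" if x: "x \<in> carrier M" for x
  proof -
    have "(\<Oplus>k\<in>I. r k \<otimes> rA k x) = (\<Oplus>k\<in>I. la (lB k) \<one>\<^bsub>A\<^esub> (rA k x))"
      by (rule finsum_cong') (use x in \<open>simp_all add: r_def la_apply br_rm_one Pi_iff\<close>)
    then show ?thesis using x by (simp add: quasi_la one_A_apply)
  qed
  have "(\<Oplus>\<^bsub>K\<^esub>i\<in>I. \<Oplus>\<^bsub>K\<^esub>k\<in>I. \<phi> (lA i a (r k)) \<otimes>\<^bsub>K\<^esub> \<tau> (rB k t) (rA i))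
    = (\<Oplus>\<^bsub>K\<^esub>k\<in>I. \<Oplus>\<^bsub>K\<^esub>i\<in>I. \<phi> (lA i a (r k)) \<otimes>\<^bsub>K\<^esub> \<tau> (rB k t) (rA i))"
    by (rule K.finsum_swap) (use assms r in \<open>simp_all add: A_one_R\<close>)
  also have "\<dots> = (\<Oplus>\<^bsub>K\<^esub>k\<in>I. \<phi> (rb (rB k t) (a \<otimes>\<^bsub>A\<^esub> lam (r k))))"
  proof (rule K.finsum_cong')
    fix k assume k: "k \<in> I"
    have "(\<Oplus>\<^bsub>K\<^esub>i\<in>I. \<tau> (lB i) (a \<otimes>\<^bsub>A\<^esub> lam (r k)) \<otimes>\<^bsub>K\<^esub> \<tau> (rB k t) (rA i)) = \<tau> (rB k t) (a \<otimes>\<^bsub>A\<^esub> lam (r k))"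
      by (rule \<tau>_expand_A[OF \<tau>_right]) (use assms k r in \<open>simp_all add: A_mult_closed\<close>)
    then show "(\<Oplus>\<^bsub>K\<^esub>i\<in>I. \<phi> (lA i a (r k)) \<otimes>\<^bsub>K\<^esub> \<tau> (rB k t) (rA i)) = \<phi> (rb (rB k t) (a \<otimes>\<^bsub>A\<^esub> lam (r k)))"
      using assms k r by (simp add: lA_lam \<tau>_def[of "rB k t" "a \<otimes>\<^bsub>A\<^esub> lam (r k)"] A_mult_closed cong: K.finsum_cong)
  qed (use assms r in \<open>simp_all add: rb_R A_mult_closed Pi_iff\<close>)
  also have "\<dots> = \<phi> (\<Oplus>k\<in>I. rb (rB k t) (a \<otimes>\<^bsub>A\<^esub> lam (r k)))"
    by (rule \<phi>_finsum[symmetric]) (use assms r in \<open>simp add: rb_R A_mult_closed Pi_iff\<close>)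
  also have "(\<Oplus>k\<in>I. rb (rB k t) (a \<otimes>\<^bsub>A\<^esub> lam (r k))) = rb t a"
  proof (rule M_eqI_finsum[OF B_T[OF assms(1)]])
    fix x y assume xy: "x \<in> carrier M" "y \<in> carrier M"
    have "(\<Oplus>k\<in>I. rb (rB k (tn x y)) (a \<otimes>\<^bsub>A\<^esub> lam (r k))) = (\<Oplus>k\<in>I. a (r k \<otimes> rA k x) \<otimes> y)"
      by (rule finsum_cong') (use assms xy r in \<open>simp_all add: T_ops A_mult_closed applies Pi_iff\<close>)
    also have "\<dots> = (\<Oplus>k\<in>I. a (r k \<otimes> rA k x)) \<otimes> y"
      by (rule finsum_ldistr[symmetric]) (use assms xy r in \<open>simp_all add: Pi_iff\<close>)
    also have "(\<Oplus>k\<in>I. a (r k \<otimes> rA k x)) = a (\<Oplus>k\<in>I. r k \<otimes> rA k x)"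
      using hom_finsum[OF M.abelian_group_axioms M.a_comm_group, of a "\<lambda>k. r k \<otimes> rA k x" I] assms xy r
      by (simp add: hom_def A_add finsum_def Pi_iff)
    finally show "(\<Oplus>k\<in>I. rb (rB k (tn x y)) (a \<otimes>\<^bsub>A\<^esub> lam (r k))) = rb (tn x y) a"
      using assms xy by (simp add: rx rb_tn)
  qed (use assms r in \<open>simp_all add: T_ops A_mult_closed\<close>)
  finally show ?thesis by (simp add: r_def \<tau>_def)
qed


section \<open>Dual bases for the pairing from the right quasibasis\<close>

abbreviation "J \<equiv> {..<s} \<times> {..<q}"
definition "u k = lm (f (snd k)) (c (fst k))"
definition "v k = (\<lambda>m\<in>carrier M. \<gamma> (fst k) m \<otimes> e (snd k))"

lemma u_B [simp]: "k \<in> J \<Longrightarrow> u k \<in> carrier B"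
  unfolding u_def by (rule lm_B) auto

lemma v_A [simp]:
  assumes "k \<in> J"
  shows "v k \<in> carrier A"
proof -
  have k: "e (snd k) \<in> carrier R" "\<gamma> (fst k) \<in> carrier A" using assms by auto
  show ?thesis unfolding v_def by (rule A_I) (use k in \<open>simp_all add: A_rules l_distr m_assoc R_comm\<close>)
qed

text \<open>Mirror image of \<open>\<tau>_dual_A\<close>: \<open>collapse_right\<close> rebuilds c^1
  a(c^2) behind \<open>\<gamma> i m\<close>, and the right quasibasis identity is pushed through t
  \<mapsto> t^1 a(t^2).\<close>

lemma P_dual_A: "dual_basis K A J (\<lambda>k a. P (u k) a) v"
  unfolding dual_basis_def
proof (intro conjI ballI)
  show "k_linear K A (base_module K) (P (u k))" if "k \<in> J" for k using that by (simp add: P_right)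
  fix a assume a: "a \<in> carrier A"
  have cl: "(\<lambda>k. P (u k) a \<odot>\<^bsub>A\<^esub> v k) \<in> J \<rightarrow> carrier A" using a by (simp add: Pi_iff)
  show "a = (\<Oplus>\<^bsub>A\<^esub>k\<in>J. P (u k) a \<odot>\<^bsub>A\<^esub> v k)"
  proof (rule A_eqI[OF a Am.finsum_closed[OF cl]])
    fix m assume m: "m \<in> carrier M"
    have "(\<Oplus>\<^bsub>A\<^esub>k\<in>J. P (u k) a \<odot>\<^bsub>A\<^esub> v k) m
      = (\<Oplus>k\<in>J. \<phi> (f (snd k) \<otimes> br (c (fst k)) a) \<odot> (\<gamma> (fst k) m \<otimes> e (snd k)))"
      unfolding finsum_A_apply[OF cl m]
      by (rule finsum_cong') (use a m in \<open>auto simp: A_smult_apply u_def v_def P_def br_lm br_R B_T\<close>)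
    also have "\<dots> = (\<Oplus>i\<in>{..<s}. \<Oplus>j\<in>{..<q}. \<phi> (f j \<otimes> br (c i) a) \<odot> (\<gamma> i m \<otimes> e j))"
      using M.add.finprod_Times[of "{..<s}" "{..<q}" "\<lambda>i j. \<phi> (f j \<otimes> br (c i) a) \<odot> (\<gamma> i m \<otimes> e j)"] a m
      by (simp add: case_prod_beta' br_R)
    also have "\<dots> = (\<Oplus>i\<in>{..<s}. br (lm (\<gamma> i m) (c i)) a)"
      by (rule finsum_cong') (use a m in \<open>auto simp: collapse_right br_R br_lm B_T\<close>)
    also have "\<dots> = br (finprod T (\<lambda>i. lm (\<gamma> i m) (c i)) {..<s}) a"
      by (rule T_hom_finsum[symmetric]) (use a m in \<open>auto simp: B_T br_add\<close>)
    also have "\<dots> = a m" using a m by (simp add: right br_tn)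
    finally show "a m = (\<Oplus>\<^bsub>A\<^esub>k\<in>J. P (u k) a \<odot>\<^bsub>A\<^esub> v k) m" by simp
  qed
qed auto

text \<open>Mirror image of \<open>\<tau>_dual_B\<close>: the Frobenius expansion leaves t^1
  \<gamma>(t^2) acting on \<open>c i\<close> from the left, and on pure tensors the right quasibasis
  identity finishes.\<close>

lemma P_dual_B: "dual_basis K B J (\<lambda>k t. P t (v k)) u"
  unfolding dual_basis_def
proof (intro conjI ballI)
  show "k_linear K B (base_module K) (\<lambda>t. P t (v k))" if "k \<in> J" for k using that by (simp add: P_left)
  fix t assume t: "t \<in> carrier B"
  have br_v: "br t (v k) = br t (\<gamma> (fst k)) \<otimes> e (snd k)" if k: "k \<in> J" and t: "t \<in> carrier T" for k t
  proof -
    have k': "e (snd k) \<in> carrier R" "\<gamma> (fst k) \<in> carrier A" using k by auto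
    have ap: "v k x = \<gamma> (fst k) x \<otimes> e (snd k)" if "x \<in> carrier M" for x using that by (simp add: v_def)
    show ?thesis
      by (rule M_eqI[OF t]) (use k' v_A[OF k] in \<open>simp_all add: T_ops ap l_distr m_assoc\<close>)
  qed
  have cl: "(\<lambda>k. P t (v k) \<odot>\<^bsub>B\<^esub> u k) \<in> J \<rightarrow> carrier B" using t by (simp add: Pi_iff)
  have "(\<Oplus>\<^bsub>B\<^esub>k\<in>J. P t (v k) \<odot>\<^bsub>B\<^esub> u k) = finprod T (\<lambda>k. P t (v k) \<odot>\<^bsub>B\<^esub> u k) J"
    by (rule finsum_B[OF cl])
  also have "\<dots> = finprod T (\<lambda>k. lm (\<phi> (br t (\<gamma> (fst k)) \<otimes> e (snd k)) \<odot> f (snd k)) (c (fst k))) J"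
    by (rule T.finprod_cong') (use t in \<open>auto simp: P_def br_v u_def lm_smult B_T br_R\<close>)
  also have "\<dots> = finprod T (\<lambda>i. finprod T (\<lambda>j. lm (\<phi> (br t (\<gamma> i) \<otimes> e j) \<odot> f j) (c i)) {..<q}) {..<s}"
    using T.finprod_Times[of "{..<s}" "{..<q}" "\<lambda>i j. lm (\<phi> (br t (\<gamma> i) \<otimes> e j) \<odot> f j) (c i)"] t
    by (simp add: case_prod_beta' br_R B_T)
  also have "\<dots> = finprod T (\<lambda>i. lm (br t (\<gamma> i)) (c i)) {..<s}"
  proof (rule T.finprod_cong')
    fix i assume i: "i \<in> {..<s}"
    have "finprod T (\<lambda>j. lm (\<phi> (br t (\<gamma> i) \<otimes> e j) \<odot> f j) (c i)) {..<q}
        = lm (\<Oplus>j\<in>{..<q}. \<phi> (br t (\<gamma> i) \<otimes> e j) \<odot> f j) (c i)"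
      by (rule lm_finsum[symmetric]) (use i t in \<open>auto simp: B_T br_R\<close>)
    then show "finprod T (\<lambda>j. lm (\<phi> (br t (\<gamma> i) \<otimes> e j) \<odot> f j) (c i)) {..<q} = lm (br t (\<gamma> i)) (c i)"
      using i t by (simp add: frobenius_left br_R)
  qed (use t in \<open>auto simp: B_T\<close>)
  also have "\<dots> = t"
  proof (rule T_finprod_ident[OF B_T[OF t]])
    fix x y assume xy: "x \<in> carrier M" "y \<in> carrier M"
    have "finprod T (\<lambda>i. lm (br (tn x y) (\<gamma> i)) (c i)) {..<s} = finprod T (\<lambda>i. lm x (lm (\<gamma> i y) (c i))) {..<s}"
      by (rule T.finprod_cong') (use xy in \<open>auto simp: br_tn lm_lm B_T\<close>)
    also have "\<dots> = lm x (finprod T (\<lambda>i. lm (\<gamma> i y) (c i)) {..<s})"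
      using hom_finprod[OF T.comm_group_axioms T.comm_group_axioms, of "lm x" "\<lambda>i. lm (\<gamma> i y) (c i)" "{..<s}"] xy
      by (simp add: hom_def lm_add B_T)
    also have "\<dots> = tn x y" using xy by (simp add: right lm_tn)
    finally show "finprod T (\<lambda>i. lm (br (tn x y) (\<gamma> i)) (c i)) {..<s} = tn x y" .
  qed (simp_all add: B_T br_add lm_plus)
  finally show "t = (\<Oplus>\<^bsub>B\<^esub>k\<in>J. P t (v k) \<odot>\<^bsub>B\<^esub> u k)" by simp
qed auto

section \<open>Agreement with the given structure maps\<close>

lemma BA_pairing_eq: "BA_pairing M \<phi> = P"
  by (intro ext) (simp add: BA_pairing_def P_def br_def)

text \<open>The prescribed left leg is a lift of its own, balanced because \<open>a\<close> is right
  linear over \<open>N\<close>. The factor \<open>e j\<close> outside that lift is moved into the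
  tensor, where it forms \<open>lB\<close>.\<close>

lemma A_comult_eq:
  assumes a: "a \<in> carrier A"
  shows "A_comult K N M \<iota> p b \<beta> q e f a = (\<Oplus>\<^bsub>k_tensor K A A\<^esub>i\<in>I. k_pure K A A (lA i a) (rA i))"
proof -
  interpret AA: k_tensor_product K A A by unfold_locales
  interpret AAg: abelian_group "k_tensor K A A" by (rule AA.abelian_group_XY)
  have l: "(\<lambda>m\<in>carrier M. tensor_lift (add_monoid M) (\<lambda>x y. a (m \<otimes> x) \<otimes> y) (b i) \<otimes> e j) = lA (i, j) a"
    if "i < p" "j < q" for i j
  proof
    fix m
    have bl: "bal (add_monoid M) (\<lambda>x y. a (m \<otimes> x) \<otimes> y)" if "m \<in> carrier M"
    proof (rule balI)
      fix x n y assume "x \<in> carrier M" "n \<in> carrier N" "y \<in> carrier M"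
      then show "a (m \<otimes> (x \<otimes> \<iota> n)) \<otimes> y = a (m \<otimes> x) \<otimes> (\<iota> n \<otimes> y)"
        using a that A_right[OF a, of n "m \<otimes> x"] by (simp add: m_assoc)
    qed (use a that in \<open>simp_all add: r_distr l_distr A_add\<close>)
    have "tensor_lift (add_monoid M) (\<lambda>x y. a (m \<otimes> x) \<otimes> y) (b i) = rb (lm m (b i)) a" if m: "m \<in> carrier M"
      by (rule M_eqI[OF B_T[OF b_B[OF \<open>i < p\<close>]]])
        (use a m L_rules[OF bl] in \<open>simp_all add: T_ops\<close>)
    then show "(\<lambda>m\<in>carrier M. tensor_lift (add_monoid M) (\<lambda>x y. a (m \<otimes> x) \<otimes> y) (b i) \<otimes> e j) m = lA (i, j) a m"
      using that a by (auto simp: lc_def lB_def lm_rm[symmetric] rb_rm B_T restrict_def)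
  qed
  have r: "(\<lambda>m\<in>carrier M. f j \<otimes> \<beta> i m) = rA (i, j)" for i j by (simp add: rA_def)
  have "A_comult K N M \<iota> p b \<beta> q e f a
    = (\<Oplus>\<^bsub>k_tensor K A A\<^esub>i\<in>{..<p}. \<Oplus>\<^bsub>k_tensor K A A\<^esub>j\<in>{..<q}. k_pure K A A (lA (i, j) a) (rA (i, j)))"
    unfolding A_comult_def
    by (intro AAg.finsum_cong') (use a in \<open>simp_all add: l r Pi_iff AAg.finsum_closed\<close>)
  also have "\<dots> = (\<Oplus>\<^bsub>k_tensor K A A\<^esub>i\<in>I. k_pure K A A (lA i a) (rA i))"
    using AAg.add.finprod_Times[of "{..<p}" "{..<q}" "\<lambda>i j. k_pure K A A (lA (i, j) a) (rA (i, j))"] a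
    by (simp add: case_prod_beta')
  finally show ?thesis .
qed

lemma B_comult_eq:
  assumes t: "t \<in> carrier B"
  shows "B_comult K N M \<iota> p b \<beta> q e f t = (\<Oplus>\<^bsub>k_tensor K B B\<^esub>i\<in>I. k_pure K B B (lB i) (rB i t))"
proof -
  interpret BB: k_tensor_product K B B by unfold_locales
  interpret BBg: abelian_group "k_tensor K B B" by (rule BB.abelian_group_XY)
  have r: "tensor_lift T (\<lambda>x y. tn (f j \<otimes> \<beta> i x) y) t = rB (i, j) t" if "i < p" "j < q" for i j
  proof -
    have rA: "rA (i, j) \<in> carrier A" using that by simp
    have ap: "rA (i, j) x = f j \<otimes> \<beta> i x" if "x \<in> carrier M" for x using that by (simp add: rA_def)
    have bl: "bal T (\<lambda>x y. tn (f j \<otimes> \<beta> i x) y)"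
      using bal_m1[OF rA] unfolding balanced_def by (simp add: ap)
    show ?thesis
      by (rule T_eqI[OF B_T[OF t]]) (use rA in \<open>simp_all add: LT[OF bl] m1_add m1_tn ap\<close>)
  qed
  have l: "rm (b i) (e j) = lB (i, j)" for i j by (simp add: lB_def)
  have "B_comult K N M \<iota> p b \<beta> q e f t
    = (\<Oplus>\<^bsub>k_tensor K B B\<^esub>i\<in>{..<p}. \<Oplus>\<^bsub>k_tensor K B B\<^esub>j\<in>{..<q}. k_pure K B B (lB (i, j)) (rB (i, j) t))"
    unfolding B_comult_def
    by (intro BBg.finsum_cong') (use t in \<open>simp_all add: r l Pi_iff BBg.finsum_closed\<close>)
  also have "\<dots> = (\<Oplus>\<^bsub>k_tensor K B B\<^esub>i\<in>I. k_pure K B B (lB i) (rB i t))"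
    using BBg.add.finprod_Times[of "{..<p}" "{..<q}" "\<lambda>i j. k_pure K B B (lB (i, j)) (rB (i, j) t)"] t
    by (simp add: case_prod_beta')
  finally show ?thesis .
qed

lemma A_counit_eq: "A_counit M \<phi> = (\<lambda>a. \<epsilon>A a)"
  by (intro ext) (simp add: A_counit_def)

lemma B_counit_eq:
  assumes t: "t \<in> carrier B"
  shows "B_counit M \<phi> t = \<epsilon>B t"
proof -
  have bl: "bal (add_monoid M) (\<lambda>x y. x \<otimes> y)" by (rule balI) (simp_all add: l_distr r_distr m_assoc)
  have "L (\<lambda>x y. x \<otimes> y) t = br t \<one>\<^bsub>A\<^esub>"
    by (rule M_eqI[OF B_T[OF t]])
      (simp_all add: L_rules[OF bl] br_add br_tn one_A_apply)
  then show ?thesis by (simp add: B_counit_def P_def)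
qed

theorem weak_hopf_pair:
  "weak_hopf_algebra K A (A_comult K N M \<iota> p b \<beta> q e f) (A_counit M \<phi>) \<and>
   weak_hopf_algebra K B (B_comult K N M \<iota> p b \<beta> q e f) (B_counit M \<phi>) \<and>
   dual_wrt K B (B_comult K N M \<iota> p b \<beta> q e f) (B_counit M \<phi>)
     A (A_comult K N M \<iota> p b \<beta> q e f) (A_counit M \<phi>) (BA_pairing M \<phi>)"
proof -
  \<comment> \<open>One index set serves both coproducts. The right legs for \<open>A\<close> and
    the left legs for \<open>B\<close> are constant in the argument.\<close>
  interpret D0: dual_algebras K A B P J u v I "\<lambda>i a. lA i a" "\<lambda>i a. rA i" "A_comult K N M \<iota> p b \<beta> q e f" "\<lambda>a. \<epsilon>A a"
    I "\<lambda>i t. lB i" "\<lambda>i t. rB i t" "B_comult K N M \<iota> p b \<beta> q e f" "B_counit M \<phi>"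
    by unfold_locales
      (simp_all add: A_algebra B_algebra P_bil P_dual_A P_dual_B A_comult_eq B_comult_eq P_mult_expand
        P_comp_expand P_one_left B_counit_eq)
  \<comment> \<open>The last two forms are the closed expressions found in
    \<open>target_counit\<close> and \<open>source_counit\<close>.\<close>
  interpret D: weak_hopf_pairing K A B P J u v I "\<lambda>i a. lA i a" "\<lambda>i a. rA i" "A_comult K N M \<iota> p b \<beta> q e f" "\<lambda>a. \<epsilon>A a"
    I "\<lambda>i t. lB i" "\<lambda>i t. rB i t" "B_comult K N M \<iota> p b \<beta> q e f" "B_counit M \<phi>"
    \<tau> "\<lambda>t a. P t (lam (a \<one>))" "\<lambda>t a. \<phi> (a (br t \<one>\<^bsub>A\<^esub>))"
    by unfold_locales
      (simp_all add: B_counit_eq \<tau>_bil mult_compatible counit_A counit_B target_counit source_counit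
        antipode_target antipode_source antipode_triple A_mult_closed cong: K.finsum_cong)
  show ?thesis
    unfolding BA_pairing_eq A_counit_eq by (rule D.weak_hopf_dual)
qed

end


section \<open>The right quasibasis of a depth two extension\<close>

text \<open>The quotient of the two first components equals the quotient of the second ones, so it
  lies in the trivial intersection.\<close>

lemma (in comm_group) direct_sum_unique:
  assumes "subgroup U G" "subgroup V G" "U \<inter> V = {\<one>}" "x \<in> U" "x' \<in> U" "y \<in> V" "y' \<in> V" "x \<otimes> y = x' \<otimes> y'"
  shows "x = x'"
proof -
  have c: "x \<in> carrier G" "x' \<in> carrier G" "y \<in> carrier G" "y' \<in> carrier G"
    using assms by (auto dest: subgroup.mem_carrier)
  have "inv x' \<otimes> x = y' \<otimes> inv y"
  proof -
    have "inv x' \<otimes> x = inv x' \<otimes> (x \<otimes> y) \<otimes> inv y" using c by (simp add: m_assoc)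
    also have "\<dots> = inv x' \<otimes> (x' \<otimes> y') \<otimes> inv y" by (simp only: assms(8))
    also have "\<dots> = y' \<otimes> inv y" using c by (simp add: m_assoc[symmetric])
    finally show ?thesis .
  qed
  moreover have "inv x' \<otimes> x \<in> U" "y' \<otimes> inv y \<in> V"
    using assms by (auto intro: subgroup.m_closed subgroup.m_inv_closed)
  ultimately have "inv x' \<otimes> x = \<one>" using assms(3) by auto
  then show ?thesis using c by (metis inv_closed inv_equality inv_inv)
qed

lemma comm_group_product:
  assumes "\<And>i. i \<in> I \<Longrightarrow> comm_group (G i)"
  shows "comm_group (product_group I G)"
proof -
  have "group (product_group I G)" by (rule product_group) (rule comm_group.axioms(2)[OF assms])
  then show ?thesis
    by (rule group.group_comm_groupI)
      (use assms in \<open>auto simp: PiE_iff intro!: restrict_ext comm_monoid.m_comm[OF comm_group.axioms(1)]\<close>)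
qed

text \<open>The dual basis argument for a direct summand of a free left \<open>M\<close>-module:
  components of the standard vectors give \<open>c\<close>, coordinates of h(1 \<otimes> m) give
  \<open>\<gamma>\<close>. The right action of \<open>N\<close> is what places them in
  \<open>B\<close> and \<open>A\<close>.\<close>

lemma (in algebra_extension) right_quasibasis:
  assumes "depth_two N M \<iota>"
  shows "\<exists>(s :: nat) c \<gamma>. (\<forall>i<s. c i \<in> carrier B) \<and> (\<forall>i<s. \<gamma> i \<in> carrier A) \<and>
    (\<forall>m\<in>carrier M. finprod T (\<lambda>i. lm (\<gamma> i m) (c i)) {..<s} = tn \<one> m)"
proof -
  from assms obtain s :: nat where s:
    "iso_direct_summand (carrier M) (carrier N) T lm (\<lambda>t a. rm t (\<iota> a))
      (product_group {..<s} (\<lambda>_. add_monoid M))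
      (\<lambda>m v. \<lambda>i\<in>{..<s}. m \<otimes> v i) (\<lambda>v a. \<lambda>i\<in>{..<s}. v i \<otimes> \<iota> a)"
    unfolding depth_two_def by blast
  define Y where "Y = product_group {..<s} (\<lambda>_. add_monoid M)"
  define lY where "lY = (\<lambda>m v. \<lambda>i\<in>{..<s}. m \<otimes> v i)"
  define rY where "rY = (\<lambda>v a. \<lambda>i\<in>{..<s}. v i \<otimes> \<iota> a)"
  from s have "iso_direct_summand (carrier M) (carrier N) T lm (\<lambda>t a. rm t (\<iota> a)) Y lY rY"
    by (simp only: Y_def lY_def rY_def)
  then obtain U V h where U: "sub_bimod (carrier M) (carrier N) Y lY rY U"
    and V: "sub_bimod (carrier M) (carrier N) Y lY rY V"
    and UV: "U \<inter> V = {\<one>\<^bsub>Y\<^esub>}" "U <#>\<^bsub>Y\<^esub> V = carrier Y"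
    and h: "bimod_hom (carrier M) (carrier N) T lm (\<lambda>t a. rm t (\<iota> a)) Y lY rY h"
    and bij: "bij_betw h (carrier T) U"
    unfolding iso_direct_summand_def by blast
  interpret Y: comm_group Y unfolding Y_def by (rule comm_group_product) (rule M.a_comm_group)
  have Ys: "subgroup U Y" "subgroup V Y" using U V by (auto simp: sub_bimod_def)
  have Yc: "carrier Y = (\<Pi>\<^sub>E i\<in>{..<s}. carrier M)" and Ym: "x \<otimes>\<^bsub>Y\<^esub> y = (\<lambda>i\<in>{..<s}. x i \<oplus> y i)" for x y
    by (simp_all add: Y_def)
  have Yi: "y i \<in> carrier M" if "y \<in> carrier Y" "i < s" for y i using that unfolding Yc by auto
  have Yeq: "x = y" if "x \<in> carrier Y" "y \<in> carrier Y" "\<And>i. i < s \<Longrightarrow> x i = y i" for x y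
    using that unfolding Yc by (intro PiE_ext[of x "{..<s}" "\<lambda>_. carrier M" y]) auto
  have lYc: "lY m y \<in> carrier Y" if "m \<in> carrier M" "y \<in> carrier Y" for m y
    using that Yi by (auto simp: lY_def Yc)
  have lYm: "lY m (x \<otimes>\<^bsub>Y\<^esub> y) = lY m x \<otimes>\<^bsub>Y\<^esub> lY m y" if "m \<in> carrier M" "x \<in> carrier Y" "y \<in> carrier Y" for m x y
    using that Yi by (auto simp: lY_def Ym r_distr)
  have rYm: "rY (x \<otimes>\<^bsub>Y\<^esub> y) n = rY x n \<otimes>\<^bsub>Y\<^esub> rY y n" if "n \<in> carrier N" "x \<in> carrier Y" "y \<in> carrier Y" for n x y
    using that Yi by (auto simp: rY_def Ym l_distr)
  have hl: "h (lm m t) = lY m (h t)" and hr: "h (rm t (\<iota> n)) = rY (h t) n"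
    if "m \<in> carrier M" "n \<in> carrier N" "t \<in> carrier T" for m n t
    using h that by (auto simp: bimod_hom_def)
  have hhom: "h \<in> hom T Y" using h by (simp add: bimod_hom_def)
  have hU: "h t \<in> U" if "t \<in> carrier T" for t using bij that by (auto simp: bij_betw_def)
  have hY: "h t \<in> carrier Y" if "t \<in> carrier T" for t by (rule subgroup.mem_carrier[OF Ys(1) hU[OF that]])
  define \<delta> where "\<delta> k = (\<lambda>i\<in>{..<s}. if i = k then \<one> else \<zero>)" for k :: nat
  have \<delta>c: "\<delta> k \<in> carrier Y" for k by (auto simp: \<delta>_def Yc)
  have "\<exists>x y. x \<in> U \<and> y \<in> V \<and> \<delta> k = x \<otimes>\<^bsub>Y\<^esub> y" for k
    using \<delta>c[of k] unfolding UV(2)[symmetric] by (auto simp: set_mult_def)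
  then obtain x y where xy: "\<And>k. x k \<in> U" "\<And>k. y k \<in> V" "\<And>k. \<delta> k = x k \<otimes>\<^bsub>Y\<^esub> y k" by metis
  have xyY: "x k \<in> carrier Y" "y k \<in> carrier Y" for k using subgroup.mem_carrier[OF Ys(1) xy(1)] subgroup.mem_carrier[OF Ys(2) xy(2)] by simp_all
  have "\<exists>t. t \<in> carrier T \<and> h t = x k" for k using xy(1)[of k] bij by (auto simp: bij_betw_def image_iff)
  then obtain c where c: "\<And>k. c k \<in> carrier T" "\<And>k. h (c k) = x k" by metis
  have inj: "t = t'" if "h t = h t'" "t \<in> carrier T" "t' \<in> carrier T" for t t'
    using bij that by (auto simp: bij_betw_def dest: inj_onD)
  have cB: "c k \<in> carrier B" for k
  proof (rule B_I[OF c(1)])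
    fix n assume n: "n \<in> carrier N"
    \<comment> \<open>A standard vector commutes with \<open>N\<close>. Both summands are stable
      under the two actions, so its component in \<open>U\<close> commutes with \<open>N\<close>
      too, and injectivity of \<open>h\<close> carries this over to \<open>c k\<close>.\<close>
    have "lY (\<iota> n) (\<delta> k) = rY (\<delta> k) n" using n by (auto simp: lY_def rY_def \<delta>_def)
    then have "lY (\<iota> n) (x k) \<otimes>\<^bsub>Y\<^esub> lY (\<iota> n) (y k) = rY (x k) n \<otimes>\<^bsub>Y\<^esub> rY (y k) n"
      unfolding xy(3) using n xyY by (simp add: lYm rYm)
    moreover have "lY (\<iota> n) (x k) \<in> U" "rY (x k) n \<in> U" "lY (\<iota> n) (y k) \<in> V" "rY (y k) n \<in> V"
      using U V xy n by (auto simp: sub_bimod_def)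
    ultimately have "lY (\<iota> n) (x k) = rY (x k) n"
      using Y.direct_sum_unique[OF Ys UV(1)] by blast
    then show "lm (\<iota> n) (c k) = rm (c k) (\<iota> n)"
      using n c by (intro inj) (simp_all add: hl[OF _ n] hr[OF _ n, of \<one>])
  qed
  define \<gamma> where "\<gamma> k = (\<lambda>m\<in>carrier M. h (tn \<one> m) k)" for k
  have \<gamma>A: "\<gamma> k \<in> carrier A" if k: "k < s" for k
    unfolding \<gamma>_def
  proof (rule A_I)
    show "h (tn \<one> m) k \<in> carrier M" if "m \<in> carrier M" for m using Yi[OF hY k] that by simp
    show "h (tn \<one> (m \<oplus> m')) k = h (tn \<one> m) k \<oplus> h (tn \<one> m') k" if "m \<in> carrier M" "m' \<in> carrier M" for m m'
      using that k hom_mult[OF hhom, of "tn \<one> m" "tn \<one> m'"] by (simp add: tn_add Ym)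
    show "h (tn \<one> (\<iota> n \<otimes> m)) k = \<iota> n \<otimes> h (tn \<one> m) k" if n: "n \<in> carrier N" and m: "m \<in> carrier M" for n m
    proof -
      have "tn \<one> (\<iota> n \<otimes> m) = lm (\<iota> n) (tn \<one> m)" using n m tn_N[of \<one> m n] by (simp add: lm_tn)
      then show ?thesis using n m k hl[OF _ n, of "\<iota> n" "tn \<one> m"] by (simp add: lY_def)
    qed
    show "h (tn \<one> (m \<otimes> \<iota> n)) k = h (tn \<one> m) k \<otimes> \<iota> n" if n: "n \<in> carrier N" and m: "m \<in> carrier M" for n m
    proof -
      have "tn \<one> (m \<otimes> \<iota> n) = rm (tn \<one> m) (\<iota> n)" using n m by (simp add: rm_tn)
      then show ?thesis using n m k hr[OF _ n, of \<one> "tn \<one> m"] by (simp add: rY_def)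
    qed
  qed
  have "finprod T (\<lambda>i. lm (\<gamma> i m) (c i)) {..<s} = tn \<one> m" if m: "m \<in> carrier M" for m
  proof (rule inj)
    have g: "\<gamma> k m \<in> carrier M" if "k < s" for k using \<gamma>A[OF that] m by simp
    show tc: "finprod T (\<lambda>i. lm (\<gamma> i m) (c i)) {..<s} \<in> carrier T" by (rule T.finprod_closed) (use g c in simp)
    show "tn \<one> m \<in> carrier T" using m by simp
    have e1: "h (finprod T (\<lambda>i. lm (\<gamma> i m) (c i)) {..<s}) = finprod Y (\<lambda>i. lY (\<gamma> i m) (x i)) {..<s}"
    proof -
      have "h (finprod T (\<lambda>i. lm (\<gamma> i m) (c i)) {..<s}) = finprod Y (\<lambda>i. h (lm (\<gamma> i m) (c i))) {..<s}"
        by (rule hom_finprod[OF T.comm_group_axioms Y.comm_group_axioms hhom]) (use g c in simp)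
      also have "\<dots> = finprod Y (\<lambda>i. lY (\<gamma> i m) (x i)) {..<s}"
        \<comment> \<open>The zero of \<open>N\<close> instantiates the element \<open>n\<close> in
          the premises that \<open>hl\<close> shares with \<open>hr\<close>.\<close>
        by (rule Y.finprod_cong') (use g c xyY lYc hl[OF _ N.zero_closed] in simp_all)
      finally show ?thesis .
    qed
    have Vc: "finprod Y (\<lambda>i. lY (\<gamma> i m) (y i)) {..<s} \<in> V"
    proof -
      have "finprod Y (\<lambda>i. lY (\<gamma> i m) (y i)) S \<in> V" if "finite S" "S \<subseteq> {..<s}" for S
        using that
      proof (induct S)
        case empty
        then show ?case using Ys(2) by (simp add: subgroup.one_closed)
      next
        case (insert i S)
        then have "lY (\<gamma> i m) (y i) \<in> V" using V g xy(2) by (auto simp: sub_bimod_def)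
        moreover have "(\<lambda>i. lY (\<gamma> i m) (y i)) \<in> S \<rightarrow> carrier Y" using insert lYc g xyY by auto
        ultimately show ?case using insert Ys(2) by (simp add: subgroup.m_closed subgroup.mem_carrier)
      qed
      then show ?thesis by simp
    qed
    \<comment> \<open>The expansion of h(1 \<otimes> m) in standard vectors; replacing each vector
      by its two components splits the sum into a part in \<open>U\<close> and a part in
      \<open>V\<close>.\<close>
    have "h (tn \<one> m) = finprod Y (\<lambda>k. lY (\<gamma> k m) (\<delta> k)) {..<s}"
    proof (rule Yeq)
      fix i assume i: "i < s"
      have "(finprod Y (\<lambda>k. lY (\<gamma> k m) (\<delta> k)) {..<s}) i = finprod (add_monoid M) (\<lambda>k. lY (\<gamma> k m) (\<delta> k) i) {..<s}"
        by (rule hom_finprod[OF Y.comm_group_axioms M.a_comm_group])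
          (use i Yi Ym lYc g \<delta>c in \<open>auto simp: hom_def\<close>)
      also have "\<dots> = (\<Oplus>k\<in>{..<s}. lY (\<gamma> k m) (\<delta> k) i)" by (simp add: finsum_def)
      also have "\<dots> = (\<Oplus>k\<in>{..<s}. if i = k then \<gamma> k m else \<zero>)"
        by (rule finsum_cong') (use i g in \<open>auto simp: lY_def \<delta>_def\<close>)
      also have "\<dots> = \<gamma> i m" by (rule finsum_singleton) (use i g in auto)
      finally show "h (tn \<one> m) i = (finprod Y (\<lambda>k. lY (\<gamma> k m) (\<delta> k)) {..<s}) i" using m by (simp add: \<gamma>_def)
    qed (use m hY lYc g \<delta>c in \<open>auto intro!: Y.finprod_closed\<close>)
    also have "\<dots> = finprod Y (\<lambda>k. lY (\<gamma> k m) (x k) \<otimes>\<^bsub>Y\<^esub> lY (\<gamma> k m) (y k)) {..<s}"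
      by (rule Y.finprod_cong') (use g lYc lYm xyY in \<open>auto simp: xy(3)\<close>)
    also have "\<dots> = finprod Y (\<lambda>k. lY (\<gamma> k m) (x k)) {..<s} \<otimes>\<^bsub>Y\<^esub> finprod Y (\<lambda>k. lY (\<gamma> k m) (y k)) {..<s}"
      by (rule Y.finprod_multf) (use g lYc xyY in auto)
    \<comment> \<open>The right-hand side already lies in \<open>U\<close>; it is padded with the
      unit of \<open>V\<close> so that the components in \<open>U\<close> can be compared.\<close>
    finally have "h (finprod T (\<lambda>i. lm (\<gamma> i m) (c i)) {..<s}) \<otimes>\<^bsub>Y\<^esub> finprod Y (\<lambda>k. lY (\<gamma> k m) (y k)) {..<s} = h (tn \<one> m) \<otimes>\<^bsub>Y\<^esub> \<one>\<^bsub>Y\<^esub>"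
      unfolding e1 using Y.r_one[OF hY[of "tn \<one> m"]] m by simp
    then show "h (finprod T (\<lambda>i. lm (\<gamma> i m) (c i)) {..<s}) = h (tn \<one> m)"
      by (rule Y.direct_sum_unique[OF Ys UV(1) _ _ Vc, rotated -1])
        (use hU tc m Ys(2) in \<open>simp_all add: subgroup.one_closed\<close>)
  qed
  with cB \<gamma>A show ?thesis by blast
qed

theorem theorem9p5:
  fixes K :: "'k ring"
    and N :: "('k, 'n) module" and M :: "('k, 'm) module" and \<iota> :: "'n \<Rightarrow> 'm"
    and p q :: nat
    and b :: "nat \<Rightarrow> ('m, 'm) tensor" and \<beta> :: "nat \<Rightarrow> 'm \<Rightarrow> 'm"
    and \<phi> :: "'m \<Rightarrow> 'k" and e f :: "nat \<Rightarrow> 'm"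
  assumes "field K"
    and "k_algebra K N" and "k_algebra K M" and "k_algebra_hom K N M \<iota>"
    and "depth_two N M \<iota>"
    and "frobenius_extension N M \<iota>"
    and "separable_algebra K (centralizer N M \<iota>)"
    and "left_D2_quasibasis N M \<iota> p b \<beta>"
    and "index_one_frobenius_system K (centralizer N M \<iota>) \<phi> q e f"
  shows "weak_hopf_algebra K (A_alg N M \<iota>) (A_comult K N M \<iota> p b \<beta> q e f) (A_counit M \<phi>) \<and>
         weak_hopf_algebra K (B_alg N M \<iota>) (B_comult K N M \<iota> p b \<beta> q e f) (B_counit M \<phi>) \<and>
         dual_wrt K (B_alg N M \<iota>) (B_comult K N M \<iota> p b \<beta> q e f) (B_counit M \<phi>)
                    (A_alg N M \<iota>) (A_comult K N M \<iota> p b \<beta> q e f) (A_counit M \<phi>)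
                    (BA_pairing M \<phi>)"
proof -
  have M: "module K M" "ring M" and N: "ring N"
    using assms(2,3) by (simp_all only: k_algebra_def)
  interpret algebra_extension K N M \<iota>
    by (rule algebra_extension.intro[OF module.axioms(1)[OF M(1)] M(2,1) N algebra_extension_axioms.intro[OF assms(3,2,4)]])
  obtain s :: nat and c :: "nat \<Rightarrow> ('m, 'm) tensor" and \<gamma> :: "nat \<Rightarrow> 'm \<Rightarrow> 'm"
    where "\<forall>i<s. c i \<in> carrier B" "\<forall>i<s. \<gamma> i \<in> carrier A"
    "\<forall>m\<in>carrier M. finprod T (\<lambda>i. lm (\<gamma> i m) (c i)) {..<s} = tn \<one>\<^bsub>M\<^esub> m"
    using right_quasibasis[OF assms(5)] by blast
  then have "d2_extension_axioms K N M \<iota> p q s b c \<beta> \<gamma> \<phi> e f"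
    by (intro d2_extension_axioms.intro assms(8,9)) simp_all
  then interpret d2_extension K N M \<iota> p q s b c \<beta> \<gamma> \<phi> e f
    by (rule d2_extension.intro[OF algebra_extension_axioms])
  show ?thesis by (rule weak_hopf_pair)
qed

end
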